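(* There exist absolute constants $C_1,C_2,C_3>0$ such that the following holds. Let $M^\star\in\mathbb{R}^{n_1\times n_2}$ have rank $r$ with reduced SVD $M^\star=U^\star\Lambda {V^\star}^\top$, $\Lambda=\mathrm{diag}(\sigma_1,\dots,\sigma_r)$, $\sigma_1\ge\dots\ge\sigma_r>0$, condition number $\kappa=\sigma_1/\sigma_r$ and incoherence parameter $\mu$. Suppose that $X(\cdot):\mathbb{R}^d\to\mathbb{R}^{n_1\times r}$ and $Y(\cdot):\mathbb{R}^d\to\mathbb{R}^{n_2\times r}$ are linear maps, that $M^\star$ and $(X(\cdot),Y(\cdot))$ satisfy the Correlated Parametric Factorization condition, and that the random set $\Omega$ follows either Model 1 or Model 2 with sampling rate $p$. Let $M=M^\star+N$ with noise matrix $N\in\mathbb{R}^{n_1\times n_2}$, and let $\tilde f$ be the objective with tuning parameters $\alpha,\lambda$. With $n_{\max}=\max(n_1,n_2)$ and $n_{\min}=\min(n_1,n_2)$, assume $$p\ge C_1\max\Big\{\tfrac{1}{n_{\min}}\mu r\log n_{\max},\ \tfrac{n_{\max}}{n_{\min}^2}\mu^2r^2\kappa^2\Big\},$$ $$C_2\sqrt{n_{\max}/p}\le\lambda\le 10C_2\sqrt{n_{\max}/p},\qquad C_2\sqrt{\mu r\sigma_1/n_{\min}}\le\alpha\le 10C_2\sqrt{\mu r\sigma_1/n_{\min}}.$$ Then, on an event $E$ with probability $\mathbb{P}[E]\ge 1-(n_1+n_2)^{-3}$, any local minimum $\hat\xi$ of $\tilde f$ satisfies, with $\widehat M=X(\hat\xi)Y(\hat\xi)^\top$,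 $$\|M^\star-\widehat M\|_F^2\le\frac{C_3r}{p^2}\psi^2,\qquad \psi:=\sup_{\theta_1,\theta_2\in\mathbb{R}^d}\|P_{X(\theta_1)}\,\mathcal{P}_\Omega(N)\,P_{Y(\theta_2)}\|.$$ In particular, if $N=0$, then on the same event any local minimum $\hat\xi$ gives exact recovery $\widehat M=M\,(=M^\star)$, i.e. there is no spurious local minimum.
   Context: Notation: $\|\cdot\|$ is the spectral norm, $\|\cdot\|_F$ the Frobenius norm, $A_{i,\cdot}$ the $i$-th row of $A$; $P_A$ is the Euclidean (orthogonal) projection matrix onto the column space of $A$; $A\succeq 0$ means $A$ is symmetric positive semidefinite. For $\Omega\subset[n_1]\times[n_2]$, $\mathcal{P}_\Omega$ keeps the entries indexed by $\Omega$ and sets the others to zero. Incoherence: $\mu=\max\{\frac{n_1}{r}\max_i\|U^\star_{i,\cdot}\|_2^2,\ \frac{n_2}{r}\max_j\|V^\star_{j,\cdot}\|_2^2\}$. Correlated Parametric Factorization: for every $\theta\in\mathbb{R}^d$ there exists $\xi\in\mathbb{R}^d$ (not necessarily unique) with $M^\star=X(\xi)Y(\xi)^\top$, $X(\xi)^\top X(\xi)=Y(\xi)^\top Y(\xi)$, and $X(\theta)^\top X(\xi)+Y(\theta)^\top Y(\xi)\succeq 0$. Model 1: each index $(i,j)\in[n_1]\times[n_2]$ belongs to $\Omega$ independently with probability $p$. Model 2 (only for $n_1=n_2=n$): $\Omega$ is symmetric, contains no diagonal index, and each unordered off-diagonal pair $\{i,j\}$ is sampled independently with probability $p$ (in which case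 both $(i,j)$ and $(j,i)$ lie in $\Omega$). Objective: $\tilde f(\theta)=\frac{1}{2p}\|\mathcal{P}_\Omega(X(\theta)Y(\theta)^\top-M)\|_F^2+\frac18\|X(\theta)^\top X(\theta)-Y(\theta)^\top Y(\theta)\|_F^2+\lambda\big(G_\alpha(X(\theta))+G_\alpha(Y(\theta))\big)$ for $\theta\in\mathbb{R}^d$, where $G_\alpha(A)=\sum_i[(\|A_{i,\cdot}\|_2-\alpha)_+]^4$, the sum running over all rows of $A$. *)

theory Defs
  imports "HOL-Probability.Product_PMF" "Jordan_Normal_Form.DL_Rank"
begin

text \<open>
  Dimensions are quantified inside the theorem (after the absolute constants), so vectors and
  matrices are those of Jordan_Normal_Form, living in \<open>carrier_vec n\<close> and \<open>carrier_mat n m\<close>.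
  Rows, columns and singular values are indexed from 0; in particular the index set
  $[n_1] \times [n_2]$ is \<open>{..<n1} \<times> {..<n2}\<close>.
\<close>

section \<open>Norms, projections, positive semidefiniteness\<close>

definition vnorm :: "real vec \<Rightarrow> real" where
  "vnorm v = sqrt (scalar_prod v v)"

definition frob_norm :: "real mat \<Rightarrow> real" where
  "frob_norm A = sqrt (\<Sum>i<dim_row A. \<Sum>j<dim_col A. (A $$ (i, j))\<^sup>2)"

definition spectral_norm :: "real mat \<Rightarrow> real" where
  "spectral_norm A =
     (SUP v \<in> {v \<in> carrier_vec (dim_col A). vnorm v \<le> 1}. vnorm (A *\<^sub>v v))"

definition psd :: "real mat \<Rightarrow> bool" where
  "psd A \<longleftrightarrow> square_mat A \<and> A\<^sup>T = A \<and>
     (\<forall>v \<in> carrier_vec (dim_row A). 0 \<le> scalar_prod v (A *\<^sub>v v))"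

text \<open>The matrix $P_A$ of the orthogonal projection onto the column space of $A$: the unique matrix
  such that $P_A v$ lies in the column space and $v - P_A v$ is orthogonal to it, for every $v$.\<close>

definition col_proj :: "real mat \<Rightarrow> real mat" where
  "col_proj A = (THE P. P \<in> carrier_mat (dim_row A) (dim_row A) \<and>
     (\<forall>v \<in> carrier_vec (dim_row A).
        P *\<^sub>v v \<in> vec_space.col_space (dim_row A) A \<and>
        (\<forall>w \<in> vec_space.col_space (dim_row A) A. scalar_prod (v - P *\<^sub>v v) w = 0)))"

definition restrict_entries :: "(nat \<times> nat) set \<Rightarrow> real mat \<Rightarrow> real mat" where
  "restrict_entries \<Omega> A =
     Matrix.mat (dim_row A) (dim_col A) (\<lambda>ij. if ij \<in> \<Omega> then A $$ ij else 0)"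


section \<open>Assumptions on the ground truth and the parametrization\<close>

definition reduced_svd ::
  "nat \<Rightarrow> nat \<Rightarrow> nat \<Rightarrow> real mat \<Rightarrow> real mat \<Rightarrow> (nat \<Rightarrow> real) \<Rightarrow> real mat \<Rightarrow> bool" where
  "reduced_svd n1 n2 r M U \<sigma> V \<longleftrightarrow>
     U \<in> carrier_mat n1 r \<and> V \<in> carrier_mat n2 r \<and>
     U\<^sup>T * U = 1\<^sub>m r \<and> V\<^sup>T * V = 1\<^sub>m r \<and>
     (\<forall>i<r. 0 < \<sigma> i) \<and> (\<forall>i j. i \<le> j \<and> j < r \<longrightarrow> \<sigma> j \<le> \<sigma> i) \<and>
     M = U * mat_diag r \<sigma> * V\<^sup>T"

definition incoherence :: "nat \<Rightarrow> nat \<Rightarrow> nat \<Rightarrow> real mat \<Rightarrow> real mat \<Rightarrow> real" where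
  "incoherence n1 n2 r U V =
     max (real n1 / real r * Max ((\<lambda>i. (vnorm (Matrix.row U i))\<^sup>2) ` {..<n1}))
         (real n2 / real r * Max ((\<lambda>j. (vnorm (Matrix.row V j))\<^sup>2) ` {..<n2}))"

definition linear_param :: "nat \<Rightarrow> nat \<Rightarrow> nat \<Rightarrow> (real vec \<Rightarrow> real mat) \<Rightarrow> bool" where
  "linear_param d n r X \<longleftrightarrow>
     linear_map class_ring (module_vec TYPE(real) d) (module_mat TYPE(real) n r) X"

lemma linear_param_iff: "linear_param d n r X \<longleftrightarrow>
  (\<forall>v\<in>carrier_vec d. X v \<in> carrier_mat n r) \<and>
  (\<forall>v\<in>carrier_vec d. \<forall>w\<in>carrier_vec d. X (v + w) = X v + X w) \<and>
  (\<forall>c. \<forall>v\<in>carrier_vec d. X (c \<cdot>\<^sub>v v) = c \<cdot>\<^sub>m X v)"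
proof -
  have 1: "vectorspace class_ring (module_vec TYPE(real) d)" by (rule vec_vs)
  have 2: "vectorspace class_ring (module_mat TYPE(real) n r)" by (rule matrix_vs)
  have m: "module class_ring (module_vec TYPE(real) d)" "module class_ring (module_mat TYPE(real) n r)"
    using 1 2 by (simp_all add: vectorspace_def)
  show ?thesis unfolding linear_param_def linear_map_def mod_hom_def mod_hom_axioms_def
    using 1 2 m by (auto simp: module_hom_def module_vec_def module_mat_def ring_mat_def)
qed

definition correlated_parametric_factorization ::
  "nat \<Rightarrow> real mat \<Rightarrow> (real vec \<Rightarrow> real mat) \<Rightarrow> (real vec \<Rightarrow> real mat) \<Rightarrow> bool" where
  "correlated_parametric_factorization d M X Y \<longleftrightarrow>
     (\<forall>\<theta> \<in> carrier_vec d. \<exists>\<xi> \<in> carrier_vec d.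
        M = X \<xi> * (Y \<xi>)\<^sup>T \<and>
        (X \<xi>)\<^sup>T * X \<xi> = (Y \<xi>)\<^sup>T * Y \<xi> \<and>
        psd ((X \<theta>)\<^sup>T * X \<xi> + (Y \<theta>)\<^sup>T * Y \<xi>))"


section \<open>Sampling models\<close>

text \<open>The random set \<open>\<Omega>\<close> is given by its law, obtained from a family of independent
  Bernoulli($p$) variables.\<close>

definition model1 :: "nat \<Rightarrow> nat \<Rightarrow> real \<Rightarrow> (nat \<times> nat) set pmf" where
  "model1 n1 n2 p =
     map_pmf (\<lambda>b. {(i, j). i < n1 \<and> j < n2 \<and> b (i, j)})
       (Pi_pmf ({..<n1} \<times> {..<n2}) False (\<lambda>_. bernoulli_pmf p))"

text \<open>Here the Bernoulli variables are indexed by the unordered pairs \<open>{i, j}\<close> with \<open>i \<noteq> j\<close>.\<close>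

definition model2 :: "nat \<Rightarrow> real \<Rightarrow> (nat \<times> nat) set pmf" where
  "model2 n p =
     map_pmf (\<lambda>b. {(i, j). i < n \<and> j < n \<and> i \<noteq> j \<and> b {i, j}})
       (Pi_pmf {{i, j} | i j. i < n \<and> j < n \<and> i \<noteq> j} False (\<lambda>_. bernoulli_pmf p))"

definition sampling_law :: "nat \<Rightarrow> nat \<Rightarrow> real \<Rightarrow> (nat \<times> nat) set pmf \<Rightarrow> bool" where
  "sampling_law n1 n2 p D \<longleftrightarrow> D = model1 n1 n2 p \<or> (n1 = n2 \<and> D = model2 n1 p)"


section \<open>The objective and its local minima\<close>

definition row_penalty :: "real \<Rightarrow> real mat \<Rightarrow> real" where
  "row_penalty \<alpha> A = (\<Sum>i<dim_row A. (max 0 (vnorm (Matrix.row A i) - \<alpha>)) ^ 4)"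

definition objective ::
  "(nat \<times> nat) set \<Rightarrow> real \<Rightarrow> real mat \<Rightarrow> (real vec \<Rightarrow> real mat) \<Rightarrow> (real vec \<Rightarrow> real mat) \<Rightarrow>
   real \<Rightarrow> real \<Rightarrow> real vec \<Rightarrow> real" where
  "objective \<Omega> p M X Y \<alpha> lam \<theta> =
     1 / (2 * p) * (frob_norm (restrict_entries \<Omega> (X \<theta> * (Y \<theta>)\<^sup>T - M)))\<^sup>2
     + 1 / 8 * (frob_norm ((X \<theta>)\<^sup>T * X \<theta> - (Y \<theta>)\<^sup>T * Y \<theta>))\<^sup>2
     + lam * (row_penalty \<alpha> (X \<theta>) + row_penalty \<alpha> (Y \<theta>))"

definition local_min :: "nat \<Rightarrow> (real vec \<Rightarrow> real) \<Rightarrow> real vec \<Rightarrow> bool" where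
  "local_min d f \<xi> \<longleftrightarrow> \<xi> \<in> carrier_vec d \<and>
     (\<exists>\<epsilon>>0. \<forall>\<theta> \<in> carrier_vec d. vnorm (\<theta> - \<xi>) < \<epsilon> \<longrightarrow> f \<xi> \<le> f \<theta>)"

definition noise_level ::
  "nat \<Rightarrow> (nat \<times> nat) set \<Rightarrow> real mat \<Rightarrow> (real vec \<Rightarrow> real mat) \<Rightarrow> (real vec \<Rightarrow> real mat) \<Rightarrow> real"
  where
  "noise_level d \<Omega> N X Y =
     (SUP (\<theta>1, \<theta>2) \<in> carrier_vec d \<times> carrier_vec d.
        spectral_norm (col_proj (X \<theta>1) * restrict_entries \<Omega> N * col_proj (Y \<theta>2)))"

end

theory Submission
  imports Defs
begin

text \<open>
  Both models satisfy, with the stated probability, $\|\Omega - p\| \lesssim \sqrt{n_{\max} p}$ (no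
  logarithm) and the restricted lower bound
  $\sum_i 1_{(i,j) \in \Omega} (U^\star_{i,\cdot} x)^2 \ge \frac{19}{20} p \|x\|^2$ for all $x$ and every
  column $j$, and the same for rows. The spectral bound comes from the trace moment method: the walk sums
  of the centred sample are compared, kernel class by kernel class, with those of a dense random matrix
  of dimension of order $n_{\max} p$, whose norm is controlled by a net. The restricted bound follows from
  a net as well, because $p \gtrsim n_{\max} \mu^2 r^2 / n_{\min}^2$ already pays for its cardinality.

  On this event, let $\xi$ be the balanced factorization correlated with a local minimum $\theta$. Second-order
  optimality at $\theta$ in the direction $\theta - \xi$ gives an inequality between the errors
  $X(\theta) Y(\theta)^\top - M^\star$ and $(X(\theta) - X(\xi))(Y(\theta) - Y(\xi))^\top$, the balancing term,
  the penalty and the noise. The sampled quadratic forms are replaced by full ones using the event; the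
  penalty absorbs the fourth-order terms $\sum_i \|\Delta_{i,\cdot}\|^4$ that the spectral bound leaves over.
  What remains is the landscape inequality for full matrix factorization, with the noise entering only
  through inner products with matrices $A B^\top$ where $A = X(\theta_1)$ and $B = Y(\theta_2)$, that is,
  through $\psi$.
\<close>

section \<open>Bernoulli sampling and a net of the ball\<close>

text \<open>A local minimum is an arbitrary function of the sample, so every estimate on the event
  must be uniform. The event mentions only the singular vectors and \<open>p\<close>; noise,
  parametrization and tuning enter deterministically, so it serves every local minimum and both
  conclusions. The curvature inequality carries minus three times the sampled squared error, so
  sampled forms are only bounded from below. Two of them pair the incoherent factor with itself; the
  spectral bound would leave the sum of its fourth powers, which no error controls, hence the
  restricted bound. The moment order in the trace method is about \<open>n_max * p\<close>, a large
  multiple of the logarithm. A net in a dimension of the same order costs a constant factor per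
  moment, which is what removes the logarithm. The correlation condition plays the role of the
  optimal rotation: it makes the alignment matrix symmetric and positive semidefinite. The constants
  are crude: \<open>C2\<close> is eight times the spectral constant 2^45, and \<open>C1\<close> is
  the square of the 2^175 that keeps \<open>lam * \<alpha>^2\<close> below the smallest singular
  value.\<close>

lemma exp_le_quadratic:
  fixes x :: real assumes "x \<le> 1" shows "exp x \<le> 1 + x + x\<^sup>2"
proof (cases "0 \<le> x")
  case True then show ?thesis using exp_bound assms by auto
next
  case False
  define y where "y = - x"
  have y: "0 < y" using False y_def by simp
  have 1: "1 + y + y\<^sup>2/2 \<le> exp y" using exp_lower_Taylor_quadratic[of y] y by simp
  have "exp x = 1 / exp y" by (simp add: y_def exp_minus field_simps)
  also have "\<dots> \<le> 1 / (1 + y + y\<^sup>2/2)" using 1 y by (intro divide_left_mono) (auto intro!: mult_pos_pos add_pos_nonneg)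
  also have "\<dots> \<le> 1 - y + y\<^sup>2"
  proof -
    have "(1 - y + y\<^sup>2) * (1 + y + y\<^sup>2/2) = 1 + y^2/2 + y^3/2 + y^4/2"
      by (simp add: field_simps power2_eq_square power3_eq_cube power4_eq_xxxx)
    also have "\<dots> \<ge> 1" using y by simp
    finally have "1 \<le> (1 - y + y\<^sup>2) * (1 + y + y\<^sup>2/2)" .
    moreover have "0 < 1 + y + y\<^sup>2/2" using y by (simp add: add_pos_nonneg)
    ultimately show ?thesis by (simp only: divide_le_eq if_True)
  qed
  finally show ?thesis by (simp add: y_def)
qed

text \<open>For a centred variable the linear term vanishes under the expectation, which leaves a
  sub-Gaussian bound on the moment generating function for every value of the parameter.\<close>

lemma exp_le_add_exp_square:
  fixes x :: real shows "exp x \<le> x + exp (x\<^sup>2)"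
proof (cases "x \<le> 1")
  case True
  then have "exp x \<le> 1 + x + x\<^sup>2" by (rule exp_le_quadratic)
  also have "\<dots> \<le> x + exp (x\<^sup>2)" using exp_ge_add_one_self[of "x\<^sup>2"] by simp
  finally show ?thesis .
next
  case False
  then have "x \<le> x\<^sup>2" by (simp add: power2_eq_square)
  then have "exp x \<le> exp (x\<^sup>2)" by (simp only: exp_le_cancel_iff)
  then show ?thesis using False by linarith
qed

lemma finite_set_Pi_pmf:
  assumes "finite A" "\<And>x. x \<in> A \<Longrightarrow> finite (set_pmf (p x))"
  shows "finite (set_pmf (Pi_pmf A dflt p))"
  using assms by (subst set_Pi_pmf) (auto intro!: finite_PiE_dflt)

text \<open>Independence, by induction on the index set; with finite supports every expectation is a
  finite sum and integrability is automatic.\<close>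

lemma expectation_prod_Pi_pmf_finite:
  fixes f :: "'a \<Rightarrow> 'b \<Rightarrow> real"
  assumes "finite A" "\<And>x. x \<in> A \<Longrightarrow> finite (set_pmf (p x))"
  shows "measure_pmf.expectation (Pi_pmf A dflt p) (\<lambda>y. \<Prod>x\<in>A. f x (y x))
     = (\<Prod>x\<in>A. measure_pmf.expectation (p x) (f x))"
  using assms
proof (induction A rule: finite_induct)
  case (insert x A)
  let ?P = "Pi_pmf A dflt p"
  have fin: "finite (set_pmf ?P)" using insert by (intro finite_set_Pi_pmf) auto
  have "measure_pmf.expectation (Pi_pmf (insert x A) dflt p) (\<lambda>y. \<Prod>z\<in>insert x A. f z (y z))
     = measure_pmf.expectation (bind_pmf (p x) (\<lambda>v. map_pmf (\<lambda>g. g(x := v)) ?P))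
         (\<lambda>y. \<Prod>z\<in>insert x A. f z (y z))"
    using insert.hyps by (simp add: Pi_pmf_insert' map_pmf_def)
  also have "\<dots> = (\<Sum>v\<in>set_pmf (p x). pmf (p x) v *\<^sub>R
      measure_pmf.expectation (map_pmf (\<lambda>g. g(x := v)) ?P) (\<lambda>y. \<Prod>z\<in>insert x A. f z (y z)))"
    by (rule pmf_expectation_bind) (use insert fin in auto)
  also have "\<dots> = (\<Sum>v\<in>set_pmf (p x). pmf (p x) v *\<^sub>R
      (f x v * (\<Prod>z\<in>A. measure_pmf.expectation (p z) (f z))))"
  proof (intro sum.cong refl arg_cong2[where f = scaleR])
    fix v
    have "(\<Prod>z\<in>insert x A. f z ((g(x := v)) z)) = f x v * (\<Prod>z\<in>A. f z (g z))" for g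
      using insert.hyps by (auto intro!: prod.cong)
    then show "measure_pmf.expectation (map_pmf (\<lambda>g. g(x := v)) ?P) (\<lambda>y. \<Prod>z\<in>insert x A. f z (y z))
      = f x v * (\<Prod>z\<in>A. measure_pmf.expectation (p z) (f z))"
      using insert by (simp del: fun_upd_apply)
  qed
  also have "\<dots> = measure_pmf.expectation (p x) (f x) * (\<Prod>z\<in>A. measure_pmf.expectation (p z) (f z))"
    using insert by (subst integral_measure_pmf[of "set_pmf (p x)"]) (auto simp: sum_distrib_right mult.assoc)
  finally show ?case using insert.hyps by simp
qed simp

text \<open>The law to which both models are reduced: Model 1 is this law on the whole grid, and
  Model 2 restricted to off-diagonal positions without mirror pairs (a strict triangle, or a row or
  column off the diagonal) is this law on those positions.\<close>

definition bernoulli_subset :: "'a set \<Rightarrow> real \<Rightarrow> 'a set pmf" where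
  "bernoulli_subset S p = map_pmf (\<lambda>b. {e \<in> S. b e}) (Pi_pmf S False (\<lambda>_. bernoulli_pmf p))"

lemma expectation_prod_bernoulli_subset:
  fixes f :: "'a \<Rightarrow> bool \<Rightarrow> real"
  assumes "finite S" "0 \<le> p" "p \<le> 1"
  shows "measure_pmf.expectation (bernoulli_subset S p) (\<lambda>\<Omega>. \<Prod>e\<in>S. f e (e \<in> \<Omega>))
     = (\<Prod>e\<in>S. p * f e True + (1 - p) * f e False)"
proof -
  have "measure_pmf.expectation (bernoulli_subset S p) (\<lambda>\<Omega>. \<Prod>e\<in>S. f e (e \<in> \<Omega>))
      = measure_pmf.expectation (Pi_pmf S False (\<lambda>_. bernoulli_pmf p)) (\<lambda>b. \<Prod>e\<in>S. f e (b e))"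
    unfolding bernoulli_subset_def by (simp cong: prod.cong)
  also have "\<dots> = (\<Prod>e\<in>S. measure_pmf.expectation (bernoulli_pmf p) (f e))"
    by (rule expectation_prod_Pi_pmf_finite) (auto simp: assms intro: finite_subset[of _ UNIV])
  also have "\<dots> = (\<Prod>e\<in>S. p * f e True + (1 - p) * f e False)"
    using assms by (intro prod.cong refl) (simp add: integral_bernoulli_pmf)
  finally show ?thesis .
qed

lemma finite_set_pmf_bernoulli_subset [simp]:
  assumes "finite S" shows "finite (set_pmf (bernoulli_subset S p))"
  by (rule finite_subset[of _ "Pow S"]) (use assms in \<open>auto simp: bernoulli_subset_def\<close>)

text \<open>The condition on \<open>t * w e\<close> is one-sided because
  \<open>exp_le_quadratic\<close> holds on the whole half-line up to 1; very negative weights do no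
  harm.\<close>

lemma bernoulli_subset_mgf:
  assumes "finite S" "0 \<le> p" "p \<le> 1" and w: "\<And>e. e \<in> S \<Longrightarrow> t * w e \<le> 1"
  shows "measure_pmf.expectation (bernoulli_subset S p)
      (\<lambda>\<Omega>. exp (t * (\<Sum>e\<in>S. (of_bool (e \<in> \<Omega>) - p) * w e))) \<le> exp (p * t\<^sup>2 * (\<Sum>e\<in>S. (w e)\<^sup>2))"
proof -
  have "measure_pmf.expectation (bernoulli_subset S p)
      (\<lambda>\<Omega>. exp (t * (\<Sum>e\<in>S. (of_bool (e \<in> \<Omega>) - p) * w e)))
     = measure_pmf.expectation (bernoulli_subset S p)
      (\<lambda>\<Omega>. \<Prod>e\<in>S. (\<lambda>e b. exp (t * ((of_bool b - p) * w e))) e (e \<in> \<Omega>))"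
    using assms(1) by (simp add: sum_distrib_left exp_sum)
  also have "\<dots> = (\<Prod>e\<in>S. p * exp (t * ((1 - p) * w e)) + (1 - p) * exp (t * (- p * w e)))"
    by (subst expectation_prod_bernoulli_subset[OF assms(1-3)]) simp
  also have "\<dots> \<le> (\<Prod>e\<in>S. exp (p * t\<^sup>2 * (w e)\<^sup>2))"
  proof (intro prod_mono conjI)
    fix e assume e: "e \<in> S"
    show "0 \<le> p * exp (t * ((1 - p) * w e)) + (1 - p) * exp (t * (- p * w e))"
      using assms by simp
    let ?x = "t * w e"
    \<comment> \<open>Pulling out exp (- p x) leaves the uncentred transform 1 + p (exp x - 1); the
      linear parts of the two exponents then cancel.\<close>
    have "p * exp (t * ((1 - p) * w e)) + (1 - p) * exp (t * (- p * w e))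
        = exp (- p * ?x) * (1 + p * (exp ?x - 1))"
      by (simp add: algebra_simps flip: exp_add)
    also have "\<dots> \<le> exp (- p * ?x) * exp (p * (exp ?x - 1))"
      by (intro mult_left_mono exp_ge_add_one_self) simp
    also have "\<dots> \<le> exp (- p * ?x) * exp (p * (?x + ?x\<^sup>2))"
      using exp_le_quadratic[OF w[OF e]] assms(2) by (intro mult_left_mono) (auto intro!: mult_left_mono)
    also have "\<dots> = exp (p * t\<^sup>2 * (w e)\<^sup>2)"
      by (simp add: algebra_simps power_mult_distrib flip: exp_add)
    finally show "p * exp (t * ((1 - p) * w e)) + (1 - p) * exp (t * (- p * w e))
      \<le> exp (p * t\<^sup>2 * (w e)\<^sup>2)" .
  qed
  also have "\<dots> = exp (p * t\<^sup>2 * (\<Sum>e\<in>S. (w e)\<^sup>2))"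
    using assms(1) by (simp add: sum_distrib_left exp_sum)
  finally show ?thesis .
qed

lemma pmf_markov:
  fixes D :: "'a pmf" and f :: "'a \<Rightarrow> real"
  assumes "finite (set_pmf D)" "\<And>x. x \<in> set_pmf D \<Longrightarrow> 0 \<le> f x" "0 < a"
  shows "measure_pmf.prob D {x. a \<le> f x} \<le> measure_pmf.expectation D f / a"
proof -
  have "measure_pmf.prob D {x \<in> space (measure_pmf D). a \<le> f x} \<le> measure_pmf.expectation D f / a"
    by (rule integral_Markov_inequality_measure[where A = "{}"])
      (use assms in \<open>auto intro!: integrable_measure_pmf_finite simp: AE_measure_pmf_iff\<close>)
  then show ?thesis by simp
qed

lemma bernoulli_subset_tail:
  assumes "finite S" "0 \<le> p" "p \<le> 1" "0 \<le> t" and w: "\<And>e. e \<in> S \<Longrightarrow> t * w e \<le> 1"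
  shows "measure_pmf.prob (bernoulli_subset S p)
      {\<Omega>. a \<le> (\<Sum>e\<in>S. (of_bool (e \<in> \<Omega>) - p) * w e)} \<le> exp (p * t\<^sup>2 * (\<Sum>e\<in>S. (w e)\<^sup>2) - t * a)"
proof -
  let ?f = "\<lambda>\<Omega>. \<Sum>e\<in>S. (of_bool (e \<in> \<Omega>) - p) * w e"
  have "measure_pmf.prob (bernoulli_subset S p) {\<Omega>. a \<le> ?f \<Omega>}
     \<le> measure_pmf.prob (bernoulli_subset S p) {\<Omega>. exp (t * a) \<le> exp (t * ?f \<Omega>)}"
    using assms(4) by (intro measure_pmf.finite_measure_mono) (auto intro: mult_left_mono)
  also have "\<dots> \<le> measure_pmf.expectation (bernoulli_subset S p) (\<lambda>\<Omega>. exp (t * ?f \<Omega>)) / exp (t * a)"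
    using assms(1) by (intro pmf_markov) auto
  also have "\<dots> \<le> exp (p * t\<^sup>2 * (\<Sum>e\<in>S. (w e)\<^sup>2)) / exp (t * a)"
    by (intro divide_right_mono bernoulli_subset_mgf assms) auto
  finally show ?thesis by (simp add: exp_diff)
qed


section \<open>Bilinear forms and an integer-lattice net of the Euclidean ball\<close>

definition bil :: "nat \<Rightarrow> nat \<Rightarrow> (nat \<Rightarrow> nat \<Rightarrow> real) \<Rightarrow> (nat \<Rightarrow> real) \<Rightarrow> (nat \<Rightarrow> real) \<Rightarrow> real" where
  "bil a b H x y = (\<Sum>i<a. \<Sum>j<b. H i j * x i * y j)"

abbreviation l2 :: "nat \<Rightarrow> (nat \<Rightarrow> real) \<Rightarrow> real" where
  "l2 n x \<equiv> L2_set x {..<n}"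

lemma bil_add_left: "bil a b H (\<lambda>i. x i + x' i) y = bil a b H x y + bil a b H x' y"
  by (simp add: bil_def algebra_simps sum.distrib)
lemma bil_add_right: "bil a b H x (\<lambda>i. y i + y' i) = bil a b H x y + bil a b H x y'"
  by (simp add: bil_def algebra_simps sum.distrib)
lemma bil_scale: "bil a b H (\<lambda>i. s * x i) (\<lambda>j. t * y j) = s * t * bil a b H x y"
  by (simp add: bil_def algebra_simps sum_distrib_left)

lemma l2_scale: "l2 n (\<lambda>i. s * x i) = \<bar>s\<bar> * l2 n x"
  by (simp add: L2_set_def power_mult_distrib real_sqrt_mult flip: sum_distrib_left)

lemma bil_le_sum_abs:
  assumes "l2 a x \<le> 1" "l2 b y \<le> 1"
  shows "bil a b H x y \<le> (\<Sum>i<a. \<Sum>j<b. \<bar>H i j\<bar>)"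
  unfolding bil_def
proof (intro sum_mono)
  fix i j assume "i \<in> {..<a}" "j \<in> {..<b}"
  then have "\<bar>x i\<bar> \<le> l2 a x" "\<bar>y j\<bar> \<le> l2 b y"
    using member_le_L2_set[of "{..<a}" i "\<lambda>i. \<bar>x i\<bar>"] member_le_L2_set[of "{..<b}" j "\<lambda>i. \<bar>y i\<bar>"]
    by (auto simp: L2_set_def)
  then have "\<bar>x i\<bar> \<le> 1" "\<bar>y j\<bar> \<le> 1" using assms by linarith+
  then have "\<bar>x i\<bar> * \<bar>y j\<bar> \<le> 1" by (simp add: mult_le_one)
  then have "\<bar>H i j\<bar> * (\<bar>x i\<bar> * \<bar>y j\<bar>) \<le> \<bar>H i j\<bar>" by (simp add: mult_left_le)
  then show "H i j * x i * y j \<le> \<bar>H i j\<bar>"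
    using abs_ge_self[of "H i j * x i * y j"] by (simp add: abs_mult mult.assoc)
qed

text \<open>After division by \<open>4 * sqrt m\<close> these are the points of the unit ball on a
  lattice of spacing 1 / (4 sqrt m), so rounding all \<open>m\<close> coordinates moves a vector by
  at most 1/4. An explicit lattice can be counted by a generating function.\<close>

definition int_net :: "nat \<Rightarrow> (nat \<Rightarrow> int) set" where
  "int_net m = {z \<in> {..<m} \<rightarrow>\<^sub>E UNIV. (\<Sum>i<m. (z i)\<^sup>2) \<le> 16 * int m}"

definition grid_net :: "nat \<Rightarrow> (nat \<Rightarrow> real) set" where
  "grid_net m = (\<lambda>z i. of_int (z i) / (4 * sqrt (real m))) ` int_net m"

lemma int_abs_le_square: "\<bar>k::int\<bar> \<le> k\<^sup>2"
proof (cases "k = 0")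
  case False
  then have "\<bar>k\<bar> * 1 \<le> \<bar>k\<bar> * \<bar>k\<bar>" by (intro mult_left_mono) auto
  then show ?thesis by (simp add: power2_eq_square)
qed simp

lemma int_net_abs_le:
  assumes "z \<in> int_net m" "i < m" shows "\<bar>z i\<bar> \<le> 16 * int m"
proof -
  have "\<bar>z i\<bar> \<le> (z i)\<^sup>2" by (rule int_abs_le_square)
  also have "\<dots> \<le> (\<Sum>i<m. (z i)\<^sup>2)" using assms(2) by (intro member_le_sum) auto
  also have "\<dots> \<le> 16 * int m" using assms(1) by (simp add: int_net_def)
  finally show ?thesis .
qed

lemma int_net_subset: "int_net m \<subseteq> {..<m} \<rightarrow>\<^sub>E {- 16 * int m..16 * int m}"
proof
  fix z assume z: "z \<in> int_net m"
  then show "z \<in> {..<m} \<rightarrow>\<^sub>E {- 16 * int m..16 * int m}"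
    using int_net_abs_le[OF z] by (force simp: int_net_def PiE_iff abs_le_iff)
qed

lemma finite_int_net: "finite (int_net m)"
  by (rule finite_subset[OF int_net_subset]) (auto intro: finite_PiE)

lemma finite_grid_net [simp]: "finite (grid_net m)"
  by (simp add: grid_net_def finite_int_net)

lemma sum_half_power_abs_le: "(\<Sum>k\<in>{- int N..int N}. (1/2::real) ^ nat \<bar>k\<bar>) \<le> 3"
proof -
  have "(\<Sum>k\<in>{- int N..int N}. (1/2::real) ^ nat \<bar>k\<bar>) = 3 - 2 * (1/2)^N"
  proof (induction N)
    case (Suc N)
    have "{- int (Suc N)..int (Suc N)} = insert (- int (Suc N)) (insert (int (Suc N)) {- int N..int N})" by auto
    then show ?case using Suc by (simp del: of_nat_Suc)
  qed simp
  then show ?thesis by simp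
qed

text \<open>On integers |k| <= k^2, so a net point has sum of absolute values at most 16 m and the
  weight 2^(16 m) times the product of the 2^(-|z i|) is at least one. Summed over a whole box the
  weight factorizes, each factor being at most 3 < 4.\<close>

lemma card_int_net: "card (int_net m) \<le> 2 ^ (18 * m)"
proof -
  let ?B = "{- int (16 * m)..int (16 * m)}"
  have "real (card (int_net m)) = (\<Sum>z\<in>int_net m. 1)" by simp
  also have "\<dots> \<le> (\<Sum>z\<in>int_net m. 2 ^ (16 * m) * (\<Prod>i<m. (1/2::real) ^ nat \<bar>z i\<bar>))"
  proof (rule sum_mono)
    fix z assume z: "z \<in> int_net m"
    have "(\<Sum>i<m. \<bar>z i\<bar>) \<le> (\<Sum>i<m. (z i)\<^sup>2)"
      by (intro sum_mono int_abs_le_square)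
    also have "\<dots> \<le> 16 * int m" using z by (simp add: int_net_def)
    finally have 1: "(\<Sum>i<m. nat \<bar>z i\<bar>) \<le> 16 * m" by (simp flip: of_nat_le_iff[where 'a=int])
    have "(\<Prod>i<m. (1/2::real) ^ nat \<bar>z i\<bar>) = (1/2) ^ (\<Sum>i<m. nat \<bar>z i\<bar>)" by (simp add: power_sum)
    also have "\<dots> \<ge> (1/2) ^ (16*m)" using 1 by (intro power_decreasing) auto
    finally have "2 ^ (16 * m) * (1/2::real) ^ (16*m) \<le> 2 ^ (16 * m) * (\<Prod>i<m. (1/2::real) ^ nat \<bar>z i\<bar>)"
      by (intro mult_left_mono) auto
    then show "1 \<le> 2 ^ (16 * m) * (\<Prod>i<m. (1/2::real) ^ nat \<bar>z i\<bar>)" by (simp add: power_divide)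
  qed
  also have "\<dots> \<le> (\<Sum>z\<in>{..<m} \<rightarrow>\<^sub>E ?B. 2 ^ (16 * m) * (\<Prod>i<m. (1/2::real) ^ nat \<bar>z i\<bar>))"
    using int_net_subset[of m] by (intro sum_mono2 finite_PiE) (auto intro!: mult_nonneg_nonneg prod_nonneg)
  also have "\<dots> = 2 ^ (16 * m) * (\<Prod>i<m. \<Sum>k\<in>?B. (1/2::real) ^ nat \<bar>k\<bar>)"
    by (subst prod_sum_PiE) (auto simp: sum_distrib_left)
  also have "\<dots> \<le> 2 ^ (16 * m) * (\<Prod>i<m. 3)"
    using sum_half_power_abs_le[of "16*m"] by (intro mult_left_mono prod_mono) (auto intro!: sum_nonneg)
  also have "\<dots> \<le> 2 ^ (16 * m) * 4 ^ m" by (intro mult_left_mono) (auto intro!: power_mono)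
  also have "\<dots> = 2 ^ (18 * m)"
  proof -
    have "(4::real) ^ m = 2 ^ (2 * m)" by (simp add: power_mult)
    then show ?thesis by (simp flip: power_add)
  qed
  finally have "real (card (int_net m)) \<le> real (2 ^ (18 * m))" by simp
  then show ?thesis by (simp only: of_nat_le_iff)
qed

lemma card_grid_net: "card (grid_net m) \<le> 2 ^ (18 * m)"
  unfolding grid_net_def using card_image_le[OF finite_int_net] card_int_net order_trans by blast

lemma grid_net_l2: assumes "x \<in> grid_net m" shows "l2 m x \<le> 1"
proof (cases "m = 0")
  case False
  obtain z where z: "z \<in> int_net m" "x = (\<lambda>i. of_int (z i) / (4 * sqrt (real m)))"
    using assms by (auto simp: grid_net_def)
  have "(\<Sum>i<m. (x i)\<^sup>2) = (\<Sum>i<m. (of_int (z i))\<^sup>2) / (16 * real m)"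
    by (simp add: z(2) power_divide power_mult_distrib sum_divide_distrib)
  also have "(\<Sum>i<m. (of_int (z i))\<^sup>2) = real_of_int (\<Sum>i<m. (z i)\<^sup>2)" by simp
  also have "real_of_int (\<Sum>i<m. (z i)\<^sup>2) / (16 * real m) \<le> 1"
  proof -
    have "(\<Sum>i<m. (z i)\<^sup>2) \<le> 16 * int m" using z(1) by (simp add: int_net_def)
    then have "real_of_int (\<Sum>i<m. (z i)\<^sup>2) \<le> real_of_int (16 * int m)" by (rule of_int_le_iff[THEN iffD2])
    then show ?thesis using False by (simp add: divide_le_eq)
  qed
  finally show ?thesis by (simp add: L2_set_def)
qed (simp add: L2_set_def)

lemma grid_net_approx:
  assumes "l2 m x \<le> 1"
  obtains y where "y \<in> grid_net m" "l2 m (\<lambda>i. x i - y i) \<le> 1/4"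
proof (cases "m = 0")
  case True
  have "(\<lambda>i. undefined) \<in> int_net m" using True by (auto simp: int_net_def PiE_def extensional_def)
  then have "grid_net m \<noteq> {}" by (auto simp: grid_net_def)
  then show ?thesis using that True by (auto simp: L2_set_def)
next
  case False
  define c where "c = 4 * sqrt (real m)"
  have c: "0 < c" "c\<^sup>2 = 16 * real m" using False by (auto simp: c_def power_mult_distrib)
  \<comment> \<open>Rounding towards zero never increases an absolute value, so the rounded point
    stays in the ball and hence in the net.\<close>
  define tr where "tr t = (if 0 \<le> t then \<lfloor>t\<rfloor> else \<lceil>t\<rceil>)" for t :: real
  have tr: "\<bar>of_int (tr t)\<bar> \<le> \<bar>t\<bar>" "\<bar>t - of_int (tr t)\<bar> \<le> 1" for t
  proof -
    have "0 \<le> t \<Longrightarrow> 0 \<le> \<lfloor>t\<rfloor>" "\<not> 0 \<le> t \<Longrightarrow> \<lceil>t\<rceil> \<le> 0" by linarith+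
    then have "0 \<le> t \<Longrightarrow> 0 \<le> real_of_int \<lfloor>t\<rfloor>" "\<not> 0 \<le> t \<Longrightarrow> real_of_int \<lceil>t\<rceil> \<le> 0" by simp_all
    then show "\<bar>of_int (tr t)\<bar> \<le> \<bar>t\<bar>" "\<bar>t - of_int (tr t)\<bar> \<le> 1"
      unfolding tr_def using floor_correct[of t] ceiling_correct[of t] by (cases "0 \<le> t"; simp; linarith)+
  qed
  define z where "z = (\<lambda>i\<in>{..<m}. tr (c * x i))"
  define y where "y i = of_int (z i) / c" for i
  have "real_of_int (\<Sum>i<m. (z i)\<^sup>2) = (\<Sum>i<m. (of_int (tr (c * x i)))\<^sup>2)" by (simp add: z_def)
  also have "\<dots> \<le> (\<Sum>i<m. (c * x i)\<^sup>2)"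
    using tr(1) by (intro sum_mono) (simp only: flip: abs_le_square_iff)
  also have "\<dots> = c\<^sup>2 * (\<Sum>i<m. (x i)\<^sup>2)" by (simp add: power_mult_distrib sum_distrib_left)
  also have "\<dots> \<le> c\<^sup>2 * 1"
    using assms by (intro mult_left_mono) (auto simp: L2_set_def)
  also have "\<dots> = real_of_int (16 * int m)" using c by simp
  finally have "(\<Sum>i<m. (z i)\<^sup>2) \<le> 16 * int m" by (simp only: of_int_le_iff)
  then have zn: "z \<in> int_net m" by (simp add: int_net_def z_def)
  have "(\<Sum>i<m. (x i - y i)\<^sup>2) \<le> (\<Sum>i<m. 1 / c\<^sup>2)"
  proof (rule sum_mono)
    fix i assume i: "i \<in> {..<m}"
    have "x i - y i = (c * x i - of_int (tr (c * x i))) / c"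
      using c i by (simp add: y_def z_def field_simps)
    then have "(x i - y i)\<^sup>2 = (c * x i - of_int (tr (c * x i)))\<^sup>2 / c\<^sup>2" by (simp add: power_divide)
    also have "\<dots> \<le> 1 / c\<^sup>2"
      using tr(2)[of "c * x i"] c by (intro divide_right_mono) (auto simp: abs_square_le_1)
    finally show "(x i - y i)\<^sup>2 \<le> 1 / c\<^sup>2" .
  qed
  also have "\<dots> = (1/4)\<^sup>2" using c False by (simp add: power2_eq_square)
  finally have "l2 m (\<lambda>i. x i - y i) \<le> 1/4" unfolding L2_set_def
    by (metis real_sqrt_le_mono real_sqrt_unique zero_le_divide_1_iff zero_le_numeral)
  moreover have "y \<in> grid_net m"
    unfolding grid_net_def using zn by (auto simp: y_def c_def fun_eq_iff intro!: image_eqI[of _ _ z])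
  ultimately show ?thesis using that by blast
qed

text \<open>With \<open>S\<close> the supremum over the two unit balls, replacing \<open>x\<close>
  and \<open>y\<close> by net points at distance 1/4 gives S <= s + S/4 + S/4. Absolute values can
  be avoided because the two remainders are values of the same form and are controlled by
  \<open>S\<close> through homogeneity.\<close>

lemma bil_net_bound:
  assumes net: "\<And>x y. x \<in> grid_net a \<Longrightarrow> y \<in> grid_net b \<Longrightarrow> bil a b H x y \<le> s"
  shows "bil a b H x y \<le> 2 * s * l2 a x * l2 b y"
proof -
  let ?B = "{bil a b H x y | x y. l2 a x \<le> 1 \<and> l2 b y \<le> 1}"
  define S where "S = Sup ?B"
  \<comment> \<open>Finiteness of the supremum is what allows \<open>S / 2\<close> to be subtracted
    at the end.\<close>
  have bdd: "bdd_above ?B" unfolding bdd_above_def using bil_le_sum_abs by blast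
  have ne: "?B \<noteq> {}"
    by (auto intro!: exI[of _ "\<lambda>_. 0::real"] simp: L2_set_def)
  have up: "bil a b H x y \<le> S" if "l2 a x \<le> 1" "l2 b y \<le> 1" for x y
    unfolding S_def using that by (intro cSup_upper bdd) auto
  have S0: "0 \<le> S" using up[of "\<lambda>_. 0" "\<lambda>_. 0"] by (simp add: bil_def L2_set_def)
  have gen: "bil a b H x y \<le> S * l2 a x * l2 b y" for x y
  proof (cases "l2 a x = 0 \<or> l2 b y = 0")
    case True
    then have "bil a b H x y = 0"
    proof
      assume "l2 a x = 0" then have "\<forall>i<a. x i = 0" by (simp add: L2_set_eq_0_iff)
      then show ?thesis by (simp add: bil_def)
    next
      assume "l2 b y = 0" then have "\<forall>i<b. y i = 0" by (simp add: L2_set_eq_0_iff)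
      then show ?thesis by (simp add: bil_def)
    qed
    then show ?thesis using True by auto
  next
    case False
    then have pos: "0 < l2 a x" "0 < l2 b y" by (auto simp: less_le)
    have "bil a b H (\<lambda>i. (1 / l2 a x) * x i) (\<lambda>j. (1 / l2 b y) * y j) \<le> S"
      by (rule up; subst l2_scale) (use pos in auto)
    then show ?thesis unfolding bil_scale using pos by (simp add: field_simps)
  qed
  have "S \<le> s + S / 2" unfolding S_def
  proof (rule cSup_least[OF ne], unfold S_def[symmetric])
    fix v assume "v \<in> ?B"
    then obtain x y where v: "v = bil a b H x y" "l2 a x \<le> 1" "l2 b y \<le> 1" by auto
    obtain x' where x': "x' \<in> grid_net a" "l2 a (\<lambda>i. x i - x' i) \<le> 1/4" using grid_net_approx v by metis
    obtain y' where y': "y' \<in> grid_net b" "l2 b (\<lambda>i. y i - y' i) \<le> 1/4" using grid_net_approx v by metis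
    have "v = bil a b H x' y' + bil a b H (\<lambda>i. x i - x' i) y' + bil a b H x (\<lambda>i. y i - y' i)"
      using bil_add_left[of a b H x' "\<lambda>i. x i - x' i" y'] bil_add_right[of a b H x y' "\<lambda>i. y i - y' i"] v(1)
      by simp
    also have "\<dots> \<le> s + S * (1/4) * 1 + S * 1 * (1/4)"
    proof (intro add_mono net x' y')
      show "bil a b H (\<lambda>i. x i - x' i) y' \<le> S * (1/4) * 1"
        by (rule order_trans[OF gen]) (use S0 x'(2) grid_net_l2[OF y'(1)] in \<open>intro mult_mono mult_left_mono; simp\<close>)
      show "bil a b H x (\<lambda>i. y i - y' i) \<le> S * 1 * (1/4)"
        by (rule order_trans[OF gen]) (use S0 v y'(2) in \<open>intro mult_mono mult_left_mono; simp\<close>)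
    qed
    finally show "v \<le> s + S / 2" by simp
  qed
  then have "S \<le> 2 * s" by simp
  then have "S * l2 a x * l2 b y \<le> 2 * s * l2 a x * l2 b y" by (intro mult_right_mono) auto
  with gen show ?thesis using order_trans by blast
qed

section \<open>Closed walks and traces\<close>

abbreviation words :: "nat \<Rightarrow> nat \<Rightarrow> (nat \<Rightarrow> nat) set" where
  "words k n \<equiv> {..<k} \<rightarrow>\<^sub>E {..<n}"

definition row_pos :: "nat \<Rightarrow> nat \<Rightarrow> nat" where "row_pos k q = (Suc q div 2) mod k"
definition col_pos :: "nat \<Rightarrow> nat" where "col_pos q = q div 2"

text \<open>A closed walk alternating between rows and columns, as in the expansion of
  $\mathrm{tr}\,(H H^\top)^k$: the steps $2l$ and $2l+1$ use the entries $(u_l, v_l)$ and $(u_{l+1}, v_l)$,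
  with $u_k = u_0$.\<close>

definition walk_edge :: "nat \<Rightarrow> (nat \<Rightarrow> nat) \<Rightarrow> (nat \<Rightarrow> nat) \<Rightarrow> nat \<Rightarrow> nat \<times> nat" where
  "walk_edge k u v q = (u (row_pos k q), v (col_pos q))"

definition walk_sum :: "nat \<Rightarrow> nat \<Rightarrow> nat \<Rightarrow> (nat \<Rightarrow> nat \<Rightarrow> real) \<Rightarrow> real" where
  "walk_sum k a b H = (\<Sum>u\<in>words k a. \<Sum>v\<in>words k b. \<Prod>q<2 * k. case_prod H (walk_edge k u v q))"

lemma finite_words [simp]: "finite (words k n)" by (auto intro: finite_PiE)

lemma sum_words_Suc:
  "(\<Sum>w\<in>words (Suc n) a. F w) = (\<Sum>u\<in>words n a. \<Sum>j<a. F (u(n := j)))"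
proof -
  have "words (Suc n) a = (\<lambda>(y, g). g(n := y)) ` ({..<a} \<times> words n a)"
    by (simp add: lessThan_Suc PiE_insert_eq)
  moreover have "inj_on (\<lambda>(y, g). g(n := y)) ({..<a} \<times> words n a)"
    by (rule inj_combinator) auto
  ultimately have "(\<Sum>w\<in>words (Suc n) a. F w) = (\<Sum>(y, g)\<in>{..<a} \<times> words n a. F (g(n := y)))"
    by (simp add: sum.reindex case_prod_unfold)
  also have "\<dots> = (\<Sum>u\<in>words n a. \<Sum>j<a. F (u(n := j)))"
    by (subst sum.cartesian_product[symmetric], rule sum.swap)
  finally show ?thesis .
qed

fun mat_pow :: "nat \<Rightarrow> (nat \<Rightarrow> nat \<Rightarrow> real) \<Rightarrow> nat \<Rightarrow> nat \<Rightarrow> nat \<Rightarrow> real" where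
  "mat_pow a G 0 i j = of_bool (i = j)"
| "mat_pow a G (Suc k) i j = (\<Sum>l<a. mat_pow a G k i l * G l j)"

text \<open>The free weight \<open>f\<close> on the two endpoints carries the induction; the choice
  f i j = G j i afterwards closes the walk.\<close>

lemma sum_mat_pow_words:
  "(\<Sum>i<a. \<Sum>j<a. mat_pow a G n i j * f i j)
    = (\<Sum>u\<in>words (Suc n) a. (\<Prod>l<n. G (u l) (u (Suc l))) * f (u 0) (u n))"
proof (induction n arbitrary: f)
  case 0
  have "(\<Sum>i<a. \<Sum>j<a. of_bool (i = j) * f i j) = (\<Sum>i<a. f i i)"
    by (intro sum.cong refl) (simp add: of_bool_def if_distrib[of "\<lambda>x. x * _"] cong: if_cong)
  then show ?case unfolding sum_words_Suc by simp
next
  case (Suc n)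
  have "(\<Sum>i<a. \<Sum>j<a. mat_pow a G (Suc n) i j * f i j)
      = (\<Sum>i<a. \<Sum>l<a. mat_pow a G n i l * (\<Sum>j<a. G l j * f i j))"
    unfolding mat_pow.simps sum_distrib_left sum_distrib_right mult.assoc
    by (rule sum.cong[OF refl]) (rule sum.swap)
  also have "\<dots> = (\<Sum>u\<in>words (Suc n) a. (\<Prod>l<n. G (u l) (u (Suc l))) * (\<Sum>j<a. G (u n) j * f (u 0) j))"
    by (rule Suc.IH)
  also have "\<dots> = (\<Sum>u\<in>words (Suc n) a. \<Sum>j<a. (\<Prod>l<Suc n. G ((u(Suc n := j)) l) ((u(Suc n := j)) (Suc l)))
       * f ((u(Suc n := j)) 0) ((u(Suc n := j)) (Suc n)))"
    unfolding sum_distrib_left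
  proof (intro sum.cong refl)
    fix u j
    have "(\<Prod>l<n. G (u l) (u (Suc l))) = (\<Prod>l<n. G ((u(Suc n := j)) l) ((u(Suc n := j)) (Suc l)))"
      by (intro prod.cong) auto
    then show "(\<Prod>l<n. G (u l) (u (Suc l))) * (G (u n) j * f (u 0) j)
      = (\<Prod>l<Suc n. G ((u(Suc n := j)) l) ((u(Suc n := j)) (Suc l)))
       * f ((u(Suc n := j)) 0) ((u(Suc n := j)) (Suc n))" by simp
  qed
  also have "\<dots> = (\<Sum>u\<in>words (Suc (Suc n)) a. (\<Prod>l<Suc n. G (u l) (u (Suc l))) * f (u 0) (u (Suc n)))"
    by (subst sum_words_Suc[where n = "Suc n"]) (rule refl)
  finally show ?case .
qed

lemma trace_mat_pow:
  assumes "1 \<le> k"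
  shows "(\<Sum>i<a. mat_pow a G k i i) = (\<Sum>u\<in>words k a. \<Prod>l<k. G (u l) (u (Suc l mod k)))"
proof -
  obtain n where k: "k = Suc n" using assms by (cases k) auto
  have "(\<Sum>i<a. mat_pow a G k i i) = (\<Sum>i<a. \<Sum>j<a. mat_pow a G n i j * G j i)"
    by (simp add: k)
  also have "\<dots> = (\<Sum>u\<in>words k a. (\<Prod>l<n. G (u l) (u (Suc l))) * G (u n) (u 0))"
    unfolding k by (rule sum_mat_pow_words)
  also have "\<dots> = (\<Sum>u\<in>words k a. \<Prod>l<k. G (u l) (u (Suc l mod k)))"
    unfolding k by (intro sum.cong refl) simp
  finally show ?thesis .
qed

lemma prod_lessThan_double: "(\<Prod>q<2 * k. f q) = (\<Prod>l<k. f (2 * l) * f (Suc (2 * l)) :: real)" for k :: nat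
  by (induction k) (simp_all add: mult.assoc)

definition gram_rows :: "nat \<Rightarrow> (nat \<Rightarrow> nat \<Rightarrow> real) \<Rightarrow> nat \<Rightarrow> nat \<Rightarrow> real" where
  "gram_rows b H i i' = (\<Sum>j<b. H i j * H i' j)"

text \<open>Expanding a product of \<open>k\<close> Gram entries chooses one column per factor;
  these choices form the column word \<open>v\<close>.\<close>

lemma walk_sum_eq_trace:
  assumes "1 \<le> k"
  shows "walk_sum k a b H = (\<Sum>i<a. mat_pow a (gram_rows b H) k i i)"
proof -
  have "(\<Prod>l<k. gram_rows b H (u l) (u (Suc l mod k)))
      = (\<Sum>v\<in>words k b. \<Prod>q<2 * k. case_prod H (walk_edge k u v q))" for u
  proof -
    have "(\<Prod>l<k. gram_rows b H (u l) (u (Suc l mod k)))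
       = (\<Sum>v\<in>words k b. \<Prod>l<k. H (u l) (v l) * H (u (Suc l mod k)) (v l))"
      unfolding gram_rows_def by (subst prod_sum_PiE) auto
    also have "\<dots> = (\<Sum>v\<in>words k b. \<Prod>q<2 * k. case_prod H (walk_edge k u v q))"
      unfolding prod_lessThan_double
      by (intro sum.cong prod.cong refl) (auto simp: walk_edge_def row_pos_def col_pos_def)
    finally show ?thesis .
  qed
  then show ?thesis unfolding trace_mat_pow[OF assms] walk_sum_def by simp
qed

section \<open>Good walks and the kernel classes of words\<close>

definition good_walk :: "nat \<Rightarrow> (nat \<Rightarrow> 'e) \<Rightarrow> bool" where
  "good_walk N g \<longleftrightarrow> (\<forall>q<N. \<exists>q'<N. q' \<noteq> q \<and> g q' = g q)"

text \<open>The partition of the positions into groups carrying the same letter. Goodness of a walk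
  and the number of distinct letters depend on a word only through it, so counts over alphabets of
  different sizes can be compared class by class.\<close>

definition kernel :: "nat \<Rightarrow> (nat \<Rightarrow> nat) \<Rightarrow> (nat \<times> nat) set" where
  "kernel k u = {(l, l'). l < k \<and> l' < k \<and> u l = u l'}"

text \<open>A word of the class is determined by its values at one representative position for each
  letter of \<open>u0\<close>.\<close>

lemma card_same_kernel_le:
  assumes u0: "u0 \<in> words k n"
  shows "card {u \<in> words k n. kernel k u = kernel k u0} \<le> n ^ card (u0 ` {..<k})"
proof -
  let ?A = "u0 ` {..<k}" and ?r = "inv_into {..<k} u0"
  let ?S = "{u \<in> words k n. kernel k u = kernel k u0}"
  let ?f = "\<lambda>u. \<lambda>x\<in>?A. u (?r x)"
  have r: "?r x < k" "u0 (?r x) = x" if "x \<in> ?A" for x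
    using inv_into_into[OF that] f_inv_into_f[OF that] by auto
  have key: "u (?r (u0 l)) = u l" if "u \<in> ?S" "l < k" for u l
  proof -
    have "(?r (u0 l), l) \<in> kernel k u0" using r[of "u0 l"] that by (auto simp: kernel_def)
    then show ?thesis using that by (auto simp: kernel_def)
  qed
  have "card ?S \<le> card (?A \<rightarrow>\<^sub>E {..<n})"
  proof (rule card_inj_on_le[of ?f])
    show "inj_on ?f ?S"
    proof (rule inj_onI)
      fix u w assume uw: "u \<in> ?S" "w \<in> ?S" "?f u = ?f w"
      have "u l = w l" if l: "l < k" for l
        using fun_cong[OF uw(3), of "u0 l"] l key[OF uw(1) l] key[OF uw(2) l] by auto
      then show "u = w" using uw by (intro PiE_ext[of u "{..<k}" "\<lambda>_. {..<n}" w]) auto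
    qed
    show "?f ` ?S \<subseteq> ?A \<rightarrow>\<^sub>E {..<n}" using r by (fastforce simp: PiE_iff)
  qed (auto intro: finite_PiE)
  also have "\<dots> = n ^ card ?A" by (simp add: card_PiE)
  finally show ?thesis .
qed

text \<open>Injective relabellings of the letters of \<open>u0\<close> stay in the class. Their
  number is a falling factorial of \<open>D\<close> with at most \<open>k\<close> factors, each at
  least D - k.\<close>

lemma card_same_kernel_ge:
  assumes u0: "u0 \<in> words k n" and "k \<le> D"
  shows "(D - k) ^ card (u0 ` {..<k}) \<le> card {u \<in> words k D. kernel k u = kernel k u0}"
proof -
  let ?A = "u0 ` {..<k}"
  let ?T = "{f \<in> ?A \<rightarrow>\<^sub>E {..<D}. inj_on f ?A}"
  let ?S = "{u \<in> words k D. kernel k u = kernel k u0}"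
  let ?F = "\<lambda>f. \<lambda>l\<in>{..<k}. f (u0 l)"
  have ck: "card ?A \<le> k" using card_image_le[of "{..<k}" u0] by simp
  have "(D - k) ^ card ?A = (\<Prod>i = 0..<card ?A. D - k)" by simp
  also have "\<dots> \<le> (\<Prod>i = 0..<card ?A. D - i)" using ck by (intro prod_mono) auto
  also have "\<dots> = card ?T" using card_inj_on_subset_funcset[of ?A "{..<D}" ?A] by simp
  also have "\<dots> \<le> card ?S"
  proof (rule card_inj_on_le[of ?F])
    show "inj_on ?F ?T"
    proof (rule inj_onI)
      fix f g assume fg: "f \<in> ?T" "g \<in> ?T" "?F f = ?F g"
      have "f (u0 l) = g (u0 l)" if "l < k" for l using fun_cong[OF fg(3), of l] that by simp
      then show "f = g" using fg by (intro PiE_ext[of f ?A "\<lambda>_. {..<D}" g]) auto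
    qed
    show "?F ` ?T \<subseteq> ?S"
    proof
      fix w assume "w \<in> ?F ` ?T"
      then obtain f where f: "f \<in> ?T" "w = ?F f" by blast
      have "(f (u0 l) = f (u0 l')) = (u0 l = u0 l')" if "l < k" "l' < k" for l l'
        using f(1) that by (auto dest: inj_onD)
      then show "w \<in> ?S" using f by (auto simp: kernel_def PiE_iff)
    qed
  qed auto
  finally show ?thesis .
qed

text \<open>Each kernel class is at least as large among the words over the alphabet of size $D$ as
  it is, after weighting every distinct letter by $p$, among the words over that of size $n$.\<close>

lemma sum_words_compare:
  fixes g :: "(nat \<times> nat) set \<Rightarrow> real"
  assumes g: "\<And>K. 0 \<le> g K" and p: "0 \<le> p" and np: "real n * p \<le> real (D - k)" and kD: "k \<le> D"
  shows "(\<Sum>u\<in>words k n. p ^ card (u ` {..<k}) * g (kernel k u)) \<le> (\<Sum>u\<in>words k D. g (kernel k u))"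
proof -
  let ?K = "kernel k"
  have card_dep: "card (u ` {..<k}) = card (u' ` {..<k})" if "?K u = ?K u'" for u u' :: "nat \<Rightarrow> nat"
  proof -
    have eq: "(u l = u l') = (u' l = u' l')" if "l < k" "l' < k" for l l'
    proof -
      have "((l, l') \<in> ?K u) = ((l, l') \<in> ?K u')" using \<open>?K u = ?K u'\<close> by simp
      then show ?thesis using that by (simp add: kernel_def)
    qed
    have le: "card (u ` {..<k}) \<le> card (u' ` {..<k})" 
      if "\<And>l l'. l < k \<Longrightarrow> l' < k \<Longrightarrow> (u l = u l') = (u' l = u' l')" for u u' :: "nat \<Rightarrow> nat"
    proof (rule surj_card_le[of _ _ "\<lambda>x. u (inv_into {..<k} u' x)"])
      show "u ` {..<k} \<subseteq> (\<lambda>x. u (inv_into {..<k} u' x)) ` (u' ` {..<k})"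
      proof
        fix x assume "x \<in> u ` {..<k}"
        then obtain l where l: "l < k" "x = u l" by auto
        have "inv_into {..<k} u' (u' l) < k" "u' (inv_into {..<k} u' (u' l)) = u' l"
          using l inv_into_into[of "u' l" u' "{..<k}"] f_inv_into_f[of "u' l" u' "{..<k}"] by auto
        then have "u (inv_into {..<k} u' (u' l)) = x" using that l by blast
        then show "x \<in> (\<lambda>x. u (inv_into {..<k} u' x)) ` (u' ` {..<k})" using l by (force simp: image_image)
      qed
    qed simp
    show ?thesis using le[of u u'] le[of u' u] eq by (meson le_antisym)
  qed
  have "(\<Sum>u\<in>words k n. p ^ card (u ` {..<k}) * g (?K u))
     = (\<Sum>K\<in>?K ` words k n. \<Sum>u\<in>{u \<in> words k n. ?K u = K}. p ^ card (u ` {..<k}) * g (?K u))"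
    by (rule sum.image_gen) simp
  also have "\<dots> \<le> (\<Sum>K\<in>?K ` words k n. \<Sum>u\<in>{u \<in> words k D. ?K u = K}. g (?K u))"
  proof (rule sum_mono)
    fix K assume "K \<in> ?K ` words k n"
    then obtain u0 where u0: "u0 \<in> words k n" "K = ?K u0" by auto
    let ?c = "card (u0 ` {..<k})"
    have "(\<Sum>u\<in>{u \<in> words k n. ?K u = K}. p ^ card (u ` {..<k}) * g (?K u))
        = (\<Sum>u\<in>{u \<in> words k n. ?K u = K}. p ^ ?c * g K)"
    proof (rule sum.cong[OF refl])
      fix u assume "u \<in> {u \<in> words k n. ?K u = K}"
      then have "?K u = K" by simp
      then have "card (u ` {..<k}) = ?c" using card_dep u0(2) by metis
      with \<open>?K u = K\<close> show "p ^ card (u ` {..<k}) * g (?K u) = p ^ ?c * g K" by simp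
    qed
    also have "\<dots> = real (card {u \<in> words k n. ?K u = K}) * p ^ ?c * g K" by simp
    also have "\<dots> \<le> real (n ^ ?c) * p ^ ?c * g K"
      using card_same_kernel_le[OF u0(1)] p g u0(2)
      by (intro mult_right_mono) (auto simp flip: of_nat_power)
    also have "\<dots> = (real n * p) ^ ?c * g K" by (simp add: power_mult_distrib)
    also have "\<dots> \<le> real (D - k) ^ ?c * g K" using np p g by (intro mult_right_mono power_mono) auto
    also have "\<dots> \<le> real (card {u \<in> words k D. ?K u = K}) * g K"
      using card_same_kernel_ge[OF u0(1) kD] u0(2) g
      by (intro mult_right_mono) (auto simp flip: of_nat_power)
    also have "\<dots> = (\<Sum>u\<in>{u \<in> words k D. ?K u = K}. g (?K u))" by simp
    finally show "(\<Sum>u\<in>{u \<in> words k n. ?K u = K}. p ^ card (u ` {..<k}) * g (?K u))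
       \<le> (\<Sum>u\<in>{u \<in> words k D. ?K u = K}. g (?K u))" .
  qed
  \<comment> \<open>The classes of the two alphabets need not coincide; over their union the
    right-hand sum regroups into all words over \<open>D\<close> letters, and the added terms are
    nonnegative.\<close>
  also have "\<dots> \<le> (\<Sum>K\<in>?K ` (words k n \<union> words k D). \<Sum>u\<in>{u \<in> words k D. ?K u = K}. g (?K u))"
  proof (rule sum_mono2)
    show "finite (?K ` (words k n \<union> words k D))" by (intro finite_imageI finite_UnI finite_words)
    show "?K ` words k n \<subseteq> ?K ` (words k n \<union> words k D)" by blast
    show "0 \<le> (\<Sum>u\<in>{u \<in> words k D. ?K u = K}. g (?K u))" for K using g by (rule sum_nonneg)
  qed
  also have "\<dots> = (\<Sum>u\<in>words k D. g (?K u))"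
  proof (rule sum.group)
    show "?K ` words k D \<subseteq> ?K ` (words k n \<union> words k D)" by blast
  qed (simp_all add: finite_imageI)
  finally show ?thesis .
qed

text \<open>A connected graph has at most one vertex more than it has edges: consecutive steps of
  the walk share an endpoint, so a new edge brings at most one new vertex.\<close>

lemma walk_vertices_le_edges:
  assumes k: "1 \<le> k"
  shows "card (u ` {..<k}) + card (v ` {..<k}) \<le> card (walk_edge k u v ` {..<2 * k}) + 1"
proof -
  let ?a = "\<lambda>q. u (row_pos k q)" and ?b = "\<lambda>q. v (col_pos q)" and ?g = "walk_edge k u v"
  have main: "card (?a ` {..<Suc Q}) + card (?b ` {..<Suc Q}) \<le> card (?g ` {..<Suc Q}) + 1" for Q
  proof (induction Q)
    case (Suc Q)
    have ins: "f ` {..<Suc (Suc Q)} = insert (f (Suc Q)) (f ` {..<Suc Q})" for f :: "nat \<Rightarrow> 'z"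
      by (simp add: lessThan_Suc)
    \<comment> \<open>The step after an even one keeps the column and moves the row; the step after
      an odd one does the opposite.\<close>
    have same: "?a (Suc Q) = ?a Q \<or> ?b (Suc Q) = ?b Q"
      by (cases "even Q") (auto simp: row_pos_def col_pos_def elim!: evenE oddE)
    show ?case
    proof (cases "?g (Suc Q) \<in> ?g ` {..<Suc Q}")
      case True
      then have "?a (Suc Q) \<in> ?a ` {..<Suc Q}" "?b (Suc Q) \<in> ?b ` {..<Suc Q}"
        by (auto simp: walk_edge_def)
      then show ?thesis using Suc True unfolding ins by (simp add: insert_absorb)
    next
      case False
      then have 1: "card (?g ` {..<Suc (Suc Q)}) = card (?g ` {..<Suc Q}) + 1"
        unfolding ins by simp
      have 2: "card (?a ` {..<Suc (Suc Q)}) \<le> card (?a ` {..<Suc Q}) + 1"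
        "card (?b ` {..<Suc (Suc Q)}) \<le> card (?b ` {..<Suc Q}) + 1"
        unfolding ins by (auto simp: card_insert_if)
      have 3: "?a ` {..<Suc (Suc Q)} = ?a ` {..<Suc Q} \<or> ?b ` {..<Suc (Suc Q)} = ?b ` {..<Suc Q}"
        unfolding ins using same by (auto intro!: insert_absorb)
      show ?thesis using Suc 1 2 3 by auto
    qed
  qed (simp add: lessThan_Suc)
  have a: "?a ` {..<2 * k} = u ` {..<k}"
  proof
    show "?a ` {..<2 * k} \<subseteq> u ` {..<k}" using k by (auto simp: row_pos_def)
    show "u ` {..<k} \<subseteq> ?a ` {..<2 * k}"
    proof
      fix x assume "x \<in> u ` {..<k}"
      then obtain l where "l < k" "x = u l" by auto
      then show "x \<in> ?a ` {..<2 * k}" by (intro image_eqI[of _ _ "2 * l"]) (auto simp: row_pos_def)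
    qed
  qed
  have b: "?b ` {..<2 * k} = v ` {..<k}"
  proof
    show "?b ` {..<2 * k} \<subseteq> v ` {..<k}" by (auto simp: col_pos_def)
    show "v ` {..<k} \<subseteq> ?b ` {..<2 * k}"
    proof
      fix x assume "x \<in> v ` {..<k}"
      then obtain l where "l < k" "x = v l" by auto
      then show "x \<in> ?b ` {..<2 * k}" by (intro image_eqI[of _ _ "2 * l"]) (auto simp: col_pos_def)
    qed
  qed
  obtain Q where "2 * k = Suc Q" using k by (cases "2 * k") auto
  with main[of Q] show ?thesis unfolding a[symmetric] b[symmetric] by simp
qed

lemma good_walk_kernel:
  "good_walk (2 * k) (walk_edge k u v) \<longleftrightarrow>
    (\<forall>q<2*k. \<exists>q'<2*k. q' \<noteq> q \<and> (row_pos k q', row_pos k q) \<in> kernel k u \<and> (col_pos q', col_pos q) \<in> kernel k v)"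
proof -
  have "row_pos k q < k" "col_pos q < k" if "q < 2 * k" for q
    using that by (auto simp: row_pos_def col_pos_def)
  then have "(walk_edge k u v q' = walk_edge k u v q) =
      ((row_pos k q', row_pos k q) \<in> kernel k u \<and> (col_pos q', col_pos q) \<in> kernel k v)"
    if "q < 2 * k" "q' < 2 * k" for q q'
    using that by (simp add: walk_edge_def kernel_def)
  then show ?thesis unfolding good_walk_def by meson
qed

text \<open>As p <= 1, a power of \<open>p\<close> per edge is at most a power of \<open>p\<close>
  per vertex, up to the factor 1/p coming from the one extra vertex. Weighted vertices are what
  \<open>sum_words_compare\<close> handles, applied to the column words and then to the row words;
  this is possible because goodness depends on the two kernels only.\<close>

lemma good_walks_compare:
  assumes k: "1 \<le> k" and p: "0 < p" "p \<le> 1"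
    and a: "real a * p \<le> real (D - k)" and b: "real b * p \<le> real (D - k)" and kD: "k \<le> D"
  shows "(\<Sum>u\<in>words k a. \<Sum>v\<in>words k b. of_bool (good_walk (2 * k) (walk_edge k u v))
            * p ^ card (walk_edge k u v ` {..<2 * k}))
     \<le> (\<Sum>u\<in>words k D. \<Sum>v\<in>words k D. of_bool (good_walk (2 * k) (walk_edge k u v))) / p"
proof -
  define good where "good K L \<longleftrightarrow> (\<forall>q<2*k. \<exists>q'<2*k. q' \<noteq> q \<and> (row_pos k q', row_pos k q) \<in> K \<and> (col_pos q', col_pos q) \<in> L)" for K L
  have gw: "good_walk (2 * k) (walk_edge k u v) = good (kernel k u) (kernel k v)" for u v
    unfolding good_walk_kernel good_def ..
  have "(\<Sum>u\<in>words k a. \<Sum>v\<in>words k b. of_bool (good_walk (2 * k) (walk_edge k u v))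
            * p ^ card (walk_edge k u v ` {..<2 * k}))
    \<le> (\<Sum>u\<in>words k a. \<Sum>v\<in>words k b. of_bool (good_walk (2 * k) (walk_edge k u v))
            * (p ^ card (u ` {..<k}) * p ^ card (v ` {..<k}) / p))"
  proof (intro sum_mono mult_left_mono)
    fix u v
    have "p * p ^ card (walk_edge k u v ` {..<2 * k}) = p ^ (card (walk_edge k u v ` {..<2 * k}) + 1)" by simp
    also have "\<dots> \<le> p ^ (card (u ` {..<k}) + card (v ` {..<k}))"
      using p walk_vertices_le_edges[OF k, of u v] by (intro power_decreasing) auto
    finally show "p ^ card (walk_edge k u v ` {..<2 * k}) \<le> p ^ card (u ` {..<k}) * p ^ card (v ` {..<k}) / p"
      using p by (simp add: power_add field_simps)
  qed auto
  also have "\<dots> = (\<Sum>u\<in>words k a. p ^ card (u ` {..<k}) *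
      (\<Sum>v\<in>words k b. p ^ card (v ` {..<k}) * of_bool (good (kernel k u) (kernel k v)))) / p"
    unfolding gw sum_distrib_left sum_divide_distrib by (intro sum.cong refl) (simp add: mult_ac)
  also have "\<dots> \<le> (\<Sum>u\<in>words k a. p ^ card (u ` {..<k}) *
      (\<Sum>v\<in>words k D. of_bool (good (kernel k u) (kernel k v)))) / p"
  proof (intro divide_right_mono sum_mono mult_left_mono)
    fix u
    show "(\<Sum>v\<in>words k b. p ^ card (v ` {..<k}) * of_bool (good (kernel k u) (kernel k v)))
      \<le> (\<Sum>v\<in>words k D. of_bool (good (kernel k u) (kernel k v)) :: real)"
      using sum_words_compare[of "\<lambda>L. of_bool (good (kernel k u) L)" p b D k] p b kD by simp
  qed (use p in auto)
  also have "\<dots> \<le> (\<Sum>u\<in>words k D. \<Sum>v\<in>words k D. of_bool (good (kernel k u) (kernel k v))) / p"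
    using sum_words_compare[of "\<lambda>K. \<Sum>v\<in>words k D. of_bool (good K (kernel k v))" p a D k] p a kD
    by (intro divide_right_mono) (auto intro: sum_nonneg)
  finally show ?thesis by (simp add: gw)
qed

section \<open>Moments along a walk, and traces against bilinear forms\<close>

lemma prod_eq_prod_power_card:
  fixes f :: "'e \<Rightarrow> real" and g :: "nat \<Rightarrow> 'e"
  assumes "finite E" "g ` {..<N} \<subseteq> E"
  shows "(\<Prod>q<N. f (g q)) = (\<Prod>e\<in>E. f e ^ card {q \<in> {..<N}. g q = e})"
proof -
  have "(\<Prod>q<N. f (g q)) = (\<Prod>e\<in>E. \<Prod>q\<in>{q \<in> {..<N}. g q = e}. f (g q))"
    using prod.group[of "{..<N}" E g "\<lambda>q. f (g q)"] assms by simp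
  also have "\<dots> = (\<Prod>e\<in>E. f e ^ card {q \<in> {..<N}. g q = e})"
    by (intro prod.cong refl) simp
  finally show ?thesis .
qed

lemma good_walk_card:
  assumes "good_walk N g" "e \<in> g ` {..<N}" shows "2 \<le> card {q \<in> {..<N}. g q = e}"
proof -
  obtain q where q: "q < N" "e = g q" using assms by auto
  then obtain q' where q': "q' < N" "q' \<noteq> q" "g q' = g q" using assms by (auto simp: good_walk_def)
  have "card {q, q'} \<le> card {q \<in> {..<N}. g q = e}" using q q' by (intro card_mono) auto
  then show ?thesis using q' by simp
qed

lemma not_good_walk_card:
  assumes "\<not> good_walk N g" obtains e where "e \<in> g ` {..<N}" "card {q \<in> {..<N}. g q = e} = 1"
proof -
  obtain q where q: "q < N" "\<And>q'. q' < N \<Longrightarrow> q' \<noteq> q \<Longrightarrow> g q' \<noteq> g q"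
    using assms by (auto simp: good_walk_def)
  then have "{q' \<in> {..<N}. g q' = g q} = {q}" by auto
  then show ?thesis using that[of "g q"] q by simp
qed

lemma prod_moments_le:
  fixes m :: "'e \<Rightarrow> nat \<Rightarrow> real"
  assumes E: "finite E" "g ` {..<N} \<subseteq> E" and m: "\<And>e. m e 0 = 1" "\<And>e. m e 1 = 0"
    "\<And>e l. 2 \<le> l \<Longrightarrow> \<bar>m e l\<bar> \<le> p" and p: "0 \<le> p"
  shows "(\<Prod>e\<in>E. m e (card {q \<in> {..<N}. g q = e})) \<le> of_bool (good_walk N g) * p ^ card (g ` {..<N})"
proof (cases "good_walk N g")
  case True
  have "(\<Prod>e\<in>E. m e (card {q \<in> {..<N}. g q = e})) \<le> (\<Prod>e\<in>E. \<bar>m e (card {q \<in> {..<N}. g q = e})\<bar>)"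
    by (simp flip: abs_prod)
  also have "\<dots> \<le> (\<Prod>e\<in>E. if e \<in> g ` {..<N} then p else 1)"
  proof (intro prod_mono conjI abs_ge_zero)
    fix e assume "e \<in> E"
    show "\<bar>m e (card {q \<in> {..<N}. g q = e})\<bar> \<le> (if e \<in> g ` {..<N} then p else 1)"
    proof (cases "e \<in> g ` {..<N}")
      case True then show ?thesis using m(3) good_walk_card[OF \<open>good_walk N g\<close>] by simp
    next
      case False
      then have "{q \<in> {..<N}. g q = e} = {}" by auto
      then show ?thesis using m(1) False by (simp only: card.empty) simp
    qed
  qed
  also have "\<dots> = (\<Prod>e\<in>g ` {..<N}. p)"
    using E by (subst prod.If_cases) (auto simp: Int_absorb1 Int_absorb2)
  finally show ?thesis using True by simp
next
  case False
  then obtain e where e: "e \<in> g ` {..<N}" "card {q \<in> {..<N}. g q = e} = 1" by (rule not_good_walk_card)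
  have "(\<Prod>e\<in>E. m e (card {q \<in> {..<N}. g q = e})) = 0"
    using E e m(2) by (intro prod_zero) (auto intro!: bexI[of _ e])
  then show ?thesis using False by simp
qed

text \<open>The counterpart for the comparison matrix: a walk that is not good still gives zero, and
  on a good walk no factor is below one.\<close>

lemma prod_moments_ge:
  fixes m :: "'e \<Rightarrow> nat \<Rightarrow> real"
  assumes E: "finite E" "g ` {..<N} \<subseteq> E" and m: "\<And>e. m e 0 = 1" "\<And>e. m e 1 = 0"
    "\<And>e l. 2 \<le> l \<Longrightarrow> 1 \<le> m e l"
  shows "of_bool (good_walk N g) \<le> (\<Prod>e\<in>E. m e (card {q \<in> {..<N}. g q = e}))"
proof (cases "good_walk N g")
  case True
  have "(\<Prod>e\<in>E. 1) \<le> (\<Prod>e\<in>E. m e (card {q \<in> {..<N}. g q = e}))"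
  proof (intro prod_mono conjI)
    fix e assume "e \<in> E"
    show "1 \<le> m e (card {q \<in> {..<N}. g q = e})"
    proof (cases "e \<in> g ` {..<N}")
      case True then show ?thesis using m(3) good_walk_card[OF \<open>good_walk N g\<close>] by simp
    next
      case False
      then have "{q \<in> {..<N}. g q = e} = {}" by auto
      then show ?thesis using m(1) by (simp only: card.empty)
    qed
  qed simp
  then show ?thesis using True by simp
next
  case False
  then obtain e where e: "e \<in> g ` {..<N}" "card {q \<in> {..<N}. g q = e} = 1" by (rule not_good_walk_card)
  have "(\<Prod>e\<in>E. m e (card {q \<in> {..<N}. g q = e})) = 0"
    using E e m(2) by (intro prod_zero) (auto intro!: bexI[of _ e])
  then show ?thesis using False by simp
qed

definition col_comb :: "nat \<Rightarrow> (nat \<Rightarrow> nat \<Rightarrow> real) \<Rightarrow> (nat \<Rightarrow> real) \<Rightarrow> nat \<Rightarrow> real" where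
  "col_comb a H x j = (\<Sum>i<a. H i j * x i)"

lemma l2_power2: "(l2 n x)\<^sup>2 = (\<Sum>i<n. (x i)\<^sup>2)"
  by (simp add: L2_set_def sum_nonneg)

lemma l2_mult_self: "(\<Sum>i<n. x i * x i) = (l2 n x)\<^sup>2"
  unfolding l2_power2 by (simp add: power2_eq_square)

lemma abs_inner_le_l2: "\<bar>\<Sum>i<n. x i * y i\<bar> \<le> l2 n x * l2 n y"
proof -
  have "\<bar>\<Sum>i<n. x i * y i\<bar> \<le> (\<Sum>i<n. \<bar>x i\<bar> * \<bar>y i\<bar>)"
    by (rule order_trans[OF sum_abs]) (simp add: abs_mult)
  also have "\<dots> \<le> l2 n x * l2 n y" by (rule L2_set_mult_ineq)
  finally show ?thesis .
qed

lemma abs_le_l2: "i < n \<Longrightarrow> \<bar>x i\<bar> \<le> l2 n x"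
  using member_le_L2_set[of "{..<n}" i "\<lambda>i. \<bar>x i\<bar>"] by (auto simp: L2_set_def)

lemma bil_col_comb: "bil a b H x y = (\<Sum>j<b. col_comb a H x j * y j)"
  unfolding bil_def col_comb_def sum_distrib_right by (rule sum.swap)

lemma gram_rows_apply: "(\<Sum>i'<a. gram_rows b H i i' * x i') = (\<Sum>j<b. H i j * col_comb a H x j)"
  unfolding gram_rows_def col_comb_def sum_distrib_left sum_distrib_right
  by (subst sum.swap) (simp add: mult_ac)

lemma square_le_mult_imp_le:
  fixes t c :: real assumes "t\<^sup>2 \<le> c * t" "0 \<le> t" "0 \<le> c" shows "t \<le> c"
  using assms by (cases "t = 0") (auto simp: power2_eq_square)

text \<open>Two applications of duality: testing the form on \<open>x\<close> and its own image
  bounds the norm of the transposed matrix applied to \<open>x\<close> by \<open>s\<close> times the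
  norm of \<open>x\<close>, and a second test does the same for the matrix itself.\<close>

lemma l2_gram_rows_apply:
  assumes s: "\<And>x y. bil a b H x y \<le> s * l2 a x * l2 b y" "0 \<le> s"
  shows "l2 a (\<lambda>i. \<Sum>i'<a. gram_rows b H i i' * x i') \<le> s\<^sup>2 * l2 a x"
proof -
  define c where "c = col_comb a H x"
  define w where "w = (\<lambda>i. \<Sum>i'<a. gram_rows b H i i' * x i')"
  have w: "w i = (\<Sum>j<b. H i j * c j)" for i unfolding w_def c_def by (rule gram_rows_apply)
  have "(l2 b c)\<^sup>2 = bil a b H x c"
    by (simp add: l2_mult_self bil_col_comb c_def)
  also have "\<dots> \<le> s * l2 a x * l2 b c" by (rule s)
  finally have 1: "l2 b c \<le> s * l2 a x" by (rule square_le_mult_imp_le) (use s(2) in simp_all)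
  have "(l2 a w)\<^sup>2 = (\<Sum>i<a. w i * (\<Sum>j<b. H i j * c j))" by (simp add: w[symmetric] l2_mult_self)
  also have "\<dots> = bil a b H w c" by (simp add: bil_def sum_distrib_left mult_ac)
  also have "\<dots> \<le> s * l2 a w * l2 b c" by (rule s)
  finally have "(l2 a w)\<^sup>2 \<le> (s * l2 b c) * l2 a w" by (simp add: mult_ac)
  then have "l2 a w \<le> s * l2 b c" by (rule square_le_mult_imp_le) (use s(2) in simp_all)
  also have "\<dots> \<le> s * (s * l2 a x)" using 1 s(2) by (rule mult_left_mono)
  finally show ?thesis unfolding w_def by (simp add: power2_eq_square mult.assoc)
qed

lemma gram_rows_sym: "gram_rows b H i j = gram_rows b H j i"
  by (simp add: gram_rows_def mult.commute)

lemma l2_unit: "i < a \<Longrightarrow> l2 a (\<lambda>j. of_bool (i = j)) = 1"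
  by (simp add: L2_set_def of_bool_def if_distrib[of "\<lambda>x. x\<^sup>2"] cong: if_cong)

text \<open>Each diagonal entry of a power of the Gram matrix is at most the norm of its row, and
  that norm grows by a factor of at most \<open>s^2\<close> per multiplication.\<close>

lemma walk_sum_le:
  assumes s: "\<And>x y. bil a b H x y \<le> s * l2 a x * l2 b y" "0 \<le> s" and k: "1 \<le> k"
  shows "walk_sum k a b H \<le> real a * s ^ (2 * k)"
proof -
  let ?G = "gram_rows b H"
  have l2: "l2 a (mat_pow a ?G k i) \<le> s ^ (2 * k)" if i: "i < a" for i k
  proof (induction k)
    case 0
    then show ?case using l2_unit[OF i] by simp
  next
    case (Suc k)
    have "mat_pow a ?G (Suc k) i = (\<lambda>j. \<Sum>l<a. ?G j l * mat_pow a ?G k i l)"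
      by (simp add: fun_eq_iff gram_rows_sym[of b H _ ] mult.commute gram_rows_def)
    then have "l2 a (mat_pow a ?G (Suc k) i) \<le> s\<^sup>2 * l2 a (mat_pow a ?G k i)"
      using l2_gram_rows_apply[OF s] by simp
    also have "\<dots> \<le> s\<^sup>2 * s ^ (2 * k)" using Suc by (intro mult_left_mono) auto
    also have "\<dots> = s ^ (2 * Suc k)" by (simp add: power2_eq_square)
    finally show ?case .
  qed
  have "walk_sum k a b H \<le> (\<Sum>i<a. s ^ (2 * k))"
    unfolding walk_sum_eq_trace[OF k]
  proof (rule sum_mono)
    fix i assume "i \<in> {..<a}"
    then have i: "i < a" by simp
    show "mat_pow a ?G k i i \<le> s ^ (2 * k)"
      using l2[OF i, of k] abs_le_l2[OF i, of "mat_pow a ?G k i"] by linarith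
  qed
  then show ?thesis by simp
qed

lemma mat_pow_add:
  assumes "j < a"
  shows "mat_pow a G (s + t) i j = (\<Sum>l<a. mat_pow a G s i l * mat_pow a G t l j)"
  using assms
proof (induction t arbitrary: j)
  case 0
  then show ?case by (simp add: of_bool_def if_distrib[of "\<lambda>x. _ * x"] cong: if_cong)
next
  case (Suc t)
  have "mat_pow a G (s + Suc t) i j = (\<Sum>l<a. (\<Sum>m<a. mat_pow a G s i m * mat_pow a G t m l) * G l j)"
    using Suc.IH by simp
  also have "\<dots> = (\<Sum>m<a. mat_pow a G s i m * (\<Sum>l<a. mat_pow a G t m l * G l j))"
    unfolding sum_distrib_left sum_distrib_right mult.assoc by (rule sum.swap)
  finally show ?case by simp
qed

lemma mat_pow_sym:
  assumes G: "\<And>i j. G i j = G j i" and "i < a" "j < a"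
  shows "mat_pow a G t i j = mat_pow a G t j i"
  using assms(2,3)
proof (induction t arbitrary: i j)
  case 0
  then show ?case by auto
next
  case (Suc t)
  have "mat_pow a G (Suc t) i j = (\<Sum>l<a. mat_pow a G t l i * G j l)"
  proof -
    have "mat_pow a G t i l * G l j = mat_pow a G t l i * G j l" if "l < a" for l
      using Suc.IH[OF Suc.prems(1) that] G[of l j] by simp
    then show ?thesis by simp
  qed
  also have "\<dots> = (\<Sum>l<a. mat_pow a G (Suc 0) j l * mat_pow a G t l i)"
    using Suc.prems
    by (simp add: mult.commute of_bool_def if_distrib[of "\<lambda>x. _ * x"] cong: if_cong)
  also have "\<dots> = mat_pow a G (Suc t) j i"
    using mat_pow_add[OF Suc.prems(1), of G "Suc 0" t j] by simp
  finally show ?case .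
qed

text \<open>For a symmetric matrix the trace of G^(2t) is the squared Frobenius norm of G^t. Besides
  its use below, this makes traces of even order nonnegative, as Markov's inequality
  requires.\<close>

lemma walk_sum_eq_sum_squares:
  assumes "1 \<le> t"
  shows "walk_sum (2 * t) a b H = (\<Sum>i<a. \<Sum>j<a. (mat_pow a (gram_rows b H) t i j)\<^sup>2)"
proof -
  let ?G = "gram_rows b H"
  have "walk_sum (2 * t) a b H = (\<Sum>i<a. mat_pow a ?G (t + t) i i)"
    using assms by (subst walk_sum_eq_trace) (auto simp: mult_2)
  also have "\<dots> = (\<Sum>i<a. \<Sum>j<a. mat_pow a ?G t i j * mat_pow a ?G t j i)"
    by (intro sum.cong refl mat_pow_add) auto
  also have "\<dots> = (\<Sum>i<a. \<Sum>j<a. (mat_pow a ?G t i j)\<^sup>2)"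
    using mat_pow_sym[of ?G, OF gram_rows_sym] by (intro sum.cong refl) (simp add: power2_eq_square)
  finally show ?thesis .
qed

text \<open>With Q t the form of G^t at \<open>x\<close>, Cauchy-Schwarz gives (Q t)^2 <= |x|^2 Q
  (2t), and repeated doubling climbs from Q 1, the squared norm of the transposed matrix applied to
  \<open>x\<close>, to Q (2^m). In the last doubling the Frobenius norm of G^t, whose square is the
  trace of order \<open>k\<close>, takes over. The doubling is the reason for \<open>k\<close> being
  a power of two.\<close>

lemma bil_power_le_walk_sum:
  assumes k: "k = 2 ^ Suc m"
  shows "\<bar>bil a b H x y\<bar> ^ (2 * k) \<le> walk_sum k a b H * (l2 a x * l2 b y) ^ (2 * k)"
proof -
  let ?G = "gram_rows b H"
  define Q where "Q t = (\<Sum>i<a. \<Sum>j<a. x i * mat_pow a ?G t i j * x j)" for t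
  define ap where "ap t i = (\<Sum>j<a. mat_pow a ?G t i j * x j)" for t i
  have Q_ap: "Q t = (\<Sum>i<a. x i * ap t i)" for t
    by (simp add: Q_def ap_def sum_distrib_left mult.assoc)
  have Q2: "Q (2 * t) = (l2 a (ap t))\<^sup>2" for t
  proof -
    have "Q (2 * t) = (\<Sum>i<a. \<Sum>j<a. x i * (\<Sum>l<a. mat_pow a ?G t l i * mat_pow a ?G t l j) * x j)"
    proof -
      have "mat_pow a ?G (t + t) i j = (\<Sum>l<a. mat_pow a ?G t l i * mat_pow a ?G t l j)"
        if "i < a" "j < a" for i j
        unfolding mat_pow_add[OF that(2)]
        by (intro sum.cong refl) (simp add: mat_pow_sym[of ?G, OF gram_rows_sym that(1)])
      then show ?thesis unfolding Q_def mult_2 by (intro sum.cong refl) simp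
    qed
    also have "\<dots> = (\<Sum>l<a. \<Sum>i<a. \<Sum>j<a. (mat_pow a ?G t l i * x i) * (mat_pow a ?G t l j * x j))"
      unfolding sum_distrib_left sum_distrib_right
      by (subst (2) sum.swap, subst (1) sum.swap) (simp add: mult_ac)
    also have "\<dots> = (\<Sum>l<a. (ap t l)\<^sup>2)"
      by (simp add: ap_def power2_eq_square sum_product)
    finally show ?thesis by (simp add: l2_power2)
  qed
  have step: "(Q t)\<^sup>2 \<le> (l2 a x)\<^sup>2 * Q (2 * t)" for t
  proof -
    have "\<bar>Q t\<bar> \<le> l2 a x * l2 a (ap t)"
      unfolding Q_ap by (rule abs_inner_le_l2)
    then have "\<bar>Q t\<bar>\<^sup>2 \<le> (l2 a x * l2 a (ap t))\<^sup>2" by (intro power_mono) auto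
    then show ?thesis by (simp add: Q2 power_mult_distrib)
  qed
  have Q1: "Q 1 = (l2 b (col_comb a H x))\<^sup>2"
  proof -
    have "Q 1 = (\<Sum>i<a. x i * (\<Sum>j<a. ?G i j * x j))"
    proof -
      have "mat_pow a ?G 1 i j = ?G i j" if "i < a" for i j
        using that by (simp add: of_bool_def if_distrib[of "\<lambda>x. x * _"] cong: if_cong)
      then show ?thesis unfolding Q_def sum_distrib_left
        by (intro sum.cong refl) (simp only: lessThan_iff mult.assoc)
    qed
    also have "\<dots> = bil a b H x (col_comb a H x)"
      by (simp add: gram_rows_apply bil_def sum_distrib_left mult.left_commute[of "x _"] mult.assoc)
    finally show ?thesis by (simp only: bil_col_comb l2_mult_self)
  qed
  have iter: "(Q 1) ^ (2 ^ m) \<le> (l2 a x) ^ (2 * (2 ^ m - 1)) * Q (2 ^ m)" for m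
  proof (induction m)
    case (Suc m)
    have "(Q 1) ^ (2 ^ Suc m) = ((Q 1) ^ (2 ^ m))\<^sup>2" by (simp add: power_mult[symmetric] mult.commute)
    also have "\<dots> \<le> ((l2 a x) ^ (2 * (2 ^ m - 1)) * Q (2 ^ m))\<^sup>2"
      using Suc Q1 by (intro power_mono) auto
    also have "\<dots> \<le> (l2 a x) ^ (4 * (2 ^ m - 1)) * ((l2 a x)\<^sup>2 * Q (2 * 2 ^ m))"
    proof -
      have "((l2 a x) ^ (2 * (2 ^ m - 1)) * Q (2 ^ m))\<^sup>2 = (l2 a x) ^ (4 * (2 ^ m - 1)) * (Q (2 ^ m))\<^sup>2"
        unfolding power_mult_distrib power_mult[symmetric] by (simp add: mult.commute mult.left_commute)
      then show ?thesis using step[of "2 ^ m"] by (simp add: mult_left_mono)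
    qed
    also have "\<dots> = (l2 a x) ^ (4 * (2 ^ m - 1) + 2) * Q (2 ^ Suc m)"
      by (simp only: power_add power_Suc mult.assoc)
    also have "4 * (2 ^ m - 1) + 2 = 2 * (2 ^ Suc m - 1 :: nat)"
    proof -
      have "1 \<le> (2::nat) ^ m" by simp
      then show ?thesis unfolding power_Suc by linarith
    qed
    finally show ?case .
  qed simp
  define t :: nat where "t = 2 ^ m"
  have t: "1 \<le> t" "k = 2 * t" by (simp_all add: t_def k)
  have Qt: "(Q t)\<^sup>2 \<le> (l2 a x) ^ 4 * walk_sum k a b H"
  proof -
    have "(l2 a (ap t))\<^sup>2 \<le> (\<Sum>i<a. (l2 a (mat_pow a ?G t i))\<^sup>2 * (l2 a x)\<^sup>2)"
      unfolding l2_power2[where x = "ap t"]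
    proof (rule sum_mono)
      fix i
      have "\<bar>ap t i\<bar> \<le> l2 a (mat_pow a ?G t i) * l2 a x"
        unfolding ap_def by (rule abs_inner_le_l2)
      then have "\<bar>ap t i\<bar>\<^sup>2 \<le> (l2 a (mat_pow a ?G t i) * l2 a x)\<^sup>2" by (intro power_mono) auto
      then show "(ap t i)\<^sup>2 \<le> (l2 a (mat_pow a ?G t i))\<^sup>2 * (l2 a x)\<^sup>2" by (simp add: power_mult_distrib)
    qed
    also have "\<dots> = walk_sum k a b H * (l2 a x)\<^sup>2"
      unfolding t(2) walk_sum_eq_sum_squares[OF t(1)] by (simp add: l2_power2 sum_distrib_right)
    finally have "(l2 a x)\<^sup>2 * Q (2 * t) \<le> (l2 a x)\<^sup>2 * (walk_sum k a b H * (l2 a x)\<^sup>2)"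
      unfolding Q2 by (intro mult_left_mono) auto
    with step[of t] show ?thesis by (simp add: power4_eq_xxxx power2_eq_square mult_ac)
  qed
  have "(Q 1) ^ k = ((Q 1) ^ t)\<^sup>2" by (simp add: t(2) power_mult[symmetric] mult.commute)
  also have "\<dots> \<le> ((l2 a x) ^ (2 * (t - 1)) * Q t)\<^sup>2"
    using iter[of m] Q1 by (intro power_mono) (auto simp: t_def)
  also have "\<dots> \<le> (l2 a x) ^ (4 * (t - 1)) * ((l2 a x) ^ 4 * walk_sum k a b H)"
  proof -
    have "((l2 a x) ^ (2 * (t - 1)) * Q t)\<^sup>2 = (l2 a x) ^ (4 * (t - 1)) * (Q t)\<^sup>2"
      unfolding power_mult_distrib power_mult[symmetric] by (simp add: mult.commute mult.left_commute)
    then show ?thesis using Qt by (simp add: mult_left_mono)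
  qed
  also have "\<dots> = (l2 a x) ^ (4 * (t - 1) + 4) * walk_sum k a b H" by (simp add: power_add)
  also have "4 * (t - 1) + 4 = 2 * k" using t by simp
  finally have main: "(Q 1) ^ k \<le> (l2 a x) ^ (2 * k) * walk_sum k a b H" .
  have "\<bar>bil a b H x y\<bar> \<le> l2 b (col_comb a H x) * l2 b y"
    unfolding bil_col_comb by (rule abs_inner_le_l2)
  then have "\<bar>bil a b H x y\<bar> ^ (2 * k) \<le> (l2 b (col_comb a H x) * l2 b y) ^ (2 * k)" by (intro power_mono) auto
  also have "\<dots> = (Q 1) ^ k * (l2 b y) ^ (2 * k)" by (simp only: Q1 power_mult power_mult_distrib)
  also have "\<dots> \<le> ((l2 a x) ^ (2 * k) * walk_sum k a b H) * (l2 b y) ^ (2 * k)"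
    using main by (intro mult_right_mono) auto
  finally show ?thesis by (simp add: power_mult_distrib mult_ac)
qed

section \<open>Spectral norm of the sampling error\<close>

text \<open>The comparison distribution: its mean vanishes and all its higher moments are at least one, so
  that, for a matrix with such independent entries, the expected trace counts at least the good walks.\<close>

definition skew_pmf :: "real pmf" where
  "skew_pmf = map_pmf (\<lambda>b. if b then 2 else -1/2) (bernoulli_pmf (1/5))"

lemma expectation_skew_pmf: "measure_pmf.expectation skew_pmf f = (f 2 + 4 * f (-1/2)) / 5" for f :: "real \<Rightarrow> real"
  by (simp add: skew_pmf_def integral_bernoulli_pmf field_simps)

lemma set_skew_pmf: "set_pmf skew_pmf \<subseteq> {2, -1/2}"
  by (auto simp: skew_pmf_def)

lemma finite_set_skew_pmf [simp]: "finite (set_pmf skew_pmf)"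
  by (rule finite_subset[OF set_skew_pmf]) simp

text \<open>The second moment is exactly 1. From the third on, 2^l is at least 8 while the atom at
  -1/2 takes off at most 4 * 1/4, so the moment is at least 7/5. The asymmetry of the law keeps the
  odd moments away from zero.\<close>

lemma skew_pmf_moment_ge:
  assumes "2 \<le> l" shows "1 \<le> measure_pmf.expectation skew_pmf (\<lambda>x. x ^ l)"
proof (cases "l = 2")
  case True then show ?thesis by (simp add: expectation_skew_pmf power2_eq_square)
next
  case False
  have "\<bar>(-1/2::real) ^ l\<bar> \<le> 1/4"
  proof -
    have "\<bar>(-1/2::real) ^ l\<bar> = (1/2) ^ l" by (simp add: power_abs)
    also have "\<dots> \<le> (1/2) ^ 2" using assms by (intro power_decreasing) auto
    finally show ?thesis by (simp add: power2_eq_square)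
  qed
  then have "- 1/4 \<le> (-1/2::real) ^ l" by linarith
  moreover have "(2::real) ^ 3 \<le> 2 ^ l" using assms False by (intro power_increasing) auto
  ultimately show ?thesis by (simp add: expectation_skew_pmf)
qed

lemma skew_pmf_mgf: "measure_pmf.expectation skew_pmf (\<lambda>x. exp (t * x)) \<le> exp (4 * t\<^sup>2)"
proof -
  have "measure_pmf.expectation skew_pmf (\<lambda>x. exp (t * x)) \<le>
     ((t * 2 + exp (4 * t\<^sup>2)) + 4 * (t * (-1/2) + exp (4 * t\<^sup>2))) / 5"
    unfolding expectation_skew_pmf
  proof (intro divide_right_mono add_mono mult_left_mono)
    show "exp (t * 2) \<le> t * 2 + exp (4 * t\<^sup>2)"
      using exp_le_add_exp_square[of "t * 2"] by (simp add: power_mult_distrib mult.commute)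
    have "exp ((t * (-1/2))\<^sup>2) \<le> exp (4 * t\<^sup>2)" by (simp add: power_mult_distrib power2_eq_square)
    then show "exp (t * (-1/2)) \<le> t * (-1/2) + exp (4 * t\<^sup>2)"
      using exp_le_add_exp_square[of "t * (-1/2)"] by linarith
  qed auto
  then show ?thesis by simp
qed

lemma power_le_fact_exp: "0 \<le> x \<Longrightarrow> x ^ n \<le> fact n * exp x" for x :: real
proof -
  assume x: "0 \<le> x"
  have "(\<Sum>i\<in>{n}. inverse (fact i) * x ^ i) \<le> (\<Sum>i. inverse (fact i) * x ^ i)"
    using x summable_exp[of x] by (intro sum_le_suminf) auto
  then have "x ^ n / fact n \<le> exp x" by (simp add: exp_def field_simps scaleR_conv_of_real)
  then show ?thesis by (simp add: field_simps)
qed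

text \<open>The form is sub-Gaussian with parameter |x|^2 |y|^2 <= 1, and its moments follow from
  z^n <= n! exp z.\<close>

lemma skew_bil_moment:
  assumes k: "1 \<le> k" and x: "l2 a x \<le> 1" and y: "l2 b y \<le> 1"
  shows "measure_pmf.expectation (Pi_pmf ({..<a} \<times> {..<b}) 0 (\<lambda>_. skew_pmf))
      (\<lambda>\<omega>. (bil a b (\<lambda>i j. \<omega> (i, j)) x y) ^ (2 * k)) \<le> 2 * (512 * real k) ^ k"
proof -
  let ?E = "{..<a} \<times> {..<b}"
  let ?P = "Pi_pmf ?E 0 (\<lambda>_. skew_pmf)"
  let ?z = "\<lambda>\<omega>. bil a b (\<lambda>i j. \<omega> (i, j)) x y"
  have fin: "finite (set_pmf ?P)" by (rule finite_set_Pi_pmf) auto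
  have int: "integrable (measure_pmf ?P) f" for f :: "_ \<Rightarrow> real"
    by (rule integrable_measure_pmf_finite[OF fin])
  have mgf: "measure_pmf.expectation ?P (\<lambda>\<omega>. exp (t * ?z \<omega>)) \<le> exp (4 * t\<^sup>2)" for t
  proof -
    have "measure_pmf.expectation ?P (\<lambda>\<omega>. exp (t * ?z \<omega>))
        = measure_pmf.expectation ?P (\<lambda>\<omega>. \<Prod>e\<in>?E. (\<lambda>e w. exp (t * x (fst e) * y (snd e) * w)) e (\<omega> e))"
      by (intro Bochner_Integration.integral_cong refl)
         (simp add: bil_def sum.cartesian_product sum_distrib_left exp_sum case_prod_unfold mult_ac)
    also have "\<dots> = (\<Prod>e\<in>?E. measure_pmf.expectation skew_pmf (\<lambda>w. exp (t * x (fst e) * y (snd e) * w)))"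
      by (rule expectation_prod_Pi_pmf_finite) auto
    also have "\<dots> \<le> (\<Prod>e\<in>?E. exp (4 * (t * x (fst e) * y (snd e))\<^sup>2))"
      by (intro prod_mono conjI skew_pmf_mgf) simp
    also have "\<dots> = exp (\<Sum>e\<in>?E. 4 * (t * x (fst e) * y (snd e))\<^sup>2)" by (simp add: exp_sum)
    also have "(\<Sum>e\<in>?E. 4 * (t * x (fst e) * y (snd e))\<^sup>2) = 4 * t\<^sup>2 * ((\<Sum>i<a. (x i)\<^sup>2) * (\<Sum>j<b. (y j)\<^sup>2))"
      unfolding sum_product sum.cartesian_product
      by (simp add: sum_distrib_left power_mult_distrib case_prod_unfold mult_ac)
    also have "exp \<dots> \<le> exp (4 * t\<^sup>2 * 1)"
    proof -
      have "(\<Sum>i<a. (x i)\<^sup>2) \<le> 1" "(\<Sum>j<b. (y j)\<^sup>2) \<le> 1" using x y by (auto simp: L2_set_def)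
      then have "(\<Sum>i<a. (x i)\<^sup>2) * (\<Sum>j<b. (y j)\<^sup>2) \<le> 1" by (intro mult_le_one) (auto intro: sum_nonneg)
      then have "4 * t\<^sup>2 * ((\<Sum>i<a. (x i)\<^sup>2) * (\<Sum>j<b. (y j)\<^sup>2)) \<le> 4 * t\<^sup>2 * 1"
        by (intro mult_left_mono) auto
      then show ?thesis by (simp only: exp_le_cancel_iff)
    qed
    finally show ?thesis by simp
  qed
  \<comment> \<open>This order of magnitude balances t^(2k) against exp (4 t^2). The factorial,
    bounded by (2k)^(2k), then leaves (4k)^k, and exp (4k) <= 128^k turns it into (512 k)^k.\<close>
  define t where "t = sqrt (real k)"
  have t: "0 < t" "t\<^sup>2 = real k" using k by (auto simp: t_def)
  have tk: "t ^ (2 * k) = real k ^ k" by (simp add: power_mult t(2))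
  have "measure_pmf.expectation ?P (\<lambda>\<omega>. (?z \<omega>) ^ (2 * k))
     \<le> measure_pmf.expectation ?P (\<lambda>\<omega>. fact (2 * k) / t ^ (2 * k) * (exp (t * ?z \<omega>) + exp (- t * ?z \<omega>)))"
  proof (rule integral_mono)
    fix \<omega> :: "nat \<times> nat \<Rightarrow> real"
    have "(t * ?z \<omega>) ^ (2 * k) = \<bar>t * ?z \<omega>\<bar> ^ (2 * k)" by (simp add: power_even_abs)
    also have "\<dots> \<le> fact (2 * k) * exp \<bar>t * ?z \<omega>\<bar>" by (rule power_le_fact_exp) simp
    also have "\<dots> \<le> fact (2 * k) * (exp (t * ?z \<omega>) + exp (- t * ?z \<omega>))"
      by (intro mult_left_mono) (auto simp: abs_if)
    finally show "(?z \<omega>) ^ (2 * k) \<le> fact (2 * k) / t ^ (2 * k) * (exp (t * ?z \<omega>) + exp (- t * ?z \<omega>))"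
      using t(1) by (simp add: power_mult_distrib field_simps)
  qed (rule int)+
  also have "\<dots> = fact (2 * k) / t ^ (2 * k) * (measure_pmf.expectation ?P (\<lambda>\<omega>. exp (t * ?z \<omega>))
       + measure_pmf.expectation ?P (\<lambda>\<omega>. exp (- t * ?z \<omega>)))"
    by (subst Bochner_Integration.integral_mult_right[OF int], subst Bochner_Integration.integral_add[OF int int]) (rule refl)
  also have "\<dots> \<le> fact (2 * k) / t ^ (2 * k) * (exp (4 * real k) + exp (4 * real k))"
    using mgf[of t] mgf[of "-t"] t by (intro mult_left_mono add_mono) auto
  also have "\<dots> \<le> (2 * real k) ^ (2 * k) / t ^ (2 * k) * (128 ^ k + 128 ^ k)"
  proof -
    have "exp (4 * real k) = exp 1 ^ (4 * k)" by (simp flip: exp_of_nat_mult)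
    also have "\<dots> \<le> 3 ^ (4 * k)" using exp_le by (intro power_mono) auto
    also have "\<dots> = 81 ^ k" by (simp add: power_mult)
    also have "\<dots> \<le> 128 ^ k" by (intro power_mono) auto
    finally have 1: "exp (4 * real k) \<le> 128 ^ k" .
    have "fact (2 * k) \<le> real ((2 * k) ^ (2 * k))" using fact_le_power[of "2 * k"] by simp
    then have "fact (2 * k) \<le> (2 * real k) ^ (2 * k)" by simp
    then show ?thesis using 1 t(1) by (intro mult_mono divide_right_mono add_mono) auto
  qed
  also have "\<dots> = 2 * (512 * real k) ^ k"
  proof -
    have "(2 * real k) ^ (2 * k) = ((2 * real k)\<^sup>2) ^ k" by (rule power_mult)
    also have "(2 * real k)\<^sup>2 = (4 * real k) * real k" by (simp add: power2_eq_square)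
    finally have "(2 * real k) ^ (2 * k) / t ^ (2 * k) = (4 * real k) ^ k"
      using k by (simp only: tk power_mult_distrib) simp
    moreover have "(4 * real k) ^ k * 128 ^ k = (512 * real k) ^ k"
      unfolding power_mult_distrib[symmetric] by simp
    ultimately show ?thesis by (simp only: distrib_left mult_2)
  qed
  finally show ?thesis .
qed

lemma walk_edge_range:
  assumes "u \<in> words k a" "v \<in> words k b" "1 \<le> k"
  shows "walk_edge k u v ` {..<2 * k} \<subseteq> {..<a} \<times> {..<b}"
  using assms by (auto simp: walk_edge_def row_pos_def col_pos_def PiE_iff)

text \<open>Every good walk contributes at least one to the expected trace and every other walk
  contributes zero or more, so the expected trace bounds the number of good walks from
  above.\<close>

lemma skew_walk_sum_ge:
  assumes k: "1 \<le> k"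
  shows "(\<Sum>u\<in>words k a. \<Sum>v\<in>words k b. of_bool (good_walk (2 * k) (walk_edge k u v)))
    \<le> measure_pmf.expectation (Pi_pmf ({..<a} \<times> {..<b}) 0 (\<lambda>_. skew_pmf))
      (\<lambda>\<omega>. walk_sum k a b (\<lambda>i j. \<omega> (i, j)))"
proof -
  let ?E = "{..<a} \<times> {..<b}"
  let ?P = "Pi_pmf ?E 0 (\<lambda>_. skew_pmf)"
  have fin: "finite (set_pmf ?P)" by (rule finite_set_Pi_pmf) auto
  have int: "integrable (measure_pmf ?P) f" for f :: "_ \<Rightarrow> real"
    by (rule integrable_measure_pmf_finite[OF fin])
  have "measure_pmf.expectation ?P (\<lambda>\<omega>. walk_sum k a b (\<lambda>i j. \<omega> (i, j)))
     = (\<Sum>u\<in>words k a. \<Sum>v\<in>words k b. measure_pmf.expectation ?P (\<lambda>\<omega>. \<Prod>q<2 * k. \<omega> (walk_edge k u v q)))"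
    unfolding walk_sum_def by (simp add: Bochner_Integration.integral_sum[OF int])
  also have "\<dots> \<ge> (\<Sum>u\<in>words k a. \<Sum>v\<in>words k b. of_bool (good_walk (2 * k) (walk_edge k u v)))"
  proof (intro sum_mono)
    fix u v assume uv: "u \<in> words k a" "v \<in> words k b"
    let ?g = "walk_edge k u v"
    have sub: "?g ` {..<2 * k} \<subseteq> ?E" using uv k by (rule walk_edge_range)
    have "measure_pmf.expectation ?P (\<lambda>\<omega>. \<Prod>q<2 * k. \<omega> (?g q))
       = measure_pmf.expectation ?P (\<lambda>\<omega>. \<Prod>e\<in>?E. (\<lambda>e w. w ^ card {q \<in> {..<2 * k}. ?g q = e}) e (\<omega> e))"
      by (intro Bochner_Integration.integral_cong refl, subst prod_eq_prod_power_card[OF _ sub]) auto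
    also have "\<dots> = (\<Prod>e\<in>?E. measure_pmf.expectation skew_pmf (\<lambda>w. w ^ card {q \<in> {..<2 * k}. ?g q = e}))"
      by (rule expectation_prod_Pi_pmf_finite) auto
    also have "of_bool (good_walk (2 * k) ?g) \<le> \<dots>"
      by (rule prod_moments_ge[OF _ sub, where m = "\<lambda>_ l. measure_pmf.expectation skew_pmf (\<lambda>w. w ^ l)"])
        (use skew_pmf_moment_ge in \<open>auto simp: expectation_skew_pmf\<close>)
    finally show "of_bool (good_walk (2 * k) ?g) \<le> measure_pmf.expectation ?P (\<lambda>\<omega>. \<Prod>q<2 * k. \<omega> (?g q))" .
  qed
  finally show ?thesis .
qed

text \<open>The maximum of the form over the net is replaced by the sum of its 2k-th powers. Since
  the dimension 2k is proportional to the moment order, the 2^(72 k) pairs of net points cost only a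
  constant factor per moment; the constant is 2^72 * 4 * 512 = 2^83.\<close>

lemma skew_walk_sum_le:
  assumes k: "1 \<le> k"
  shows "measure_pmf.expectation (Pi_pmf ({..<2 * k} \<times> {..<2 * k}) 0 (\<lambda>_. skew_pmf))
      (\<lambda>\<omega>. walk_sum k (2 * k) (2 * k) (\<lambda>i j. \<omega> (i, j))) \<le> 4 * real k * (2 ^ 83 * real k) ^ k"
proof -
  let ?D = "2 * k"
  let ?P = "Pi_pmf ({..<?D} \<times> {..<?D}) 0 (\<lambda>_. skew_pmf)"
  let ?N = "grid_net ?D"
  let ?bil = "\<lambda>\<omega> x y. bil ?D ?D (\<lambda>i j. \<omega> (i, j)) x y"
  have fin: "finite (set_pmf ?P)" by (rule finite_set_Pi_pmf) auto
  have int: "integrable (measure_pmf ?P) f" for f :: "_ \<Rightarrow> real"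
    by (rule integrable_measure_pmf_finite[OF fin])
  have ne: "?N \<noteq> {}" using grid_net_approx[where m = ?D and x = "\<lambda>_. 0"] by (auto simp: L2_set_def)
  have pt: "walk_sum k ?D ?D (\<lambda>i j. \<omega> (i, j)) \<le> real ?D * (\<Sum>x\<in>?N. \<Sum>y\<in>?N. (2 * ?bil \<omega> x y) ^ (2 * k))"
    for \<omega> :: "nat \<times> nat \<Rightarrow> real"
  proof -
    define B where "B = (\<lambda>(x, y). \<bar>?bil \<omega> x y\<bar>) ` (?N \<times> ?N)"
    have B: "finite B" "B \<noteq> {}" using ne by (auto simp: B_def)
    define s where "s = Max B"
    obtain x0 y0 where xy: "x0 \<in> ?N" "y0 \<in> ?N" "s = \<bar>?bil \<omega> x0 y0\<bar>"
      using Max_in[OF B] by (auto simp: s_def B_def)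
    have le: "?bil \<omega> x y \<le> s" if "x \<in> ?N" "y \<in> ?N" for x y
    proof -
      have "\<bar>?bil \<omega> x y\<bar> \<in> B" using that by (auto simp: B_def)
      then show ?thesis using Max_ge[OF B(1)] by (fastforce simp: s_def)
    qed
    have "walk_sum k ?D ?D (\<lambda>i j. \<omega> (i, j)) \<le> real ?D * (2 * s) ^ (2 * k)"
      by (rule walk_sum_le[OF bil_net_bound _ k]) (use le xy in auto)
    also have "(2 * s) ^ (2 * k) = (2 * ?bil \<omega> x0 y0) ^ (2 * k)" by (simp add: xy(3) power_mult_distrib power_even_abs)
    also have "\<dots> \<le> (\<Sum>y\<in>?N. (2 * ?bil \<omega> x0 y) ^ (2 * k))"
      using xy(2) by (intro member_le_sum) (auto simp: power_mult)
    also have "\<dots> \<le> (\<Sum>x\<in>?N. \<Sum>y\<in>?N. (2 * ?bil \<omega> x y) ^ (2 * k))"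
      using xy(1) by (intro member_le_sum[where f = "\<lambda>x. \<Sum>y\<in>?N. (2 * ?bil \<omega> x y) ^ (2 * k)"])
        (auto simp: power_mult intro!: sum_nonneg)
    finally show ?thesis by (simp add: mult_left_mono)
  qed
  have "measure_pmf.expectation ?P (\<lambda>\<omega>. walk_sum k ?D ?D (\<lambda>i j. \<omega> (i, j)))
     \<le> measure_pmf.expectation ?P (\<lambda>\<omega>. real ?D * (\<Sum>x\<in>?N. \<Sum>y\<in>?N. (2 * ?bil \<omega> x y) ^ (2 * k)))"
    by (intro integral_mono int pt)
  also have "\<dots> = real ?D * (\<Sum>x\<in>?N. \<Sum>y\<in>?N. 4 ^ k * measure_pmf.expectation ?P (\<lambda>\<omega>. (?bil \<omega> x y) ^ (2 * k)))"
    by (simp add: Bochner_Integration.integral_sum[OF int] Bochner_Integration.integral_mult_right[OF int]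
        power_mult_distrib power_mult)
  also have "\<dots> \<le> real ?D * (\<Sum>x\<in>?N. \<Sum>y\<in>?N. 4 ^ k * (2 * (512 * real k) ^ k))"
    by (intro mult_left_mono sum_mono skew_bil_moment k grid_net_l2) auto
  also have "\<dots> = real ?D * ((real (card ?N) * real (card ?N)) * (2 * (4 ^ k * (512 * real k) ^ k)))"
    by simp
  also have "\<dots> \<le> real ?D * ((2 ^ (18 * ?D) * 2 ^ (18 * ?D)) * (2 * (4 ^ k * (512 * real k) ^ k)))"
  proof -
    have "real (card ?N) \<le> 2 ^ (18 * ?D)" using card_grid_net[of ?D] by (metis of_nat_le_iff of_nat_numeral of_nat_power)
    then show ?thesis by (intro mult_left_mono mult_right_mono mult_mono) auto
  qed
  also have "\<dots> = 4 * real k * (2 ^ 83 * real k) ^ k"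
  proof -
    have "(2::real) ^ (18 * ?D) * 2 ^ (18 * ?D) = (2 ^ 72) ^ k" 
      unfolding power_add[symmetric] power_mult[symmetric] by (rule arg_cong[where f = "power 2"]) simp
    moreover have "(2 ^ 72) ^ k * (4 ^ k * (512 * real k) ^ k) = (2 ^ 83 * real k) ^ k"
      unfolding power_mult_distrib[symmetric] by simp
    ultimately show ?thesis by simp
  qed
  finally show ?thesis .
qed

text \<open>Outside \<open>S\<close> the entry is 0 and not -p, so that one triangle of the grid can
  be treated as a matrix of its own.\<close>

definition centered_sample :: "(nat \<times> nat) set \<Rightarrow> real \<Rightarrow> (nat \<times> nat) set \<Rightarrow> nat \<Rightarrow> nat \<Rightarrow> real" where
  "centered_sample S p \<Omega> i j = of_bool ((i, j) \<in> S) * (of_bool ((i, j) \<in> \<Omega>) - p)"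

text \<open>The centred Bernoulli moments of order at least two are bounded by p (1 - p) + p^2 = p.
  The alphabet size is D = 2k, for then the hypothesis of the comparison, that the dimension times
  \<open>p\<close> be at most D - k, is the assumed bound by \<open>k\<close>.\<close>

lemma sample_walk_sum_le:
  assumes k: "1 \<le> k" and p: "0 < p" "p \<le> 1" and S: "S \<subseteq> {..<a} \<times> {..<b}"
    and a: "real a * p \<le> real k" and b: "real b * p \<le> real k"
  shows "measure_pmf.expectation (bernoulli_subset S p) (\<lambda>\<Omega>. walk_sum k a b (centered_sample S p \<Omega>))
      \<le> 4 * real k * (2 ^ 83 * real k) ^ k / p"
proof -
  let ?E = "{..<a} \<times> {..<b}"
  let ?P = "bernoulli_subset S p"
  have finS: "finite S" using S by (rule finite_subset) auto
  have int: "integrable (measure_pmf ?P) f" for f :: "_ \<Rightarrow> real"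
    using finS by (intro integrable_measure_pmf_finite) simp
  define m where "m e l = (if e \<in> S then p * (1 - p) ^ l + (1 - p) * (- p) ^ l else 0 ^ l)" for e :: "nat \<times> nat" and l :: nat
  have m2: "\<bar>m e l\<bar> \<le> p" if "2 \<le> l" for e l
  proof (cases "e \<in> S")
    case True
    have "\<bar>m e l\<bar> \<le> \<bar>p * (1 - p) ^ l\<bar> + \<bar>(1 - p) * (- p) ^ l\<bar>" using True by (simp add: m_def)
    also have "\<dots> = p * (1 - p) ^ l + (1 - p) * p ^ l" using p by (simp add: abs_mult power_abs)
    also have "\<dots> \<le> p * (1 - p) ^ 1 + 1 * p ^ 2"
      using p that by (intro add_mono mult_mono power_decreasing mult_left_mono) auto
    also have "\<dots> = p" by (simp add: algebra_simps power2_eq_square)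
    finally show ?thesis .
  next
    case False then show ?thesis using that p by (simp add: m_def power_0_left)
  qed
  have "measure_pmf.expectation ?P (\<lambda>\<Omega>. walk_sum k a b (centered_sample S p \<Omega>))
     = (\<Sum>u\<in>words k a. \<Sum>v\<in>words k b. measure_pmf.expectation ?P
          (\<lambda>\<Omega>. \<Prod>q<2 * k. case_prod (centered_sample S p \<Omega>) (walk_edge k u v q)))"
    unfolding walk_sum_def by (simp add: Bochner_Integration.integral_sum[OF int])
  also have "\<dots> \<le> (\<Sum>u\<in>words k a. \<Sum>v\<in>words k b. of_bool (good_walk (2 * k) (walk_edge k u v))
            * p ^ card (walk_edge k u v ` {..<2 * k}))"
  proof (intro sum_mono)
    fix u v assume uv: "u \<in> words k a" "v \<in> words k b"
    let ?g = "walk_edge k u v"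
    let ?c = "\<lambda>e. card {q \<in> {..<2 * k}. ?g q = e}"
    have sub: "?g ` {..<2 * k} \<subseteq> ?E" using uv k by (rule walk_edge_range)
    have E: "?E = S \<union> (?E - S)" "S \<inter> (?E - S) = {}" using S by auto
    have split: "(\<Prod>e\<in>?E. f e) = (\<Prod>e\<in>S. f e) * (\<Prod>e\<in>?E - S. f e)" for f :: "nat \<times> nat \<Rightarrow> real"
      using prod.union_disjoint[of S "?E - S" f] E finS by (metis finite_Diff finite_SigmaI finite_lessThan)
    have "measure_pmf.expectation ?P (\<lambda>\<Omega>. \<Prod>q<2 * k. case_prod (centered_sample S p \<Omega>) (?g q))
       = measure_pmf.expectation ?P (\<lambda>\<Omega>. (\<Prod>e\<in>?E - S. 0 ^ ?c e) * (\<Prod>e\<in>S. (\<lambda>e w. (of_bool w - p) ^ ?c e) e (e \<in> \<Omega>)))"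
    proof (intro Bochner_Integration.integral_cong refl)
      fix \<Omega>
      have "(\<Prod>q<2 * k. case_prod (centered_sample S p \<Omega>) (?g q)) = (\<Prod>e\<in>?E. (case_prod (centered_sample S p \<Omega>) e) ^ ?c e)"
        by (rule prod_eq_prod_power_card[OF _ sub]) auto
      also have "\<dots> = (\<Prod>e\<in>S. (of_bool (e \<in> \<Omega>) - p) ^ ?c e) * (\<Prod>e\<in>?E - S. 0 ^ ?c e)"
        unfolding split by (intro arg_cong2[where f = "(*)"] prod.cong refl) (auto simp: centered_sample_def)
      finally show "(\<Prod>q<2 * k. case_prod (centered_sample S p \<Omega>) (?g q))
        = (\<Prod>e\<in>?E - S. 0 ^ ?c e) * (\<Prod>e\<in>S. (\<lambda>e w. (of_bool w - p) ^ ?c e) e (e \<in> \<Omega>))" by simp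
    qed
    also have "\<dots> = (\<Prod>e\<in>?E - S. 0 ^ ?c e) * (\<Prod>e\<in>S. p * (1 - p) ^ ?c e + (1 - p) * (- p) ^ ?c e)"
      using p by (subst Bochner_Integration.integral_mult_right[OF int],
          subst expectation_prod_bernoulli_subset[OF finS]) auto
    also have "\<dots> = (\<Prod>e\<in>?E. m e (?c e))"
      unfolding split by (subst mult.commute, intro arg_cong2[where f = "(*)"] prod.cong refl) (auto simp: m_def)
    also have "\<dots> \<le> of_bool (good_walk (2 * k) ?g) * p ^ card (?g ` {..<2 * k})"
      by (rule prod_moments_le[OF _ sub _ _ m2]) (use p in \<open>auto simp: m_def algebra_simps\<close>)
    finally show "measure_pmf.expectation ?P (\<lambda>\<Omega>. \<Prod>q<2 * k. case_prod (centered_sample S p \<Omega>) (?g q))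
      \<le> of_bool (good_walk (2 * k) ?g) * p ^ card (?g ` {..<2 * k})" .
  qed
  also have "\<dots> \<le> (\<Sum>u\<in>words k (2 * k). \<Sum>v\<in>words k (2 * k). of_bool (good_walk (2 * k) (walk_edge k u v))) / p"
    by (rule good_walks_compare) (use k p a b in auto)
  also have "\<dots> \<le> (4 * real k * (2 ^ 83 * real k) ^ k) / p"
    using skew_walk_sum_ge[OF k, of "2 * k" "2 * k"] skew_walk_sum_le[OF k] p by (intro divide_right_mono) auto
  finally show ?thesis .
qed

lemma ex_power2_between: fixes x :: real assumes "1 \<le> x" shows "\<exists>m. x \<le> 2 ^ Suc m \<and> 2 ^ Suc m \<le> 2 * x"
proof -
  obtain n where n: "x \<le> 2 ^ n" using real_arch_pow[of 2 x] by (auto intro: less_imp_le)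
  define m where "m = (LEAST n. x \<le> 2 ^ n)"
  have m: "x \<le> 2 ^ m" unfolding m_def by (rule LeastI[where P = "\<lambda>n. x \<le> 2 ^ n", OF n])
  show ?thesis
  proof (cases m)
    case 0 then show ?thesis using m assms by (intro exI[of _ 0]) auto
  next
    case (Suc l)
    then have "\<not> x \<le> 2 ^ l" using not_less_Least[of l "\<lambda>n. x \<le> 2 ^ n"] by (simp add: m_def)
    then show ?thesis using m Suc by (intro exI[of _ l]) auto
  qed
qed

text \<open>Markov's inequality for the trace of order \<open>k\<close>, a power of two between n p
  and 2 n p. The threshold s = 2^43 sqrt (n p) makes the ratio 2^83 k / s^2 at most 1/4 < exp (-1),
  so its k-th power is below exp (- n p). The supremum over \<open>x\<close> and \<open>y\<close> is
  already contained in the trace.\<close>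

lemma sample_spectral_tail:
  assumes p: "0 < p" "p \<le> 1" and S: "S \<subseteq> {..<a} \<times> {..<b}" and n: "n = max a b" "1 \<le> real n * p"
  shows "measure_pmf.prob (bernoulli_subset S p)
      {\<Omega>. \<exists>x y. 2 ^ 43 * sqrt (real n * p) * l2 a x * l2 b y < \<bar>bil a b (centered_sample S p \<Omega>) x y\<bar>}
     \<le> 8 * real n * exp (- real n * p)"
proof -
  obtain m where m: "real n * p \<le> 2 ^ Suc m" "2 ^ Suc m \<le> 2 * (real n * p)"
    using ex_power2_between[OF n(2)] by auto
  define k :: nat where "k = 2 ^ Suc m"
  have k: "1 \<le> k" "real n * p \<le> real k" "real k \<le> 2 * (real n * p)" using m by (auto simp: k_def)
  have ab: "real a * p \<le> real k" "real b * p \<le> real k"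
  proof -
    have "real a * p \<le> real n * p" "real b * p \<le> real n * p"
      using p n(1) by (auto intro!: mult_right_mono)
    then show "real a * p \<le> real k" "real b * p \<le> real k" using k(2) by linarith+
  qed
  have finS: "finite S" using S by (rule finite_subset) auto
  let ?W = "\<lambda>\<Omega>. walk_sum k a b (centered_sample S p \<Omega>)"
  define s where "s = 2 ^ 43 * sqrt (real n * p)"
  have s: "0 < s" "s\<^sup>2 = 2 ^ 86 * (real n * p)" using n(2) by (auto simp: s_def power_mult_distrib)
  have "measure_pmf.prob (bernoulli_subset S p)
      {\<Omega>. \<exists>x y. s * l2 a x * l2 b y < \<bar>bil a b (centered_sample S p \<Omega>) x y\<bar>}
    \<le> measure_pmf.prob (bernoulli_subset S p) {\<Omega>. s ^ (2 * k) \<le> ?W \<Omega>}"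
  proof (rule measure_pmf.finite_measure_mono)
    show "{\<Omega>. \<exists>x y. s * l2 a x * l2 b y < \<bar>bil a b (centered_sample S p \<Omega>) x y\<bar>}
      \<subseteq> {\<Omega>. s ^ (2 * k) \<le> ?W \<Omega>}"
    proof safe
    fix \<Omega> x y
    let ?b = "\<bar>bil a b (centered_sample S p \<Omega>) x y\<bar>" and ?l = "l2 a x * l2 b y"
    assume lt: "s * l2 a x * l2 b y < ?b"
    have l0: "0 \<le> ?l" by simp
    have "(s * ?l) ^ (2 * k) < ?b ^ (2 * k)"
      using lt s l0 k(1) by (intro power_strict_mono) (auto simp: mult.assoc)
    also have "\<dots> \<le> ?W \<Omega> * ?l ^ (2 * k)" by (rule bil_power_le_walk_sum[OF k_def])
    finally have "s ^ (2 * k) * ?l ^ (2 * k) < ?W \<Omega> * ?l ^ (2 * k)" by (simp only: power_mult_distrib)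
    moreover have "0 \<le> ?l ^ (2 * k)" using l0 by simp
    ultimately show "s ^ (2 * k) \<le> ?W \<Omega>" by (metis less_le_not_le linorder_le_less_linear mult_right_mono)
    qed
  qed simp
  also have "\<dots> \<le> measure_pmf.expectation (bernoulli_subset S p) ?W / s ^ (2 * k)"
  proof (rule pmf_markov)
    \<comment> \<open>An even order makes the trace a sum of squares, hence nonnegative.\<close>
    have k2: "k = 2 * 2 ^ m" by (simp add: k_def)
    show "0 \<le> ?W \<Omega>" for \<Omega> unfolding k2 by (subst walk_sum_eq_sum_squares) (auto intro!: sum_nonneg)
  qed (use finS s in auto)
  also have "\<dots> \<le> (4 * real k * (2 ^ 83 * real k) ^ k / p) / s ^ (2 * k)"
    using sample_walk_sum_le[OF k(1) p S ab] s by (intro divide_right_mono) auto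
  also have "\<dots> = (4 * real k / p) * ((2 ^ 83 * real k) / s\<^sup>2) ^ k" by (simp add: power_mult power_divide)
  also have "\<dots> \<le> (8 * real n) * exp (- real n * p)"
  proof (rule mult_mono)
    show "4 * real k / p \<le> 8 * real n" using k(3) p by (simp add: field_simps)
    have pos: "0 < real n * p" using n(2) by linarith
    have "(2 ^ 83 * real k) / s\<^sup>2 \<le> (2 ^ 83 * (2 * (real n * p))) / s\<^sup>2"
      using k(3) s by (intro divide_right_mono mult_left_mono) auto
    also have "\<dots> = 1 / 4"
    proof -
      have "2 ^ 83 * (2 * c) / (2 ^ 86 * c) = 1 / 4" if "0 < c" for c :: real using that by simp
      then show ?thesis unfolding s(2) using pos by blast
    qed
    also have "\<dots> \<le> exp (- 1)" 
    proof -
      have "exp (1::real) \<le> 4" using exp_le by simp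
      then show ?thesis by (simp add: exp_minus inverse_eq_divide field_simps)
    qed
    finally have "((2 ^ 83 * real k) / s\<^sup>2) ^ k \<le> exp (- 1) ^ k" by (intro power_mono) auto
    also have "\<dots> = exp (- real k)" by (simp flip: exp_of_nat_mult)
    also have "\<dots> \<le> exp (- real n * p)" using k(2) by simp
    finally show "((2 ^ 83 * real k) / s\<^sup>2) ^ k \<le> exp (- real n * p)" .
  qed (use s p in auto)
  finally show ?thesis unfolding s_def .
qed

section \<open>The sampling event\<close>

text \<open>The deviation is a quadratic form in only \<open>r\<close> variables, so a net of size
  2^(36 r) in pairs suffices. For net points incoherence bounds each weight by
  \<open>\<gamma>\<close>, and with isotropy it bounds the sum of squared weights by
  \<open>\<gamma>\<close> as well. The factor 2 in the event is the loss in
  \<open>bil_net_bound\<close>.\<close>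

lemma isotropic_sample_tail:
  fixes u :: "'a \<Rightarrow> nat \<Rightarrow> real"
  assumes S: "finite S" and p: "0 \<le> p" "p \<le> 1" and c: "0 < c" "c \<le> 2" and \<gamma>: "0 < \<gamma>"
    and iso: "\<And>x. (\<Sum>e\<in>S. (\<Sum>k<r. u e k * x k)\<^sup>2) \<le> (l2 r x)\<^sup>2"
    and bnd: "\<And>e. e \<in> S \<Longrightarrow> (l2 r (u e))\<^sup>2 \<le> \<gamma>"
  shows "measure_pmf.prob (bernoulli_subset S p)
      {\<Omega>. \<exists>x. (\<Sum>e\<in>S. (of_bool (e \<in> \<Omega>) - p) * (\<Sum>k<r. u e k * x k)\<^sup>2) < - (2 * c * p * (l2 r x)\<^sup>2)}
    \<le> 2 ^ (36 * r) * exp (- (c\<^sup>2 * p / (4 * \<gamma>)))"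
proof -
  let ?P = "bernoulli_subset S p"
  let ?N = "grid_net r"
  define ip where "ip e x = (\<Sum>k<r. u e k * x k)" for e x
  define A where "A \<Omega> k l = - (\<Sum>e\<in>S. (of_bool (e \<in> \<Omega>) - p) * (u e k * u e l))" for \<Omega> k l
  define w where "w x y e = - (ip e x * ip e y)" for x y e
  have bilA: "bil r r (A \<Omega>) x y = (\<Sum>e\<in>S. (of_bool (e \<in> \<Omega>) - p) * w x y e)" for \<Omega> x y
  proof -
    have "bil r r (A \<Omega>) x y = (\<Sum>k<r. \<Sum>l<r. \<Sum>e\<in>S. (of_bool (e \<in> \<Omega>) - p) * - (u e k * x k * (u e l * y l)))"
      unfolding bil_def A_def
      by (intro sum.cong refl) (simp add: sum_distrib_left sum_distrib_right sum_negf mult_ac)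
    also have "\<dots> = (\<Sum>e\<in>S. \<Sum>k<r. \<Sum>l<r. (of_bool (e \<in> \<Omega>) - p) * - (u e k * x k * (u e l * y l)))"
      by (subst (2) sum.swap, subst (1) sum.swap) (rule refl)
    also have "\<dots> = (\<Sum>e\<in>S. (of_bool (e \<in> \<Omega>) - p) * w x y e)"
      unfolding w_def ip_def sum_product by (simp add: sum_distrib_left sum_negf flip: sum_negf)
    finally show ?thesis .
  qed
  have ip: "(ip e x)\<^sup>2 \<le> \<gamma>" if "e \<in> S" "l2 r x \<le> 1" for e x
  proof -
    have "\<bar>ip e x\<bar> \<le> l2 r (u e) * l2 r x" unfolding ip_def by (rule abs_inner_le_l2)
    also have "\<dots> \<le> l2 r (u e) * 1" using that by (intro mult_left_mono) auto
    finally have "\<bar>ip e x\<bar>\<^sup>2 \<le> (l2 r (u e))\<^sup>2" by (intro power_mono) auto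
    also have "\<dots> \<le> \<gamma>" by (rule bnd[OF that(1)])
    finally show ?thesis by simp
  qed
  \<comment> \<open>The minimizer of the Chernoff exponent p t^2 \<gamma> - t c p; it is admissible
    because c <= 2 gives t \<gamma> <= 1.\<close>
  define t where "t = c / (2 * \<gamma>)"
  have tail: "measure_pmf.prob ?P {\<Omega>. c * p \<le> bil r r (A \<Omega>) x y} \<le> exp (- (c\<^sup>2 * p / (4 * \<gamma>)))"
    if x: "x \<in> ?N" and y: "y \<in> ?N" for x y
  proof -
    have xy: "l2 r x \<le> 1" "l2 r y \<le> 1" using x y by (auto intro: grid_net_l2)
    have w1: "t * w x y e \<le> 1" if e: "e \<in> S" for e
    proof -
      have "w x y e \<le> \<bar>ip e x\<bar> * \<bar>ip e y\<bar>" by (simp add: w_def) (metis abs_ge_minus_self abs_mult)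
      also have "\<dots> \<le> sqrt \<gamma> * sqrt \<gamma>"
        using ip[OF e xy(1)] ip[OF e xy(2)] \<gamma> by (intro mult_mono) (auto simp: real_le_rsqrt)
      also have "\<dots> = \<gamma>" using \<gamma> by simp
      finally have "t * w x y e \<le> t * \<gamma>" using c \<gamma> by (intro mult_left_mono) (auto simp: t_def)
      also have "\<dots> \<le> 1" using c \<gamma> by (simp add: t_def)
      finally show ?thesis .
    qed
    have "(\<Sum>e\<in>S. (w x y e)\<^sup>2) = (\<Sum>e\<in>S. (ip e x)\<^sup>2 * (ip e y)\<^sup>2)" by (simp add: w_def power_mult_distrib)
    also have "\<dots> \<le> (\<Sum>e\<in>S. \<gamma> * (ip e y)\<^sup>2)" using ip xy by (intro sum_mono mult_right_mono) auto
    also have "\<dots> \<le> \<gamma> * (l2 r y)\<^sup>2" using iso[of y] \<gamma> by (simp add: sum_distrib_left[symmetric] ip_def)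
    also have "\<dots> \<le> \<gamma> * 1" using xy \<gamma> by (intro mult_left_mono) (auto simp: power_le_one)
    finally have w2: "(\<Sum>e\<in>S. (w x y e)\<^sup>2) \<le> \<gamma>" by simp
    have "measure_pmf.prob ?P {\<Omega>. c * p \<le> bil r r (A \<Omega>) x y} \<le> exp (p * t\<^sup>2 * (\<Sum>e\<in>S. (w x y e)\<^sup>2) - t * (c * p))"
      unfolding bilA by (rule bernoulli_subset_tail[OF S p _ w1]) (use c \<gamma> in \<open>auto simp: t_def\<close>)
    also have "\<dots> \<le> exp (p * t\<^sup>2 * \<gamma> - t * (c * p))"
      using w2 p by (simp add: mult_left_mono)
    also have "p * t\<^sup>2 * \<gamma> - t * (c * p) = - (c\<^sup>2 * p / (4 * \<gamma>))"
      using \<gamma> by (simp add: t_def field_simps power2_eq_square)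
    finally show ?thesis .
  qed
  have "measure_pmf.prob ?P {\<Omega>. \<exists>x. (\<Sum>e\<in>S. (of_bool (e \<in> \<Omega>) - p) * (\<Sum>k<r. u e k * x k)\<^sup>2) < - (2 * c * p * (l2 r x)\<^sup>2)}
     \<le> measure_pmf.prob ?P (\<Union>(x, y)\<in>?N \<times> ?N. {\<Omega>. c * p \<le> bil r r (A \<Omega>) x y})"
  proof (rule measure_pmf.finite_measure_mono)
    show "{\<Omega>. \<exists>x. (\<Sum>e\<in>S. (of_bool (e \<in> \<Omega>) - p) * (\<Sum>k<r. u e k * x k)\<^sup>2) < - (2 * c * p * (l2 r x)\<^sup>2)}
      \<subseteq> (\<Union>(x, y)\<in>?N \<times> ?N. {\<Omega>. c * p \<le> bil r r (A \<Omega>) x y})"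
    proof (rule subsetI, rule ccontr)
      fix \<Omega> assume "\<Omega> \<in> {\<Omega>. \<exists>x. (\<Sum>e\<in>S. (of_bool (e \<in> \<Omega>) - p) * (\<Sum>k<r. u e k * x k)\<^sup>2) < - (2 * c * p * (l2 r x)\<^sup>2)}"
        and no: "\<Omega> \<notin> (\<Union>(x, y)\<in>?N \<times> ?N. {\<Omega>. c * p \<le> bil r r (A \<Omega>) x y})"
      then obtain x where x: "(\<Sum>e\<in>S. (of_bool (e \<in> \<Omega>) - p) * (ip e x)\<^sup>2) < - (2 * c * p * (l2 r x)\<^sup>2)"
        by (auto simp: ip_def)
      have "bil r r (A \<Omega>) x x \<le> 2 * (c * p) * l2 r x * l2 r x"
        by (rule bil_net_bound) (use no in force)
      moreover have "bil r r (A \<Omega>) x x = - (\<Sum>e\<in>S. (of_bool (e \<in> \<Omega>) - p) * (ip e x)\<^sup>2)"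
        by (simp add: bilA w_def power2_eq_square sum_negf)
      ultimately show False using x by (simp add: power2_eq_square mult_ac)
    qed
  qed simp
  also have "\<dots> \<le> (\<Sum>(x, y)\<in>?N \<times> ?N. measure_pmf.prob ?P {\<Omega>. c * p \<le> bil r r (A \<Omega>) x y})"
    unfolding case_prod_unfold by (rule measure_pmf.finite_measure_subadditive_finite) auto
  also have "\<dots> \<le> (\<Sum>(x, y)\<in>?N \<times> ?N. exp (- (c\<^sup>2 * p / (4 * \<gamma>))))"
    using tail by (intro sum_mono) auto
  also have "\<dots> = (real (card ?N) * real (card ?N)) * exp (- (c\<^sup>2 * p / (4 * \<gamma>)))"
    by (simp add: case_prod_unfold)
  also have "\<dots> \<le> (2 ^ (18 * r) * 2 ^ (18 * r)) * exp (- (c\<^sup>2 * p / (4 * \<gamma>)))"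
  proof -
    have "real (card ?N) \<le> 2 ^ (18 * r)" using card_grid_net[of r] by (metis of_nat_le_iff of_nat_numeral of_nat_power)
    then show ?thesis by (intro mult_right_mono mult_mono) auto
  qed
  also have "(2::real) ^ (18 * r) * 2 ^ (18 * r) = 2 ^ (36 * r)" by (simp flip: power_add)
  finally show ?thesis .
qed

section \<open>Restrictions of the two sampling models to sets of positions\<close>

lemma map_pmf_bernoulli_subset_Int:
  assumes "finite A" "A' \<subseteq> A"
  shows "map_pmf (\<lambda>\<Omega>. \<Omega> \<inter> A') (bernoulli_subset A p) = bernoulli_subset A' p"
proof -
  have "bernoulli_subset A' p = map_pmf (\<lambda>b. {e \<in> A'. if e \<in> A' then b e else False}) (Pi_pmf A False (\<lambda>_. bernoulli_pmf p))"
    unfolding bernoulli_subset_def Pi_pmf_subset[OF assms] by (simp add: pmf.map_comp o_def)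
  also have "\<dots> = map_pmf (\<lambda>\<Omega>. \<Omega> \<inter> A') (bernoulli_subset A p)"
    unfolding bernoulli_subset_def using assms(2)
    by (simp add: pmf.map_comp o_def) (intro map_pmf_cong refl, auto)
  finally show ?thesis ..
qed

lemma model1_eq: "model1 n1 n2 p = bernoulli_subset ({..<n1} \<times> {..<n2}) p"
  unfolding model1_def bernoulli_subset_def by (intro map_pmf_cong refl) auto

text \<open>If \<open>S\<close> contains no two mirror images, distinct positions of
  \<open>S\<close> read distinct Bernoulli variables, and the symmetric sample becomes an
  independent one on \<open>S\<close>.\<close>

lemma map_pmf_model2_Int:
  assumes S: "S \<subseteq> {(i, j). i < n \<and> j < n \<and> i \<noteq> j}" and inj: "inj_on (\<lambda>(i, j). {i, j}) S"
  shows "map_pmf (\<lambda>\<Omega>. \<Omega> \<inter> S) (model2 n p) = bernoulli_subset S p"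
proof -
  let ?I = "{{i, j} | i j. i < n \<and> j < n \<and> i \<noteq> j}"
  \<comment> \<open>Reindexing requires positions outside \<open>S\<close> to be sent outside the
    image of \<open>S\<close>; the empty set is never a pair.\<close>
  let ?h = "\<lambda>e :: nat \<times> nat. if e \<in> S then {fst e, snd e} else {}"
  have finI: "finite ?I" by (rule finite_subset[of _ "Pow {..<n}"]) auto
  have finS: "finite S" by (rule finite_subset[of _ "{..<n} \<times> {..<n}"]) (use S in auto)
  have sub: "?h ` S \<subseteq> ?I" using S by force
  have bij: "bij_betw ?h S (?h ` S)"
    using inj by (intro inj_on_imp_bij_betw) (auto simp: inj_on_def case_prod_unfold)
  have "bernoulli_subset S p = map_pmf (\<lambda>b. {e \<in> S. b e}) (map_pmf (\<lambda>g. g \<circ> ?h) (Pi_pmf (?h ` S) False (\<lambda>_. bernoulli_pmf p)))"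
    unfolding bernoulli_subset_def by (subst Pi_pmf_bij_betw[OF finS bij]) auto
  also have "\<dots> = map_pmf (\<lambda>b. {e \<in> S. b {fst e, snd e}}) (Pi_pmf ?I False (\<lambda>_. bernoulli_pmf p))"
    unfolding Pi_pmf_subset[OF finI sub] pmf.map_comp by (intro map_pmf_cong refl) auto
  also have "\<dots> = map_pmf (\<lambda>\<Omega>. \<Omega> \<inter> S) (model2 n p)"
    unfolding model2_def pmf.map_comp using S by (intro map_pmf_cong refl) auto
  finally show ?thesis ..
qed

lemma prob_map_pmf: "measure_pmf.prob (map_pmf f D) A = measure_pmf.prob D {x. f x \<in> A}"
  by (simp add: vimage_def)

lemma centered_sample_Int: "centered_sample S p (\<Omega> \<inter> S) = centered_sample S p \<Omega>"
  by (auto simp: centered_sample_def fun_eq_iff)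

text \<open>In Model 2 the centred matrix is the sum of its two strict triangles, each an
  independent sample, and of -p times the identity, whose norm \<open>p\<close> is at most sqrt (n
  p). Two bounds of size 2^43 and this diagonal fit below 2^45, and the failure probability
  doubles.\<close>

lemma sampling_spectral:
  assumes D: "sampling_law n1 n2 p D" and p: "0 < p" "p \<le> 1" and n: "n = max n1 n2" "1 \<le> real n * p"
  shows "measure_pmf.prob D {\<Omega>. \<exists>x y. 2 ^ 45 * sqrt (real n * p) * l2 n1 x * l2 n2 y
       < \<bar>bil n1 n2 (\<lambda>i j. of_bool ((i, j) \<in> \<Omega>) - p) x y\<bar>} \<le> 16 * real n * exp (- real n * p)"
proof -
  let ?s = "sqrt (real n * p)"
  have s1: "1 \<le> ?s" using n by simp
  define bad where "bad S = {\<Omega>. \<exists>x y. 2 ^ 43 * ?s * l2 n1 x * l2 n2 y < \<bar>bil n1 n2 (centered_sample S p \<Omega>) x y\<bar>}" for S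
  have badS: "measure_pmf.prob D (bad S) \<le> 8 * real n * exp (- real n * p)"
    if S: "S \<subseteq> {..<n1} \<times> {..<n2}" "map_pmf (\<lambda>\<Omega>. \<Omega> \<inter> S) D = bernoulli_subset S p" for S
  proof -
    have "measure_pmf.prob D (bad S) = measure_pmf.prob (bernoulli_subset S p) (bad S)"
      unfolding S(2)[symmetric] prob_map_pmf bad_def by (simp add: centered_sample_Int)
    also have "\<dots> \<le> 8 * real n * exp (- real n * p)"
      unfolding bad_def by (rule sample_spectral_tail[OF p S(1) n])
    finally show ?thesis .
  qed
  let ?B = "{\<Omega>. \<exists>x y. 2 ^ 45 * ?s * l2 n1 x * l2 n2 y < \<bar>bil n1 n2 (\<lambda>i j. of_bool ((i, j) \<in> \<Omega>) - p) x y\<bar>}"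
  from D consider (1) "D = model1 n1 n2 p" | (2) "n1 = n2" "D = model2 n1 p" by (auto simp: sampling_law_def)
  then show ?thesis
  proof cases
    case 1
    let ?S = "{..<n1} \<times> {..<n2}"
    have "?B \<subseteq> bad ?S"
    proof safe
      fix \<Omega> x y
      assume "2 ^ 45 * ?s * l2 n1 x * l2 n2 y < \<bar>bil n1 n2 (\<lambda>i j. of_bool ((i, j) \<in> \<Omega>) - p) x y\<bar>"
      moreover have "bil n1 n2 (\<lambda>i j. of_bool ((i, j) \<in> \<Omega>) - p) x y = bil n1 n2 (centered_sample ?S p \<Omega>) x y"
        unfolding bil_def by (intro sum.cong refl) (simp add: centered_sample_def)
      moreover have "2 ^ 43 * ?s * l2 n1 x * l2 n2 y \<le> 2 ^ 45 * ?s * l2 n1 x * l2 n2 y"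
        using s1 by (intro mult_right_mono) auto
      ultimately have "2 ^ 43 * ?s * l2 n1 x * l2 n2 y < \<bar>bil n1 n2 (centered_sample ?S p \<Omega>) x y\<bar>"
        by (simp only:)
      then show "\<Omega> \<in> bad ?S" unfolding bad_def by blast
    qed
    then have "measure_pmf.prob D ?B \<le> measure_pmf.prob D (bad ?S)"
      by (intro measure_pmf.finite_measure_mono) auto
    also have "\<dots> \<le> 8 * real n * exp (- real n * p)"
      by (rule badS) (auto simp: 1 model1_eq map_pmf_bernoulli_subset_Int)
    also have "\<dots> \<le> 16 * real n * exp (- real n * p)" by (intro mult_right_mono) auto
    finally show ?thesis .
  next
    case 2
    let ?U = "{(i, j). i < n1 \<and> j < n1 \<and> i < j}" and ?L = "{(i, j). i < n1 \<and> j < n1 \<and> j < i}"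
    have inj: "inj_on (\<lambda>(i, j). {i, j}) ?U" "inj_on (\<lambda>(i, j). {i, j}) ?L"
      by (auto simp: inj_on_def doubleton_eq_iff)
    have diag: "set_pmf D \<subseteq> {\<Omega>. \<forall>i. (i, i) \<notin> \<Omega>}" by (auto simp: 2 model2_def)
    have "measure_pmf.prob D ?B = measure_pmf.prob D (?B \<inter> set_pmf D)" by (simp add: measure_Int_set_pmf)
    also have "\<dots> \<le> measure_pmf.prob D (bad ?U \<union> bad ?L)"
    proof (rule measure_pmf.finite_measure_mono)
      show "?B \<inter> set_pmf D \<subseteq> bad ?U \<union> bad ?L"
      proof (rule subsetI, rule ccontr)
        fix \<Omega> assume \<Omega>: "\<Omega> \<in> ?B \<inter> set_pmf D" "\<Omega> \<notin> bad ?U \<union> bad ?L"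
        then obtain x y where xy: "2 ^ 45 * ?s * l2 n1 x * l2 n2 y < \<bar>bil n1 n2 (\<lambda>i j. of_bool ((i, j) \<in> \<Omega>) - p) x y\<bar>"
          by auto
        let ?l = "l2 n1 x * l2 n2 y"
        have nd: "(i, i) \<notin> \<Omega>" for i using \<Omega> diag by auto
        have H: "of_bool ((i, j) \<in> \<Omega>) - p = centered_sample ?U p \<Omega> i j + centered_sample ?L p \<Omega> i j + (- p) * of_bool (i = j)"
          if "i < n1" "j < n2" for i j
          using that nd[of i] by (cases i j rule: linorder_cases) (auto simp: centered_sample_def 2(1))
        have "bil n1 n2 (\<lambda>i j. of_bool ((i, j) \<in> \<Omega>) - p) x y = bil n1 n2 (centered_sample ?U p \<Omega>) x y
            + bil n1 n2 (centered_sample ?L p \<Omega>) x y + (- p) * (\<Sum>i<n1. x i * y i)"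
        proof -
          have "bil n1 n2 (\<lambda>i j. of_bool ((i, j) \<in> \<Omega>) - p) x y = (\<Sum>i<n1. \<Sum>j<n2.
             centered_sample ?U p \<Omega> i j * x i * y j + centered_sample ?L p \<Omega> i j * x i * y j + (- p) * (of_bool (i = j) * (x i * y j)))"
            unfolding bil_def by (intro sum.cong refl) (simp only: lessThan_iff H, simp add: algebra_simps)
          also have "\<dots> = bil n1 n2 (centered_sample ?U p \<Omega>) x y
            + bil n1 n2 (centered_sample ?L p \<Omega>) x y + (- p) * (\<Sum>i<n1. \<Sum>j<n2. of_bool (i = j) * (x i * y j))"
            unfolding bil_def sum.distrib sum_distrib_left[symmetric] by simp
          also have "(\<Sum>i<n1. \<Sum>j<n2. of_bool (i = j) * (x i * y j)) = (\<Sum>i<n1. x i * y i)"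
            by (intro sum.cong refl) (simp add: 2(1)[symmetric] of_bool_def if_distrib[of "\<lambda>x. x * _"] cong: if_cong)
          finally show ?thesis .
        qed
        moreover have "\<bar>bil n1 n2 (centered_sample ?U p \<Omega>) x y\<bar> \<le> 2 ^ 43 * ?s * l2 n1 x * l2 n2 y"
          "\<bar>bil n1 n2 (centered_sample ?L p \<Omega>) x y\<bar> \<le> 2 ^ 43 * ?s * l2 n1 x * l2 n2 y"
          using \<Omega>(2) unfolding bad_def by (auto simp: not_less)
        moreover have "\<bar>(- p) * (\<Sum>i<n1. x i * y i)\<bar> \<le> ?s * ?l"
        proof -
          have "\<bar>(- p) * (\<Sum>i<n1. x i * y i)\<bar> = p * \<bar>\<Sum>i<n1. x i * y i\<bar>" using p by (simp add: abs_mult)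
          also have "\<dots> \<le> ?s * ?l" 
          proof (rule mult_mono)
            show "p \<le> ?s" using p s1 by linarith
            show "\<bar>\<Sum>i<n1. x i * y i\<bar> \<le> ?l" using abs_inner_le_l2[of x y n1] by (simp add: 2(1))
          qed (use s1 in auto)
          finally show ?thesis .
        qed
        ultimately have "\<bar>bil n1 n2 (\<lambda>i j. of_bool ((i, j) \<in> \<Omega>) - p) x y\<bar> \<le> 2 ^ 43 * (?s * ?l) + 2 ^ 43 * (?s * ?l) + ?s * ?l"
          unfolding mult.assoc by linarith
        also have "\<dots> \<le> 2 ^ 45 * (?s * ?l)"
        proof -
          have "0 \<le> ?s * ?l" using s1 by simp
          moreover have "2 ^ 43 * c + 2 ^ 43 * c + c \<le> 2 ^ 45 * c" if "0 \<le> c" for c :: real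
            using that by simp
          ultimately show ?thesis by blast
        qed
        finally show False using xy by (simp add: mult.assoc)
      qed
    qed simp
    also have "\<dots> \<le> measure_pmf.prob D (bad ?U) + measure_pmf.prob D (bad ?L)"
      by (rule measure_Un_le) auto
    also have "\<dots> \<le> 8 * real n * exp (- real n * p) + 8 * real n * exp (- real n * p)"
    proof (intro add_mono badS)
      show "map_pmf (\<lambda>\<Omega>. \<Omega> \<inter> ?U) D = bernoulli_subset ?U p" "map_pmf (\<lambda>\<Omega>. \<Omega> \<inter> ?L) D = bernoulli_subset ?L p"
        unfolding 2(2) by (rule map_pmf_model2_Int; use inj in auto)+
    qed (auto simp: 2(1))
    finally show ?thesis by simp
  qed
qed

text \<open>In both models the entries sampled in a fixed row or column are independent, apart from
  the missing diagonal entry in Model 2.\<close>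

lemma sampling_law_line:
  assumes D: "sampling_law n1 n2 p D" and line: "S = {..<n1} \<times> {j} \<and> j < n2 \<or> S = {i} \<times> {..<n2} \<and> i < n1"
  obtains d where "map_pmf (\<lambda>\<Omega>. \<Omega> \<inter> (S - d)) D = bernoulli_subset (S - d) p" "d = {} \<or> (\<exists>e. d = {e})"
proof -
  from D consider (1) "D = model1 n1 n2 p" | (2) "n1 = n2" "D = model2 n1 p" by (auto simp: sampling_law_def)
  then show ?thesis
  proof cases
    case 1
    show ?thesis
      by (rule that[of "{}"]) (use line in \<open>auto simp: 1 model1_eq intro!: map_pmf_bernoulli_subset_Int\<close>)
  next
    case 2
    obtain m where m: "m < n1" "S = {..<n1} \<times> {m} \<or> S = {m} \<times> {..<n1}" using line 2 by auto
    show ?thesis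
    proof (rule that[of "{(m, m)}"])
      show "map_pmf (\<lambda>\<Omega>. \<Omega> \<inter> (S - {(m, m)})) D = bernoulli_subset (S - {(m, m)}) p"
        unfolding 2(2) by (rule map_pmf_model2_Int) (use m in \<open>auto simp: inj_on_def doubleton_eq_iff\<close>)
    qed simp
  qed
qed

text \<open>A missing diagonal entry removes at most \<open>\<gamma>\<close> <= 1/40 of the
  isotropic form. With c = 1/80 the deviation costs another 2c = 1/40, which leaves 38/40 =
  19/20.\<close>

lemma line_sample_tail:
  fixes u :: "'b \<Rightarrow> nat \<Rightarrow> real"
  assumes D: "map_pmf (\<lambda>\<Omega>. \<Omega> \<inter> (S - d)) D = bernoulli_subset (S - d) p" and d: "d = {} \<or> (\<exists>e. d = {e})"
    and S: "finite S" and p: "0 < p" "p \<le> 1" and \<gamma>: "0 < \<gamma>" "\<gamma> \<le> 1 / 40"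
    and iso: "\<And>x. (\<Sum>e\<in>S. (\<Sum>k<r. u e k * x k)\<^sup>2) = (l2 r x)\<^sup>2"
    and bnd: "\<And>e. e \<in> S \<Longrightarrow> (l2 r (u e))\<^sup>2 \<le> \<gamma>"
    and L: "1000000 * \<gamma> * (real r + L) \<le> p" "0 \<le> L"
  shows "measure_pmf.prob D {\<Omega>. \<exists>x. (\<Sum>e\<in>S. of_bool (e \<in> \<Omega>) * (\<Sum>k<r. u e k * x k)\<^sup>2) < 19/20 * p * (l2 r x)\<^sup>2}
    \<le> exp (- 39 * L)"
proof -
  let ?S = "S - d"
  have le: "(\<Sum>e\<in>?S. (\<Sum>k<r. u e k * x k)\<^sup>2) \<le> (l2 r x)\<^sup>2" for x
    unfolding iso[symmetric] using S by (intro sum_mono2) auto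
  have ge: "(39/40) * (l2 r x)\<^sup>2 \<le> (\<Sum>e\<in>?S. (\<Sum>k<r. u e k * x k)\<^sup>2)" for x
  proof (cases "S \<inter> d = {}")
    case True
    then have "?S = S" by auto
    then show ?thesis by (simp add: iso)
  next
    case False
    then obtain e where e: "d = {e}" "e \<in> S" using d by auto
    have "\<bar>\<Sum>k<r. u e k * x k\<bar> \<le> l2 r (u e) * l2 r x" by (rule abs_inner_le_l2)
    then have "\<bar>\<Sum>k<r. u e k * x k\<bar>\<^sup>2 \<le> (l2 r (u e) * l2 r x)\<^sup>2" by (intro power_mono) auto
    also have "\<dots> \<le> (1/40) * (l2 r x)\<^sup>2"
      unfolding power_mult_distrib using bnd[OF e(2)] \<gamma> by (intro mult_right_mono) auto
    finally have "(\<Sum>k<r. u e k * x k)\<^sup>2 \<le> (1/40) * (l2 r x)\<^sup>2" by simp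
    moreover have "(\<Sum>e\<in>S. (\<Sum>k<r. u e k * x k)\<^sup>2) = (\<Sum>k<r. u e k * x k)\<^sup>2 + (\<Sum>e\<in>?S. (\<Sum>k<r. u e k * x k)\<^sup>2)"
      unfolding e(1) by (rule sum.remove[OF S e(2)])
    ultimately show ?thesis using iso[of x] by simp
  qed
  let ?B = "{\<Omega>. \<exists>x. (\<Sum>e\<in>?S. (of_bool (e \<in> \<Omega>) - p) * (\<Sum>k<r. u e k * x k)\<^sup>2) < - (2 * (1/80) * p * (l2 r x)\<^sup>2)}"
  have "measure_pmf.prob D {\<Omega>. \<exists>x. (\<Sum>e\<in>S. of_bool (e \<in> \<Omega>) * (\<Sum>k<r. u e k * x k)\<^sup>2) < 19/20 * p * (l2 r x)\<^sup>2}
     \<le> measure_pmf.prob D {\<Omega>. \<Omega> \<inter> ?S \<in> ?B}"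
  proof (rule measure_pmf.finite_measure_mono)
    show "{\<Omega>. \<exists>x. (\<Sum>e\<in>S. of_bool (e \<in> \<Omega>) * (\<Sum>k<r. u e k * x k)\<^sup>2) < 19/20 * p * (l2 r x)\<^sup>2} \<subseteq> {\<Omega>. \<Omega> \<inter> ?S \<in> ?B}"
    proof safe
      fix \<Omega> x
      let ?q = "\<lambda>e. (\<Sum>k<r. u e k * x k)\<^sup>2"
      assume lt: "(\<Sum>e\<in>S. of_bool (e \<in> \<Omega>) * ?q e) < 19/20 * p * (l2 r x)\<^sup>2"
      have "(\<Sum>e\<in>?S. (of_bool (e \<in> \<Omega> \<inter> ?S) - p) * ?q e) = (\<Sum>e\<in>?S. of_bool (e \<in> \<Omega>) * ?q e) - p * (\<Sum>e\<in>?S. ?q e)"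
        unfolding sum_distrib_left sum_subtractf[symmetric] by (intro sum.cong refl) (simp add: left_diff_distrib)
      moreover have "(\<Sum>e\<in>?S. of_bool (e \<in> \<Omega>) * ?q e) \<le> (\<Sum>e\<in>S. of_bool (e \<in> \<Omega>) * ?q e)"
        using S by (intro sum_mono2) auto
      moreover have "p * ((39/40) * (l2 r x)\<^sup>2) \<le> p * (\<Sum>e\<in>?S. ?q e)" using ge[of x] p by (intro mult_left_mono) auto
      ultimately have "(\<Sum>e\<in>?S. (of_bool (e \<in> \<Omega> \<inter> ?S) - p) * ?q e) < - (2 * (1/80) * p * (l2 r x)\<^sup>2)"
        using lt by (simp add: algebra_simps)
      then show "\<exists>x. (\<Sum>e\<in>?S. (of_bool (e \<in> \<Omega> \<inter> ?S) - p) * (\<Sum>k<r. u e k * x k)\<^sup>2) < - (2 * (1/80) * p * (l2 r x)\<^sup>2)"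
        by blast
    qed
  qed simp
  also have "\<dots> = measure_pmf.prob (bernoulli_subset ?S p) ?B" unfolding D[symmetric] prob_map_pmf ..
  also have "\<dots> \<le> 2 ^ (36 * r) * exp (- ((1/80)\<^sup>2 * p / (4 * \<gamma>)))"
    by (rule isotropic_sample_tail) (use S p \<gamma> le bnd in auto)
  \<comment> \<open>For c = 1/80 the exponent is p / (25600 \<gamma>), and 1000000 / 25600 exceeds
    39: the part 39 r absorbs the 36 r of the net and 39 L is left for the probability.\<close>
  also have "\<dots> \<le> exp (36 * real r) * exp (- 39 * (real r + L))"
  proof (rule mult_mono)
    have "(2::real) \<le> exp 1" using exp_ge_add_one_self[of 1] by simp
    then have "(2::real) ^ (36 * r) \<le> exp 1 ^ (36 * r)" by (intro power_mono) auto
    then show "(2::real) ^ (36 * r) \<le> exp (36 * real r)" by (simp flip: exp_of_nat_mult)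
    have "39 * (real r + L) \<le> (1000000 / 25600) * (real r + L)" using L(2) by (intro mult_right_mono) auto
    also have "\<dots> = (1000000 * \<gamma> * (real r + L)) / (25600 * \<gamma>)" using \<gamma> by simp
    also have "\<dots> \<le> p / (25600 * \<gamma>)" using L(1) \<gamma> by (intro divide_right_mono) auto
    also have "\<dots> = (1/80)\<^sup>2 * p / (4 * \<gamma>)" by (simp add: power2_eq_square)
    finally show "exp (- ((1/80)\<^sup>2 * p / (4 * \<gamma>))) \<le> exp (- 39 * (real r + L))" by simp
  qed auto
  also have "\<dots> = exp (36 * real r + - 39 * (real r + L))" by (simp only: exp_add)
  also have "\<dots> \<le> exp (- 39 * L)" by simp
  finally show ?thesis .
qed

text \<open>\<open>U\<close> and \<open>V\<close> are meant to be the singular vectors. Any balanced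
  factor is a singular-vector matrix times an invertible one, so a lower bound for all
  \<open>x\<close> transfers to whichever factorization is correlated with the local
  minimum.\<close>

definition sampling_regular ::
  "nat \<Rightarrow> nat \<Rightarrow> nat \<Rightarrow> real \<Rightarrow> (nat \<Rightarrow> nat \<Rightarrow> real) \<Rightarrow> (nat \<Rightarrow> nat \<Rightarrow> real) \<Rightarrow> (nat \<times> nat) set \<Rightarrow> bool" where
  "sampling_regular n1 n2 r p U V \<Omega> \<longleftrightarrow>
     (\<forall>j<n2. \<forall>x. 19/20 * p * (l2 r x)\<^sup>2 \<le> (\<Sum>i<n1. of_bool ((i, j) \<in> \<Omega>) * (\<Sum>k<r. U i k * x k)\<^sup>2)) \<and>
     (\<forall>i<n1. \<forall>x. 19/20 * p * (l2 r x)\<^sup>2 \<le> (\<Sum>j<n2. of_bool ((i, j) \<in> \<Omega>) * (\<Sum>k<r. V j k * x k)\<^sup>2)) \<and>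
     (\<forall>x y. \<bar>bil n1 n2 (\<lambda>i j. of_bool ((i, j) \<in> \<Omega>) - p) x y\<bar>
        \<le> 2 ^ 45 * sqrt (real (max n1 n2) * p) * l2 n1 x * l2 n2 y)"

text \<open>A union bound over at most 2n rows and columns, each failing with probability at most
  n^(-39), and over the spectral bound, failing with at most 16 n^(-38). The gap between n^(-38) and
  the required third power absorbs the constants because n >= 2.\<close>

lemma prob_sampling_regular:
  assumes D: "sampling_law n1 n2 p D" and p: "0 < p" "p \<le> 1" and n: "n = max n1 n2" "2 \<le> n"
    and \<gamma>: "0 < \<gamma>" "\<gamma> \<le> 1 / 40"
    and isoU: "\<And>x. (\<Sum>i<n1. (\<Sum>k<r. U i k * x k)\<^sup>2) = (l2 r x)\<^sup>2"
    and isoV: "\<And>x. (\<Sum>j<n2. (\<Sum>k<r. V j k * x k)\<^sup>2) = (l2 r x)\<^sup>2"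
    and bndU: "\<And>i. i < n1 \<Longrightarrow> (l2 r (U i))\<^sup>2 \<le> \<gamma>" and bndV: "\<And>j. j < n2 \<Longrightarrow> (l2 r (V j))\<^sup>2 \<le> \<gamma>"
    and p1: "1000000 * \<gamma> * (real r + ln (real n)) \<le> p" and p2: "1000000 * ln (real n) \<le> real n * p"
  shows "1 - 1 / (real (n1 + n2)) ^ 3 \<le> measure_pmf.prob D {\<Omega>. sampling_regular n1 n2 r p U V \<Omega>}"
proof -
  define C where "C j = {\<Omega>. \<exists>x. (\<Sum>i<n1. of_bool ((i, j) \<in> \<Omega>) * (\<Sum>k<r. U i k * x k)\<^sup>2) < 19/20 * p * (l2 r x)\<^sup>2}" for j :: nat
  define R where "R i = {\<Omega>. \<exists>x. (\<Sum>j<n2. of_bool ((i, j) \<in> \<Omega>) * (\<Sum>k<r. V j k * x k)\<^sup>2) < 19/20 * p * (l2 r x)\<^sup>2}" for i :: nat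
  define B where "B = {\<Omega>. \<exists>x y. 2 ^ 45 * sqrt (real n * p) * l2 n1 x * l2 n2 y
       < \<bar>bil n1 n2 (\<lambda>i j. of_bool ((i, j) \<in> \<Omega>) - p) x y\<bar>}"
  have ln: "0 < ln (real n)" "ln 2 \<le> ln (real n)" using n by auto
  have np1: "1 \<le> real n * p"
  proof -
    have "1/2 \<le> ln (2::real)" using ln2_ge_two_thirds by simp
    then show ?thesis using p2 ln by linarith
  qed
  have e39: "exp (- 39 * ln (real n)) = 1 / real n ^ 39"
  proof -
    have "exp (- 39 * ln (real n)) = inverse (exp (real 39 * ln (real n)))" by (simp add: exp_minus)
    also have "exp (real 39 * ln (real n)) = real n ^ 39" using n(2) by (subst exp_of_nat_mult) auto
    finally show ?thesis by (simp add: inverse_eq_divide)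
  qed
  have Cj: "measure_pmf.prob D (C j) \<le> 1 / real n ^ 39" if j: "j < n2" for j
  proof -
    obtain d where d: "map_pmf (\<lambda>\<Omega>. \<Omega> \<inter> ({..<n1} \<times> {j} - d)) D = bernoulli_subset ({..<n1} \<times> {j} - d) p" "d = {} \<or> (\<exists>e. d = {e})"
      using sampling_law_line[OF D, of "{..<n1} \<times> {j}" j] j by blast
    have sum: "(\<Sum>e\<in>{..<n1} \<times> {j}. f e) = (\<Sum>i<n1. f (i, j))" for f :: "nat \<times> nat \<Rightarrow> real"
      by (simp add: sum.cartesian_product[symmetric, where g = "\<lambda>i j. f (i, j)", simplified])
    show ?thesis
      using line_sample_tail[OF d _ p \<gamma>, where r = r and u = "\<lambda>e. U (fst e)" and L = "ln (real n)"] isoU bndU p1 ln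
      unfolding sum C_def e39 by auto
  qed
  have Ri: "measure_pmf.prob D (R i) \<le> 1 / real n ^ 39" if i: "i < n1" for i
  proof -
    obtain d where d: "map_pmf (\<lambda>\<Omega>. \<Omega> \<inter> ({i} \<times> {..<n2} - d)) D = bernoulli_subset ({i} \<times> {..<n2} - d) p" "d = {} \<or> (\<exists>e. d = {e})"
      using sampling_law_line[OF D, of "{i} \<times> {..<n2}" _ i] i by blast
    have sum: "(\<Sum>e\<in>{i} \<times> {..<n2}. f e) = (\<Sum>j<n2. f (i, j))" for f :: "nat \<times> nat \<Rightarrow> real"
      by (simp add: sum.cartesian_product[symmetric, where g = "\<lambda>i j. f (i, j)", simplified])
    show ?thesis
      using line_sample_tail[OF d _ p \<gamma>, where r = r and u = "\<lambda>e. V (snd e)" and L = "ln (real n)"] isoV bndV p1 ln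
      unfolding sum R_def e39 by auto
  qed
  have PB: "measure_pmf.prob D B \<le> 16 / real n ^ 38"
  proof -
    have "measure_pmf.prob D B \<le> 16 * real n * exp (- real n * p)"
      unfolding B_def by (rule sampling_spectral[OF D p n(1) np1])
    also have "\<dots> \<le> 16 * real n * exp (- 39 * ln (real n))"
      using p2 ln by (intro mult_left_mono) auto
    also have "\<dots> = 16 / real n ^ 38"
      unfolding e39 using n(2) by (simp add: field_simps flip: power_Suc)
    finally show ?thesis .
  qed
  let ?bad = "(\<Union>j<n2. C j) \<union> (\<Union>i<n1. R i) \<union> B"
  have "measure_pmf.prob D ?bad \<le> (\<Sum>j<n2. measure_pmf.prob D (C j)) + (\<Sum>i<n1. measure_pmf.prob D (R i)) + measure_pmf.prob D B"
  proof -
    have "measure_pmf.prob D ?bad \<le> measure_pmf.prob D ((\<Union>j<n2. C j) \<union> (\<Union>i<n1. R i)) + measure_pmf.prob D B"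
      by (rule measure_Un_le) auto
    moreover have "measure_pmf.prob D ((\<Union>j<n2. C j) \<union> (\<Union>i<n1. R i)) \<le> measure_pmf.prob D (\<Union>j<n2. C j) + measure_pmf.prob D (\<Union>i<n1. R i)"
      by (rule measure_Un_le) auto
    moreover have "measure_pmf.prob D (\<Union>j<n2. C j) \<le> (\<Sum>j<n2. measure_pmf.prob D (C j))"
      by (rule measure_pmf.finite_measure_subadditive_finite) auto
    moreover have "measure_pmf.prob D (\<Union>i<n1. R i) \<le> (\<Sum>i<n1. measure_pmf.prob D (R i))"
      by (rule measure_pmf.finite_measure_subadditive_finite) auto
    ultimately show ?thesis by linarith
  qed
  also have "\<dots> \<le> (\<Sum>j<n2. 1 / real n ^ 39) + (\<Sum>i<n1. 1 / real n ^ 39) + 16 / real n ^ 38"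
    using Cj Ri PB by (intro add_mono sum_mono) auto
  also have "\<dots> \<le> real n * (1 / real n ^ 39) + real n * (1 / real n ^ 39) + 16 / real n ^ 38"
  proof -
    have "real n1 * (1 / real n ^ 39) \<le> real n * (1 / real n ^ 39)"
      "real n2 * (1 / real n ^ 39) \<le> real n * (1 / real n ^ 39)"
      using n(1) by (intro mult_right_mono; simp)+
    then show ?thesis by simp
  qed
  also have "\<dots> = 18 / real n ^ 38" using n(2) by (simp add: field_simps flip: power_Suc)
  also have "\<dots> \<le> 1 / (real (n1 + n2)) ^ 3"
  proof -
    have pos: "0 < n1 + n2" using n by auto
    have "(real (n1 + n2)) ^ 3 * 18 \<le> (2 * real n) ^ 3 * 18"
      using n(1) by (intro mult_right_mono power_mono) auto
    also have "\<dots> = real n ^ 3 * 144" by (simp add: power_mult_distrib)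
    also have "\<dots> \<le> real n ^ 3 * 2 ^ 35" by (intro mult_left_mono) auto
    also have "\<dots> \<le> real n ^ 3 * real n ^ 35" using n(2) by (intro mult_left_mono power_mono) auto
    also have "\<dots> = real n ^ 38" by (simp flip: power_add)
    finally have "(real (n1 + n2)) ^ 3 * 18 \<le> real n ^ 38" .
    moreover have "0 < real (n1 + n2)" using pos by (simp only: of_nat_0_less_iff)
    then have "0 < (real (n1 + n2)) ^ 3" by (rule zero_less_power)
    moreover have "0 < real n ^ 38" using n(2) by simp
    ultimately show ?thesis by (subst frac_le_eq) (simp_all add: divide_le_0_iff mult.commute)
  qed
  finally have bad: "measure_pmf.prob D ?bad \<le> 1 / (real (n1 + n2)) ^ 3" .
  have "measure_pmf.prob D (- ?bad) = 1 - measure_pmf.prob D ?bad"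
    using measure_pmf.prob_compl[of ?bad D] by (simp add: Compl_eq_Diff_UNIV)
  moreover have "measure_pmf.prob D (- ?bad) \<le> measure_pmf.prob D {\<Omega>. sampling_regular n1 n2 r p U V \<Omega>}"
    by (rule measure_pmf.finite_measure_mono)
      (auto simp: sampling_regular_def C_def R_def B_def n(1)[symmetric] not_less)
  ultimately show ?thesis using bad by linarith
qed

section \<open>Gram matrices and the curvature of the sampled loss\<close>

definition ip :: "nat \<Rightarrow> (nat \<Rightarrow> real) \<Rightarrow> (nat \<Rightarrow> real) \<Rightarrow> real" where
  "ip r x y = (\<Sum>k<r. x k * y k)"

definition gram :: "nat \<Rightarrow> (nat \<Rightarrow> nat \<Rightarrow> real) \<Rightarrow> (nat \<Rightarrow> nat \<Rightarrow> real) \<Rightarrow> nat \<Rightarrow> nat \<Rightarrow> real" where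
  "gram n A B k l = (\<Sum>i<n. A i k * B i l)"

definition fro :: "nat \<Rightarrow> (nat \<Rightarrow> nat \<Rightarrow> real) \<Rightarrow> (nat \<Rightarrow> nat \<Rightarrow> real) \<Rightarrow> real" where
  "fro r P Q = (\<Sum>k<r. \<Sum>l<r. P k l * Q k l)"

lemma ip_self: "ip r x x = (l2 r x)\<^sup>2"
  by (simp add: ip_def l2_mult_self)

text \<open>The identity <A B^T, C D^T> = <A^T C, B^T D>. It moves all inner products of large
  matrices to \<open>r\<close> by \<open>r\<close> matrices, where the positive semidefiniteness of
  the alignment can act.\<close>

lemma sum_ip_ip_eq_fro:
  "(\<Sum>i<n1. \<Sum>j<n2. ip r (A i) (B j) * ip r (C i) (D j)) = fro r (gram n1 A C) (gram n2 B D)"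
proof -
  have "(\<Sum>i<n1. \<Sum>j<n2. ip r (A i) (B j) * ip r (C i) (D j))
     = (\<Sum>i<n1. \<Sum>j<n2. \<Sum>k<r. \<Sum>l<r. (A i k * C i l) * (B j k * D j l))"
    unfolding ip_def sum_product by (intro sum.cong refl) (simp add: mult_ac)
  also have "\<dots> = (\<Sum>i<n1. \<Sum>k<r. \<Sum>j<n2. \<Sum>l<r. (A i k * C i l) * (B j k * D j l))"
    by (rule sum.cong[OF refl]) (rule sum.swap)
  also have "\<dots> = (\<Sum>k<r. \<Sum>i<n1. \<Sum>j<n2. \<Sum>l<r. (A i k * C i l) * (B j k * D j l))"
    by (rule sum.swap)
  also have "\<dots> = (\<Sum>k<r. \<Sum>i<n1. \<Sum>l<r. \<Sum>j<n2. (A i k * C i l) * (B j k * D j l))"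
    by (rule sum.cong[OF refl], rule sum.cong[OF refl], rule sum.swap)
  also have "\<dots> = (\<Sum>k<r. \<Sum>l<r. \<Sum>i<n1. \<Sum>j<n2. (A i k * C i l) * (B j k * D j l))"
    by (rule sum.cong[OF refl]) (rule sum.swap)
  also have "\<dots> = fro r (gram n1 A C) (gram n2 B D)"
    unfolding fro_def gram_def sum_product ..
  finally show ?thesis .
qed

lemma fro_add_left: "fro r (\<lambda>k l. P k l + P' k l) Q = fro r P Q + fro r P' Q"
  and fro_add_right: "fro r Q (\<lambda>k l. P k l + P' k l) = fro r Q P + fro r Q P'"
  and fro_diff_left: "fro r (\<lambda>k l. P k l - P' k l) Q = fro r P Q - fro r P' Q"
  and fro_diff_right: "fro r Q (\<lambda>k l. P k l - P' k l) = fro r Q P - fro r Q P'"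
  and fro_scale_left: "fro r (\<lambda>k l. c * P k l) Q = c * fro r P Q"
  and fro_scale_right: "fro r Q (\<lambda>k l. c * P k l) = c * fro r Q P"
  by (simp_all add: fro_def algebra_simps sum.distrib sum_subtractf sum_distrib_left)

lemma fro_commute: "fro r P Q = fro r Q P"
  by (simp add: fro_def mult.commute)

lemma fro_transpose: "fro r (\<lambda>k l. P l k) Q = fro r P (\<lambda>k l. Q l k)"
  unfolding fro_def by (rule sum.swap)

lemma fro_self_nonneg: "0 \<le> fro r P P"
  unfolding fro_def by (intro sum_nonneg) simp

lemmas fro_simps = fro_add_left fro_add_right fro_diff_left fro_diff_right fro_scale_left fro_scale_right

lemma fro_cong: "(\<And>k l. k < r \<Longrightarrow> l < r \<Longrightarrow> P k l = P' k l) \<Longrightarrow> (\<And>k l. k < r \<Longrightarrow> l < r \<Longrightarrow> Q k l = Q' k l) \<Longrightarrow> fro r P Q = fro r P' Q'"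
  unfolding fro_def by (intro sum.cong refl) auto

text \<open>The quantity $\|W W^\top - Z Z^\top\|_F^2$ for the stacked factors $Z = (U; V)$ and $W = Z + H$,
  in terms of $G = H^\top H$, $A = Z^\top H$ and $z = U^\top U = V^\top V$ (so that $Z^\top Z = 2 z$).\<close>

definition lifted_error :: "nat \<Rightarrow> (nat \<Rightarrow> nat \<Rightarrow> real) \<Rightarrow> (nat \<Rightarrow> nat \<Rightarrow> real) \<Rightarrow> (nat \<Rightarrow> nat \<Rightarrow> real) \<Rightarrow> real" where
  "lifted_error r G A z = fro r G G + 4 * fro r G A + 2 * fro r A A + 4 * fro r G z"

text \<open>The right side exceeds the left by exactly 2 |AU - AV|^2. The symmetry of AU + AV, that
  is, of the alignment matrix, enters by replacing |AU + AV|^2 with its inner product against the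
  transpose.\<close>

lemma lifted_error_le:
  assumes a: "\<And>k l. a k l = a l k" and b: "\<And>k l. b k l = b l k"
    and A: "\<And>k l. k < r \<Longrightarrow> l < r \<Longrightarrow> AU k l + AV k l = AU l k + AV l k"
  shows "lifted_error r (\<lambda>k l. a k l + b k l) (\<lambda>k l. AU k l + AV k l) z \<le>
     4 * (fro r a z + fro r z b + fro r a b + 2 * fro r (\<lambda>k l. AU l k) AV + 2 * fro r a AV + 2 * fro r AU b)
     + fro r (\<lambda>k l. (AU k l + AU l k + a k l) - (AV k l + AV l k + b k l))
             (\<lambda>k l. (AU k l + AU l k + a k l) - (AV k l + AV l k + b k l))"
proof -
  have ta: "(\<lambda>k l. a l k) = a" "(\<lambda>k l. b l k) = b" using a b by (auto simp: fun_eq_iff)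
  have sym: "fro r a (\<lambda>k l. P l k) = fro r a P" "fro r b (\<lambda>k l. P l k) = fro r b P"
    "fro r (\<lambda>k l. P l k) a = fro r a P" "fro r (\<lambda>k l. P l k) b = fro r b P" for P
  proof -
    show *: "fro r a (\<lambda>k l. P l k) = fro r a P" "fro r b (\<lambda>k l. P l k) = fro r b P"
      using fro_transpose[of r a P] fro_transpose[of r b P] by (simp_all only: ta)
    show "fro r (\<lambda>k l. P l k) a = fro r a P" "fro r (\<lambda>k l. P l k) b = fro r b P"
      by (subst fro_commute, rule *)+
  qed
  have both: "fro r (\<lambda>k l. P l k) (\<lambda>k l. Q l k) = fro r P Q" for P Q
    by (rule fro_transpose)
  have tr: "fro r AV (\<lambda>k l. AU l k) = fro r (\<lambda>k l. AU l k) AV"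
    "fro r AU (\<lambda>k l. AV l k) = fro r (\<lambda>k l. AU l k) AV" "fro r (\<lambda>k l. AV l k) AU = fro r (\<lambda>k l. AU l k) AV"
    using fro_commute[of r AV "\<lambda>k l. AU l k"] fro_transpose[of r AU AV] fro_commute[of r "\<lambda>k l. AV l k" AU]
    by simp_all
  note insts = sym[of AU] sym[of AV] both[of AU AU] both[of AU AV] both[of AV AU] both[of AV AV]
  have com: "fro r AV AU = fro r AU AV" "fro r AU a = fro r a AU" "fro r AV a = fro r a AV"
    "fro r AU b = fro r b AU" "fro r AV b = fro r b AV" "fro r b a = fro r a b" "fro r z b = fro r b z"
    by (rule fro_commute)+
  have "fro r (\<lambda>k l. AU k l + AV k l) (\<lambda>k l. AU k l + AV k l) = fro r (\<lambda>k l. AU k l + AV k l) (\<lambda>k l. AU l k + AV l k)"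
    by (rule fro_cong) (use A in auto)
  then have symA: "fro r AU AU + 2 * fro r AU AV + fro r AV AV
     = fro r AU (\<lambda>k l. AU l k) + 2 * fro r (\<lambda>k l. AU l k) AV + fro r AV (\<lambda>k l. AV l k)"
    unfolding fro_simps insts tr com by linarith
  have tt: "fro r (\<lambda>k l. AU l k) AU = fro r AU (\<lambda>k l. AU l k)" "fro r (\<lambda>k l. AV l k) AV = fro r AV (\<lambda>k l. AV l k)"
    by (rule fro_transpose)+
  have "0 \<le> 2 * fro r (\<lambda>k l. AU k l - AV k l) (\<lambda>k l. AU k l - AV k l)" by (simp add: fro_self_nonneg)
  then have "0 \<le> 2 * fro r AU AU - 4 * fro r AU AV + 2 * fro r AV AV" by (simp add: fro_simps com)
  then show ?thesis using symA unfolding lifted_error_def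
    unfolding fro_simps insts tr com tt by argo
qed

text \<open>Completing squares, with F the lifted error: 2F - |G|^2 = |G + 2A|^2 + 4 <G, A + 2z>,
  and F - 8/5 <G, z> = |G + 7/5 A|^2 + 6/5 <G, A + 2z> + 1/25 |A|^2. The multiple 7/5 stays just
  below sqrt 2, which keeps the last coefficient positive.\<close>

lemma lifted_error_ge:
  assumes psd: "0 \<le> fro r G (\<lambda>k l. A k l + 2 * z k l)"
  shows "fro r G G \<le> 2 * lifted_error r G A z" and "8/5 * fro r G z \<le> lifted_error r G A z"
proof -
  have c: "fro r A G = fro r G A" by (rule fro_commute)
  have "0 \<le> fro r (\<lambda>k l. G k l + 2 * A k l) (\<lambda>k l. G k l + 2 * A k l)" by (rule fro_self_nonneg)
  then show "fro r G G \<le> 2 * lifted_error r G A z"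
    using psd unfolding lifted_error_def by (simp add: fro_simps c)
  have "0 \<le> fro r (\<lambda>k l. G k l + 7/5 * A k l) (\<lambda>k l. G k l + 7/5 * A k l)" by (rule fro_self_nonneg)
  moreover have "0 \<le> fro r A A" by (rule fro_self_nonneg)
  ultimately show "8/5 * fro r G z \<le> lifted_error r G A z"
    using psd unfolding lifted_error_def fro_simps c by argo
qed

lemma fro_gram_psd:
  assumes "\<And>x. 0 \<le> (\<Sum>k<r. \<Sum>l<r. x k * P k l * x l)"
  shows "0 \<le> fro r (gram n B B) P"
proof -
  have "fro r (gram n B B) P = (\<Sum>k<r. \<Sum>l<r. \<Sum>i<n. B i k * P k l * B i l)"
    unfolding fro_def gram_def sum_distrib_right by (simp add: mult_ac)
  also have "\<dots> = (\<Sum>i<n. \<Sum>k<r. \<Sum>l<r. B i k * P k l * B i l)"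
    by (subst (2) sum.swap, subst (1) sum.swap) (rule refl)
  also have "\<dots> \<ge> 0" by (rule sum_nonneg) (rule assms)
  finally show ?thesis .
qed

text \<open>Expanding both inner products over index pairs (k, l) turns the sum into r^2 values of
  the form at entrywise products of columns. The squared norms of these products add up to products
  of squared row norms; this is where fourth powers of row norms come from.\<close>

lemma spectral_hadamard_bound:
  assumes H: "\<And>x y. \<bar>bil n1 n2 H x y\<bar> \<le> h * l2 n1 x * l2 n2 y" and h: "0 \<le> h"
  shows "\<bar>\<Sum>i<n1. \<Sum>j<n2. H i j * (ip r (A i) (B j) * ip r (C i) (D j))\<bar>
    \<le> h / 2 * ((\<Sum>i<n1. (l2 r (A i))\<^sup>2 * (l2 r (C i))\<^sup>2) + (\<Sum>j<n2. (l2 r (B j))\<^sup>2 * (l2 r (D j))\<^sup>2))"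
proof -
  let ?K = "{..<r} \<times> {..<r}"
  define x where "x = (\<lambda>(k, l) i. A i k * C i l)"
  define y where "y = (\<lambda>(k, l) j. B j k * D j l)"
  have "(\<Sum>i<n1. \<Sum>j<n2. H i j * (ip r (A i) (B j) * ip r (C i) (D j)))
     = (\<Sum>i<n1. \<Sum>j<n2. \<Sum>e\<in>?K. H i j * x e i * y e j)"
  proof (rule sum.cong[OF refl], rule sum.cong[OF refl])
    fix i j
    have "ip r (A i) (B j) * ip r (C i) (D j) = (\<Sum>(k, l)\<in>?K. (A i k * B j k) * (C i l * D j l))"
      unfolding ip_def sum_product sum.cartesian_product ..
    also have "\<dots> = (\<Sum>e\<in>?K. x e i * y e j)"
      by (intro sum.cong refl) (auto simp: x_def y_def)
    finally show "H i j * (ip r (A i) (B j) * ip r (C i) (D j)) = (\<Sum>e\<in>?K. H i j * x e i * y e j)"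
      by (simp add: sum_distrib_left mult.assoc)
  qed
  also have "\<dots> = (\<Sum>e\<in>?K. bil n1 n2 H (x e) (y e))"
    unfolding bil_def by (subst (2) sum.swap, subst (1) sum.swap) (rule refl)
  finally have "\<bar>\<Sum>i<n1. \<Sum>j<n2. H i j * (ip r (A i) (B j) * ip r (C i) (D j))\<bar> = \<bar>\<Sum>e\<in>?K. bil n1 n2 H (x e) (y e)\<bar>" by simp
  also have "\<dots> \<le> (\<Sum>e\<in>?K. \<bar>bil n1 n2 H (x e) (y e)\<bar>)" by (rule sum_abs)
  also have "\<dots> \<le> (\<Sum>e\<in>?K. h / 2 * ((l2 n1 (x e))\<^sup>2 + (l2 n2 (y e))\<^sup>2))"
  proof (rule sum_mono)
    fix e
    have "2 * (l2 n1 (x e) * l2 n2 (y e)) \<le> (l2 n1 (x e))\<^sup>2 + (l2 n2 (y e))\<^sup>2"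
      using sum_squares_bound[of "l2 n1 (x e)" "l2 n2 (y e)"] by simp
    then have "h / 2 * (2 * (l2 n1 (x e) * l2 n2 (y e))) \<le> h / 2 * ((l2 n1 (x e))\<^sup>2 + (l2 n2 (y e))\<^sup>2)"
      using h by (intro mult_left_mono) auto
    then show "\<bar>bil n1 n2 H (x e) (y e)\<bar> \<le> h / 2 * ((l2 n1 (x e))\<^sup>2 + (l2 n2 (y e))\<^sup>2)"
      using H[of "x e" "y e"] by (simp add: mult.assoc)
  qed
  also have "\<dots> = h / 2 * ((\<Sum>e\<in>?K. (l2 n1 (x e))\<^sup>2) + (\<Sum>e\<in>?K. (l2 n2 (y e))\<^sup>2))"
    by (simp only: sum_distrib_left[symmetric] sum.distrib)
  also have "(\<Sum>e\<in>?K. (l2 n1 (x e))\<^sup>2) = (\<Sum>i<n1. (l2 r (A i))\<^sup>2 * (l2 r (C i))\<^sup>2)"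
    unfolding l2_power2
  proof (subst sum.swap, rule sum.cong[OF refl])
    fix i
    show "(\<Sum>e\<in>?K. (x e i)\<^sup>2) = (\<Sum>k<r. (A i k)\<^sup>2) * (\<Sum>k<r. (C i k)\<^sup>2)"
      unfolding sum_product sum.cartesian_product
      by (intro sum.cong refl) (auto simp: x_def power_mult_distrib)
  qed
  also have "(\<Sum>e\<in>?K. (l2 n2 (y e))\<^sup>2) = (\<Sum>j<n2. (l2 r (B j))\<^sup>2 * (l2 r (D j))\<^sup>2)"
    unfolding l2_power2
  proof (subst sum.swap, rule sum.cong[OF refl])
    fix j
    show "(\<Sum>e\<in>?K. (y e j)\<^sup>2) = (\<Sum>k<r. (B j k)\<^sup>2) * (\<Sum>k<r. (D j k)\<^sup>2)"
      unfolding sum_product sum.cartesian_product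
      by (intro sum.cong refl) (auto simp: y_def power_mult_distrib)
  qed
  finally show ?thesis .
qed

section \<open>Sampled against full inner products\<close>

definition sampled_inner :: "nat \<Rightarrow> nat \<Rightarrow> (nat \<times> nat) set \<Rightarrow> (nat \<Rightarrow> nat \<Rightarrow> real) \<Rightarrow> (nat \<Rightarrow> nat \<Rightarrow> real) \<Rightarrow> real" where
  "sampled_inner n1 n2 \<Omega> P Q = (\<Sum>i<n1. \<Sum>j<n2. of_bool ((i, j) \<in> \<Omega>) * (P i j * Q i j))"

lemma sampled_inner_add_left: "sampled_inner n1 n2 \<Omega> (\<lambda>i j. P i j + P' i j) Q = sampled_inner n1 n2 \<Omega> P Q + sampled_inner n1 n2 \<Omega> P' Q"
  and sampled_inner_add_right: "sampled_inner n1 n2 \<Omega> Q (\<lambda>i j. P i j + P' i j) = sampled_inner n1 n2 \<Omega> Q P + sampled_inner n1 n2 \<Omega> Q P'"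
  by (simp_all add: sampled_inner_def distrib_left distrib_right sum.distrib del: sum_of_bool_mult_eq sum_mult_of_bool_eq)

lemma sampled_inner_commute: "sampled_inner n1 n2 \<Omega> P Q = sampled_inner n1 n2 \<Omega> Q P"
  by (simp add: sampled_inner_def mult.commute[of "P _ _"])

abbreviation full_inner :: "nat \<Rightarrow> nat \<Rightarrow> (nat \<Rightarrow> nat \<Rightarrow> real) \<Rightarrow> (nat \<Rightarrow> nat \<Rightarrow> real) \<Rightarrow> real" where
  "full_inner n1 n2 P Q \<equiv> (\<Sum>i<n1. \<Sum>j<n2. P i j * Q i j)"

lemma full_inner_add_left: "full_inner n1 n2 (\<lambda>i j. P i j + P' i j) Q = full_inner n1 n2 P Q + full_inner n1 n2 P' Q"
  and full_inner_add_right: "full_inner n1 n2 Q (\<lambda>i j. P i j + P' i j) = full_inner n1 n2 Q P + full_inner n1 n2 Q P'"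
  by (simp_all add: algebra_simps sum.distrib)

lemma sampled_inner_ip_bound:
  assumes H: "\<And>x y. \<bar>bil n1 n2 (\<lambda>i j. of_bool ((i, j) \<in> \<Omega>) - p) x y\<bar> \<le> h * l2 n1 x * l2 n2 y" and h: "0 \<le> h"
  shows "\<bar>sampled_inner n1 n2 \<Omega> (\<lambda>i j. ip r (A i) (B j)) (\<lambda>i j. ip r (C i) (D j))
      - p * full_inner n1 n2 (\<lambda>i j. ip r (A i) (B j)) (\<lambda>i j. ip r (C i) (D j))\<bar>
    \<le> h / 2 * ((\<Sum>i<n1. (l2 r (A i))\<^sup>2 * (l2 r (C i))\<^sup>2) + (\<Sum>j<n2. (l2 r (B j))\<^sup>2 * (l2 r (D j))\<^sup>2))"
proof -
  have "sampled_inner n1 n2 \<Omega> (\<lambda>i j. ip r (A i) (B j)) (\<lambda>i j. ip r (C i) (D j))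
      - p * full_inner n1 n2 (\<lambda>i j. ip r (A i) (B j)) (\<lambda>i j. ip r (C i) (D j))
    = (\<Sum>i<n1. \<Sum>j<n2. (of_bool ((i, j) \<in> \<Omega>) - p) * (ip r (A i) (B j) * ip r (C i) (D j)))"
    unfolding sampled_inner_def sum_distrib_left sum_subtractf[symmetric] left_diff_distrib ..
  then show ?thesis using spectral_hadamard_bound[OF H h, of r A B C D] by simp
qed

lemma sum_l2_mult_le:
  assumes "\<And>i. i < n \<Longrightarrow> (l2 r (U i))\<^sup>2 \<le> B"
  shows "(\<Sum>i<n. (l2 r (U i))\<^sup>2 * (l2 r (x i))\<^sup>2) \<le> B * (\<Sum>i<n. (l2 r (x i))\<^sup>2)"
  unfolding sum_distrib_left using assms by (intro sum_mono mult_right_mono) auto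

text \<open>In the expansion of E = P + Q + D all sampled terms occur with negative coefficients, so
  lower bounds suffice. In the cross terms and in D each side of the spectral estimate contains an
  error row, which gives \<open>B * S2\<close> or \<open>S4\<close>. For P with P and Q with Q one
  side would be the incoherent factor alone; these two use the restricted bound, at the cost of 3 *
  1/20 of their size.\<close>

lemma sampled_curvature_bound:
  fixes U V \<Delta> \<Gamma> :: "nat \<Rightarrow> nat \<Rightarrow> real" and r n1 n2 :: nat
  defines "P \<equiv> \<lambda>i j. ip r (\<Delta> i) (V j)" and "Q \<equiv> \<lambda>i j. ip r (U i) (\<Gamma> j)" and "D \<equiv> \<lambda>i j. ip r (\<Delta> i) (\<Gamma> j)"
  defines "E \<equiv> \<lambda>i j. P i j + Q i j + D i j"
  defines "S2 \<equiv> (\<Sum>i<n1. (l2 r (\<Delta> i))\<^sup>2) + (\<Sum>j<n2. (l2 r (\<Gamma> j))\<^sup>2)"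
  defines "S4 \<equiv> (\<Sum>i<n1. (l2 r (\<Delta> i)) ^ 4) + (\<Sum>j<n2. (l2 r (\<Gamma> j)) ^ 4)"
  assumes H: "\<And>x y. \<bar>bil n1 n2 (\<lambda>i j. of_bool ((i, j) \<in> \<Omega>) - p) x y\<bar> \<le> h * l2 n1 x * l2 n2 y" and h: "0 \<le> h"
    and U: "\<And>i. i < n1 \<Longrightarrow> (l2 r (U i))\<^sup>2 \<le> B" and V: "\<And>j. j < n2 \<Longrightarrow> (l2 r (V j))\<^sup>2 \<le> B"
    and cU: "\<And>j. j < n2 \<Longrightarrow> 19/20 * p * (\<Sum>i<n1. (Q i j)\<^sup>2) \<le> (\<Sum>i<n1. of_bool ((i, j) \<in> \<Omega>) * (Q i j)\<^sup>2)"
    and cV: "\<And>i. i < n1 \<Longrightarrow> 19/20 * p * (\<Sum>j<n2. (P i j)\<^sup>2) \<le> (\<Sum>j<n2. of_bool ((i, j) \<in> \<Omega>) * (P i j)\<^sup>2)"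
  shows "sampled_inner n1 n2 \<Omega> D D - 3 * sampled_inner n1 n2 \<Omega> E E \<le>
     p * (full_inner n1 n2 D D - 3 * full_inner n1 n2 E E + 3/20 * (full_inner n1 n2 P P + full_inner n1 n2 Q Q))
      + h * (6 * B * S2 + 4 * S4)"
proof -
  let ?s = "sampled_inner n1 n2 \<Omega>" and ?f = "full_inner n1 n2"
  let ?d2 = "\<Sum>i<n1. (l2 r (\<Delta> i))\<^sup>2" and ?g2 = "\<Sum>j<n2. (l2 r (\<Gamma> j))\<^sup>2"
  let ?d4 = "\<Sum>i<n1. (l2 r (\<Delta> i)) ^ 4" and ?g4 = "\<Sum>j<n2. (l2 r (\<Gamma> j)) ^ 4"
  have sq4: "(l2 r x)\<^sup>2 * (l2 r x)\<^sup>2 = (l2 r x) ^ 4" for x by (simp add: power2_eq_square power4_eq_xxxx)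
  have UD: "(\<Sum>i<n1. (l2 r (U i))\<^sup>2 * (l2 r (\<Delta> i))\<^sup>2) \<le> B * ?d2" by (rule sum_l2_mult_le[OF U])
  have VG: "(\<Sum>j<n2. (l2 r (V j))\<^sup>2 * (l2 r (\<Gamma> j))\<^sup>2) \<le> B * ?g2" by (rule sum_l2_mult_le[OF V])
  have bound: "p * ?f (\<lambda>i j. ip r (A i) (B' j)) (\<lambda>i j. ip r (C i) (D' j)) - h / 2 * Z
      \<le> ?s (\<lambda>i j. ip r (A i) (B' j)) (\<lambda>i j. ip r (C i) (D' j))"
    if "(\<Sum>i<n1. (l2 r (A i))\<^sup>2 * (l2 r (C i))\<^sup>2) + (\<Sum>j<n2. (l2 r (B' j))\<^sup>2 * (l2 r (D' j))\<^sup>2) \<le> Z" for A B' C D' Z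
  proof -
    have "h / 2 * ((\<Sum>i<n1. (l2 r (A i))\<^sup>2 * (l2 r (C i))\<^sup>2) + (\<Sum>j<n2. (l2 r (B' j))\<^sup>2 * (l2 r (D' j))\<^sup>2)) \<le> h / 2 * Z"
      using that h by (intro mult_left_mono) auto
    then show ?thesis using sampled_inner_ip_bound[OF H h, of r A B' C D'] by linarith
  qed
  have PQ: "p * ?f P Q - h / 2 * (B * ?d2 + B * ?g2) \<le> ?s P Q"
    unfolding P_def Q_def by (rule bound) (use UD VG in \<open>simp add: mult.commute\<close>)
  have PD: "p * ?f P D - h / 2 * (?d4 + B * ?g2) \<le> ?s P D"
    unfolding P_def D_def by (rule bound) (use VG in \<open>simp add: sq4\<close>)
  have QD: "p * ?f Q D - h / 2 * (B * ?d2 + ?g4) \<le> ?s Q D"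
    unfolding Q_def D_def by (rule bound) (use UD in \<open>simp add: sq4\<close>)
  have DD: "p * ?f D D - h / 2 * (?d4 + ?g4) \<le> ?s D D"
    unfolding D_def by (rule bound) (simp add: sq4)
  have PP: "19/20 * p * ?f P P \<le> ?s P P"
  proof -
    have "19/20 * p * ?f P P = (\<Sum>i<n1. 19/20 * p * (\<Sum>j<n2. (P i j)\<^sup>2))"
      by (simp add: sum_distrib_left power2_eq_square)
    also have "\<dots> \<le> (\<Sum>i<n1. \<Sum>j<n2. of_bool ((i, j) \<in> \<Omega>) * (P i j)\<^sup>2)" using cV by (intro sum_mono) auto
    also have "\<dots> = ?s P P" unfolding sampled_inner_def by (simp add: power2_eq_square)
    finally show ?thesis .
  qed
  have QQ: "19/20 * p * ?f Q Q \<le> ?s Q Q"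
  proof -
    have "19/20 * p * ?f Q Q = (\<Sum>j<n2. 19/20 * p * (\<Sum>i<n1. (Q i j)\<^sup>2))"
      by (subst sum.swap) (simp add: sum_distrib_left power2_eq_square)
    also have "\<dots> \<le> (\<Sum>j<n2. \<Sum>i<n1. of_bool ((i, j) \<in> \<Omega>) * (Q i j)\<^sup>2)" using cU by (intro sum_mono) auto
    also have "\<dots> = ?s Q Q" unfolding sampled_inner_def by (subst sum.swap) (simp add: power2_eq_square)
    finally show ?thesis .
  qed
  have sE: "?s E E = ?s P P + ?s Q Q + ?s D D + 2 * ?s P Q + 2 * ?s P D + 2 * ?s Q D"
    unfolding E_def sampled_inner_add_left sampled_inner_add_right
    using sampled_inner_commute[of n1 n2 \<Omega> Q P] sampled_inner_commute[of n1 n2 \<Omega> D P] sampled_inner_commute[of n1 n2 \<Omega> D Q] by simp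
  have fE: "?f E E = ?f P P + ?f Q Q + ?f D D + 2 * ?f P Q + 2 * ?f P D + 2 * ?f Q D"
    unfolding E_def full_inner_add_left full_inner_add_right by (simp add: mult.commute)
  \<comment> \<open>The coefficient of the D term turns negative only here, as 1 - 3 = -2.\<close>
  have "?s D D - 3 * ?s E E = - 3 * (?s P P + ?s Q Q) - 6 * ?s P Q - 6 * ?s P D - 6 * ?s Q D - 2 * ?s D D"
    unfolding sE by simp
  also have "\<dots> \<le> - 3 * (19/20 * p * ?f P P + 19/20 * p * ?f Q Q) - 6 * (p * ?f P Q - h / 2 * (B * ?d2 + B * ?g2))
      - 6 * (p * ?f P D - h / 2 * (?d4 + B * ?g2)) - 6 * (p * ?f Q D - h / 2 * (B * ?d2 + ?g4))
      - 2 * (p * ?f D D - h / 2 * (?d4 + ?g4))"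
  proof -
    have "- 3 * (x1 + x2) - 6 * x3 - 6 * x4 - 6 * x5 - 2 * x6 \<le> - 3 * (a1 + a2) - 6 * a3 - 6 * a4 - 6 * a5 - 2 * a6"
      if "a1 \<le> x1" "a2 \<le> x2" "a3 \<le> x3" "a4 \<le> x4" "a5 \<le> x5" "a6 \<le> x6" for a1 a2 a3 a4 a5 a6 x1 x2 x3 x4 x5 x6 :: real
      using that by argo
    from this[OF PP QQ PQ PD QD DD] show ?thesis .
  qed
  also have "\<dots> = p * (?f D D - 3 * ?f E E + 3/20 * (?f P P + ?f Q Q)) + h * (6 * B * S2 + 4 * S4)"
    unfolding fE S2_def S4_def by (simp add: algebra_simps)
  finally show ?thesis .
qed

lemma gram_self_sym: "gram n A A k l = gram n A A l k"
  by (simp add: gram_def mult.commute)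

text \<open>Everything is measured by the lifted error F. The terms with E and E' give -3/4 F; those
  with D and D' add up to |G|^2 / 4 <= F/2; the sampling loss and the small terms cost 3/20 + 1/20
  of <G, z>, at most F/8. Since 1/2 - 3/4 + 1/8 = -1/8, the noise must dominate F/8. The noise is
  tested against Y, Q and D separately because each is a product of two parametrized factors, to
  which the noise level applies, while E = Y + Q is only a sum of two such products.\<close>

lemma deterministic_recovery:
  fixes U V \<Delta> \<Gamma> :: "nat \<Rightarrow> nat \<Rightarrow> real" and r n1 n2 :: nat
  defines "P \<equiv> \<lambda>i j. ip r (\<Delta> i) (V j)" and "Q \<equiv> \<lambda>i j. ip r (U i) (\<Gamma> j)" and "D \<equiv> \<lambda>i j. ip r (\<Delta> i) (\<Gamma> j)"
  defines "E \<equiv> \<lambda>i j. P i j + Q i j + D i j" and "Y \<equiv> \<lambda>i j. P i j + D i j"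
  defines "S2 \<equiv> (\<Sum>i<n1. (l2 r (\<Delta> i))\<^sup>2) + (\<Sum>j<n2. (l2 r (\<Gamma> j))\<^sup>2)"
  defines "S4 \<equiv> (\<Sum>i<n1. (l2 r (\<Delta> i)) ^ 4) + (\<Sum>j<n2. (l2 r (\<Gamma> j)) ^ 4)"
  defines "D' \<equiv> \<lambda>k l. gram n1 \<Delta> \<Delta> k l - gram n2 \<Gamma> \<Gamma> k l"
  defines "E' \<equiv> \<lambda>k l. (gram n1 U \<Delta> k l + gram n1 U \<Delta> l k + gram n1 \<Delta> \<Delta> k l)
        - (gram n2 V \<Gamma> k l + gram n2 V \<Gamma> l k + gram n2 \<Gamma> \<Gamma> k l)"
  assumes bal: "\<And>k l. k < r \<Longrightarrow> l < r \<Longrightarrow> gram n1 U U k l = gram n2 V V k l"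
    and sym: "\<And>k l. k < r \<Longrightarrow> l < r \<Longrightarrow> gram n1 U \<Delta> k l + gram n2 V \<Gamma> k l = gram n1 U \<Delta> l k + gram n2 V \<Gamma> l k"
    and psd: "\<And>x. 0 \<le> (\<Sum>k<r. \<Sum>l<r. x k * (gram n1 U \<Delta> k l + gram n2 V \<Gamma> k l + 2 * gram n1 U U k l) * x l)"
    and p: "0 < p" and h: "0 \<le> h" and lam: "8 * (h / p) \<le> lam" and \<nu>: "0 \<le> \<nu>"
    and H: "\<And>x y. \<bar>bil n1 n2 (\<lambda>i j. of_bool ((i, j) \<in> \<Omega>) - p) x y\<bar> \<le> h * l2 n1 x * l2 n2 y"
    and U: "\<And>i. i < n1 \<Longrightarrow> (l2 r (U i))\<^sup>2 \<le> B" and V: "\<And>j. j < n2 \<Longrightarrow> (l2 r (V j))\<^sup>2 \<le> B"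
    and cU: "\<And>j. j < n2 \<Longrightarrow> 19/20 * p * (\<Sum>i<n1. (Q i j)\<^sup>2) \<le> (\<Sum>i<n1. of_bool ((i, j) \<in> \<Omega>) * (Q i j)\<^sup>2)"
    and cV: "\<And>i. i < n1 \<Longrightarrow> 19/20 * p * (\<Sum>j<n2. (P i j)\<^sup>2) \<le> (\<Sum>j<n2. of_bool ((i, j) \<in> \<Omega>) * (P i j)\<^sup>2)"
    and sU: "\<And>x. s * (l2 r x)\<^sup>2 \<le> (\<Sum>i<n1. (ip r (U i) x)\<^sup>2)" and sV: "\<And>x. s * (l2 r x)\<^sup>2 \<le> (\<Sum>j<n2. (ip r x (V j))\<^sup>2)"
    and small: "6 * (h / p) * B + lam * c \<le> s / 20"
    and K: "0 \<le> (sampled_inner n1 n2 \<Omega> D D - 3 * sampled_inner n1 n2 \<Omega> E E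
         + 4 * (sampled_inner n1 n2 \<Omega> N Y + sampled_inner n1 n2 \<Omega> N Q) + 2 * sampled_inner n1 n2 \<Omega> N D) / p
      + (fro r D' D' - 3 * fro r E' E') / 4 + lam * (c * S2 - S4 / 2)"
    and NY: "sampled_inner n1 n2 \<Omega> N Y \<le> \<nu> * sqrt (full_inner n1 n2 Y Y)"
    and NQ: "sampled_inner n1 n2 \<Omega> N Q \<le> \<nu> * sqrt (full_inner n1 n2 Q Q)"
    and ND: "sampled_inner n1 n2 \<Omega> N D \<le> \<nu> * sqrt (full_inner n1 n2 D D)"
  shows "full_inner n1 n2 E E \<le> 27000 * (\<nu> / p)\<^sup>2"
proof -
  let ?f = "full_inner n1 n2" and ?s = "sampled_inner n1 n2 \<Omega>"
  define a where "a = gram n1 \<Delta> \<Delta>"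
  define b where "b = gram n2 \<Gamma> \<Gamma>"
  define z where "z = gram n1 U U"
  define AU where "AU = gram n1 U \<Delta>"
  define AV where "AV = gram n2 V \<Gamma>"
  define G where "G = (\<lambda>k l. a k l + b k l)"
  define A where "A = (\<lambda>k l. AU k l + AV k l)"
  define F where "F = lifted_error r G A z"
  have asym: "a k l = a l k" "b k l = b l k" for k l unfolding a_def b_def by (rule gram_self_sym)+
  have zV: "fro r R z = fro r R (gram n2 V V)" for R unfolding z_def by (rule fro_cong) (use bal in auto)
  have fPP: "?f P P = fro r a z" unfolding zV unfolding P_def a_def by (rule sum_ip_ip_eq_fro)
  have fQQ: "?f Q Q = fro r z b" unfolding Q_def b_def z_def by (rule sum_ip_ip_eq_fro)
  have fDD: "?f D D = fro r a b" unfolding D_def a_def b_def by (rule sum_ip_ip_eq_fro)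
  have fPQ: "?f P Q = fro r (\<lambda>k l. AU l k) AV"
  proof -
    have "?f P Q = fro r (gram n1 \<Delta> U) AV" unfolding P_def Q_def AV_def by (rule sum_ip_ip_eq_fro)
    also have "gram n1 \<Delta> U = (\<lambda>k l. AU l k)" by (simp add: AU_def fun_eq_iff gram_def mult.commute)
    finally show ?thesis .
  qed
  have fPD: "?f P D = fro r a AV" unfolding P_def D_def a_def AV_def by (rule sum_ip_ip_eq_fro)
  have fQD: "?f Q D = fro r AU b" unfolding Q_def D_def AU_def b_def by (rule sum_ip_ip_eq_fro)
  have fE: "?f E E = ?f P P + ?f Q Q + ?f D D + 2 * ?f P Q + 2 * ?f P D + 2 * ?f Q D"
    unfolding E_def full_inner_add_left full_inner_add_right by (simp add: mult.commute)
  have fY: "?f Y Y = ?f P P + ?f D D + 2 * ?f P D"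
    unfolding Y_def full_inner_add_left full_inner_add_right by (simp add: mult.commute)
  have nn: "0 \<le> ?f R R" for R by (intro sum_nonneg) simp
  have F1: "F \<le> 4 * ?f E E + fro r E' E'"
    using lifted_error_le[of a b r AU AV z, OF asym] sym
    unfolding F_def G_def A_def fE fPP fQQ fDD fPQ fPD fQD E'_def a_def[symmetric] b_def[symmetric] AU_def[symmetric] AV_def[symmetric]
    by (simp add: AU_def AV_def)
  have psd': "0 \<le> fro r G (\<lambda>k l. A k l + 2 * z k l)"
    unfolding G_def fro_add_left[of r a b] A_def AU_def AV_def z_def
    using fro_gram_psd[OF psd, of n1 \<Delta>] fro_gram_psd[OF psd, of n2 \<Gamma>] by (simp add: a_def b_def)
  have F2: "fro r G G \<le> 2 * F" and F3: "8/5 * fro r G z \<le> F"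
    unfolding F_def by (rule lifted_error_ge[OF psd'])+
  have GG: "fro r G G = fro r a a + 2 * fro r a b + fro r b b"
    unfolding G_def fro_simps using fro_commute[of r b a] by simp
  have DD': "fro r D' D' = fro r a a - 2 * fro r a b + fro r b b"
    unfolding D'_def a_def[symmetric] b_def[symmetric] fro_simps using fro_commute[of r b a] by simp
  have Gz: "fro r G z = ?f P P + ?f Q Q"
    unfolding fPP fQQ G_def fro_simps using fro_commute[of r b z] by simp
  have F0: "0 \<le> F" using F3 Gz nn[of P] nn[of Q] by linarith
  have D4: "4 * ?f D D \<le> fro r G G" unfolding fDD GG
    using fro_self_nonneg[of r D'] DD' by linarith
  have curv: "?s D D - 3 * ?s E E \<le> p * (?f D D - 3 * ?f E E + 3/20 * (?f P P + ?f Q Q)) + h * (6 * B * S2 + 4 * S4)"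
    unfolding D_def E_def P_def Q_def S2_def S4_def
    by (rule sampled_curvature_bound[OF H h U V]) (use cU cV in \<open>simp_all add: P_def Q_def\<close>)
  have S2: "s * S2 \<le> fro r G z"
  proof -
    have "s * (\<Sum>i<n1. (l2 r (\<Delta> i))\<^sup>2) \<le> ?f P P"
      unfolding sum_distrib_left P_def power2_eq_square[symmetric] by (intro sum_mono sV)
    moreover have "s * (\<Sum>j<n2. (l2 r (\<Gamma> j))\<^sup>2) \<le> ?f Q Q"
      unfolding sum_distrib_left Q_def power2_eq_square[symmetric] by (subst sum.swap) (intro sum_mono sU)
    ultimately show ?thesis unfolding Gz S2_def by (simp add: distrib_left)
  qed
  have S2n: "0 \<le> S2" and S4n: "0 \<le> S4" unfolding S2_def S4_def by (auto intro!: add_nonneg_nonneg sum_nonneg)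
  define noise where "noise = 4 * (?s N Y + ?s N Q) + 2 * ?s N D"
  have main: "F / 8 \<le> noise / p"
  proof -
    have k: "0 \<le> ((?s D D - 3 * ?s E E) / p + noise / p) + (fro r D' D' - 3 * fro r E' E') / 4 + lam * (c * S2 - S4 / 2)"
      using K unfolding noise_def by (simp only: add_divide_distrib[symmetric] add.assoc)
    have "(?s D D - 3 * ?s E E) / p \<le> (p * (?f D D - 3 * ?f E E + 3/20 * (?f P P + ?f Q Q)) + h * (6 * B * S2 + 4 * S4)) / p"
      using curv p by (intro divide_right_mono) auto
    also have "\<dots> = ?f D D - 3 * ?f E E + 3/20 * fro r G z + 6 * (h / p) * B * S2 + 4 * (h / p) * S4"
      unfolding Gz using p by (simp add: field_simps)
    finally have 1: "(?s D D - 3 * ?s E E) / p \<le> ?f D D - 3 * ?f E E + 3/20 * fro r G z + 6 * (h / p) * B * S2 + 4 * (h / p) * S4" .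
    \<comment> \<open>The lower bound on \<open>lam\<close> is calibrated here: the penalty term -S4
      / 2 exactly covers the fourth powers left by the spectral bound.\<close>
    have 2: "4 * (h / p) * S4 \<le> lam * S4 / 2" using mult_right_mono[OF lam S4n] by simp
    have "(6 * (h / p) * B + lam * c) * S2 \<le> s / 20 * S2" using small S2n by (rule mult_right_mono)
    then have 3: "6 * (h / p) * B * S2 + lam * c * S2 \<le> fro r G z / 20" using S2 by (simp add: distrib_right)
    have 4: "lam * (c * S2 - S4 / 2) = lam * c * S2 - lam * S4 / 2" by (simp add: algebra_simps)
    have 5: "?f D D + fro r D' D' / 4 = fro r G G / 4" unfolding fDD DD' GG by argo
    have "0 \<le> noise / p + fro r G G / 4 - 3/4 * F + 3/20 * fro r G z + fro r G z / 20"
      using k 1 2 3 F1 5 unfolding 4 by argo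
    then show ?thesis using F2 F3 by argo
  qed
  \<comment> \<open>The coefficients 4/5, 3/4 and 3/2 stand for square roots: |Q|^2 <= 5/8 F, |D|^2
    <= F/2, and |Y|^2 <= 2 (|P|^2 + |D|^2) <= 9/4 F.\<close>
  have bQ: "sqrt (?f Q Q) \<le> 4/5 * sqrt F"
  proof (rule real_le_lsqrt[THEN order_trans])
    show "?f Q Q \<le> (sqrt (16/25 * F))\<^sup>2" using Gz F3 nn[of P] F0 by simp
  qed (use F0 in \<open>auto simp: real_sqrt_mult real_sqrt_divide\<close>)
  have bD: "sqrt (?f D D) \<le> 3/4 * sqrt F"
  proof (rule real_le_lsqrt[THEN order_trans])
    show "?f D D \<le> (sqrt (9/16 * F))\<^sup>2" using D4 F2 F0 by simp
  qed (use F0 in \<open>auto simp: real_sqrt_mult real_sqrt_divide\<close>)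
  have fPDle: "2 * ?f P D \<le> ?f P P + ?f D D" "2 * ?f P Q \<le> ?f P P + ?f Q Q" "2 * ?f Q D \<le> ?f Q Q + ?f D D"
  proof -
    have "2 * ?f R T \<le> ?f R R + ?f T T" for R T
    proof -
      have "2 * ?f R T \<le> (\<Sum>i<n1. \<Sum>j<n2. R i j * R i j + T i j * T i j)"
        unfolding sum_distrib_left
        by (intro sum_mono) (use sum_squares_bound in \<open>simp add: power2_eq_square mult.assoc\<close>)
      then show ?thesis by (simp add: sum.distrib)
    qed
    then show "2 * ?f P D \<le> ?f P P + ?f D D" "2 * ?f P Q \<le> ?f P P + ?f Q Q" "2 * ?f Q D \<le> ?f Q Q + ?f D D" by auto
  qed
  have bY: "sqrt (?f Y Y) \<le> 3/2 * sqrt F"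
  proof (rule real_le_lsqrt[THEN order_trans])
    show "?f Y Y \<le> (sqrt (9/4 * F))\<^sup>2" unfolding fY using fPDle(1) D4 F2 F3 Gz nn[of Q] F0 by simp
  qed (use F0 in \<open>auto simp: real_sqrt_mult real_sqrt_divide\<close>)
  have "noise \<le> 4 * (\<nu> * (3/2 * sqrt F) + \<nu> * (4/5 * sqrt F)) + 2 * (\<nu> * (3/4 * sqrt F))"
    unfolding noise_def
    using order_trans[OF NY mult_left_mono[OF bY \<nu>]] order_trans[OF NQ mult_left_mono[OF bQ \<nu>]]
      order_trans[OF ND mult_left_mono[OF bD \<nu>]] by argo
  also have "\<dots> \<le> 11 * \<nu> * sqrt F"
  proof -
    have "0 \<le> \<nu> * sqrt F" using \<nu> F0 by simp
    then show ?thesis by (simp add: algebra_simps)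
  qed
  finally have "F / 8 \<le> 11 * \<nu> * sqrt F / p" using main p by (smt (verit) divide_right_mono)
  then have "(sqrt F)\<^sup>2 \<le> (88 * (\<nu> / p)) * sqrt F" using F0 by simp
  then have "sqrt F \<le> 88 * (\<nu> / p)" by (rule square_le_mult_imp_le) (use F0 \<nu> p in auto)
  then have "(sqrt F)\<^sup>2 \<le> (88 * (\<nu> / p))\<^sup>2" using F0 by (intro power_mono) auto
  then have F: "F \<le> 7744 * (\<nu> / p)\<^sup>2" using F0 by (simp add: power_mult_distrib power_divide)
  \<comment> \<open>The factor 27/8 is 3 (5/8 + 1/2); times 88^2 = 7744 it gives 26136, rounded up
    to 27000.\<close>
  have "?f E E \<le> 3 * (?f P P + ?f Q Q + ?f D D)" unfolding fE using fPDle by argo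
  also have "\<dots> \<le> 27/8 * F" using Gz F3 D4 F2 by argo
  also have "\<dots> \<le> 27/8 * (7744 * (\<nu> / p)\<^sup>2)" using F by simp
  also have "\<dots> \<le> 27000 * (\<nu> / p)\<^sup>2" by (simp add: mult_right_mono)
  finally show ?thesis .
qed

section \<open>Second-order conditions along a line\<close>

text \<open>An expansion with cubic remainder on [-1, 1] takes the place of derivatives: it is
  closed under sums and products and applies directly to a majorant that touches the objective at t
  = 0.\<close>

definition jet2 :: "(real \<Rightarrow> real) \<Rightarrow> real \<Rightarrow> real \<Rightarrow> real \<Rightarrow> bool" where
  "jet2 f c0 c1 c2 \<longleftrightarrow> (\<exists>C\<ge>0. \<forall>t. \<bar>t\<bar> \<le> 1 \<longrightarrow> \<bar>f t - (c0 + c1 * t + c2 * t\<^sup>2)\<bar> \<le> C * \<bar>t\<bar> ^ 3)"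

lemma jet2_poly: "jet2 (\<lambda>t. c0 + c1 * t + c2 * t\<^sup>2) c0 c1 c2"
  unfolding jet2_def by (intro exI[of _ 0]) auto

lemma jet2_const: "jet2 (\<lambda>t. c) c 0 0"
  using jet2_poly[of c 0 0] by simp

lemma jet2_add:
  assumes "jet2 f c0 c1 c2" "jet2 g d0 d1 d2"
  shows "jet2 (\<lambda>t. f t + g t) (c0 + d0) (c1 + d1) (c2 + d2)"
proof -
  obtain C where C: "0 \<le> C" "\<And>t. \<bar>t\<bar> \<le> 1 \<Longrightarrow> \<bar>f t - (c0 + c1 * t + c2 * t\<^sup>2)\<bar> \<le> C * \<bar>t\<bar> ^ 3"
    using assms(1) by (auto simp: jet2_def)
  obtain D where D: "0 \<le> D" "\<And>t. \<bar>t\<bar> \<le> 1 \<Longrightarrow> \<bar>g t - (d0 + d1 * t + d2 * t\<^sup>2)\<bar> \<le> D * \<bar>t\<bar> ^ 3"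
    using assms(2) by (auto simp: jet2_def)
  show ?thesis unfolding jet2_def
  proof (intro exI[of _ "C + D"] conjI allI impI)
    fix t :: real assume t: "\<bar>t\<bar> \<le> 1"
    show "\<bar>f t + g t - (c0 + d0 + (c1 + d1) * t + (c2 + d2) * t\<^sup>2)\<bar> \<le> (C + D) * \<bar>t\<bar> ^ 3"
      using C(2)[OF t] D(2)[OF t] by (simp add: algebra_simps)
  qed (use C D in auto)
qed

lemma jet2_mult:
  assumes "jet2 f c0 c1 c2" "jet2 g d0 d1 d2"
  shows "jet2 (\<lambda>t. f t * g t) (c0 * d0) (c0 * d1 + c1 * d0) (c0 * d2 + c1 * d1 + c2 * d0)"
proof -
  obtain C where C: "0 \<le> C" "\<And>t. \<bar>t\<bar> \<le> 1 \<Longrightarrow> \<bar>f t - (c0 + c1 * t + c2 * t\<^sup>2)\<bar> \<le> C * \<bar>t\<bar> ^ 3"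
    using assms(1) by (auto simp: jet2_def)
  obtain D where D: "0 \<le> D" "\<And>t. \<bar>t\<bar> \<le> 1 \<Longrightarrow> \<bar>g t - (d0 + d1 * t + d2 * t\<^sup>2)\<bar> \<le> D * \<bar>t\<bar> ^ 3"
    using assms(2) by (auto simp: jet2_def)
  let ?A = "\<bar>c0\<bar> + \<bar>c1\<bar> + \<bar>c2\<bar>" and ?B = "\<bar>d0\<bar> + \<bar>d1\<bar> + \<bar>d2\<bar>"
  have small: "\<bar>a0 + a1 * t + a2 * t\<^sup>2\<bar> \<le> \<bar>a0\<bar> + \<bar>a1\<bar> + \<bar>a2\<bar>" if "\<bar>t\<bar> \<le> 1" for a0 a1 a2 t :: real
  proof -
    have "\<bar>a1 * t\<bar> \<le> \<bar>a1\<bar>" "\<bar>a2 * t\<^sup>2\<bar> \<le> \<bar>a2\<bar>"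
      using that abs_square_le_1[of t] by (simp_all add: abs_mult mult_left_le)
    then show ?thesis by linarith
  qed
  let ?K = "C * (?B + D) + ?A * D + (\<bar>c1 * d2 + c2 * d1\<bar> + \<bar>c2 * d2\<bar>)"
  show ?thesis unfolding jet2_def
  proof (intro exI[of _ ?K] conjI allI impI)
    fix t :: real assume t: "\<bar>t\<bar> \<le> 1"
    let ?p = "c0 + c1 * t + c2 * t\<^sup>2" and ?q = "d0 + d1 * t + d2 * t\<^sup>2"
    let ?e = "f t - ?p" and ?k = "g t - ?q"
    have t3: "\<bar>t\<bar> ^ 3 \<le> 1" using t by (simp add: power_le_one)
    have g: "\<bar>g t\<bar> \<le> ?B + D"
    proof -
      have "D * \<bar>t\<bar> ^ 3 \<le> D" using D(1) t3 by (simp add: mult_left_le)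
      then show ?thesis using D(2)[OF t] small[OF t, of d0 d1 d2] by linarith
    qed
    have eq: "f t * g t - (c0 * d0 + (c0 * d1 + c1 * d0) * t + (c0 * d2 + c1 * d1 + c2 * d0) * t\<^sup>2)
       = ?e * g t + ?p * ?k + ((c1 * d2 + c2 * d1) + c2 * d2 * t) * t ^ 3"
      by (simp add: algebra_simps power2_eq_square power3_eq_cube)
    have 1: "\<bar>?e * g t\<bar> \<le> C * \<bar>t\<bar> ^ 3 * (?B + D)"
      unfolding abs_mult using C D(1) t g by (intro mult_mono) auto
    have 2: "\<bar>?p * ?k\<bar> \<le> ?A * (D * \<bar>t\<bar> ^ 3)"
      unfolding abs_mult using D(2)[OF t] small[OF t, of c0 c1 c2] by (intro mult_mono) auto
    have 3: "\<bar>((c1 * d2 + c2 * d1) + c2 * d2 * t) * t ^ 3\<bar> \<le> (\<bar>c1 * d2 + c2 * d1\<bar> + \<bar>c2 * d2\<bar>) * \<bar>t\<bar> ^ 3"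
    proof -
      have "\<bar>c2 * d2 * t\<bar> \<le> \<bar>c2 * d2\<bar>" using t by (simp add: abs_mult mult_left_le)
      then have "\<bar>(c1 * d2 + c2 * d1) + c2 * d2 * t\<bar> \<le> \<bar>c1 * d2 + c2 * d1\<bar> + \<bar>c2 * d2\<bar>" by linarith
      then show ?thesis unfolding abs_mult power_abs by (intro mult_right_mono) auto
    qed
    have "\<bar>?e * g t + ?p * ?k + ((c1 * d2 + c2 * d1) + c2 * d2 * t) * t ^ 3\<bar>
      \<le> C * \<bar>t\<bar> ^ 3 * (?B + D) + ?A * (D * \<bar>t\<bar> ^ 3) + (\<bar>c1 * d2 + c2 * d1\<bar> + \<bar>c2 * d2\<bar>) * \<bar>t\<bar> ^ 3"
    proof -
      have "\<bar>x + y + z\<bar> \<le> a + b + c" if "\<bar>x\<bar> \<le> a" "\<bar>y\<bar> \<le> b" "\<bar>z\<bar> \<le> c" for x y z a b c :: real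
        using that by linarith
      from this[OF 1 2 3] show ?thesis .
    qed
    also have "\<dots> = ?K * \<bar>t\<bar> ^ 3"
    proof -
      have "C * T * B + A * (D * T) + F * T = (C * B + A * D + F) * T" for A B C D F T :: real
        by (simp add: algebra_simps)
      then show ?thesis .
    qed
    finally show "\<bar>f t * g t - (c0 * d0 + (c0 * d1 + c1 * d0) * t + (c0 * d2 + c1 * d1 + c2 * d0) * t\<^sup>2)\<bar> \<le> ?K * \<bar>t\<bar> ^ 3"
      unfolding eq .
  qed (use C D in \<open>auto intro!: add_nonneg_nonneg\<close>)
qed

lemma jet2_scale: "jet2 f c0 c1 c2 \<Longrightarrow> jet2 (\<lambda>t. c * f t) (c * c0) (c * c1) (c * c2)"
  using jet2_mult[OF jet2_const[of c], of f c0 c1 c2] by simp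

lemma jet2_sum:
  assumes "finite A" "\<And>i. i \<in> A \<Longrightarrow> jet2 (f i) (c0 i) (c1 i) (c2 i)"
  shows "jet2 (\<lambda>t. \<Sum>i\<in>A. f i t) (\<Sum>i\<in>A. c0 i) (\<Sum>i\<in>A. c1 i) (\<Sum>i\<in>A. c2 i)"
  using assms by (induction A rule: finite_induct) (auto intro: jet2_const jet2_add)

lemma jet2_square: "jet2 f c0 c1 c2 \<Longrightarrow> jet2 (\<lambda>t. (f t)\<^sup>2) (c0\<^sup>2) (2 * c0 * c1) (2 * c0 * c2 + c1\<^sup>2)"
  using jet2_mult[of f c0 c1 c2 f c0 c1 c2] by (simp add: power2_eq_square mult_ac)

lemma jet2_cong: "jet2 f c0 c1 c2 \<Longrightarrow> c0 = d0 \<Longrightarrow> c1 = d1 \<Longrightarrow> c2 = d2 \<Longrightarrow> jet2 f d0 d1 d2" by simp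

text \<open>Near 0 the majorant satisfies c0 <= g t <= G t and it equals c0 at 0, so
  \<open>G\<close> has a local minimum there. Both conditions are read off \<open>G\<close>, whether
  or not \<open>g\<close> itself has an expansion.\<close>

lemma jet2_local_min:
  assumes jet: "jet2 G c0 c1 c2" and le: "\<And>t. \<bar>t\<bar> \<le> 1 \<Longrightarrow> g t \<le> G t"
    and \<epsilon>: "0 < \<epsilon>" and min: "\<And>t. \<bar>t\<bar> < \<epsilon> \<Longrightarrow> c0 \<le> g t"
  shows "c1 = 0" "0 \<le> c2"
proof -
  obtain C where C: "0 \<le> C" "\<And>t. \<bar>t\<bar> \<le> 1 \<Longrightarrow> \<bar>G t - (c0 + c1 * t + c2 * t\<^sup>2)\<bar> \<le> C * \<bar>t\<bar> ^ 3"
    using jet by (auto simp: jet2_def)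
  have key: "0 \<le> c1 * t + c2 * t\<^sup>2 + C * \<bar>t\<bar> ^ 3" if "\<bar>t\<bar> \<le> 1" "\<bar>t\<bar> < \<epsilon>" for t
    using C(2)[OF that(1)] le[OF that(1)] min[OF that(2)] by linarith
  show c1: "c1 = 0"
  proof (rule ccontr)
    assume "c1 \<noteq> 0"
    define \<tau> where "\<tau> = Min {1, \<epsilon> / 2, \<bar>c1\<bar> / (2 * (\<bar>c2\<bar> + C + 1))}"
    have \<tau>: "0 < \<tau>" "\<tau> \<le> 1" "\<tau> < \<epsilon>" "\<tau> \<le> \<bar>c1\<bar> / (2 * (\<bar>c2\<bar> + C + 1))"
      using \<open>c1 \<noteq> 0\<close> C(1) \<epsilon> by (auto simp: \<tau>_def)
    define \<sigma> :: real where "\<sigma> = (if 0 < c1 then - 1 else 1)"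
    have \<sigma>: "\<bar>\<sigma>\<bar> = 1" "\<sigma>\<^sup>2 = 1" "c1 * \<sigma> = - \<bar>c1\<bar>" by (auto simp: \<sigma>_def)
    have "0 \<le> c1 * (\<sigma> * \<tau>) + c2 * (\<sigma> * \<tau>)\<^sup>2 + C * \<bar>\<sigma> * \<tau>\<bar> ^ 3"
      by (rule key) (use \<tau> \<sigma> in \<open>auto simp: abs_mult\<close>)
    also have "\<dots> = - \<bar>c1\<bar> * \<tau> + c2 * \<tau>\<^sup>2 + C * \<tau> ^ 3"
      using \<tau> by (simp add: abs_mult power_mult_distrib \<sigma> mult.assoc[symmetric])
    also have "\<dots> \<le> - \<bar>c1\<bar> * \<tau> + \<bar>c2\<bar> * \<tau>\<^sup>2 + C * \<tau>\<^sup>2"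
    proof -
      have "\<tau> ^ 3 \<le> \<tau>\<^sup>2" using \<tau> by (intro power_decreasing) auto
      then have "C * \<tau> ^ 3 \<le> C * \<tau>\<^sup>2" using C(1) by (rule mult_left_mono)
      moreover have "c2 * \<tau>\<^sup>2 \<le> \<bar>c2\<bar> * \<tau>\<^sup>2" by (rule mult_right_mono) auto
      ultimately show ?thesis by linarith
    qed
    also have "\<dots> = \<tau> * (- \<bar>c1\<bar> + (\<bar>c2\<bar> + C) * \<tau>)" by (simp add: algebra_simps power2_eq_square)
    also have "\<dots> < 0"
    proof (rule mult_pos_neg[OF \<tau>(1)])
      have "(\<bar>c2\<bar> + C) * \<tau> \<le> (\<bar>c2\<bar> + C + 1) * \<tau>" using \<tau> by (intro mult_right_mono) auto
      also have "\<dots> \<le> (\<bar>c2\<bar> + C + 1) * (\<bar>c1\<bar> / (2 * (\<bar>c2\<bar> + C + 1)))"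
        using \<tau>(4) C(1) by (intro mult_left_mono) auto
      also have "\<dots> = \<bar>c1\<bar> / 2"
      proof -
        have "K * (e / (2 * K)) = e / 2" if "0 < K" for K e :: real using that by simp
        then show ?thesis using C(1) by (simp only: add_nonneg_pos abs_ge_zero add_nonneg_nonneg zero_less_one)
      qed
      finally show "- \<bar>c1\<bar> + (\<bar>c2\<bar> + C) * \<tau> < 0" using \<open>c1 \<noteq> 0\<close> by linarith
    qed
    finally show False by simp
  qed
  show "0 \<le> c2"
  proof (rule ccontr)
    assume "\<not> 0 \<le> c2"
    define \<tau> where "\<tau> = Min {1, \<epsilon> / 2, - c2 / (2 * (C + 1))}"
    have \<tau>: "0 < \<tau>" "\<tau> \<le> 1" "\<tau> < \<epsilon>" "\<tau> \<le> - c2 / (2 * (C + 1))"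
    proof -
      have "0 < - c2 / (2 * (C + 1))" using \<open>\<not> 0 \<le> c2\<close> C(1) by (intro divide_pos_pos) auto
      then show "0 < \<tau>" "\<tau> \<le> 1" "\<tau> < \<epsilon>" "\<tau> \<le> - c2 / (2 * (C + 1))"
        using \<epsilon> by (auto simp: \<tau>_def)
    qed
    have "0 \<le> c2 * \<tau>\<^sup>2 + C * \<tau> ^ 3" using key[of \<tau>] \<tau> c1 by simp
    also have "\<dots> = \<tau>\<^sup>2 * (c2 + C * \<tau>)" by (simp add: algebra_simps power2_eq_square power3_eq_cube)
    also have "\<dots> < 0"
    proof (rule mult_pos_neg)
      have "C * \<tau> \<le> (C + 1) * \<tau>" using \<tau> by (intro mult_right_mono) auto
      also have "\<dots> \<le> (C + 1) * (- c2 / (2 * (C + 1)))" using \<tau>(4) C(1) by (intro mult_left_mono) auto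
      also have "\<dots> = - c2 / 2"
      proof -
        have "K * (e / (2 * K)) = e / 2" if "0 < K" for K e :: real using that by simp
        then show ?thesis using C(1) by (simp only: add_nonneg_pos zero_less_one)
      qed
      finally show "c2 + C * \<tau> < 0" using \<open>\<not> 0 \<le> c2\<close> by linarith
    qed (use \<tau> in auto)
    finally show False by simp
  qed
qed

text \<open>This is the third-order Taylor polynomial; its square exceeds 1 + u by u^4 / 256 ((u -
  2)^2 + 16). Being valid on the whole domain, it makes the norm along a line majorized by a
  polynomial.\<close>

lemma sqrt_le_cubic:
  fixes u :: real assumes u: "-1 \<le> u"
  shows "sqrt (1 + u) \<le> 1 + u / 2 - u\<^sup>2 / 8 + u ^ 3 / 16"
proof (rule real_le_lsqrt)
  have "16 * (1 + u / 2 - u\<^sup>2 / 8 + u ^ 3 / 16) = (u + 1) * ((u - 3/2)\<^sup>2 + 35/4) + 5"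
    by (simp add: algebra_simps power2_eq_square power3_eq_cube)
  moreover have "0 \<le> (u + 1) * ((u - 3/2)\<^sup>2 + 35/4)" using u by (intro mult_nonneg_nonneg) auto
  ultimately show "0 \<le> 1 + u / 2 - u\<^sup>2 / 8 + u ^ 3 / 16" by argo
  have "(1 + u / 2 - u\<^sup>2 / 8 + u ^ 3 / 16)\<^sup>2 = 1 + u + (u\<^sup>2)\<^sup>2 / 256 * ((u - 2)\<^sup>2 + 16)"
    by (simp add: field_simps power2_eq_square power3_eq_cube)
  moreover have "0 \<le> (u\<^sup>2)\<^sup>2 / 256 * ((u - 2)\<^sup>2 + 16)" by (intro mult_nonneg_nonneg) auto
  ultimately show "1 + u \<le> (1 + u / 2 - u\<^sup>2 / 8 + u ^ 3 / 16)\<^sup>2" by linarith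
qed

section \<open>The row penalty along a line\<close>

definition penalty :: "real \<Rightarrow> real \<Rightarrow> real" where "penalty \<alpha> \<rho> = (max 0 (\<rho> - \<alpha>)) ^ 4"

lemma l2_line_power2: "(l2 r (\<lambda>k. x k + t * v k))\<^sup>2 = (l2 r x)\<^sup>2 + 2 * t * ip r x v + t\<^sup>2 * (l2 r v)\<^sup>2"
  unfolding l2_power2 ip_def sum_distrib_left sum.distrib[symmetric]
  by (intro sum.cong refl) (simp add: power2_eq_square algebra_simps)

text \<open>The norm is not differentiable at the origin and the penalty is only piecewise smooth, so the
  second-order conditions are extracted from a smooth upper bound that agrees to second order.\<close>

lemma penalty_jet:
  fixes x v :: "nat \<Rightarrow> real" and r :: nat
  assumes \<alpha>: "0 < \<alpha>"
  defines "\<rho> \<equiv> l2 r x" and "m \<equiv> ip r x v" and "w \<equiv> l2 r v"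
  defines "s \<equiv> max 0 (\<rho> - \<alpha>)"
  shows "\<exists>G. jet2 G (s ^ 4) (4 * s ^ 3 * (m / \<rho>))
      (4 * s ^ 3 * (w\<^sup>2 / (2 * \<rho>) - m\<^sup>2 / (2 * \<rho> ^ 3)) + 6 * s\<^sup>2 * (m / \<rho>)\<^sup>2) \<and>
     (\<forall>t. \<bar>t\<bar> \<le> 1 \<longrightarrow> penalty \<alpha> (l2 r (\<lambda>k. x k + t * v k)) \<le> G t)"
proof (cases "\<rho> \<le> \<alpha>")
  case True
  have s: "s = 0" using True by (simp add: s_def)
  \<comment> \<open>From below the threshold the norm can exceed \<alpha> by at most |t| w, so a
    quartic in t is a majorant; its expansion to second order vanishes.\<close>
  have "jet2 (\<lambda>t. w ^ 4 * t ^ 4) 0 0 0" unfolding jet2_def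
  proof (intro exI[of _ "w ^ 4"] conjI allI impI)
    fix t :: real assume "\<bar>t\<bar> \<le> 1"
    then have "\<bar>t\<bar> ^ 4 \<le> \<bar>t\<bar> ^ 3" by (intro power_decreasing) auto
    then show "\<bar>w ^ 4 * t ^ 4 - (0 + 0 * t + 0 * t\<^sup>2)\<bar> \<le> w ^ 4 * \<bar>t\<bar> ^ 3"
      by (simp add: abs_mult power_abs mult_left_mono)
  qed simp
  moreover have "penalty \<alpha> (l2 r (\<lambda>k. x k + t * v k)) \<le> w ^ 4 * t ^ 4" for t
  proof -
    have "l2 r (\<lambda>k. x k + t * v k) \<le> \<rho> + \<bar>t\<bar> * w"
      using L2_set_triangle_ineq[of x "\<lambda>k. t * v k" "{..<r}"] l2_scale[of t v r] by (simp add: \<rho>_def w_def)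
    then have "max 0 (l2 r (\<lambda>k. x k + t * v k) - \<alpha>) \<le> \<bar>t\<bar> * w" using True by (simp add: w_def)
    then have "penalty \<alpha> (l2 r (\<lambda>k. x k + t * v k)) \<le> (\<bar>t\<bar> * w) ^ 4"
      unfolding penalty_def by (intro power_mono) auto
    then show ?thesis by (simp add: power_mult_distrib mult.commute)
  qed
  ultimately show ?thesis using s by (intro exI[of _ "\<lambda>t. w ^ 4 * t ^ 4"]) auto
next
  case False
  then have \<rho>: "0 < \<rho>" "\<alpha> < \<rho>" using \<alpha> by auto
  have s: "s = \<rho> - \<alpha>" using False by (simp add: s_def)
  \<comment> \<open>The relative change of the squared norm, |x + t v|^2 = \<rho>^2 (1 + u t);
    \<open>G\<close> is the fourth power of the excess after \<open>sqrt_le_cubic\<close>.\<close>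
  define u where "u t = 2 * m / \<rho>\<^sup>2 * t + w\<^sup>2 / \<rho>\<^sup>2 * t\<^sup>2" for t
  define G where "G t = ((s + \<rho> * (u t / 2 + - 1 / 8 * (u t)\<^sup>2 + 1 / 16 * (u t * (u t)\<^sup>2)))\<^sup>2)\<^sup>2" for t
  have ju: "jet2 u 0 (2 * m / \<rho>\<^sup>2) (w\<^sup>2 / \<rho>\<^sup>2)"
    using jet2_poly[of 0 "2 * m / \<rho>\<^sup>2" "w\<^sup>2 / \<rho>\<^sup>2"] by (simp add: u_def[abs_def])
  note ju2 = jet2_square[OF ju]
  note ju3 = jet2_mult[OF ju ju2]
  note j1 = jet2_add[OF jet2_add[OF jet2_scale[OF ju, of "1/2"] jet2_scale[OF ju2, of "- 1/8"]] jet2_scale[OF ju3, of "1/16"]]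
  note j2 = jet2_square[OF jet2_square[OF jet2_add[OF jet2_const[of s] jet2_scale[OF j1, of \<rho>]]]]
  have "jet2 G (s ^ 4) (4 * s ^ 3 * (m / \<rho>))
      (4 * s ^ 3 * (w\<^sup>2 / (2 * \<rho>) - m\<^sup>2 / (2 * \<rho> ^ 3)) + 6 * s\<^sup>2 * (m / \<rho>)\<^sup>2)"
  proof -
    have "G = (\<lambda>t. ((s + \<rho> * (1/2 * u t + - 1 / 8 * (u t)\<^sup>2 + 1 / 16 * (u t * (u t)\<^sup>2)))\<^sup>2)\<^sup>2)"
      by (simp add: G_def fun_eq_iff)
    then show ?thesis
      by (elim ssubst, intro jet2_cong[OF j2])
        (use \<rho> in \<open>simp_all add: field_simps power2_eq_square power3_eq_cube power4_eq_xxxx\<close>)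
  qed
  moreover have "penalty \<alpha> (l2 r (\<lambda>k. x k + t * v k)) \<le> G t" for t
  proof -
    let ?l = "l2 r (\<lambda>k. x k + t * v k)"
    have sq: "?l\<^sup>2 = \<rho>\<^sup>2 * (1 + u t)"
      unfolding l2_line_power2 u_def using \<rho> by (simp add: \<rho>_def[symmetric] m_def w_def field_simps)
    have "0 \<le> \<rho>\<^sup>2 * (1 + u t)" unfolding sq[symmetric] by simp
    then have u1: "- 1 \<le> u t" using \<rho> by (simp add: zero_le_mult_iff)
    have "?l = \<rho> * sqrt (1 + u t)"
      using sq \<rho> by (metis L2_set_nonneg abs_of_pos real_sqrt_abs real_sqrt_mult real_sqrt_unique)
    also have "\<dots> \<le> \<rho> * (1 + u t / 2 - (u t)\<^sup>2 / 8 + (u t) ^ 3 / 16)"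
      using sqrt_le_cubic[OF u1] \<rho> by (intro mult_left_mono) auto
    finally have le: "?l - \<alpha> \<le> s + \<rho> * (u t / 2 + - 1 / 8 * (u t)\<^sup>2 + 1 / 16 * (u t * (u t)\<^sup>2))" (is "_ \<le> ?P")
      by (simp add: s algebra_simps power2_eq_square power3_eq_cube)
    have "max 0 (?l - \<alpha>) \<le> \<bar>?P\<bar>" using le by linarith
    then have "(max 0 (?l - \<alpha>)) ^ 4 \<le> \<bar>?P\<bar> ^ 4" by (intro power_mono) auto
    also have "\<dots> = G t" by (simp add: G_def power_abs[symmetric] power4_eq_xxxx power2_eq_square)
    finally show ?thesis by (simp add: penalty_def)
  qed
  ultimately show ?thesis by blast
qed

text \<open>The combination $\phi'' - 4 \phi'$ of the penalty along the direction $v = x - u$.\<close>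

lemma penalty_curvature:
  fixes u v x :: "nat \<Rightarrow> real" and r :: nat
  assumes u: "l2 r u \<le> \<beta>" and \<beta>: "100 * \<beta> \<le> \<alpha>" and \<alpha>: "0 < \<alpha>" and x: "x = (\<lambda>k. u k + v k)"
  defines "\<rho> \<equiv> l2 r x" and "m \<equiv> ip r x v" and "w \<equiv> l2 r v"
  defines "s \<equiv> max 0 (\<rho> - \<alpha>)"
  shows "2 * (4 * s ^ 3 * (w\<^sup>2 / (2 * \<rho>) - m\<^sup>2 / (2 * \<rho> ^ 3)) + 6 * s\<^sup>2 * (m / \<rho>)\<^sup>2) - 4 * (4 * s ^ 3 * (m / \<rho>))
    \<le> 20000 * \<alpha>\<^sup>2 * w\<^sup>2 - w ^ 4 / 2"
proof -
  have b0: "0 \<le> \<beta>" using u L2_set_nonneg[of u "{..<r}"] by linarith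
  have w\<rho>: "w \<le> \<rho> + \<beta>"
  proof -
    have "v = (\<lambda>k. x k + - 1 * u k)" by (simp add: x)
    then have "w \<le> \<rho> + l2 r (\<lambda>k. - 1 * u k)" unfolding w_def \<rho>_def using L2_set_triangle_ineq[of x "\<lambda>k. - 1 * u k" "{..<r}"] by simp
    then show ?thesis using u unfolding l2_scale by simp
  qed
  have \<rho>w: "\<rho> \<le> w + \<beta>" using L2_set_triangle_ineq[of u v "{..<r}"] u unfolding x w_def \<rho>_def by linarith
  have w0: "0 \<le> w" and \<rho>0: "0 \<le> \<rho>" by (simp_all add: w_def \<rho>_def)
  have mabs: "\<bar>m\<bar> \<le> \<rho> * w" unfolding m_def ip_def \<rho>_def w_def by (rule abs_inner_le_l2)
  have w4: "w ^ 4 = w\<^sup>2 * w\<^sup>2" by (simp add: power2_eq_square power4_eq_xxxx)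
  have nn: "0 \<le> \<alpha>\<^sup>2 * w\<^sup>2" by simp
  show ?thesis
  proof (cases "\<rho> \<le> \<alpha>")
    case True
    then have s: "s = 0" by (simp add: s_def)
    have "w \<le> 2 * \<alpha>" using True w\<rho> \<beta> b0 \<alpha> by linarith
    then have "w\<^sup>2 \<le> (2 * \<alpha>)\<^sup>2" using w0 by (intro power_mono) auto
    then have "w\<^sup>2 * w\<^sup>2 \<le> (4 * \<alpha>\<^sup>2) * w\<^sup>2" by (intro mult_right_mono) (auto simp: power_mult_distrib)
    then have "w ^ 4 / 2 \<le> 20000 * \<alpha>\<^sup>2 * w\<^sup>2" using nn unfolding w4 by argo
    then show ?thesis unfolding s by simp
  next
    case False
    then have \<rho>: "0 < \<rho>" "s = \<rho> - \<alpha>" "0 < s" using \<alpha> by (auto simp: s_def)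
    \<comment> \<open>The radial component of \<open>v\<close>; the second derivative of the norm
      sees only w^2 - q^2.\<close>
    define q where "q = m / \<rho>"
    have qw: "\<bar>q\<bar> \<le> w" using mabs \<rho>(1) unfolding q_def by (simp add: abs_divide divide_le_eq mult.commute)
    have expr: "2 * (4 * s ^ 3 * (w\<^sup>2 / (2 * \<rho>) - m\<^sup>2 / (2 * \<rho> ^ 3)) + 6 * s\<^sup>2 * (m / \<rho>)\<^sup>2) - 4 * (4 * s ^ 3 * (m / \<rho>))
       = 12 * s\<^sup>2 * q\<^sup>2 + 4 * s ^ 3 / \<rho> * (w\<^sup>2 - q\<^sup>2) - 16 * s ^ 3 * q"
      using \<rho> by (simp add: q_def field_simps power2_eq_square power3_eq_cube)
    have q2: "q\<^sup>2 \<le> w\<^sup>2" using qw by (metis abs_ge_zero power2_abs power_mono)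
    have s3: "s ^ 3 = s\<^sup>2 * s" by (simp add: power2_eq_square power3_eq_cube)
    have t1: "12 * s\<^sup>2 * q\<^sup>2 \<le> 12 * s\<^sup>2 * w\<^sup>2" using q2 by (intro mult_left_mono) auto
    show ?thesis
    \<comment> \<open>Up to ten times the threshold s is at most 9 \<alpha> and every term is
      bounded by a multiple of \<alpha>^2 w^2, whatever the sign of q. Beyond the cut s is at least
      9/10 of \<rho>, enough for 16 s^3 q to outweigh 12 s^2 q^2.\<close>
    proof (cases "\<rho> \<le> 10 * \<alpha>")
      case True
      have s9: "s \<le> 9 * \<alpha>" using True \<rho> by linarith
      have wa: "\<alpha> \<le> 10/9 * w" using \<rho>w False \<beta> b0 \<alpha> by linarith
      have t2: "4 * s ^ 3 / \<rho> * (w\<^sup>2 - q\<^sup>2) \<le> 4 * s\<^sup>2 * w\<^sup>2"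
      proof (rule mult_mono)
        have "s / \<rho> \<le> 1" using \<rho> \<alpha> by simp
        then have "4 * s\<^sup>2 * (s / \<rho>) \<le> 4 * s\<^sup>2 * 1" by (intro mult_left_mono) auto
        then show "4 * s ^ 3 / \<rho> \<le> 4 * s\<^sup>2" by (simp add: s3)
      qed (use q2 in auto)
      have t3: "- 16 * s ^ 3 * q \<le> 160 * s\<^sup>2 * w\<^sup>2"
      proof -
        have "s * - q \<le> s * w" using qw \<rho> by (intro mult_left_mono) auto
        also have "\<dots> \<le> (10 * w) * w" using s9 wa w0 by (intro mult_right_mono) auto
        finally have "s * - q \<le> (10 * w) * w" .
        then have "16 * s\<^sup>2 * (s * - q) \<le> 16 * s\<^sup>2 * ((10 * w) * w)" by (intro mult_left_mono) auto
        then show ?thesis by (simp add: s3 power2_eq_square mult_ac)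
      qed
      have "s\<^sup>2 \<le> (9 * \<alpha>)\<^sup>2" using s9 \<rho> by (intro power_mono) auto
      then have s2: "s\<^sup>2 * w\<^sup>2 \<le> 81 * \<alpha>\<^sup>2 * w\<^sup>2" by (intro mult_right_mono) (auto simp: power_mult_distrib)
      have "w \<le> 11 * \<alpha>" using True w\<rho> \<beta> b0 \<alpha> by linarith
      then have "w\<^sup>2 \<le> (11 * \<alpha>)\<^sup>2" using w0 by (intro power_mono) auto
      then have w2: "w\<^sup>2 * w\<^sup>2 \<le> 121 * \<alpha>\<^sup>2 * w\<^sup>2" by (intro mult_right_mono) (auto simp: power_mult_distrib)
      have "12 * s\<^sup>2 * q\<^sup>2 + 4 * s ^ 3 / \<rho> * (w\<^sup>2 - q\<^sup>2) - 16 * s ^ 3 * q \<le> 176 * (s\<^sup>2 * w\<^sup>2)"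
        using t1 t2 t3 by linarith
      also have "\<dots> \<le> 20000 * \<alpha>\<^sup>2 * w\<^sup>2 - w ^ 4 / 2"
        using s2 w2 nn unfolding w4 by linarith
      finally show ?thesis unfolding expr .
    next
      case False
      then have big: "10 * \<alpha> < \<rho>" by simp
      have br: "1000 * \<beta> \<le> \<rho>" using big \<beta> by linarith
      have s9: "9/10 * \<rho> \<le> s" using big \<rho> by linarith
      have wu: "w \<le> 1001/1000 * \<rho>" using w\<rho> br by linarith
      \<comment> \<open>Far out \<open>x\<close> dwarfs \<open>u\<close>, so \<open>v\<close> is
        nearly \<open>x\<close> and nearly radial: q, w and \<rho> agree up to a few
        thousandths.\<close>
      have ql: "999/1000 * \<rho> \<le> q"
      proof -
        have "v = (\<lambda>k. x k + - 1 * u k)" by (simp add: x)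
        then have "m = ip r x x - ip r x u" unfolding m_def ip_def by (simp add: right_diff_distrib sum_subtractf)
        moreover have "ip r x u \<le> \<rho> * \<beta>"
        proof -
          have "\<bar>ip r x u\<bar> \<le> \<rho> * l2 r u" unfolding ip_def \<rho>_def by (rule abs_inner_le_l2)
          also have "\<dots> \<le> \<rho> * \<beta>" using u \<rho>0 by (rule mult_left_mono)
          finally show ?thesis by linarith
        qed
        ultimately have "\<rho> * (\<rho> - \<beta>) \<le> m" by (simp add: ip_self \<rho>_def[symmetric] right_diff_distrib power2_eq_square)
        then have "\<rho> - \<beta> \<le> q" using \<rho> by (simp add: q_def field_simps)
        then show ?thesis using br by linarith
      qed
      have w2: "w\<^sup>2 \<le> (1001/1000 * \<rho>)\<^sup>2" using wu w0 by (intro power_mono) auto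
      have q2l: "(999/1000 * \<rho>)\<^sup>2 \<le> q\<^sup>2" using ql \<rho> by (intro power_mono) auto
      have r2: "0 \<le> \<rho>\<^sup>2" by simp
      have w2': "w\<^sup>2 \<le> 1003/1000 * \<rho>\<^sup>2"
      proof -
        have "w\<^sup>2 \<le> 1002001/1000000 * \<rho>\<^sup>2" using w2 by (simp add: power_mult_distrib power2_eq_square)
        then show ?thesis using r2 by argo
      qed
      have q2l': "99/100 * \<rho>\<^sup>2 \<le> q\<^sup>2"
      proof -
        have "998001/1000000 * \<rho>\<^sup>2 \<le> q\<^sup>2" using q2l by (simp add: power_mult_distrib power2_eq_square)
        then show ?thesis using r2 by argo
      qed
      have "12 * s\<^sup>2 * w\<^sup>2 \<le> 12 * s\<^sup>2 * (1003/1000 * \<rho>\<^sup>2)" using w2' by (intro mult_left_mono) auto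
      then have t1': "12 * s\<^sup>2 * q\<^sup>2 \<le> 12 * s\<^sup>2 * (1003/1000 * \<rho>\<^sup>2)" using t1 by linarith
      have t2: "4 * s ^ 3 / \<rho> * (w\<^sup>2 - q\<^sup>2) \<le> 4 * s\<^sup>2 * (2/100 * \<rho>\<^sup>2)"
      proof (rule mult_mono)
        have "s / \<rho> \<le> 1" using \<rho> \<alpha> by simp
        then have "4 * s\<^sup>2 * (s / \<rho>) \<le> 4 * s\<^sup>2 * 1" by (intro mult_left_mono) auto
        then show "4 * s ^ 3 / \<rho> \<le> 4 * s\<^sup>2" by (simp add: s3)
        show "w\<^sup>2 - q\<^sup>2 \<le> 2/100 * \<rho>\<^sup>2" using w2' q2l' r2 by argo
      qed (use q2 in auto)
      have t3: "16 * s\<^sup>2 * (89/100 * \<rho>\<^sup>2) \<le> 16 * s ^ 3 * q"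
      proof -
        have "(9/10 * \<rho>) * (999/1000 * \<rho>) \<le> s * q" using s9 ql \<rho> by (intro mult_mono) auto
        moreover have "(9/10 * \<rho>) * (999/1000 * \<rho>) = 8991/10000 * \<rho>\<^sup>2" by (simp add: power2_eq_square)
        ultimately have "89/100 * \<rho>\<^sup>2 \<le> s * q" using r2 by argo
        then have "16 * s\<^sup>2 * (89/100 * \<rho>\<^sup>2) \<le> 16 * s\<^sup>2 * (s * q)" by (intro mult_left_mono) auto
        then show ?thesis by (simp add: s3 mult_ac)
      qed
      have "12 * s\<^sup>2 * q\<^sup>2 + 4 * s ^ 3 / \<rho> * (w\<^sup>2 - q\<^sup>2) - 16 * s ^ 3 * q \<le> - 2 * (s\<^sup>2 * \<rho>\<^sup>2)"
      proof -
        have nn': "0 \<le> s\<^sup>2 * \<rho>\<^sup>2" by simp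
        have "12 * s\<^sup>2 * (1003/1000 * \<rho>\<^sup>2) = 12036/1000 * (s\<^sup>2 * \<rho>\<^sup>2)"
          "4 * s\<^sup>2 * (2/100 * \<rho>\<^sup>2) = 8/100 * (s\<^sup>2 * \<rho>\<^sup>2)"
          "16 * s\<^sup>2 * (89/100 * \<rho>\<^sup>2) = 1424/100 * (s\<^sup>2 * \<rho>\<^sup>2)" by simp_all
        then show ?thesis using t1' t2 t3 nn' by argo
      qed
      also have "\<dots> \<le> - (3/2) * (\<rho>\<^sup>2 * \<rho>\<^sup>2)"
      proof -
        have "(9/10 * \<rho>)\<^sup>2 \<le> s\<^sup>2" using s9 \<rho> by (intro power_mono) auto
        then have "81/100 * \<rho>\<^sup>2 * \<rho>\<^sup>2 \<le> s\<^sup>2 * \<rho>\<^sup>2" by (intro mult_right_mono) (auto simp: power_mult_distrib power2_eq_square)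
        moreover have "0 \<le> \<rho>\<^sup>2 * \<rho>\<^sup>2" by simp
        ultimately show ?thesis by linarith
      qed
      also have "\<dots> \<le> - (w ^ 4 / 2)"
      proof -
        have "w\<^sup>2 * w\<^sup>2 \<le> (1003/1000 * \<rho>\<^sup>2) * (1003/1000 * \<rho>\<^sup>2)" using w2' by (intro mult_mono) auto
        moreover have "0 \<le> \<rho>\<^sup>2 * \<rho>\<^sup>2" by simp
        moreover have "(1003/1000 * \<rho>\<^sup>2) * (1003/1000 * \<rho>\<^sup>2) = 1006009/1000000 * (\<rho>\<^sup>2 * \<rho>\<^sup>2)" by simp
        ultimately show ?thesis unfolding w4 by argo
      qed
      finally show ?thesis unfolding expr using nn by argo
    qed
  qed
qed

section \<open>The objective along the line through the two parameters\<close>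

definition line_objective ::
  "nat \<Rightarrow> nat \<Rightarrow> nat \<Rightarrow> (nat \<times> nat) set \<Rightarrow> real \<Rightarrow> real \<Rightarrow> real \<Rightarrow> (nat \<Rightarrow> nat \<Rightarrow> real) \<Rightarrow> (nat \<Rightarrow> nat \<Rightarrow> real) \<Rightarrow>
    (nat \<Rightarrow> nat \<Rightarrow> real) \<Rightarrow> real" where
  "line_objective n1 n2 r \<Omega> p \<alpha> lam M X Y =
     1 / (2 * p) * (\<Sum>i<n1. \<Sum>j<n2. of_bool ((i, j) \<in> \<Omega>) * (ip r (X i) (Y j) - M i j)\<^sup>2)
     + 1 / 8 * (\<Sum>k<r. \<Sum>l<r. (gram n1 X X k l - gram n2 Y Y k l)\<^sup>2)
     + lam * ((\<Sum>i<n1. penalty \<alpha> (l2 r (X i))) + (\<Sum>j<n2. penalty \<alpha> (l2 r (Y j))))"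

lemma penalty_rows_jet:
  fixes U \<Delta> :: "nat \<Rightarrow> nat \<Rightarrow> real"
  assumes \<alpha>: "0 < \<alpha>" and \<beta>: "100 * \<beta> \<le> \<alpha>" and U: "\<And>i. i < n \<Longrightarrow> l2 r (U i) \<le> \<beta>"
  shows "\<exists>G c1 c2. jet2 G (\<Sum>i<n. penalty \<alpha> (l2 r (\<lambda>k. U i k + \<Delta> i k))) c1 c2 \<and>
     (\<forall>t. \<bar>t\<bar> \<le> 1 \<longrightarrow> (\<Sum>i<n. penalty \<alpha> (l2 r (\<lambda>k. U i k + \<Delta> i k + t * \<Delta> i k))) \<le> G t) \<and>
     2 * c2 - 4 * c1 \<le> 20000 * \<alpha>\<^sup>2 * (\<Sum>i<n. (l2 r (\<Delta> i))\<^sup>2) - (\<Sum>i<n. (l2 r (\<Delta> i)) ^ 4) / 2"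
proof -
  define X where "X i = (\<lambda>k. U i k + \<Delta> i k)" for i
  define c1 where "c1 i = 4 * (max 0 (l2 r (X i) - \<alpha>)) ^ 3 * (ip r (X i) (\<Delta> i) / l2 r (X i))" for i
  define c2 where "c2 i = 4 * (max 0 (l2 r (X i) - \<alpha>)) ^ 3 * ((l2 r (\<Delta> i))\<^sup>2 / (2 * l2 r (X i)) - (ip r (X i) (\<Delta> i))\<^sup>2 / (2 * l2 r (X i) ^ 3))
      + 6 * (max 0 (l2 r (X i) - \<alpha>))\<^sup>2 * (ip r (X i) (\<Delta> i) / l2 r (X i))\<^sup>2" for i
  have "\<forall>i. \<exists>G. jet2 G (penalty \<alpha> (l2 r (X i))) (c1 i) (c2 i) \<and> (\<forall>t. \<bar>t\<bar> \<le> 1 \<longrightarrow> penalty \<alpha> (l2 r (\<lambda>k. X i k + t * \<Delta> i k)) \<le> G t)"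
    unfolding penalty_def[of \<alpha> "l2 r (X _)"] c1_def c2_def using penalty_jet[OF \<alpha>, where r = r] by blast
  then obtain G where G: "\<And>i. jet2 (G i) (penalty \<alpha> (l2 r (X i))) (c1 i) (c2 i)"
      "\<And>i t. \<bar>t\<bar> \<le> 1 \<Longrightarrow> penalty \<alpha> (l2 r (\<lambda>k. X i k + t * \<Delta> i k)) \<le> G i t"
    by metis
  have "2 * (\<Sum>i<n. c2 i) - 4 * (\<Sum>i<n. c1 i) = (\<Sum>i<n. 2 * c2 i - 4 * c1 i)"
    by (simp add: sum_distrib_left sum_subtractf)
  also have "\<dots> \<le> (\<Sum>i<n. 20000 * \<alpha>\<^sup>2 * (l2 r (\<Delta> i))\<^sup>2 - (l2 r (\<Delta> i)) ^ 4 / 2)"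
    unfolding c1_def c2_def by (intro sum_mono penalty_curvature[OF U \<beta> \<alpha>]) (auto simp: X_def)
  also have "\<dots> = 20000 * \<alpha>\<^sup>2 * (\<Sum>i<n. (l2 r (\<Delta> i))\<^sup>2) - (\<Sum>i<n. (l2 r (\<Delta> i)) ^ 4) / 2"
    by (simp add: sum_subtractf sum_distrib_left sum_divide_distrib)
  finally have c: "2 * (\<Sum>i<n. c2 i) - 4 * (\<Sum>i<n. c1 i) \<le> \<dots>" .
  have "jet2 (\<lambda>t. \<Sum>i<n. G i t) (\<Sum>i<n. penalty \<alpha> (l2 r (X i))) (\<Sum>i<n. c1 i) (\<Sum>i<n. c2 i)"
    by (intro jet2_sum G) auto
  moreover have "(\<Sum>i<n. penalty \<alpha> (l2 r (\<lambda>k. X i k + t * \<Delta> i k))) \<le> (\<Sum>i<n. G i t)" if "\<bar>t\<bar> \<le> 1" for t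
    using G(2)[OF that] by (intro sum_mono) auto
  ultimately show ?thesis using c unfolding X_def by blast
qed

text \<open>This is $g''(0) - 4 g'(0) \ge 0$ with the contribution of the penalty bounded from above; the
  multiple of $g'(0) = 0$ cancels the term of $g''(0)$ that is linear in both $E$ and $D$.\<close>

lemma second_order_condition:
  fixes U V \<Delta> \<Gamma> N :: "nat \<Rightarrow> nat \<Rightarrow> real" and r n1 n2 :: nat and \<Omega> :: "(nat \<times> nat) set" and p \<alpha> lam :: real
  defines "P \<equiv> \<lambda>i j. ip r (\<Delta> i) (V j)" and "Q \<equiv> \<lambda>i j. ip r (U i) (\<Gamma> j)" and "D \<equiv> \<lambda>i j. ip r (\<Delta> i) (\<Gamma> j)"
  defines "E \<equiv> \<lambda>i j. P i j + Q i j + D i j" and "Y \<equiv> \<lambda>i j. P i j + D i j"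
  defines "S2 \<equiv> (\<Sum>i<n1. (l2 r (\<Delta> i))\<^sup>2) + (\<Sum>j<n2. (l2 r (\<Gamma> j))\<^sup>2)"
  defines "S4 \<equiv> (\<Sum>i<n1. (l2 r (\<Delta> i)) ^ 4) + (\<Sum>j<n2. (l2 r (\<Gamma> j)) ^ 4)"
  defines "D' \<equiv> \<lambda>k l. gram n1 \<Delta> \<Delta> k l - gram n2 \<Gamma> \<Gamma> k l"
  defines "E' \<equiv> \<lambda>k l. (gram n1 U \<Delta> k l + gram n1 U \<Delta> l k + gram n1 \<Delta> \<Delta> k l)
        - (gram n2 V \<Gamma> k l + gram n2 V \<Gamma> l k + gram n2 \<Gamma> \<Gamma> k l)"
  defines "g \<equiv> \<lambda>t. line_objective n1 n2 r \<Omega> p \<alpha> lam (\<lambda>i j. ip r (U i) (V j) + N i j)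
      (\<lambda>i k. U i k + \<Delta> i k + t * \<Delta> i k) (\<lambda>j k. V j k + \<Gamma> j k + t * \<Gamma> j k)"
  assumes bal: "\<And>k l. k < r \<Longrightarrow> l < r \<Longrightarrow> gram n1 U U k l = gram n2 V V k l"
    and p: "0 < p" and lam: "0 \<le> lam" and \<alpha>: "0 < \<alpha>" and \<beta>: "100 * \<beta> \<le> \<alpha>"
    and U: "\<And>i. i < n1 \<Longrightarrow> l2 r (U i) \<le> \<beta>" and V: "\<And>j. j < n2 \<Longrightarrow> l2 r (V j) \<le> \<beta>"
    and \<epsilon>: "0 < \<epsilon>" and min: "\<And>t. \<bar>t\<bar> < \<epsilon> \<Longrightarrow> g 0 \<le> g t"
  shows "0 \<le> (sampled_inner n1 n2 \<Omega> D D - 3 * sampled_inner n1 n2 \<Omega> E E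
         + 4 * (sampled_inner n1 n2 \<Omega> N Y + sampled_inner n1 n2 \<Omega> N Q) + 2 * sampled_inner n1 n2 \<Omega> N D) / p
      + (fro r D' D' - 3 * fro r E' E') / 4 + lam * (20000 * \<alpha>\<^sup>2 * S2 - S4 / 2)"
proof -
  let ?o = "\<lambda>i j. of_bool ((i, j) \<in> \<Omega>) :: real"
  let ?e = "\<lambda>i j. E i j - N i j" and ?c = "\<lambda>i j. E i j + D i j"
  let ?c' = "\<lambda>k l. E' k l + D' k l"
  have fit: "ip r (\<lambda>k. U i k + \<Delta> i k + t * \<Delta> i k) (\<lambda>k. V j k + \<Gamma> j k + t * \<Gamma> j k) - (ip r (U i) (V j) + N i j)
     = ?e i j + ?c i j * t + D i j * t\<^sup>2" for i j t
  proof -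
    have "ip r (\<lambda>k. U i k + \<Delta> i k + t * \<Delta> i k) (\<lambda>k. V j k + \<Gamma> j k + t * \<Gamma> j k)
       = ip r (U i) (V j) + E i j + ?c i j * t + D i j * t\<^sup>2"
      unfolding E_def P_def Q_def D_def ip_def sum_distrib_right sum.distrib[symmetric]
      by (intro sum.cong refl) (simp add: algebra_simps power2_eq_square)
    then show ?thesis by simp
  qed
  have regl: "gram n1 (\<lambda>i k. U i k + \<Delta> i k + t * \<Delta> i k) (\<lambda>i k. U i k + \<Delta> i k + t * \<Delta> i k) k l
      - gram n2 (\<lambda>i k. V i k + \<Gamma> i k + t * \<Gamma> i k) (\<lambda>i k. V i k + \<Gamma> i k + t * \<Gamma> i k) k l
     = E' k l + ?c' k l * t + D' k l * t\<^sup>2" if "k < r" "l < r" for k l t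
  proof -
    have "gram n (\<lambda>i k. A i k + B i k + t * B i k) (\<lambda>i k. A i k + B i k + t * B i k) k l
       = gram n A A k l + (1 + t) * (gram n A B k l + gram n A B l k) + (1 + t)\<^sup>2 * gram n B B k l" for A B :: "nat \<Rightarrow> nat \<Rightarrow> real" and n
      unfolding gram_def sum_distrib_left sum.distrib[symmetric]
      by (intro sum.cong refl) (simp add: algebra_simps power2_eq_square)
    then show ?thesis unfolding E'_def D'_def using bal[OF that] by (simp add: algebra_simps power2_eq_square)
  qed
  obtain G1 a1 a2 where G1: "jet2 G1 (\<Sum>i<n1. penalty \<alpha> (l2 r (\<lambda>k. U i k + \<Delta> i k))) a1 a2"
     "\<And>t. \<bar>t\<bar> \<le> 1 \<Longrightarrow> (\<Sum>i<n1. penalty \<alpha> (l2 r (\<lambda>k. U i k + \<Delta> i k + t * \<Delta> i k))) \<le> G1 t"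
     "2 * a2 - 4 * a1 \<le> 20000 * \<alpha>\<^sup>2 * (\<Sum>i<n1. (l2 r (\<Delta> i))\<^sup>2) - (\<Sum>i<n1. (l2 r (\<Delta> i)) ^ 4) / 2"
    using penalty_rows_jet[OF \<alpha> \<beta>, where U = U and n = n1 and \<Delta> = \<Delta> and r = r] U by blast
  obtain G2 b1 b2 where G2: "jet2 G2 (\<Sum>i<n2. penalty \<alpha> (l2 r (\<lambda>k. V i k + \<Gamma> i k))) b1 b2"
     "\<And>t. \<bar>t\<bar> \<le> 1 \<Longrightarrow> (\<Sum>i<n2. penalty \<alpha> (l2 r (\<lambda>k. V i k + \<Gamma> i k + t * \<Gamma> i k))) \<le> G2 t"
     "2 * b2 - 4 * b1 \<le> 20000 * \<alpha>\<^sup>2 * (\<Sum>i<n2. (l2 r (\<Gamma> i))\<^sup>2) - (\<Sum>i<n2. (l2 r (\<Gamma> i)) ^ 4) / 2"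
    using penalty_rows_jet[OF \<alpha> \<beta>, where U = V and n = n2 and \<Delta> = \<Gamma> and r = r] V by blast
  define f1 where "f1 t = (\<Sum>i<n1. \<Sum>j<n2. ?o i j * (?e i j + ?c i j * t + D i j * t\<^sup>2)\<^sup>2)" for t
  define f2 where "f2 t = (\<Sum>k<r. \<Sum>l<r. (E' k l + ?c' k l * t + D' k l * t\<^sup>2)\<^sup>2)" for t
  have g_eq: "g t = 1 / (2 * p) * f1 t + 1 / 8 * f2 t
     + lam * ((\<Sum>i<n1. penalty \<alpha> (l2 r (\<lambda>k. U i k + \<Delta> i k + t * \<Delta> i k))) + (\<Sum>j<n2. penalty \<alpha> (l2 r (\<lambda>k. V j k + \<Gamma> j k + t * \<Gamma> j k))))" for t
  proof -
    have "f2 t = (\<Sum>k<r. \<Sum>l<r. (gram n1 (\<lambda>i k. U i k + \<Delta> i k + t * \<Delta> i k) (\<lambda>i k. U i k + \<Delta> i k + t * \<Delta> i k) k l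
      - gram n2 (\<lambda>i k. V i k + \<Gamma> i k + t * \<Gamma> i k) (\<lambda>i k. V i k + \<Gamma> i k + t * \<Gamma> i k) k l)\<^sup>2)"
      unfolding f2_def by (intro sum.cong refl) (simp add: regl)
    then show ?thesis unfolding g_def line_objective_def fit f1_def by simp
  qed
  define x1 where "x1 = (\<Sum>i<n1. \<Sum>j<n2. ?o i j * (2 * ?e i j * ?c i j))"
  define x2 where "x2 = (\<Sum>i<n1. \<Sum>j<n2. ?o i j * (2 * ?e i j * D i j + (?c i j)\<^sup>2))"
  define y1 where "y1 = (\<Sum>k<r. \<Sum>l<r. 2 * E' k l * ?c' k l)"
  define y2 where "y2 = (\<Sum>k<r. \<Sum>l<r. 2 * E' k l * D' k l + (?c' k l)\<^sup>2)"
  have j1: "jet2 f1 (f1 0) x1 x2"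
  proof -
    have "jet2 (\<lambda>t. ?o i j * (?e i j + ?c i j * t + D i j * t\<^sup>2)\<^sup>2) (?o i j * (?e i j)\<^sup>2)
       (?o i j * (2 * ?e i j * ?c i j)) (?o i j * (2 * ?e i j * D i j + (?c i j)\<^sup>2))" for i j
      by (rule jet2_scale[OF jet2_square[OF jet2_poly]])
    then show ?thesis unfolding f1_def[abs_def] x1_def x2_def
      by (intro jet2_cong[OF jet2_sum[OF finite_lessThan jet2_sum[OF finite_lessThan]]]) (assumption | simp)+
  qed
  have j2: "jet2 f2 (f2 0) y1 y2"
  proof -
    have "jet2 (\<lambda>t. (E' k l + ?c' k l * t + D' k l * t\<^sup>2)\<^sup>2) ((E' k l)\<^sup>2)
       (2 * E' k l * ?c' k l) (2 * E' k l * D' k l + (?c' k l)\<^sup>2)" for k l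
      by (rule jet2_square[OF jet2_poly])
    then show ?thesis unfolding f2_def[abs_def] y1_def y2_def
      by (intro jet2_cong[OF jet2_sum[OF finite_lessThan jet2_sum[OF finite_lessThan]]]) (assumption | simp)+
  qed
  let ?G = "\<lambda>t. 1 / (2 * p) * f1 t + 1 / 8 * f2 t + lam * (G1 t + G2 t)"
  have jG: "jet2 ?G (g 0) (1 / (2 * p) * x1 + 1 / 8 * y1 + lam * (a1 + b1)) (1 / (2 * p) * x2 + 1 / 8 * y2 + lam * (a2 + b2))"
    by (rule jet2_cong[OF jet2_add[OF jet2_add[OF jet2_scale[OF j1] jet2_scale[OF j2]] jet2_scale[OF jet2_add[OF G1(1) G2(1)]]]])
      (simp_all add: g_eq)
  have le: "g t \<le> ?G t" if "\<bar>t\<bar> \<le> 1" for t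
    unfolding g_eq using G1(2)[OF that] G2(2)[OF that] lam by (intro add_left_mono mult_left_mono add_mono) auto
  have "1 / (2 * p) * x1 + 1 / 8 * y1 + lam * (a1 + b1) = 0" "0 \<le> 1 / (2 * p) * x2 + 1 / 8 * y2 + lam * (a2 + b2)"
    by (rule jet2_local_min(1)[OF jG le \<epsilon> min], assumption+) (rule jet2_local_min(2)[OF jG le \<epsilon> min], assumption+)
  then have K: "0 \<le> 1 / (2 * p) * (2 * x2 - 4 * x1) + 1 / 8 * (2 * y2 - 4 * y1) + lam * ((2 * a2 - 4 * a1) + (2 * b2 - 4 * b1))"
    by (simp add: algebra_simps)
  \<comment> \<open>With e = E - N and c = E + D one has 2 (2 e D + c^2) - 8 e c = 2 D^2 - 6 E^2 + 8
    N E + 4 N D, entry by entry; in the noise term E is then split as Y + Q.\<close>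
  have X: "2 * x2 - 4 * x1 = 2 * (sampled_inner n1 n2 \<Omega> D D - 3 * sampled_inner n1 n2 \<Omega> E E
         + 4 * (sampled_inner n1 n2 \<Omega> N Y + sampled_inner n1 n2 \<Omega> N Q) + 2 * sampled_inner n1 n2 \<Omega> N D)"
  proof -
    have "2 * x2 - 4 * x1 = (\<Sum>i<n1. \<Sum>j<n2. ?o i j * (2 * (D i j * D i j - 3 * (E i j * E i j) + 4 * (N i j * Y i j + N i j * Q i j) + 2 * (N i j * D i j))))"
      unfolding x1_def x2_def sum_distrib_left sum_subtractf[symmetric]
      by (intro sum.cong refl) (simp add: Y_def E_def algebra_simps power2_eq_square)
    also have "\<dots> = (\<Sum>i<n1. \<Sum>j<n2. 2 * (?o i j * (D i j * D i j)) - 6 * (?o i j * (E i j * E i j)) + 8 * (?o i j * (N i j * Y i j))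
        + 8 * (?o i j * (N i j * Q i j)) + 4 * (?o i j * (N i j * D i j)))"
      by (intro sum.cong refl) (simp add: algebra_simps)
    also have "\<dots> = 2 * (sampled_inner n1 n2 \<Omega> D D - 3 * sampled_inner n1 n2 \<Omega> E E
         + 4 * (sampled_inner n1 n2 \<Omega> N Y + sampled_inner n1 n2 \<Omega> N Q) + 2 * sampled_inner n1 n2 \<Omega> N D)"
      unfolding sampled_inner_def sum.distrib sum_subtractf sum_distrib_left[symmetric] by argo
    finally show ?thesis .
  qed
  have Y2: "2 * y2 - 4 * y1 = 2 * (fro r D' D' - 3 * fro r E' E')"
  proof -
    have "2 * y2 - 4 * y1 = (\<Sum>k<r. \<Sum>l<r. 2 * (D' k l * D' k l) - 6 * (E' k l * E' k l))"
      unfolding y1_def y2_def sum_distrib_left sum_subtractf[symmetric]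
      by (intro sum.cong refl) (simp add: algebra_simps power2_eq_square)
    also have "\<dots> = 2 * (fro r D' D' - 3 * fro r E' E')"
      unfolding fro_def sum_subtractf sum_distrib_left[symmetric] by argo
    finally show ?thesis .
  qed
  have Z: "lam * ((2 * a2 - 4 * a1) + (2 * b2 - 4 * b1)) \<le> lam * (20000 * \<alpha>\<^sup>2 * S2 - S4 / 2)"
  proof (rule mult_left_mono[OF _ lam])
    have "20000 * \<alpha>\<^sup>2 * S2 = 20000 * \<alpha>\<^sup>2 * (\<Sum>i<n1. (l2 r (\<Delta> i))\<^sup>2) + 20000 * \<alpha>\<^sup>2 * (\<Sum>i<n2. (l2 r (\<Gamma> i))\<^sup>2)"
      unfolding S2_def by (simp add: distrib_left)
    then show "(2 * a2 - 4 * a1) + (2 * b2 - 4 * b1) \<le> 20000 * \<alpha>\<^sup>2 * S2 - S4 / 2"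
      using G1(3) G2(3) unfolding S4_def by argo
  qed
  have "1 / (2 * p) * (2 * z) = z / p" for z :: real by simp
  moreover have "1 / 8 * (2 * z) = z / 4" for z :: real by simp
  ultimately have "0 \<le> (sampled_inner n1 n2 \<Omega> D D - 3 * sampled_inner n1 n2 \<Omega> E E
         + 4 * (sampled_inner n1 n2 \<Omega> N Y + sampled_inner n1 n2 \<Omega> N Q) + 2 * sampled_inner n1 n2 \<Omega> N D) / p
      + (fro r D' D' - 3 * fro r E' E') / 4 + lam * ((2 * a2 - 4 * a1) + (2 * b2 - 4 * b1))"
    using K unfolding X Y2 by (simp only:)
  then show ?thesis using Z by linarith
qed

section \<open>Compressions to column spaces and the noise level\<close>

text \<open>Gram--Schmidt: $Q$ has orthonormal columns and the same column space as $B$.\<close>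

definition column_basis ::
  "nat \<Rightarrow> nat \<Rightarrow> (nat \<Rightarrow> nat \<Rightarrow> real) \<Rightarrow> nat \<Rightarrow> (nat \<Rightarrow> nat \<Rightarrow> real) \<Rightarrow> (nat \<Rightarrow> nat \<Rightarrow> real) \<Rightarrow> (nat \<Rightarrow> nat \<Rightarrow> real) \<Rightarrow> bool" where
  "column_basis n r B s Q C D \<longleftrightarrow> s \<le> r \<and>
     (\<forall>a<s. \<forall>b<s. (\<Sum>i<n. Q i a * Q i b) = of_bool (a = b)) \<and>
     (\<forall>i<n. \<forall>k<r. B i k = (\<Sum>a<s. Q i a * C a k)) \<and>
     (\<forall>i<n. \<forall>a<s. Q i a = (\<Sum>k<r. B i k * D k a))"

lemma column_basisD:
  assumes "column_basis n r B s Q C D"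
  shows "s \<le> r" "\<And>a b. a < s \<Longrightarrow> b < s \<Longrightarrow> (\<Sum>i<n. Q i a * Q i b) = of_bool (a = b)"
    "\<And>i k. i < n \<Longrightarrow> k < r \<Longrightarrow> B i k = (\<Sum>a<s. Q i a * C a k)"
    "\<And>i a. i < n \<Longrightarrow> a < s \<Longrightarrow> Q i a = (\<Sum>k<r. B i k * D k a)"
  using assms unfolding column_basis_def by blast+

lemma ex_column_basis: "\<exists>s Q C D. column_basis n r B s Q C D"
proof (induction r)
  case 0
  show ?case by (rule exI[of _ 0]) (simp add: column_basis_def)
next
  case (Suc r)
  then obtain s Q C D where IH: "column_basis n r B s Q C D" by blast
  note s = column_basisD(1)[OF IH] and on = column_basisD(2)[OF IH]
    and BQ = column_basisD(3)[OF IH] and QB = column_basisD(4)[OF IH]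
  define c where "c a = (\<Sum>i<n. Q i a * B i r)" for a
  define e where "e i = B i r - (\<Sum>a<s. Q i a * c a)" for i
  have orth: "(\<Sum>i<n. Q i a * e i) = 0" if "a < s" for a
  proof -
    have "(\<Sum>i<n. Q i a * e i) = c a - (\<Sum>i<n. \<Sum>b<s. Q i a * Q i b * c b)"
      unfolding e_def right_diff_distrib sum_subtractf c_def[of a] sum_distrib_left by (simp add: mult.assoc)
    also have "(\<Sum>i<n. \<Sum>b<s. Q i a * Q i b * c b) = (\<Sum>b<s. (\<Sum>i<n. Q i a * Q i b) * c b)"
      unfolding sum_distrib_right by (rule sum.swap)
    also have "\<dots> = (\<Sum>b<s. of_bool (a = b) * c b)" using on[OF that] by (intro sum.cong refl) auto
    also have "\<dots> = c a" using that by (simp add: of_bool_def if_distrib[of "\<lambda>x. x * _"] cong: if_cong)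
    finally show ?thesis by simp
  qed
  show ?case
  proof (cases "l2 n e = 0")
    \<comment> \<open>A column in the span of the earlier ones adds no basis vector; this keeps the
      basis linearly independent while s <= r.\<close>
    case True
    then have e0: "e i = 0" if "i < n" for i using that by (simp add: L2_set_eq_0_iff)
    have "column_basis n (Suc r) B s Q (\<lambda>a k. if k = r then c a else C a k) (\<lambda>k a. if k = r then 0 else D k a)"
      unfolding column_basis_def
    proof (intro conjI allI impI)
      show "s \<le> Suc r" using s by simp
      fix a b assume "a < s" "b < s"
      then show "(\<Sum>i<n. Q i a * Q i b) = of_bool (a = b)" by (rule on)
    next
      fix i k assume i: "i < n" and k: "k < Suc r"
      show "B i k = (\<Sum>a<s. Q i a * (if k = r then c a else C a k))"
      proof (cases "k = r")
        case True then show ?thesis using e0[OF i] by (simp add: e_def)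
      next
        case False then show ?thesis using BQ[OF i, of k] k by simp
      qed
    next
      fix i a assume "i < n" "a < s"
      then show "Q i a = (\<Sum>k<Suc r. B i k * (if k = r then 0 else D k a))" using QB by simp
    qed
    then show ?thesis by blast
  next
    case False
    let ?l = "l2 n e"
    define Q' where "Q' i a = (if a = s then e i / ?l else Q i a)" for i a
    have e_span: "e i / ?l = (\<Sum>k<Suc r. B i k * (if k = r then 1 / ?l else - (\<Sum>a<s. D k a * c a) / ?l))" if i: "i < n" for i
    proof -
      have "(\<Sum>a<s. Q i a * c a) = (\<Sum>a<s. \<Sum>k<r. B i k * D k a * c a)"
        using QB[OF i] by (intro sum.cong refl) (simp add: sum_distrib_right)
      also have "\<dots> = (\<Sum>k<r. B i k * (\<Sum>a<s. D k a * c a))"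
        by (subst sum.swap) (simp add: sum_distrib_left mult.assoc)
      finally have "e i = B i r - (\<Sum>k<r. B i k * (\<Sum>a<s. D k a * c a))" unfolding e_def[of i] by simp
      moreover have "(x - (\<Sum>k<r. f k * g k)) / L = (\<Sum>k<Suc r. f k * (if k = r then 1 / L else - g k / L))"
        if "x = f r" for x L f and g :: "nat \<Rightarrow> real"
        using that by (simp add: diff_divide_distrib sum_divide_distrib sum_negf)
      ultimately show ?thesis by metis
    qed
    have "column_basis n (Suc r) B (Suc s) Q' (\<lambda>a k. if k = r then (if a = s then ?l else c a) else if a = s then 0 else C a k)
       (\<lambda>k a. if a = s then (if k = r then 1 / ?l else - (\<Sum>a<s. D k a * c a) / ?l) else if k = r then 0 else D k a)"
      unfolding column_basis_def
    proof (intro conjI allI impI)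
      show "Suc s \<le> Suc r" using s by simp
    next
      fix a b assume ab: "a < Suc s" "b < Suc s"
      have ee: "(\<Sum>i<n. e i / ?l * (e i / ?l)) = 1"
      proof -
        have "(\<Sum>i<n. e i / ?l * (e i / ?l)) = (\<Sum>i<n. e i * e i) / (?l * ?l)" by (simp add: sum_divide_distrib)
        then show ?thesis using False by (simp add: l2_mult_self power2_eq_square)
      qed
      have qe: "(\<Sum>i<n. Q i a * (e i / ?l)) = 0" "(\<Sum>i<n. (e i / ?l) * Q i a) = 0" if "a < s" for a
        using orth[OF that] by (simp_all add: sum_divide_distrib[symmetric] mult.commute)
      show "(\<Sum>i<n. Q' i a * Q' i b) = of_bool (a = b)"
        unfolding Q'_def using ab on ee qe by (cases "a = s"; cases "b = s") auto
    next
      fix i k assume i: "i < n" and k: "k < Suc r"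
      show "B i k = (\<Sum>a<Suc s. Q' i a * (if k = r then (if a = s then ?l else c a) else if a = s then 0 else C a k))"
      proof (cases "k = r")
        case True then show ?thesis using False by (simp add: Q'_def e_def)
      next
        case False then show ?thesis using BQ[OF i, of k] k by (simp add: Q'_def)
      qed
    next
      fix i a assume i: "i < n" and a: "a < Suc s"
      show "Q' i a = (\<Sum>k<Suc r. B i k * (if a = s then (if k = r then 1 / ?l else - (\<Sum>a<s. D k a * c a) / ?l) else if k = r then 0 else D k a))"
      proof (cases "a = s")
        case True then show ?thesis using e_span[OF i] by (simp add: Q'_def)
      next
        case False then show ?thesis using QB[OF i, of a] a by (simp add: Q'_def)
      qed
    qed
    then show ?thesis by blast
  qed
qed

text \<open>The entries of \<open>Q Q^T\<close>; for a \<open>column_basis\<close> this is the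
  orthogonal projection onto the column space.\<close>

definition proj_kernel :: "nat \<Rightarrow> (nat \<Rightarrow> nat \<Rightarrow> real) \<Rightarrow> nat \<Rightarrow> nat \<Rightarrow> real" where
  "proj_kernel s Q i j = (\<Sum>a<s. Q i a * Q j a)"

definition apply_mat :: "nat \<Rightarrow> (nat \<Rightarrow> nat \<Rightarrow> real) \<Rightarrow> (nat \<Rightarrow> real) \<Rightarrow> nat \<Rightarrow> real" where
  "apply_mat n P x i = (\<Sum>j<n. P i j * x j)"

lemma proj_kernel_sym: "proj_kernel s Q i j = proj_kernel s Q j i"
  by (simp add: proj_kernel_def mult.commute)

lemma apply_proj_kernel: "apply_mat n (proj_kernel s Q) x i = (\<Sum>a<s. Q i a * (\<Sum>j<n. Q j a * x j))"
  unfolding apply_mat_def proj_kernel_def sum_distrib_left sum_distrib_right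
  by (subst sum.swap) (simp add: mult.assoc)

lemma proj_kernel_basis:
  assumes cb: "column_basis n r B s Q C D" and "i < n" "a < s"
  shows "apply_mat n (proj_kernel s Q) (\<lambda>i. Q i a) i = Q i a"
proof -
  have "apply_mat n (proj_kernel s Q) (\<lambda>i. Q i a) i = (\<Sum>b<s. Q i b * of_bool (b = a))"
    unfolding apply_proj_kernel using column_basisD(2)[OF cb _ assms(3)] by (intro sum.cong refl) simp
  also have "\<dots> = Q i a" using assms(3) by (simp add: of_bool_def if_distrib[of "\<lambda>x. _ * x"] cong: if_cong)
  finally show ?thesis .
qed

lemma apply_mat_lincomb:
  "apply_mat n P (\<lambda>i. \<Sum>a\<in>S. f a * q a i) i = (\<Sum>a\<in>S. f a * apply_mat n P (q a) i)"
  unfolding apply_mat_def sum_distrib_left by (subst sum.swap) (simp add: mult_ac)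

lemma apply_mat_cong: "(\<And>i. i < n \<Longrightarrow> x i = y i) \<Longrightarrow> apply_mat n P x i = apply_mat n P y i"
  by (simp add: apply_mat_def)

lemma proj_kernel_column:
  assumes cb: "column_basis n r B s Q C D" and i: "i < n"
  shows "apply_mat n (proj_kernel s Q) (\<lambda>i. \<Sum>k<r. B i k * y k) i = (\<Sum>k<r. B i k * y k)"
proof -
  have B: "(\<Sum>k<r. B i k * y k) = (\<Sum>a<s. (\<Sum>k<r. C a k * y k) * Q i a)" if "i < n" for i
  proof -
    have "(\<Sum>k<r. B i k * y k) = (\<Sum>k<r. \<Sum>a<s. Q i a * C a k * y k)"
      using column_basisD(3)[OF cb that] by (intro sum.cong refl) (simp add: sum_distrib_right)
    then show ?thesis by (subst (asm) sum.swap) (simp add: sum_distrib_left sum_distrib_right mult_ac)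
  qed
  have "apply_mat n (proj_kernel s Q) (\<lambda>i. \<Sum>k<r. B i k * y k) i
      = apply_mat n (proj_kernel s Q) (\<lambda>i. \<Sum>a<s. (\<Sum>k<r. C a k * y k) * Q i a) i"
    by (rule apply_mat_cong) (rule B)
  also have "\<dots> = (\<Sum>a<s. (\<Sum>k<r. C a k * y k) * Q i a)"
    unfolding apply_mat_lincomb using proj_kernel_basis[OF cb i] by (intro sum.cong refl) auto
  finally show ?thesis using B[OF i] by simp
qed

text \<open>Orthonormality gives |P x|^2 = <P x, x>, and Cauchy-Schwarz removes one factor |P
  x|.\<close>

lemma l2_proj_le:
  assumes cb: "column_basis n r B s Q C D"
  shows "l2 n (apply_mat n (proj_kernel s Q) x) \<le> l2 n x"
proof -
  let ?P = "apply_mat n (proj_kernel s Q)"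
  define c where "c a = (\<Sum>j<n. Q j a * x j)" for a
  have P: "?P x i = (\<Sum>a<s. Q i a * c a)" for i unfolding apply_proj_kernel c_def ..
  have "(\<Sum>i<n. ?P x i * ?P x i) = (\<Sum>i<n. \<Sum>a<s. \<Sum>b<s. (Q i a * Q i b) * (c a * c b))"
    unfolding P sum_product by (simp add: mult_ac)
  also have "\<dots> = (\<Sum>a<s. \<Sum>i<n. \<Sum>b<s. (Q i a * Q i b) * (c a * c b))" by (rule sum.swap)
  also have "\<dots> = (\<Sum>a<s. \<Sum>b<s. (\<Sum>i<n. Q i a * Q i b) * (c a * c b))"
    unfolding sum_distrib_right by (rule sum.cong[OF refl]) (rule sum.swap)
  also have "\<dots> = (\<Sum>a<s. \<Sum>b<s. of_bool (a = b) * (c a * c b))"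
    using column_basisD(2)[OF cb] by (intro sum.cong refl) simp
  also have "\<dots> = (\<Sum>a<s. c a * c a)"
    by (intro sum.cong refl) (simp add: of_bool_def if_distrib[of "\<lambda>x. x * _"] cong: if_cong)
  also have "\<dots> = (\<Sum>a<s. \<Sum>i<n. Q i a * c a * x i)"
    by (intro sum.cong refl) (simp add: c_def sum_distrib_left sum_distrib_right mult_ac)
  also have "\<dots> = (\<Sum>i<n. ?P x i * x i)" unfolding P sum_distrib_right by (rule sum.swap)
  finally have "(l2 n (?P x))\<^sup>2 = (\<Sum>i<n. ?P x i * x i)" by (simp add: l2_mult_self)
  also have "\<dots> \<le> l2 n x * l2 n (?P x)" using abs_inner_le_l2[of "?P x" x n] by (simp add: mult.commute)
  finally show ?thesis by (rule square_le_mult_imp_le) auto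
qed

definition compress :: "nat \<Rightarrow> nat \<Rightarrow> (nat \<Rightarrow> nat \<Rightarrow> real) \<Rightarrow> (nat \<Rightarrow> nat \<Rightarrow> real) \<Rightarrow> (nat \<Rightarrow> nat \<Rightarrow> real) \<Rightarrow> nat \<Rightarrow> nat \<Rightarrow> real" where
  "compress n1 n2 PA K PB i j = (\<Sum>j'<n2. (\<Sum>i'<n1. PA i i' * K i' j') * PB j' j)"

lemma bil_compress:
  assumes sym: "\<And>i j. PA i j = PA j i"
  shows "bil n1 n2 (compress n1 n2 PA K PB) x y = bil n1 n2 K (apply_mat n1 PA x) (apply_mat n2 PB y)"
proof -
  have "bil n1 n2 (compress n1 n2 PA K PB) x y
     = (\<Sum>i<n1. \<Sum>j<n2. \<Sum>j'<n2. \<Sum>i'<n1. PA i' i * K i' j' * PB j' j * x i * y j)"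
    unfolding bil_def compress_def sum_distrib_right using sym by simp
  also have "\<dots> = (\<Sum>i<n1. \<Sum>j'<n2. \<Sum>j<n2. \<Sum>i'<n1. PA i' i * K i' j' * PB j' j * x i * y j)"
    by (rule sum.cong[OF refl]) (rule sum.swap)
  also have "\<dots> = (\<Sum>i<n1. \<Sum>j'<n2. \<Sum>i'<n1. \<Sum>j<n2. PA i' i * K i' j' * PB j' j * x i * y j)"
    by (rule sum.cong[OF refl], rule sum.cong[OF refl], rule sum.swap)
  also have "\<dots> = (\<Sum>i<n1. \<Sum>i'<n1. \<Sum>j'<n2. \<Sum>j<n2. PA i' i * K i' j' * PB j' j * x i * y j)"
    by (rule sum.cong[OF refl]) (rule sum.swap)
  also have "\<dots> = (\<Sum>i'<n1. \<Sum>i<n1. \<Sum>j'<n2. \<Sum>j<n2. PA i' i * K i' j' * PB j' j * x i * y j)"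
    by (rule sum.swap)
  also have "\<dots> = (\<Sum>i'<n1. \<Sum>j'<n2. \<Sum>i<n1. \<Sum>j<n2. PA i' i * K i' j' * PB j' j * x i * y j)"
    by (rule sum.cong[OF refl]) (rule sum.swap)
  also have "\<dots> = bil n1 n2 K (apply_mat n1 PA x) (apply_mat n2 PB y)"
    unfolding bil_def
  proof (rule sum.cong[OF refl], rule sum.cong[OF refl])
    fix i' j'
    have "K i' j' * apply_mat n1 PA x i' * apply_mat n2 PB y j'
       = K i' j' * (\<Sum>i<n1. \<Sum>j<n2. (PA i' i * x i) * (PB j' j * y j))"
      unfolding apply_mat_def mult.assoc[of "K i' j'"] sum_product ..
    also have "\<dots> = (\<Sum>i<n1. \<Sum>j<n2. PA i' i * K i' j' * PB j' j * x i * y j)"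
      unfolding sum_distrib_left by (intro sum.cong refl) (simp add: mult_ac)
    finally show "(\<Sum>i<n1. \<Sum>j<n2. PA i' i * K i' j' * PB j' j * x i * y j)
       = K i' j' * apply_mat n1 PA x i' * apply_mat n2 PB y j'" ..
  qed
  finally show ?thesis .
qed

text \<open>A form of the duality between spectral and nuclear norm. In an orthonormal basis of the
  column space of B the product Z = A B^T is a sum of at most \<open>r\<close> rank-one terms. Each
  of them is fixed by the projections, so the compressed form applies to it, and Cauchy-Schwarz over
  the terms yields sqrt r times the Frobenius norm of Z.\<close>

lemma inner_le_compressed_norm:
  assumes A: "column_basis n1 r A s1 QA CA DA" and B: "column_basis n2 r B s2 QB CB DB"
    and \<psi>: "\<And>x y. bil n1 n2 (compress n1 n2 (proj_kernel s1 QA) K (proj_kernel s2 QB)) x y \<le> \<psi> * l2 n1 x * l2 n2 y"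
    and \<psi>0: "0 \<le> \<psi>"
  shows "(\<Sum>i<n1. \<Sum>j<n2. K i j * ip r (A i) (B j)) \<le> \<psi> * sqrt (real r) * sqrt (full_inner n1 n2 (\<lambda>i j. ip r (A i) (B j)) (\<lambda>i j. ip r (A i) (B j)))"
proof -
  define Z where "Z i j = ip r (A i) (B j)" for i j
  define W where "W i a = (\<Sum>j<n2. Z i j * QB j a)" for i a
  let ?PA = "apply_mat n1 (proj_kernel s1 QA)" and ?PB = "apply_mat n2 (proj_kernel s2 QB)"
  have ZW: "Z i j = (\<Sum>a<s2. W i a * QB j a)" if "j < n2" for i j
  proof -
    have "Z i j = (\<Sum>k<r. B j k * A i k)" by (simp add: Z_def ip_def mult.commute)
    also have "\<dots> = ?PB (\<lambda>j. \<Sum>k<r. B j k * A i k) j" by (rule proj_kernel_column[OF B that, symmetric])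
    also have "\<dots> = (\<Sum>a<s2. W i a * QB j a)"
      unfolding apply_proj_kernel W_def Z_def ip_def by (intro sum.cong refl) (simp add: mult.commute)
    finally show ?thesis .
  qed
  have "(\<Sum>i<n1. \<Sum>j<n2. K i j * Z i j) = (\<Sum>i<n1. \<Sum>j<n2. \<Sum>a<s2. K i j * W i a * QB j a)"
    by (intro sum.cong refl) (simp add: ZW sum_distrib_left mult.assoc)
  also have "\<dots> = (\<Sum>i<n1. \<Sum>a<s2. \<Sum>j<n2. K i j * W i a * QB j a)"
    by (rule sum.cong[OF refl]) (rule sum.swap)
  also have "\<dots> = (\<Sum>a<s2. bil n1 n2 K (\<lambda>i. W i a) (\<lambda>j. QB j a))"
    unfolding bil_def by (rule sum.swap)
  also have "\<dots> \<le> (\<Sum>a<s2. \<psi> * l2 n1 (\<lambda>i. W i a))"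
  proof (rule sum_mono)
    fix a assume "a \<in> {..<s2}"
    then have a: "a < s2" by simp
    have PW: "?PA (\<lambda>i. W i a) i = W i a" if "i < n1" for i
    proof -
      have W: "W i a = (\<Sum>k<r. A i k * (\<Sum>j<n2. B j k * QB j a))" for i
        unfolding W_def Z_def ip_def sum_distrib_left sum_distrib_right by (subst sum.swap) (simp add: mult.assoc)
      show ?thesis unfolding W by (rule proj_kernel_column[OF A that])
    qed
    have "bil n1 n2 K (\<lambda>i. W i a) (\<lambda>j. QB j a) = bil n1 n2 K (?PA (\<lambda>i. W i a)) (?PB (\<lambda>j. QB j a))"
      unfolding bil_def using PW proj_kernel_basis[OF B _ a] by (intro sum.cong refl) auto
    also have "\<dots> \<le> \<psi> * l2 n1 (\<lambda>i. W i a) * l2 n2 (\<lambda>j. QB j a)"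
      unfolding bil_compress[OF proj_kernel_sym, symmetric] by (rule \<psi>)
    also have "l2 n2 (\<lambda>j. QB j a) = 1"
    proof -
      have "(l2 n2 (\<lambda>j. QB j a))\<^sup>2 = 1" using column_basisD(2)[OF B a a] by (simp add: l2_mult_self[symmetric])
      then show ?thesis using L2_set_nonneg[of "\<lambda>j. QB j a" "{..<n2}"] by (simp add: power2_eq_1_iff)
    qed
    finally show "bil n1 n2 K (\<lambda>i. W i a) (\<lambda>j. QB j a) \<le> \<psi> * l2 n1 (\<lambda>i. W i a)" by simp
  qed
  also have "\<dots> = \<psi> * (\<Sum>a<s2. 1 * l2 n1 (\<lambda>i. W i a))" by (simp add: sum_distrib_left)
  also have "\<dots> \<le> \<psi> * (l2 s2 (\<lambda>a. 1) * l2 s2 (\<lambda>a. l2 n1 (\<lambda>i. W i a)))"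
    using abs_inner_le_l2[of "\<lambda>a. 1" "\<lambda>a. l2 n1 (\<lambda>i. W i a)" s2] \<psi>0 by (intro mult_left_mono) auto
  also have "\<dots> \<le> \<psi> * (sqrt (real r) * sqrt (full_inner n1 n2 Z Z))"
  proof (intro mult_left_mono mult_mono \<psi>0)
    show "l2 s2 (\<lambda>a. 1) \<le> sqrt (real r)" using column_basisD(1)[OF B] by (simp add: L2_set_def)
    have "(\<Sum>a<s2. (l2 n1 (\<lambda>i. W i a))\<^sup>2) = (\<Sum>i<n1. \<Sum>a<s2. W i a * W i a)"
      unfolding l2_power2 by (subst sum.swap) (simp add: power2_eq_square)
    also have "\<dots> = (\<Sum>i<n1. \<Sum>a<s2. \<Sum>j<n2. W i a * Z i j * QB j a)"
      by (intro sum.cong refl) (subst (2) W_def, simp add: sum_distrib_left mult.assoc)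
    also have "\<dots> = (\<Sum>i<n1. \<Sum>j<n2. \<Sum>a<s2. W i a * Z i j * QB j a)"
      by (rule sum.cong[OF refl]) (rule sum.swap)
    also have "\<dots> = full_inner n1 n2 Z Z"
    proof (intro sum.cong refl)
      fix i j assume "j \<in> {..<n2}"
      then have "Z i j = (\<Sum>a<s2. W i a * QB j a)" using ZW by simp
      then have "Z i j * Z i j = Z i j * (\<Sum>a<s2. W i a * QB j a)" by (rule arg_cong)
      then show "(\<Sum>a<s2. W i a * Z i j * QB j a) = Z i j * Z i j" by (simp add: sum_distrib_left mult_ac)
    qed
    finally show "l2 s2 (\<lambda>a. l2 n1 (\<lambda>i. W i a)) \<le> sqrt (full_inner n1 n2 Z Z)" by (simp add: L2_set_def)
  qed auto
  finally show ?thesis by (simp add: Z_def mult.assoc)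
qed

section \<open>From entry functions to matrices, spectral norms and column projections\<close>

abbreviation ent :: "real mat \<Rightarrow> nat \<Rightarrow> nat \<Rightarrow> real" where "ent A \<equiv> \<lambda>i j. A $$ (i, j)"
abbreviation cmp :: "real Matrix.vec \<Rightarrow> nat \<Rightarrow> real" where "cmp v \<equiv> \<lambda>i. vec_index v i"

lemma scalar_prod_sum: "w \<in> carrier_vec n \<Longrightarrow> scalar_prod v w = (\<Sum>i<n. cmp v i * cmp w i)"
  unfolding scalar_prod_def by (simp add: lessThan_atLeast0)

lemma vnorm_l2: "v \<in> carrier_vec n \<Longrightarrow> vnorm v = l2 n (cmp v)"
  by (simp add: vnorm_def scalar_prod_sum L2_set_def power2_eq_square)

lemma mult_mat_vec_apply:
  "A \<in> carrier_mat n m \<Longrightarrow> v \<in> carrier_vec m \<Longrightarrow> i < n \<Longrightarrow> cmp (A *\<^sub>v v) i = (\<Sum>j<m. ent A i j * cmp v j)"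
  by (simp add: mult_mat_vec_def scalar_prod_def lessThan_atLeast0)

lemma l2_cong: "(\<And>i. i < n \<Longrightarrow> x i = y i) \<Longrightarrow> l2 n x = l2 n y"
  by (simp add: L2_set_def)

lemma bil_cong: "(\<And>i j. i < a \<Longrightarrow> j < b \<Longrightarrow> H i j = H' i j) \<Longrightarrow> bil a b H x y = bil a b H' x y"
  by (simp add: bil_def)

lemma bil_cong_vec: "(\<And>i. i < a \<Longrightarrow> x i = x' i) \<Longrightarrow> (\<And>j. j < b \<Longrightarrow> y j = y' j) \<Longrightarrow> bil a b H x y = bil a b H x' y'"
  by (simp add: bil_def)

lemma bil_mult_mat_vec:
  assumes M: "M \<in> carrier_mat n1 n2" and v: "v \<in> carrier_vec n2"
  shows "bil n1 n2 (ent M) x (cmp v) = (\<Sum>i<n1. x i * cmp (M *\<^sub>v v) i)"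
  unfolding bil_def by (intro sum.cong refl) (simp add: mult_mat_vec_apply[OF M v] sum_distrib_left mult_ac)

lemma spectral_norm_set_le:
  assumes M: "M \<in> carrier_mat n1 n2" and S: "\<And>x y. bil n1 n2 (ent M) x y \<le> S * l2 n1 x * l2 n2 y" "0 \<le> S"
    and v: "v \<in> carrier_vec n2" "vnorm v \<le> 1"
  shows "vnorm (M *\<^sub>v v) \<le> S"
proof -
  have Mv: "M *\<^sub>v v \<in> carrier_vec n1" using M v by auto
  have "(vnorm (M *\<^sub>v v))\<^sup>2 = bil n1 n2 (ent M) (cmp (M *\<^sub>v v)) (cmp v)"
    unfolding vnorm_l2[OF Mv] bil_mult_mat_vec[OF M v(1)] by (simp add: l2_mult_self)
  also have "\<dots> \<le> S * vnorm (M *\<^sub>v v) * vnorm v" unfolding vnorm_l2[OF Mv] vnorm_l2[OF v(1)] by (rule S)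
  also have "\<dots> \<le> S * vnorm (M *\<^sub>v v) * 1"
    using v S(2) by (intro mult_left_mono) (auto simp: vnorm_l2[OF Mv])
  finally have "(vnorm (M *\<^sub>v v))\<^sup>2 \<le> S * vnorm (M *\<^sub>v v)" by simp
  then show ?thesis by (rule square_le_mult_imp_le) (use S(2) in \<open>simp_all add: vnorm_l2[OF Mv]\<close>)
qed

lemma spectral_norm_le:
  assumes M: "M \<in> carrier_mat n1 n2" and S: "\<And>x y. bil n1 n2 (ent M) x y \<le> S * l2 n1 x * l2 n2 y" "0 \<le> S"
  shows "spectral_norm M \<le> S"
  unfolding spectral_norm_def
proof (rule cSUP_least)
  have "0\<^sub>v n2 \<in> {v \<in> carrier_vec (dim_col M). vnorm v \<le> 1}" using M by (simp add: vnorm_def)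
  then show "{v \<in> carrier_vec (dim_col M). vnorm v \<le> 1} \<noteq> {}" by blast
qed (use spectral_norm_set_le[OF M S] M in auto)

text \<open>Serves to show that the suprema in \<open>spectral_norm\<close> and
  \<open>noise_level\<close> are taken over bounded sets, without which a real-valued supremum would
  say nothing.\<close>

lemma bil_le_crude: "bil a b H x y \<le> 2 * (\<Sum>i<a. \<Sum>j<b. \<bar>H i j\<bar>) * l2 a x * l2 b y"
  by (rule bil_net_bound) (use bil_le_sum_abs grid_net_l2 in blast)

lemma bil_le_spectral_norm:
  assumes M: "M \<in> carrier_mat n1 n2"
  shows "bil n1 n2 (ent M) x y \<le> spectral_norm M * l2 n1 x * l2 n2 y" and "0 \<le> spectral_norm M"
proof -
  let ?S = "2 * (\<Sum>i<n1. \<Sum>j<n2. \<bar>ent M i j\<bar>)"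
  have S0: "0 \<le> ?S" by (intro mult_nonneg_nonneg sum_nonneg) auto
  have bdd: "bdd_above ((\<lambda>v. vnorm (M *\<^sub>v v)) ` {v \<in> carrier_vec (dim_col M). vnorm v \<le> 1})"
    by (rule bdd_aboveI2[of _ _ ?S]) (use spectral_norm_set_le[OF M bil_le_crude S0] M in auto)
  have up: "vnorm (M *\<^sub>v v) \<le> spectral_norm M" if "v \<in> carrier_vec n2" "vnorm v \<le> 1" for v
    unfolding spectral_norm_def by (rule cSUP_upper[OF _ bdd]) (use that M in auto)
  show nn: "0 \<le> spectral_norm M"
  proof -
    have "vnorm (M *\<^sub>v 0\<^sub>v n2) \<le> spectral_norm M" by (rule up) (auto simp: vnorm_def)
    moreover have "0 \<le> vnorm (M *\<^sub>v 0\<^sub>v n2)" using M by (subst vnorm_l2[of _ n1]) auto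
    ultimately show ?thesis by linarith
  qed
  show "bil n1 n2 (ent M) x y \<le> spectral_norm M * l2 n1 x * l2 n2 y"
  proof (cases "l2 n2 y = 0")
    case True
    then have "\<forall>j<n2. y j = 0" by (simp add: L2_set_eq_0_iff)
    then have "bil n1 n2 (ent M) x y = 0" by (simp add: bil_def)
    then show ?thesis using True by simp
  next
    case False
    then have pos: "0 < l2 n2 y" by (simp add: less_le)
    define v where "v = Matrix.vec n2 (\<lambda>j. (1 / l2 n2 y) * y j)"
    have v: "v \<in> carrier_vec n2" by (simp add: v_def)
    have "vnorm v = l2 n2 (\<lambda>j. (1 / l2 n2 y) * y j)"
      unfolding vnorm_l2[OF v] by (rule l2_cong) (simp add: v_def)
    then have v1: "vnorm v = 1" unfolding l2_scale using pos by simp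
    have Mv: "M *\<^sub>v v \<in> carrier_vec n1" using M v by auto
    have "bil n1 n2 (ent M) x y = l2 n2 y * bil n1 n2 (ent M) x (cmp v)"
    proof -
      have "bil n1 n2 (ent M) x (cmp v) = bil n1 n2 (ent M) (\<lambda>i. 1 * x i) (\<lambda>j. (1 / l2 n2 y) * y j)"
        by (rule bil_cong_vec) (auto simp: v_def)
      then show ?thesis unfolding bil_scale using pos by simp
    qed
    also have "bil n1 n2 (ent M) x (cmp v) \<le> l2 n1 x * vnorm (M *\<^sub>v v)"
      unfolding bil_mult_mat_vec[OF M v] vnorm_l2[OF Mv] using abs_inner_le_l2 abs_le_D1 by blast
    also have "\<dots> \<le> l2 n1 x * spectral_norm M" using up[OF v] v1 by (intro mult_left_mono) auto
    finally show ?thesis using pos by (simp add: mult_ac mult_left_mono)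
  qed
qed

lemma apply_mat_sym_inner:
  assumes "\<And>i j. P i j = P j i"
  shows "(\<Sum>i<n. apply_mat n P x i * y i) = (\<Sum>i<n. x i * apply_mat n P y i)"
  unfolding apply_mat_def sum_distrib_left sum_distrib_right
  by (subst sum.swap) (simp add: assms mult_ac)

lemma cmp_minus: "a \<in> carrier_vec n \<Longrightarrow> b \<in> carrier_vec n \<Longrightarrow> i < n \<Longrightarrow> cmp (a - b) i = cmp a i - cmp b i"
  by simp

lemma minus_vec_eq: "a \<in> carrier_vec n \<Longrightarrow> b \<in> carrier_vec n \<Longrightarrow> v \<in> carrier_vec n \<Longrightarrow> a - b = (v - b) - (v - a)"
  for a b v :: "real Matrix.vec"
  by (intro eq_vecI) auto

lemma vec_eq_if_minus_zero:
  "a \<in> carrier_vec n \<Longrightarrow> b \<in> carrier_vec n \<Longrightarrow> \<forall>i<n. cmp (a - b) i = 0 \<Longrightarrow> b = a"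
  by (intro eq_vecI) auto

text \<open>Evaluates the definite description in \<open>col_proj\<close>: Gram-Schmidt supplies
  existence, and uniqueness holds because two candidates differ, at each vector, by an element of
  the column space orthogonal to the column space.\<close>

lemma col_proj_eq:
  assumes A: "A \<in> carrier_mat n r" and cb: "column_basis n r (ent A) s Q C D"
  shows "col_proj A = Matrix.mat n n (\<lambda>(i, j). proj_kernel s Q i j)"
proof -
  interpret vec_space "TYPE(real)" n .
  define PP where "PP = Matrix.mat n n (\<lambda>(i, j). proj_kernel s Q i j)"
  have PPc: "PP \<in> carrier_mat n n" by (simp add: PP_def)
  have cs: "vec_space.col_space n A = {y \<in> carrier_vec n. \<exists>x\<in>carrier_vec r. A *\<^sub>v x = y}"
    using col_space_eq[OF A] A by simp
  have P: "cmp (PP *\<^sub>v v) i = apply_mat n (proj_kernel s Q) (cmp v) i" if "v \<in> carrier_vec n" "i < n" for v i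
    unfolding mult_mat_vec_apply[OF PPc that] apply_mat_def using that by (intro sum.cong refl) (simp add: PP_def)
  have Ax: "cmp (A *\<^sub>v x) i = (\<Sum>k<r. ent A i k * cmp x k)" if "x \<in> carrier_vec r" "i < n" for x i
    using that A by (intro mult_mat_vec_apply) auto
  have inP: "PP *\<^sub>v v \<in> vec_space.col_space n A" if v: "v \<in> carrier_vec n" for v
  proof -
    define c where "c a = (\<Sum>j<n. Q j a * cmp v j)" for a
    define x where "x = Matrix.vec r (\<lambda>k. \<Sum>a<s. D k a * c a)"
    have x: "x \<in> carrier_vec r" by (simp add: x_def)
    have "A *\<^sub>v x = PP *\<^sub>v v"
    proof (rule eq_vecI)
      fix i assume "i < dim_vec (PP *\<^sub>v v)"
      then have i: "i < n" using PPc by simp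
      have "cmp (A *\<^sub>v x) i = (\<Sum>k<r. \<Sum>a<s. ent A i k * D k a * c a)"
        unfolding Ax[OF x i] by (intro sum.cong refl) (simp add: x_def sum_distrib_left mult.assoc)
      also have "\<dots> = (\<Sum>a<s. (\<Sum>k<r. ent A i k * D k a) * c a)"
        unfolding sum_distrib_right by (rule sum.swap)
      also have "\<dots> = (\<Sum>a<s. Q i a * c a)" using column_basisD(4)[OF cb i] by (intro sum.cong refl) simp
      finally show "cmp (A *\<^sub>v x) i = cmp (PP *\<^sub>v v) i" unfolding P[OF v i] apply_proj_kernel c_def .
    qed (use A PPc in auto)
    moreover have "PP *\<^sub>v v \<in> carrier_vec n" using PPc v by auto
    ultimately show ?thesis unfolding cs using x by auto
  qed
  have orth: "scalar_prod (v - PP *\<^sub>v v) w = 0" if v: "v \<in> carrier_vec n" and w: "w \<in> vec_space.col_space n A" for v w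
  proof -
    obtain x where x: "x \<in> carrier_vec r" "w = A *\<^sub>v x" using w unfolding cs by auto
    have wc: "w \<in> carrier_vec n" using w unfolding cs by auto
    have Pw: "apply_mat n (proj_kernel s Q) (cmp w) i = cmp w i" if "i < n" for i
    proof -
      have "apply_mat n (proj_kernel s Q) (cmp w) i = apply_mat n (proj_kernel s Q) (\<lambda>i. \<Sum>k<r. ent A i k * cmp x k) i"
        unfolding x(2) by (rule apply_mat_cong) (rule Ax[OF x(1)])
      also have "\<dots> = cmp w i" unfolding proj_kernel_column[OF cb that] x(2) Ax[OF x(1) that] ..
      finally show ?thesis .
    qed
    have "scalar_prod (v - PP *\<^sub>v v) w = (\<Sum>i<n. (cmp v i - apply_mat n (proj_kernel s Q) (cmp v) i) * cmp w i)"
    proof -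
      have c: "PP *\<^sub>v v \<in> carrier_vec n" using PPc v by auto
      have "cmp (v - PP *\<^sub>v v) i = cmp v i - apply_mat n (proj_kernel s Q) (cmp v) i" if "i < n" for i
        unfolding cmp_minus[OF v c that] P[OF v that] ..
      then show ?thesis unfolding scalar_prod_sum[OF wc] by (intro sum.cong refl) (simp only: lessThan_iff)
    qed
    also have "\<dots> = (\<Sum>i<n. cmp v i * cmp w i) - (\<Sum>i<n. cmp v i * apply_mat n (proj_kernel s Q) (cmp w) i)"
      unfolding left_diff_distrib sum_subtractf apply_mat_sym_inner[of "proj_kernel s Q", OF proj_kernel_sym] ..
    also have "\<dots> = 0" using Pw by simp
    finally show ?thesis .
  qed
  show ?thesis unfolding col_proj_def PP_def[symmetric]
  proof (rule the_equality, intro conjI ballI)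
    show "PP \<in> carrier_mat (dim_row A) (dim_row A)" using A PPc by simp
    show "PP *\<^sub>v v \<in> vec_space.col_space (dim_row A) A" if "v \<in> carrier_vec (dim_row A)" for v
      using inP that A by simp
    show "scalar_prod (v - PP *\<^sub>v v) w = 0" if "v \<in> carrier_vec (dim_row A)" "w \<in> vec_space.col_space (dim_row A) A" for v w
      using orth that A by simp
  next
    fix P' assume P'a: "P' \<in> carrier_mat (dim_row A) (dim_row A) \<and>
      (\<forall>v\<in>carrier_vec (dim_row A). P' *\<^sub>v v \<in> vec_space.col_space (dim_row A) A \<and>
        (\<forall>w\<in>vec_space.col_space (dim_row A) A. scalar_prod (v - P' *\<^sub>v v) w = 0))"
    have dA: "dim_row A = n" using A by simp
    have P': "P' \<in> carrier_mat n n" "\<And>v. v \<in> carrier_vec n \<Longrightarrow> P' *\<^sub>v v \<in> vec_space.col_space n A"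
      "\<And>v w. v \<in> carrier_vec n \<Longrightarrow> w \<in> vec_space.col_space n A \<Longrightarrow> scalar_prod (v - P' *\<^sub>v v) w = 0"
      using P'a unfolding dA by blast+
    have eq: "P' *\<^sub>v v = PP *\<^sub>v v" if v: "v \<in> carrier_vec n" for v
    proof -
      obtain x where x: "x \<in> carrier_vec r" "A *\<^sub>v x = PP *\<^sub>v v" using inP[OF v] unfolding cs by auto
      obtain y where y: "y \<in> carrier_vec r" "A *\<^sub>v y = P' *\<^sub>v v" using P'(2)[OF v] unfolding cs by auto
      \<comment> \<open>It lies in the column space as a difference of two images, and as a
        difference of two residuals it is orthogonal to that space, so <d, d> = 0.\<close>
      define d where "d = PP *\<^sub>v v - P' *\<^sub>v v"
      have pc: "PP *\<^sub>v v \<in> carrier_vec n" "P' *\<^sub>v v \<in> carrier_vec n" using v P'(1) PPc by auto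
      have dc: "d \<in> carrier_vec n" using pc by (simp add: d_def)
      have "d = A *\<^sub>v (x - y)" unfolding d_def x(2)[symmetric] y(2)[symmetric]
        by (rule mult_minus_distrib_mat_vec[OF A x(1) y(1), symmetric])
      then have dcs: "d \<in> vec_space.col_space n A" unfolding cs using dc x y by auto
      have "d = (v - P' *\<^sub>v v) - (v - PP *\<^sub>v v)" unfolding d_def by (rule minus_vec_eq[OF pc v])
      then have "scalar_prod d d = scalar_prod (v - P' *\<^sub>v v) d - scalar_prod (v - PP *\<^sub>v v) d"
        using dc v pc by (metis minus_carrier_vec minus_scalar_prod_distrib)
      also have "\<dots> = 0" using P'(3)[OF v dcs] orth[OF v dcs] by simp
      finally have "\<forall>i<n. cmp d i = 0" unfolding scalar_prod_sum[OF dc] l2_mult_self by (simp add: L2_set_eq_0_iff)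
      then show ?thesis unfolding d_def by (rule vec_eq_if_minus_zero[OF pc])
    qed
    show "P' = PP"
    proof (rule eq_matI)
      fix i j assume "i < dim_row PP" "j < dim_col PP"
      then have ij: "i < n" "j < n" using PPc by auto
      have e: "unit_vec n j \<in> carrier_vec n" by simp
      have "cmp (M *\<^sub>v unit_vec n j) i = ent M i j" if M: "M \<in> carrier_mat n n" for M
        unfolding mult_mat_vec_apply[OF M e ij(1)] using ij
        by (simp add: if_distrib[of "\<lambda>x. _ * x"] cong: if_cong)
      then show "P' $$ (i, j) = PP $$ (i, j)" using eq[OF e] P'(1) PPc by metis
    qed (use P'(1) PPc in auto)
  qed
qed

text \<open>Projections do not expand, so one bound \<open>S\<close> on the sampled noise holds for
  all parameter pairs. It makes the supremum an upper bound for each single pair, and it is zero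
  when the noise is.\<close>

lemma noise_level_bound:
  assumes X: "\<And>\<theta>. \<theta> \<in> carrier_vec d \<Longrightarrow> X \<theta> \<in> carrier_mat n1 r"
    and Y: "\<And>\<theta>. \<theta> \<in> carrier_vec d \<Longrightarrow> Y \<theta> \<in> carrier_mat n2 r"
    and N: "N \<in> carrier_mat n1 n2" and \<theta>1: "\<theta>1 \<in> carrier_vec d" and \<theta>2: "\<theta>2 \<in> carrier_vec d"
  shows "sampled_inner n1 n2 \<Omega> (ent N) (\<lambda>i j. ip r (ent (X \<theta>1) i) (ent (Y \<theta>2) j))
      \<le> sqrt (real r) * noise_level d \<Omega> N X Y * sqrt (full_inner n1 n2 (\<lambda>i j. ip r (ent (X \<theta>1) i) (ent (Y \<theta>2) j)) (\<lambda>i j. ip r (ent (X \<theta>1) i) (ent (Y \<theta>2) j)))"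
    and "0 \<le> noise_level d \<Omega> N X Y" and "N = 0\<^sub>m n1 n2 \<Longrightarrow> noise_level d \<Omega> N X Y = 0"
proof -
  let ?K = "restrict_entries \<Omega> N"
  let ?f = "\<lambda>(\<theta>1, \<theta>2). spectral_norm (col_proj (X \<theta>1) * ?K * col_proj (Y \<theta>2))"
  have K: "?K \<in> carrier_mat n1 n2" using N by (simp add: restrict_entries_def)
  have entK: "ent ?K i j = of_bool ((i, j) \<in> \<Omega>) * ent N i j" if "i < n1" "j < n2" for i j
    using that N by (simp add: restrict_entries_def)
  define S where "S = 2 * (\<Sum>i<n1. \<Sum>j<n2. \<bar>ent ?K i j\<bar>)"
  have S0: "0 \<le> S" unfolding S_def by (intro mult_nonneg_nonneg sum_nonneg) auto
  have comp: "\<exists>s1 Q1 C1 D1 s2 Q2 C2 D2. column_basis n1 r (ent (X a)) s1 Q1 C1 D1 \<and> column_basis n2 r (ent (Y b)) s2 Q2 C2 D2 \<and>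
     col_proj (X a) * ?K * col_proj (Y b) \<in> carrier_mat n1 n2 \<and>
     (\<forall>i<n1. \<forall>j<n2. ent (col_proj (X a) * ?K * col_proj (Y b)) i j = compress n1 n2 (proj_kernel s1 Q1) (ent ?K) (proj_kernel s2 Q2) i j)"
    if ab: "a \<in> carrier_vec d" "b \<in> carrier_vec d" for a b
  proof -
    obtain s1 Q1 C1 D1 where 1: "column_basis n1 r (ent (X a)) s1 Q1 C1 D1" using ex_column_basis by blast
    obtain s2 Q2 C2 D2 where 2: "column_basis n2 r (ent (Y b)) s2 Q2 C2 D2" using ex_column_basis by blast
    note P1 = col_proj_eq[OF X[OF ab(1)] 1] and P2 = col_proj_eq[OF Y[OF ab(2)] 2]
    have c: "col_proj (X a) * ?K * col_proj (Y b) \<in> carrier_mat n1 n2" unfolding P1 P2 using K by auto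
    have "ent (col_proj (X a) * ?K * col_proj (Y b)) i j = compress n1 n2 (proj_kernel s1 Q1) (ent ?K) (proj_kernel s2 Q2) i j"
      if "i < n1" "j < n2" for i j
      unfolding P1 P2 using that K by (simp add: scalar_prod_def compress_def lessThan_atLeast0)
    with 1 2 c show ?thesis by blast
  qed
  have le: "?f (a, b) \<le> S" if ab: "a \<in> carrier_vec d" "b \<in> carrier_vec d" for a b
  proof -
    obtain s1 Q1 C1 D1 s2 Q2 C2 D2 where *: "column_basis n1 r (ent (X a)) s1 Q1 C1 D1" "column_basis n2 r (ent (Y b)) s2 Q2 C2 D2"
      "col_proj (X a) * ?K * col_proj (Y b) \<in> carrier_mat n1 n2"
      "\<forall>i<n1. \<forall>j<n2. ent (col_proj (X a) * ?K * col_proj (Y b)) i j = compress n1 n2 (proj_kernel s1 Q1) (ent ?K) (proj_kernel s2 Q2) i j"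
      using comp[OF ab] by blast
    have "spectral_norm (col_proj (X a) * ?K * col_proj (Y b)) \<le> S"
    proof (rule spectral_norm_le[OF *(3) _ S0])
      fix x y
      have "bil n1 n2 (ent (col_proj (X a) * ?K * col_proj (Y b))) x y
         = bil n1 n2 (compress n1 n2 (proj_kernel s1 Q1) (ent ?K) (proj_kernel s2 Q2)) x y"
        by (rule bil_cong) (use *(4) in blast)
      also have "\<dots> = bil n1 n2 (ent ?K) (apply_mat n1 (proj_kernel s1 Q1) x) (apply_mat n2 (proj_kernel s2 Q2) y)"
        by (rule bil_compress) (rule proj_kernel_sym)
      also have "\<dots> \<le> S * l2 n1 (apply_mat n1 (proj_kernel s1 Q1) x) * l2 n2 (apply_mat n2 (proj_kernel s2 Q2) y)"
        unfolding S_def by (rule bil_le_crude)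
      also have "\<dots> \<le> S * l2 n1 x * l2 n2 y"
        using l2_proj_le[OF *(1)] l2_proj_le[OF *(2)] S0 by (intro mult_mono mult_nonneg_nonneg) auto
      finally show "bil n1 n2 (ent (col_proj (X a) * ?K * col_proj (Y b))) x y \<le> S * l2 n1 x * l2 n2 y" .
    qed
    then show ?thesis by simp
  qed
  have bdd: "bdd_above (?f ` (carrier_vec d \<times> carrier_vec d))"
    by (rule bdd_aboveI2[of _ _ S]) (use le in auto)
  have up: "spectral_norm (col_proj (X a) * ?K * col_proj (Y b)) \<le> noise_level d \<Omega> N X Y"
    if "a \<in> carrier_vec d" "b \<in> carrier_vec d" for a b
    using cSUP_upper[OF _ bdd, of "(a, b)"] that unfolding noise_level_def by simp
  obtain s1 Q1 C1 D1 s2 Q2 C2 D2 where *: "column_basis n1 r (ent (X \<theta>1)) s1 Q1 C1 D1" "column_basis n2 r (ent (Y \<theta>2)) s2 Q2 C2 D2"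
      "col_proj (X \<theta>1) * ?K * col_proj (Y \<theta>2) \<in> carrier_mat n1 n2"
      "\<forall>i<n1. \<forall>j<n2. ent (col_proj (X \<theta>1) * ?K * col_proj (Y \<theta>2)) i j = compress n1 n2 (proj_kernel s1 Q1) (ent ?K) (proj_kernel s2 Q2) i j"
    using comp[OF \<theta>1 \<theta>2] by blast
  show nn: "0 \<le> noise_level d \<Omega> N X Y"
    using up[OF \<theta>1 \<theta>2] bil_le_spectral_norm(2)[OF *(3)] by linarith
  have bnd: "bil n1 n2 (compress n1 n2 (proj_kernel s1 Q1) (ent ?K) (proj_kernel s2 Q2)) x y \<le> noise_level d \<Omega> N X Y * l2 n1 x * l2 n2 y" for x y
  proof -
    have "bil n1 n2 (compress n1 n2 (proj_kernel s1 Q1) (ent ?K) (proj_kernel s2 Q2)) x y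
       = bil n1 n2 (ent (col_proj (X \<theta>1) * ?K * col_proj (Y \<theta>2))) x y"
      by (rule bil_cong) (use *(4) in simp)
    also have "\<dots> \<le> spectral_norm (col_proj (X \<theta>1) * ?K * col_proj (Y \<theta>2)) * l2 n1 x * l2 n2 y"
      by (rule bil_le_spectral_norm[OF *(3)])
    also have "\<dots> \<le> noise_level d \<Omega> N X Y * l2 n1 x * l2 n2 y"
      using up[OF \<theta>1 \<theta>2] by (intro mult_right_mono) auto
    finally show ?thesis .
  qed
  have "sampled_inner n1 n2 \<Omega> (ent N) (\<lambda>i j. ip r (ent (X \<theta>1) i) (ent (Y \<theta>2) j))
     = (\<Sum>i<n1. \<Sum>j<n2. ent ?K i j * ip r (ent (X \<theta>1) i) (ent (Y \<theta>2) j))"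
    unfolding sampled_inner_def by (intro sum.cong refl) (simp add: entK)
  also have "\<dots> \<le> noise_level d \<Omega> N X Y * sqrt (real r) * sqrt (full_inner n1 n2 (\<lambda>i j. ip r (ent (X \<theta>1) i) (ent (Y \<theta>2) j)) (\<lambda>i j. ip r (ent (X \<theta>1) i) (ent (Y \<theta>2) j)))"
    by (rule inner_le_compressed_norm[OF *(1,2) bnd nn])
  finally show "sampled_inner n1 n2 \<Omega> (ent N) (\<lambda>i j. ip r (ent (X \<theta>1) i) (ent (Y \<theta>2) j))
      \<le> sqrt (real r) * noise_level d \<Omega> N X Y * sqrt (full_inner n1 n2 (\<lambda>i j. ip r (ent (X \<theta>1) i) (ent (Y \<theta>2) j)) (\<lambda>i j. ip r (ent (X \<theta>1) i) (ent (Y \<theta>2) j)))"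
    by (simp add: mult.commute)
  assume "N = 0\<^sub>m n1 n2"
  then have "S = 0" unfolding S_def using entK by simp
  then have "noise_level d \<Omega> N X Y \<le> 0"
    unfolding noise_level_def by (intro cSUP_least) (use le \<theta>1 in auto)
  then show "noise_level d \<Omega> N X Y = 0" using nn by simp
qed

section \<open>Factors of the ground truth and recovery\<close>

text \<open>Multiplying the factorization by the singular vectors on both sides makes R R'^T the
  diagonal matrix of singular values, which is invertible; hence R is invertible, and U R'^T = Us L
  can be solved for U.\<close>

lemma factor_through:
  fixes U V Us Vs :: "real mat"
  assumes U: "U \<in> carrier_mat n1 r" and V: "V \<in> carrier_mat n2 r"
    and Us: "Us \<in> carrier_mat n1 r" and Vs: "Vs \<in> carrier_mat n2 r"
    and oU: "Us\<^sup>T * Us = 1\<^sub>m r" and oV: "Vs\<^sup>T * Vs = 1\<^sub>m r"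
    and \<sigma>: "\<And>i. i < r \<Longrightarrow> 0 < \<sigma> i" and M: "U * V\<^sup>T = Us * mat_diag r \<sigma> * Vs\<^sup>T"
  defines "R \<equiv> Us\<^sup>T * U" and "R' \<equiv> Vs\<^sup>T * V"
  shows "R * R'\<^sup>T = mat_diag r \<sigma>" and "\<exists>S\<in>carrier_mat r r. S * R = 1\<^sub>m r" and "U = Us * R"
proof -
  define L where "L = mat_diag r \<sigma>"
  define Li where "Li = mat_diag r (\<lambda>i. 1 / \<sigma> i)"
  have L: "L \<in> carrier_mat r r" and Li: "Li \<in> carrier_mat r r" by (simp_all add: L_def Li_def)
  have VT: "V\<^sup>T \<in> carrier_mat r n2" and UsT: "Us\<^sup>T \<in> carrier_mat r n1" and VsT: "Vs\<^sup>T \<in> carrier_mat r n2"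
    using V Us Vs by auto
  have R: "R \<in> carrier_mat r r" unfolding R_def by (rule mult_carrier_mat[OF UsT U])
  have R': "R' \<in> carrier_mat r r" unfolding R'_def by (rule mult_carrier_mat[OF VsT V])
  have R'Tc: "R'\<^sup>T \<in> carrier_mat r r" using R' by auto
  have R'T: "R'\<^sup>T = V\<^sup>T * Vs" unfolding R'_def transpose_mult[OF VsT V] by simp
  have UR: "U * R'\<^sup>T = Us * L"
  proof -
    have "U * R'\<^sup>T = (U * V\<^sup>T) * Vs" unfolding R'T by (rule assoc_mult_mat[OF U VT Vs, symmetric])
    also have "\<dots> = (Us * L) * (Vs\<^sup>T * Vs)" unfolding M L_def[symmetric]
      by (rule assoc_mult_mat[OF mult_carrier_mat[OF Us L] VsT Vs])
    also have "\<dots> = Us * L" unfolding oV by (rule right_mult_one_mat[OF mult_carrier_mat[OF Us L]])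
    finally show ?thesis .
  qed
  have RR: "R * R'\<^sup>T = L"
  proof -
    have "R * R'\<^sup>T = Us\<^sup>T * (U * R'\<^sup>T)" unfolding R_def by (rule assoc_mult_mat[OF UsT U R'Tc])
    also have "\<dots> = (Us\<^sup>T * Us) * L" unfolding UR by (rule assoc_mult_mat[OF UsT Us L, symmetric])
    also have "\<dots> = L" unfolding oU by (rule left_mult_one_mat[OF L])
    finally show ?thesis .
  qed
  then show "R * R'\<^sup>T = mat_diag r \<sigma>" by (simp add: L_def)
  have LL: "L * Li = 1\<^sub>m r" unfolding L_def Li_def mat_diag_diag
    using \<sigma> by (intro eq_matI) (force simp: mat_diag_def)+
  \<comment> \<open>A right inverse of R by construction, hence a left inverse, the matrices being
    square.\<close>
  define S where "S = R'\<^sup>T * Li"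
  have S: "S \<in> carrier_mat r r" unfolding S_def by (rule mult_carrier_mat[OF R'Tc Li])
  have "R * S = (R * R'\<^sup>T) * Li" unfolding S_def by (rule assoc_mult_mat[OF R R'Tc Li, symmetric])
  then have "R * S = 1\<^sub>m r" unfolding RR LL .
  then have SR: "S * R = 1\<^sub>m r" by (rule mat_mult_left_right_inverse[OF R S])
  then show "\<exists>S\<in>carrier_mat r r. S * R = 1\<^sub>m r" using S by blast
  have "U * S = (U * R'\<^sup>T) * Li" unfolding S_def by (rule assoc_mult_mat[OF U R'Tc Li, symmetric])
  also have "\<dots> = Us * (L * Li)" unfolding UR by (rule assoc_mult_mat[OF Us L Li])
  also have "\<dots> = Us" unfolding LL by (rule right_mult_one_mat[OF Us])
  finally have "Us * R = (U * S) * R" by simp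
  also have "\<dots> = U * (S * R)" by (rule assoc_mult_mat[OF U S R])
  also have "\<dots> = U" unfolding SR by (rule right_mult_one_mat[OF U])
  finally show "U = Us * R" by simp
qed

text \<open>(R R^T)^2 = R (R^T R) R^T = R (R'^T R') R^T = (R R'^T) (R' R^T), where the balance of
  the two factors gives the second equality and both final factors are the diagonal matrix of
  singular values.\<close>

lemma balanced_factor_matrix:
  fixes U V Us Vs :: "real mat"
  assumes U: "U \<in> carrier_mat n1 r" and V: "V \<in> carrier_mat n2 r"
    and Us: "Us \<in> carrier_mat n1 r" and Vs: "Vs \<in> carrier_mat n2 r"
    and oU: "Us\<^sup>T * Us = 1\<^sub>m r" and oV: "Vs\<^sup>T * Vs = 1\<^sub>m r"
    and \<sigma>: "\<And>i. i < r \<Longrightarrow> 0 < \<sigma> i" and M: "U * V\<^sup>T = Us * mat_diag r \<sigma> * Vs\<^sup>T" and bal: "U\<^sup>T * U = V\<^sup>T * V"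
  shows "\<exists>R\<in>carrier_mat r r. \<exists>S\<in>carrier_mat r r. U = Us * R \<and> S * R = 1\<^sub>m r \<and>
     (R * R\<^sup>T) * (R * R\<^sup>T) = mat_diag r \<sigma> * mat_diag r \<sigma>"
proof -
  define L where "L = mat_diag r \<sigma>"
  define R where "R = Us\<^sup>T * U"
  define R' where "R' = Vs\<^sup>T * V"
  have L: "L \<in> carrier_mat r r" by (simp add: L_def)
  have LT: "L\<^sup>T = L" unfolding L_def by (intro eq_matI) (auto simp: mat_diag_def)
  have VT: "V\<^sup>T \<in> carrier_mat r n2" and UsT: "Us\<^sup>T \<in> carrier_mat r n1" and VsT: "Vs\<^sup>T \<in> carrier_mat r n2"
    using U V Us Vs by auto
  have M': "V * U\<^sup>T = Vs * mat_diag r \<sigma> * Us\<^sup>T"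
  proof -
    have "V * U\<^sup>T = (U * V\<^sup>T)\<^sup>T" unfolding transpose_mult[OF U VT] by simp
    also have "\<dots> = Vs * (Us * L)\<^sup>T" unfolding M L_def[symmetric] transpose_mult[OF mult_carrier_mat[OF Us L] VsT] by simp
    also have "\<dots> = Vs * (L * Us\<^sup>T)" unfolding transpose_mult[OF Us L] LT ..
    also have "\<dots> = Vs * L * Us\<^sup>T" by (rule assoc_mult_mat[OF Vs L UsT, symmetric])
    finally show ?thesis unfolding L_def .
  qed
  have f: "R * R'\<^sup>T = mat_diag r \<sigma>" "\<exists>S\<in>carrier_mat r r. S * R = 1\<^sub>m r" "U = Us * R"
    unfolding R_def R'_def
    by (rule factor_through(1)[OF U V Us Vs oU oV \<sigma> M], assumption)
      (rule factor_through(2)[OF U V Us Vs oU oV \<sigma> M], assumption, rule factor_through(3)[OF U V Us Vs oU oV \<sigma> M], assumption)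
  have f': "R' * R\<^sup>T = mat_diag r \<sigma>" "V = Vs * R'"
    unfolding R_def R'_def
    by (rule factor_through(1)[OF V U Vs Us oV oU \<sigma> M'], assumption) (rule factor_through(3)[OF V U Vs Us oV oU \<sigma> M'], assumption)
  have R: "R \<in> carrier_mat r r" unfolding R_def by (rule mult_carrier_mat[OF UsT U])
  have R': "R' \<in> carrier_mat r r" unfolding R'_def by (rule mult_carrier_mat[OF VsT V])
  have RT: "R\<^sup>T \<in> carrier_mat r r" and R'T: "R'\<^sup>T \<in> carrier_mat r r" using R R' by auto
  have gram: "A\<^sup>T * A = Q\<^sup>T * Q" if A: "A = W * Q" and o: "W\<^sup>T * W = 1\<^sub>m r" and W: "W \<in> carrier_mat n r" and Q: "Q \<in> carrier_mat r r"
    for A W Q :: "real mat" and n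
  proof -
    have WT: "W\<^sup>T \<in> carrier_mat r n" and QT: "Q\<^sup>T \<in> carrier_mat r r" using W Q by auto
    have "A\<^sup>T * A = (Q\<^sup>T * W\<^sup>T) * (W * Q)" unfolding A transpose_mult[OF W Q] ..
    also have "\<dots> = Q\<^sup>T * (W\<^sup>T * (W * Q))" by (rule assoc_mult_mat[OF QT WT mult_carrier_mat[OF W Q]])
    also have "W\<^sup>T * (W * Q) = (W\<^sup>T * W) * Q" by (rule assoc_mult_mat[OF WT W Q, symmetric])
    also have "\<dots> = Q" unfolding o by (rule left_mult_one_mat[OF Q])
    finally show ?thesis .
  qed
  have RR': "R\<^sup>T * R = R'\<^sup>T * R'" using gram[OF f(3) oU Us R] gram[OF f'(2) oV Vs R'] bal by simp
  have "(R * R\<^sup>T) * (R * R\<^sup>T) = R * (R\<^sup>T * (R * R\<^sup>T))" by (rule assoc_mult_mat[OF R RT mult_carrier_mat[OF R RT]])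
  also have "R\<^sup>T * (R * R\<^sup>T) = (R\<^sup>T * R) * R\<^sup>T" by (rule assoc_mult_mat[OF RT R RT, symmetric])
  also have "\<dots> = R'\<^sup>T * (R' * R\<^sup>T)" unfolding RR' by (rule assoc_mult_mat[OF R'T R' RT])
  also have "R * (R'\<^sup>T * (R' * R\<^sup>T)) = (R * R'\<^sup>T) * (R' * R\<^sup>T)"
    by (rule assoc_mult_mat[OF R R'T mult_carrier_mat[OF R' RT], symmetric])
  also have "\<dots> = mat_diag r \<sigma> * mat_diag r \<sigma>" unfolding f(1) f'(1) ..
  finally show ?thesis using f(2,3) R by blast
qed

lemma l2_diag_bounds:
  assumes "\<And>i. i < r \<Longrightarrow> smin \<le> \<sigma> i \<and> \<sigma> i \<le> smax" "0 \<le> smin"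
  shows "l2 r (\<lambda>i. \<sigma> i * y i) \<le> smax * l2 r y \<or> r = 0" and "smin * l2 r y \<le> l2 r (\<lambda>i. \<sigma> i * y i)"
proof -
  have "l2 r (\<lambda>i. \<sigma> i * y i) \<le> l2 r (\<lambda>i. smax * y i)" 
  proof -
    have "(\<Sum>i<r. (\<sigma> i * y i)\<^sup>2) \<le> (\<Sum>i<r. (smax * y i)\<^sup>2)"
      unfolding power_mult_distrib using assms by (intro sum_mono mult_right_mono power_mono) (auto intro: order_trans)
    then show ?thesis unfolding L2_set_def by (rule real_sqrt_le_mono)
  qed
  moreover have "0 \<le> smax" if "r \<noteq> 0" using assms(1)[of 0] assms(2) that by auto
  ultimately show "l2 r (\<lambda>i. \<sigma> i * y i) \<le> smax * l2 r y \<or> r = 0" unfolding l2_scale by auto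
  have "(\<Sum>i<r. (smin * y i)\<^sup>2) \<le> (\<Sum>i<r. (\<sigma> i * y i)\<^sup>2)"
    unfolding power_mult_distrib using assms by (intro sum_mono mult_right_mono power_mono) auto
  then have "l2 r (\<lambda>i. smin * y i) \<le> l2 r (\<lambda>i. \<sigma> i * y i)" unfolding L2_set_def by (rule real_sqrt_le_mono)
  then show "smin * l2 r y \<le> l2 r (\<lambda>i. \<sigma> i * y i)" unfolding l2_scale using assms(2) by simp
qed

text \<open>With $T = R R^\top$ one has $\|T y\| = \|\Lambda y\|$ because $T^2 = \Lambda^2$; Cauchy--Schwarz then
  bounds the form $y^\top T y = \|R^\top y\|^2$ on both sides without identifying $T$ with $\Lambda$.\<close>

lemma balanced_factor:
  fixes U V Us Vs :: "real mat"
  assumes U: "U \<in> carrier_mat n1 r" and V: "V \<in> carrier_mat n2 r"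
    and Us: "Us \<in> carrier_mat n1 r" and Vs: "Vs \<in> carrier_mat n2 r"
    and oU: "Us\<^sup>T * Us = 1\<^sub>m r" and oV: "Vs\<^sup>T * Vs = 1\<^sub>m r"
    and \<sigma>: "\<And>i. i < r \<Longrightarrow> smin \<le> \<sigma> i \<and> \<sigma> i \<le> smax" and smin: "0 < smin" and r: "1 \<le> r"
    and M: "U * V\<^sup>T = Us * mat_diag r \<sigma> * Vs\<^sup>T" and bal: "U\<^sup>T * U = V\<^sup>T * V"
  shows "\<exists>R :: nat \<Rightarrow> nat \<Rightarrow> real. (\<forall>i<n1. \<forall>k<r. ent U i k = (\<Sum>l<r. ent Us i l * R l k)) \<and>
     (\<forall>y. (\<Sum>k<r. (\<Sum>l<r. R l k * y l)\<^sup>2) \<le> smax * (l2 r y)\<^sup>2) \<and>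
     (\<forall>x. smin * (l2 r x)\<^sup>2 \<le> (\<Sum>l<r. (\<Sum>k<r. R l k * x k)\<^sup>2))"
proof -
  let ?L = "mat_diag r \<sigma>"
  have \<sigma>0: "0 < \<sigma> i" if "i < r" for i using \<sigma>[OF that] smin by linarith
  obtain R S where RS: "R \<in> carrier_mat r r" "S \<in> carrier_mat r r" "U = Us * R" "S * R = 1\<^sub>m r"
     "(R * R\<^sup>T) * (R * R\<^sup>T) = ?L * ?L"
    using balanced_factor_matrix[OF U V Us Vs oU oV \<sigma>0 M bal] by blast
  define T where "T = R * R\<^sup>T"
  have c: "R\<^sup>T \<in> carrier_mat r r" "T \<in> carrier_mat r r" "S\<^sup>T \<in> carrier_mat r r" using RS by (auto simp: T_def)
  have TT: "T\<^sup>T = T" unfolding T_def using RS by (subst transpose_mult[of _ r r]) auto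
  have LT: "?L\<^sup>T = ?L" by (intro eq_matI) (auto simp: mat_diag_def)
  have Lc: "?L \<in> carrier_mat r r" by simp
  have selfadj: "scalar_prod (A *\<^sub>v y) (A *\<^sub>v y) = scalar_prod y ((A * A) *\<^sub>v y)"
    if "A \<in> carrier_mat r r" "A\<^sup>T = A" "y \<in> carrier_vec r" for A :: "real mat" and y
  proof -
    have "scalar_prod (A\<^sup>T *\<^sub>v y) (A *\<^sub>v y) = scalar_prod y (A *\<^sub>v (A *\<^sub>v y))"
      using that by (intro transpose_vec_mult_scalar[of A r r]) auto
    then show ?thesis using that by simp
  qed
  have norm: "l2 r (cmp (T *\<^sub>v y)) = l2 r (\<lambda>i. \<sigma> i * cmp y i)" if y: "y \<in> carrier_vec r" for y
  proof -
    have "scalar_prod (T *\<^sub>v y) (T *\<^sub>v y) = scalar_prod (?L *\<^sub>v y) (?L *\<^sub>v y)"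
      unfolding selfadj[OF c(2) TT y] selfadj[OF Lc LT y] using RS(5) by (simp add: T_def)
    then have "(l2 r (cmp (T *\<^sub>v y)))\<^sup>2 = (l2 r (cmp (?L *\<^sub>v y)))\<^sup>2"
      unfolding scalar_prod_sum[OF mult_mat_vec_carrier[OF c(2) y]] scalar_prod_sum[OF mult_mat_vec_carrier[OF Lc y]] l2_mult_self .
    then have "l2 r (cmp (T *\<^sub>v y)) = l2 r (cmp (?L *\<^sub>v y))" by (rule power2_eq_imp_eq) auto
    also have "\<dots> = l2 r (\<lambda>i. \<sigma> i * cmp y i)"
    proof (rule l2_cong)
      fix i assume i: "i < r"
      show "cmp (?L *\<^sub>v y) i = \<sigma> i * cmp y i"
        unfolding mult_mat_vec_apply[OF Lc y i] using i
        by (simp add: mat_diag_def if_distrib[of "\<lambda>x. x * _"] cong: if_cong)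
    qed
    finally show ?thesis .
  qed
  have RTy: "(l2 r (cmp (R\<^sup>T *\<^sub>v y)))\<^sup>2 \<le> l2 r (cmp y) * l2 r (cmp (T *\<^sub>v y))" if y: "y \<in> carrier_vec r" for y
  proof -
    have rc: "R\<^sup>T *\<^sub>v y \<in> carrier_vec r" and tc: "T *\<^sub>v y \<in> carrier_vec r" using c y by auto
    have "(l2 r (cmp (R\<^sup>T *\<^sub>v y)))\<^sup>2 = scalar_prod (R\<^sup>T *\<^sub>v y) (R\<^sup>T *\<^sub>v y)"
      unfolding scalar_prod_sum[OF rc] l2_mult_self ..
    also have "\<dots> = scalar_prod y (R *\<^sub>v (R\<^sup>T *\<^sub>v y))"
      by (rule transpose_vec_mult_scalar[OF RS(1) rc y])
    also have "R *\<^sub>v (R\<^sup>T *\<^sub>v y) = T *\<^sub>v y" unfolding T_def using assoc_mult_mat_vec[OF RS(1) c(1) y] by simp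
    also have "scalar_prod y (T *\<^sub>v y) \<le> l2 r (cmp y) * l2 r (cmp (T *\<^sub>v y))"
      unfolding scalar_prod_sum[OF tc] using abs_inner_le_l2 abs_le_D1 by blast
    finally show ?thesis .
  qed
  show ?thesis
  proof (intro exI[of _ "ent R"] conjI allI impI)
    fix i k assume "i < n1" "k < r"
    then show "ent U i k = (\<Sum>l<r. ent Us i l * ent R l k)"
      unfolding RS(3) using Us RS(1) by (simp add: scalar_prod_def lessThan_atLeast0)
  next
    fix f :: "nat \<Rightarrow> real"
    define y where "y = Matrix.vec r f"
    have y: "y \<in> carrier_vec r" by (simp add: y_def)
    have yf: "l2 r (cmp y) = l2 r f" by (rule l2_cong) (simp add: y_def)
    have "(\<Sum>k<r. (\<Sum>l<r. ent R l k * f l)\<^sup>2) = (l2 r (cmp (R\<^sup>T *\<^sub>v y)))\<^sup>2"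
      unfolding l2_power2
    proof (rule sum.cong[OF refl])
      fix k assume "k \<in> {..<r}"
      then have k: "k < r" by simp
      show "(\<Sum>l<r. ent R l k * f l)\<^sup>2 = (cmp (R\<^sup>T *\<^sub>v y) k)\<^sup>2"
        unfolding mult_mat_vec_apply[OF c(1) y k] using RS(1) k by (simp add: y_def)
    qed
    also have "\<dots> \<le> l2 r (cmp y) * l2 r (cmp (T *\<^sub>v y))" by (rule RTy[OF y])
    also have "\<dots> \<le> l2 r (cmp y) * (smax * l2 r (cmp y))"
      unfolding norm[OF y] using l2_diag_bounds(1)[where r = r and \<sigma> = \<sigma> and smin = smin and smax = smax and y = "cmp y", OF \<sigma>] smin r by (intro mult_left_mono) auto
    finally show "(\<Sum>k<r. (\<Sum>l<r. ent R l k * f l)\<^sup>2) \<le> smax * (l2 r f)\<^sup>2"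
      unfolding yf by (simp add: power2_eq_square mult_ac)
  next
    fix g :: "nat \<Rightarrow> real"
    define x where "x = Matrix.vec r g"
    have x: "x \<in> carrier_vec r" by (simp add: x_def)
    have xg: "l2 r (cmp x) = l2 r g" by (rule l2_cong) (simp add: x_def)
    \<comment> \<open>Chosen with R^T y = x, so that R x = T y. Then smin |x|^2 <= smin |y| |T y| <=
      |T y|^2 = |R x|^2.\<close>
    define y where "y = S\<^sup>T *\<^sub>v x"
    have y: "y \<in> carrier_vec r" using c x by (simp add: y_def)
    have "R\<^sup>T * S\<^sup>T = 1\<^sub>m r" using transpose_mult[OF RS(2,1)] RS(4) by simp
    then have Ry: "R\<^sup>T *\<^sub>v y = x" unfolding y_def using assoc_mult_mat_vec[OF c(1,3) x] x by simp
    have "R *\<^sub>v x = T *\<^sub>v y" unfolding Ry[symmetric] T_def using assoc_mult_mat_vec[OF RS(1) c(1) y] by simp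
    then have Rx: "l2 r (cmp (R *\<^sub>v x)) = l2 r (\<lambda>i. \<sigma> i * cmp y i)" using norm[OF y] by simp
    have "smin * (l2 r (cmp x))\<^sup>2 \<le> smin * (l2 r (cmp y) * l2 r (cmp (T *\<^sub>v y)))"
      using RTy[OF y] smin unfolding Ry by (intro mult_left_mono) auto
    also have "\<dots> = (smin * l2 r (cmp y)) * l2 r (cmp (R *\<^sub>v x))" unfolding norm[OF y] Rx by simp
    also have "\<dots> \<le> l2 r (cmp (R *\<^sub>v x)) * l2 r (cmp (R *\<^sub>v x))"
      unfolding Rx using l2_diag_bounds(2)[where r = r and \<sigma> = \<sigma> and smin = smin and smax = smax and y = "cmp y", OF \<sigma>] smin by (intro mult_right_mono) auto
    also have "\<dots> = (\<Sum>l<r. (\<Sum>k<r. ent R l k * g k)\<^sup>2)"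
      unfolding power2_eq_square[symmetric] l2_power2
    proof (rule sum.cong[OF refl])
      fix k assume "k \<in> {..<r}"
      then have k: "k < r" by simp
      show "(cmp (R *\<^sub>v x) k)\<^sup>2 = (\<Sum>l<r. ent R k l * g l)\<^sup>2"
        unfolding mult_mat_vec_apply[OF RS(1) x k] by (simp add: x_def)
    qed
    finally show "smin * (l2 r g)\<^sup>2 \<le> (\<Sum>l<r. (\<Sum>k<r. ent R l k * g k)\<^sup>2)" unfolding xg .
  qed
qed

section \<open>Reading the objective off the matrix entries\<close>

lemma ip_cong: "(\<And>k. k < r \<Longrightarrow> x k = x' k) \<Longrightarrow> (\<And>k. k < r \<Longrightarrow> y k = y' k) \<Longrightarrow> ip r x y = ip r x' y'"
  by (simp add: ip_def)

lemma gram_cong: "(\<And>i. i < n \<Longrightarrow> A i k = A' i k) \<Longrightarrow> (\<And>i. i < n \<Longrightarrow> B i l = B' i l) \<Longrightarrow> gram n A B k l = gram n A' B' k l"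
  by (simp add: gram_def)

text \<open>Entries of a matrix outside its dimensions are unspecified, so the parametrized factors
  agree with points on the line only inside the index range.\<close>

lemma line_objective_cong:
  assumes X: "\<And>i k. i < n1 \<Longrightarrow> k < r \<Longrightarrow> X i k = X' i k" and Y: "\<And>j k. j < n2 \<Longrightarrow> k < r \<Longrightarrow> Y j k = Y' j k"
    and M: "\<And>i j. i < n1 \<Longrightarrow> j < n2 \<Longrightarrow> M i j = M' i j"
  shows "line_objective n1 n2 r \<Omega> p \<alpha> lam M X Y = line_objective n1 n2 r \<Omega> p \<alpha> lam M' X' Y'"
proof -
  have 1: "ip r (X i) (Y j) = ip r (X' i) (Y' j)" if "i < n1" "j < n2" for i j
    by (rule ip_cong) (use X Y that in auto)
  have 2: "gram n1 X X k l = gram n1 X' X' k l" "gram n2 Y Y k l = gram n2 Y' Y' k l" if "k < r" "l < r" for k l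
    by (rule gram_cong; use X Y that in auto)+
  have 3: "l2 r (X i) = l2 r (X' i)" if "i < n1" for i by (rule l2_cong) (use X that in auto)
  have 4: "l2 r (Y i) = l2 r (Y' i)" if "i < n2" for i by (rule l2_cong) (use Y that in auto)
  show ?thesis unfolding line_objective_def
    by (intro arg_cong2[where f = "(+)"] arg_cong2[where f = "(*)"] sum.cong refl arg_cong2[where f = power] arg_cong2[where f = "(-)"])
      (simp_all add: 1 2 3 4 M)
qed

lemma frob_norm_power2:
  "A \<in> carrier_mat n m \<Longrightarrow> (frob_norm A)\<^sup>2 = (\<Sum>i<n. \<Sum>j<m. (ent A i j)\<^sup>2)"
  by (auto simp: frob_norm_def intro!: real_sqrt_pow2 sum_nonneg)

lemma ent_mult_transpose:
  "A \<in> carrier_mat n1 r \<Longrightarrow> B \<in> carrier_mat n2 r \<Longrightarrow> i < n1 \<Longrightarrow> j < n2 \<Longrightarrow> ent (A * B\<^sup>T) i j = ip r (ent A i) (ent B j)"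
  by (simp add: scalar_prod_def ip_def lessThan_atLeast0)

lemma ent_transpose_mult:
  "A \<in> carrier_mat n r \<Longrightarrow> B \<in> carrier_mat n s \<Longrightarrow> k < r \<Longrightarrow> l < s \<Longrightarrow> ent (A\<^sup>T * B) k l = gram n (ent A) (ent B) k l"
  by (simp add: scalar_prod_def gram_def lessThan_atLeast0)

lemma objective_eq:
  assumes X: "X \<theta> \<in> carrier_mat n1 r" and Y: "Y \<theta> \<in> carrier_mat n2 r" and M: "M \<in> carrier_mat n1 n2"
  shows "objective \<Omega> p M X Y \<alpha> lam \<theta> = line_objective n1 n2 r \<Omega> p \<alpha> lam (ent M) (ent (X \<theta>)) (ent (Y \<theta>))"
proof -
  have Z: "X \<theta> * (Y \<theta>)\<^sup>T - M \<in> carrier_mat n1 n2" using X Y M by auto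
  have R: "restrict_entries \<Omega> (X \<theta> * (Y \<theta>)\<^sup>T - M) \<in> carrier_mat n1 n2"
    using Z M by (simp add: restrict_entries_def)
  have e: "ent (restrict_entries \<Omega> (X \<theta> * (Y \<theta>)\<^sup>T - M)) i j = of_bool ((i, j) \<in> \<Omega>) * (ip r (ent (X \<theta>) i) (ent (Y \<theta>) j) - ent M i j)"
    if "i < n1" "j < n2" for i j
    using that M X Y ent_mult_transpose[OF X Y that] by (simp add: restrict_entries_def)
  have 1: "(frob_norm (restrict_entries \<Omega> (X \<theta> * (Y \<theta>)\<^sup>T - M)))\<^sup>2
     = (\<Sum>i<n1. \<Sum>j<n2. of_bool ((i, j) \<in> \<Omega>) * (ip r (ent (X \<theta>) i) (ent (Y \<theta>) j) - ent M i j)\<^sup>2)"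
    unfolding frob_norm_power2[OF R]
  proof (intro sum.cong refl)
    fix i j assume "i \<in> {..<n1}" "j \<in> {..<n2}"
    then show "(ent (restrict_entries \<Omega> (X \<theta> * (Y \<theta>)\<^sup>T - M)) i j)\<^sup>2 = of_bool ((i, j) \<in> \<Omega>) * (ip r (ent (X \<theta>) i) (ent (Y \<theta>) j) - ent M i j)\<^sup>2"
      using e[of i j] by (cases "(i, j) \<in> \<Omega>") auto
  qed
  have G: "(X \<theta>)\<^sup>T * X \<theta> - (Y \<theta>)\<^sup>T * Y \<theta> \<in> carrier_mat r r" using X Y by auto
  have 2: "(frob_norm ((X \<theta>)\<^sup>T * X \<theta> - (Y \<theta>)\<^sup>T * Y \<theta>))\<^sup>2
     = (\<Sum>k<r. \<Sum>l<r. (gram n1 (ent (X \<theta>)) (ent (X \<theta>)) k l - gram n2 (ent (Y \<theta>)) (ent (Y \<theta>)) k l)\<^sup>2)"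
    unfolding frob_norm_power2[OF G]
  proof (intro sum.cong refl)
    fix k l assume "k \<in> {..<r}" "l \<in> {..<r}"
    then have kl: "k < r" "l < r" by auto
    have "ent ((X \<theta>)\<^sup>T * X \<theta> - (Y \<theta>)\<^sup>T * Y \<theta>) k l = ent ((X \<theta>)\<^sup>T * X \<theta>) k l - ent ((Y \<theta>)\<^sup>T * Y \<theta>) k l"
      using kl X Y by simp
    then show "(ent ((X \<theta>)\<^sup>T * X \<theta> - (Y \<theta>)\<^sup>T * Y \<theta>) k l)\<^sup>2
       = (gram n1 (ent (X \<theta>)) (ent (X \<theta>)) k l - gram n2 (ent (Y \<theta>)) (ent (Y \<theta>)) k l)\<^sup>2"
      unfolding ent_transpose_mult[OF X X kl] ent_transpose_mult[OF Y Y kl] by simp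
  qed
  have 3: "row_penalty \<alpha> A = (\<Sum>i<n. penalty \<alpha> (l2 r (ent A i)))" if A: "A \<in> carrier_mat n r" for A n
  proof -
    have "vnorm (Matrix.row A i) = l2 r (ent A i)" if "i < n" for i
    proof -
      have "Matrix.row A i \<in> carrier_vec r" using A that by auto
      then have "vnorm (Matrix.row A i) = l2 r (cmp (Matrix.row A i))" by (rule vnorm_l2)
      also have "\<dots> = l2 r (ent A i)" by (rule l2_cong) (use A that in auto)
      finally show ?thesis .
    qed
    then show ?thesis using A by (simp add: row_penalty_def penalty_def)
  qed
  show ?thesis unfolding objective_def line_objective_def 1 2 3[OF X] 3[OF Y] ..
qed

lemma orthonormal_columns_isotropic:
  fixes W :: "real mat"
  assumes W: "W \<in> carrier_mat n r" "W\<^sup>T * W = 1\<^sub>m r"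
  shows "(\<Sum>i<n. (\<Sum>k<r. ent W i k * x k)\<^sup>2) = (l2 r x)\<^sup>2"
proof -
  have g: "gram n (ent W) (ent W) k l = of_bool (k = l)" if "k < r" "l < r" for k l
    unfolding ent_transpose_mult[OF W(1) W(1) that, symmetric] W(2) using that by simp
  have "(\<Sum>i<n. (\<Sum>k<r. ent W i k * x k)\<^sup>2) = (\<Sum>i<n. \<Sum>k<r. \<Sum>l<r. (ent W i k * ent W i l) * (x k * x l))"
    unfolding power2_eq_square sum_product by (intro sum.cong refl) (simp add: mult_ac)
  also have "\<dots> = (\<Sum>k<r. \<Sum>l<r. gram n (ent W) (ent W) k l * (x k * x l))"
    unfolding gram_def sum_distrib_right by (subst sum.swap, rule sum.cong[OF refl], rule sum.swap)
  also have "\<dots> = (\<Sum>k<r. \<Sum>l<r. of_bool (k = l) * (x k * x l))" using g by (intro sum.cong refl) simp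
  also have "\<dots> = (\<Sum>k<r. x k * x k)"
    by (intro sum.cong refl) (simp add: of_bool_def if_distrib[of "\<lambda>x. x * _"] cong: if_cong)
  finally show ?thesis by (simp add: l2_mult_self)
qed

lemma ent_minus:
  "A \<in> carrier_mat n m \<Longrightarrow> B \<in> carrier_mat n m \<Longrightarrow> i < n \<Longrightarrow> j < m \<Longrightarrow> ent (A - B) i j = ent A i j - ent B i j"
  by simp

text \<open>The deterministic half: on a regular sample the correlated factorization supplies
  symmetry, semidefiniteness and balance, the line through the two parameters supplies the
  second-order condition, and \<open>deterministic_recovery\<close> combines them.\<close>

lemma local_min_recovery:
  fixes Mstar U V N :: "real mat" and X Y :: "real Matrix.vec \<Rightarrow> real mat"
  assumes r: "1 \<le> r" and U: "U \<in> carrier_mat n1 r" and V: "V \<in> carrier_mat n2 r"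
    and oU: "U\<^sup>T * U = 1\<^sub>m r" and oV: "V\<^sup>T * V = 1\<^sub>m r"
    and \<sigma>: "\<And>i. i < r \<Longrightarrow> smin \<le> \<sigma> i \<and> \<sigma> i \<le> smax" and smin: "0 < smin"
    and M: "Mstar = U * mat_diag r \<sigma> * V\<^sup>T"
    and X: "linear_param d n1 r X" and Y: "linear_param d n2 r Y"
    and cpf: "correlated_parametric_factorization d Mstar X Y"
    and N: "N \<in> carrier_mat n1 n2"
    and bU: "\<And>i. i < n1 \<Longrightarrow> (l2 r (ent U i))\<^sup>2 \<le> \<gamma>" and bV: "\<And>j. j < n2 \<Longrightarrow> (l2 r (ent V j))\<^sup>2 \<le> \<gamma>"
    and p: "0 < p" and reg: "sampling_regular n1 n2 r p (ent U) (ent V) \<Omega>"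
    and lam: "8 * (2 ^ 45 * sqrt (real (max n1 n2) * p) / p) \<le> lam"
    and \<alpha>: "0 < \<alpha>" "100 * sqrt (smax * \<gamma>) \<le> \<alpha>"
    and small: "6 * (2 ^ 45 * sqrt (real (max n1 n2) * p) / p) * (smax * \<gamma>) + lam * (20000 * \<alpha>\<^sup>2) \<le> smin / 20"
    and lmin: "local_min d (objective \<Omega> p (Mstar + N) X Y \<alpha> lam) th"
  shows "(frob_norm (Mstar - X th * (Y th)\<^sup>T))\<^sup>2 \<le> 27000 * (sqrt (real r) * noise_level d \<Omega> N X Y / p)\<^sup>2"
    and "N = 0\<^sub>m n1 n2 \<Longrightarrow> X th * (Y th)\<^sup>T = Mstar"
proof -
  have th: "th \<in> carrier_vec d" using lmin by (simp add: local_min_def)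
  obtain \<epsilon> where \<epsilon>: "0 < \<epsilon>" "\<And>\<theta>. \<theta> \<in> carrier_vec d \<Longrightarrow> vnorm (\<theta> - th) < \<epsilon> \<Longrightarrow>
      objective \<Omega> p (Mstar + N) X Y \<alpha> lam th \<le> objective \<Omega> p (Mstar + N) X Y \<alpha> lam \<theta>"
    using lmin by (auto simp: local_min_def)
  obtain xi where xi: "xi \<in> carrier_vec d" "Mstar = X xi * (Y xi)\<^sup>T" "(X xi)\<^sup>T * X xi = (Y xi)\<^sup>T * Y xi"
      "psd ((X th)\<^sup>T * X xi + (Y th)\<^sup>T * Y xi)"
    using cpf th by (auto simp: correlated_parametric_factorization_def)
  have Xc: "X v \<in> carrier_mat n1 r" and Yc: "Y v \<in> carrier_mat n2 r" if "v \<in> carrier_vec d" for v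
    using X Y that by (simp_all add: linear_param_iff)
  have Xadd: "X (v + w) = X v + X w" and Yadd: "Y (v + w) = Y v + Y w" if "v \<in> carrier_vec d" "w \<in> carrier_vec d" for v w
    using X Y that by (simp_all add: linear_param_iff)
  have Xsc: "X (c \<cdot>\<^sub>v v) = c \<cdot>\<^sub>m X v" and Ysc: "Y (c \<cdot>\<^sub>v v) = c \<cdot>\<^sub>m Y v" if "v \<in> carrier_vec d" for c v
    using X Y that by (simp_all add: linear_param_iff)
  \<comment> \<open>By linearity the factors along this direction are Uf + (1 + t) \<Delta> and Vf +
    (1 + t) \<Gamma>: the local minimum is at t = 0 and the ground truth at t = -1.\<close>
  define dl where "dl = th - xi"
  have dl: "dl \<in> carrier_vec d" using th xi by (simp add: dl_def)
  have th_eq: "th = xi + dl" unfolding dl_def using th xi(1) by (intro eq_vecI) auto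
  define Uf where "Uf = ent (X xi)"
  define Vf where "Vf = ent (Y xi)"
  define \<Delta> where "\<Delta> = ent (X dl)"
  define \<Gamma> where "\<Gamma> = ent (Y dl)"
  have Xline: "ent (X (th + t \<cdot>\<^sub>v dl)) i k = Uf i k + \<Delta> i k + t * \<Delta> i k" if "i < n1" "k < r" for t i k
  proof -
    have "X (th + t \<cdot>\<^sub>v dl) = (X xi + X dl) + t \<cdot>\<^sub>m X dl"
      using th dl xi(1) by (simp add: Xadd Xsc) (simp add: th_eq Xadd)
    then show ?thesis using that Xc[OF dl] Xc[OF xi(1)] by (simp add: Uf_def \<Delta>_def)
  qed
  have Yline: "ent (Y (th + t \<cdot>\<^sub>v dl)) i k = Vf i k + \<Gamma> i k + t * \<Gamma> i k" if "i < n2" "k < r" for t i k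
  proof -
    have "Y (th + t \<cdot>\<^sub>v dl) = (Y xi + Y dl) + t \<cdot>\<^sub>m Y dl"
      using th dl xi(1) by (simp add: Yadd Ysc) (simp add: th_eq Yadd)
    then show ?thesis using that Yc[OF dl] Yc[OF xi(1)] by (simp add: Vf_def \<Gamma>_def)
  qed
  have Xth: "ent (X th) i k = Uf i k + \<Delta> i k" if "i < n1" "k < r" for i k
    unfolding th_eq Xadd[OF xi(1) dl] using that Xc[OF dl] Xc[OF xi(1)] by (simp add: Uf_def \<Delta>_def)
  have Yth: "ent (Y th) i k = Vf i k + \<Gamma> i k" if "i < n2" "k < r" for i k
    unfolding th_eq Yadd[OF xi(1) dl] using that Yc[OF dl] Yc[OF xi(1)] by (simp add: Vf_def \<Gamma>_def)
  define P where "P = (\<lambda>i j. ip r (\<Delta> i) (Vf j))"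
  define Q where "Q = (\<lambda>i j. ip r (Uf i) (\<Gamma> j))"
  define D where "D = (\<lambda>i j. ip r (\<Delta> i) (\<Gamma> j))"
  have Mc: "Mstar \<in> carrier_mat n1 n2" unfolding M using U V by auto
  have entM: "ent Mstar i j = ip r (Uf i) (Vf j)" if "i < n1" "j < n2" for i j
    unfolding xi(2) Uf_def Vf_def by (rule ent_mult_transpose[OF Xc[OF xi(1)] Yc[OF xi(1)] that])
  have bal: "gram n1 Uf Uf k l = gram n2 Vf Vf k l" if "k < r" "l < r" for k l
    using ent_transpose_mult[OF Xc[OF xi(1)] Xc[OF xi(1)] that] ent_transpose_mult[OF Yc[OF xi(1)] Yc[OF xi(1)] that] xi(3)
    by (simp add: Uf_def Vf_def)
  let ?A = "(X th)\<^sup>T * X xi + (Y th)\<^sup>T * Y xi"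
  have Ac: "?A \<in> carrier_mat r r"
    by (intro add_carrier_mat mult_carrier_mat[OF transpose_carrier_mat[THEN iffD2, OF Yc[OF th]] Yc[OF xi(1)]])
  have entA: "ent ?A k l = gram n1 Uf \<Delta> l k + gram n2 Vf \<Gamma> l k + 2 * gram n1 Uf Uf k l" if kl: "k < r" "l < r" for k l
  proof -
    have "ent ?A k l = ent ((X th)\<^sup>T * X xi) k l + ent ((Y th)\<^sup>T * Y xi) k l"
      using kl Xc[OF th] Yc[OF th] Xc[OF xi(1)] Yc[OF xi(1)] by simp
    also have "\<dots> = gram n1 (ent (X th)) Uf k l + gram n2 (ent (Y th)) Vf k l"
      unfolding Uf_def Vf_def ent_transpose_mult[OF Xc[OF th] Xc[OF xi(1)] kl] ent_transpose_mult[OF Yc[OF th] Yc[OF xi(1)] kl] ..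
    also have "gram n1 (ent (X th)) Uf k l = gram n1 Uf Uf k l + gram n1 Uf \<Delta> l k"
      unfolding gram_def sum.distrib[symmetric] using Xth kl by (intro sum.cong refl) (simp add: algebra_simps)
    also have "gram n2 (ent (Y th)) Vf k l = gram n2 Vf Vf k l + gram n2 Vf \<Gamma> l k"
      unfolding gram_def sum.distrib[symmetric] using Yth kl by (intro sum.cong refl) (simp add: algebra_simps)
    finally show ?thesis using bal[OF kl] by simp
  qed
  have sym: "gram n1 Uf \<Delta> k l + gram n2 Vf \<Gamma> k l = gram n1 Uf \<Delta> l k + gram n2 Vf \<Gamma> l k" if kl: "k < r" "l < r" for k l
  proof -
    have "?A\<^sup>T = ?A" using xi(4) by (simp add: psd_def)
    then have "ent ?A\<^sup>T k l = ent ?A k l" by simp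
    then have "ent ?A l k = ent ?A k l" using kl Ac by (metis carrier_matD index_transpose_mat(1))
    then show ?thesis unfolding entA[OF kl] entA[OF kl(2,1)] using gram_self_sym[of n1 Uf k l] by simp
  qed
  have psd': "0 \<le> (\<Sum>k<r. \<Sum>l<r. x k * (gram n1 Uf \<Delta> k l + gram n2 Vf \<Gamma> k l + 2 * gram n1 Uf Uf k l) * x l)" for x
  proof -
    define v where "v = Matrix.vec r x"
    have v: "v \<in> carrier_vec r" by (simp add: v_def)
    have "0 \<le> scalar_prod v (?A *\<^sub>v v)" using xi(4) Ac v unfolding psd_def by auto
    also have "\<dots> = (\<Sum>k<r. \<Sum>l<r. x k * ent ?A k l * x l)"
    proof -
      have "scalar_prod v (?A *\<^sub>v v) = (\<Sum>k<r. cmp v k * cmp (?A *\<^sub>v v) k)"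
        by (rule scalar_prod_sum[OF mult_mat_vec_carrier[OF Ac v]])
      also have "\<dots> = (\<Sum>k<r. \<Sum>l<r. x k * ent ?A k l * x l)"
      proof (rule sum.cong[OF refl])
        fix k assume "k \<in> {..<r}"
        then have k: "k < r" by simp
        show "cmp v k * cmp (?A *\<^sub>v v) k = (\<Sum>l<r. x k * ent ?A k l * x l)"
          unfolding mult_mat_vec_apply[OF Ac v k] sum_distrib_left using k by (intro sum.cong refl) (simp add: v_def mult.assoc)
      qed
      finally show ?thesis .
    qed
    also have "\<dots> = (\<Sum>k<r. \<Sum>l<r. x k * (gram n1 Uf \<Delta> k l + gram n2 Vf \<Gamma> k l + 2 * gram n1 Uf Uf k l) * x l)"
      using entA sym by (intro sum.cong refl) simp
    finally show ?thesis .
  qed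
  have M1: "X xi * (Y xi)\<^sup>T = U * mat_diag r \<sigma> * V\<^sup>T" using xi(2) M by simp
  have M2: "Y xi * (X xi)\<^sup>T = V * mat_diag r \<sigma> * U\<^sup>T"
  proof -
    have YT: "(Y xi)\<^sup>T \<in> carrier_mat r n2" and VT: "V\<^sup>T \<in> carrier_mat r n2" and UT: "U\<^sup>T \<in> carrier_mat r n1" using Yc[OF xi(1)] U V by auto
    have L: "mat_diag r \<sigma> \<in> carrier_mat r r" by simp
    have LT: "(mat_diag r \<sigma>)\<^sup>T = mat_diag r \<sigma>" by (intro eq_matI) (auto simp: mat_diag_def)
    have "Y xi * (X xi)\<^sup>T = (X xi * (Y xi)\<^sup>T)\<^sup>T" unfolding transpose_mult[OF Xc[OF xi(1)] YT] by simp
    also have "\<dots> = V * (U * mat_diag r \<sigma>)\<^sup>T" unfolding M1 transpose_mult[OF mult_carrier_mat[OF U L] VT] by simp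
    also have "\<dots> = V * (mat_diag r \<sigma> * U\<^sup>T)" unfolding transpose_mult[OF U L] LT ..
    also have "\<dots> = V * mat_diag r \<sigma> * U\<^sup>T" by (rule assoc_mult_mat[OF V L UT, symmetric])
    finally show ?thesis .
  qed
  \<comment> \<open>Used for both factors. The last clause rewrites a combination of columns of the
    factor as one of singular vectors, with the same norm; it transports the restricted bound from
    the singular vectors to the factor.\<close>
  have factor: "(\<forall>i<n. (l2 r (F i))\<^sup>2 \<le> smax * \<gamma>) \<and> (\<forall>x. smin * (l2 r x)\<^sup>2 \<le> (\<Sum>i<n. (ip r (F i) x)\<^sup>2)) \<and>
      (\<forall>x. \<exists>y. (\<forall>i<n. ip r (F i) x = (\<Sum>k<r. ent W i k * y k)) \<and> (\<Sum>i<n. (ip r (F i) x)\<^sup>2) = (l2 r y)\<^sup>2)"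
    if W: "W \<in> carrier_mat n r" "W\<^sup>T * W = 1\<^sub>m r" and bW: "\<And>i. i < n \<Longrightarrow> (l2 r (ent W i))\<^sup>2 \<le> \<gamma>"
      and R: "\<forall>i<n. \<forall>k<r. F i k = (\<Sum>l<r. ent W i l * R l k)"
        "\<forall>y. (\<Sum>k<r. (\<Sum>l<r. R l k * y l)\<^sup>2) \<le> smax * (l2 r y)\<^sup>2"
        "\<forall>x. smin * (l2 r x)\<^sup>2 \<le> (\<Sum>l<r. (\<Sum>k<r. R l k * x k)\<^sup>2)" for W :: "real mat" and n F and R :: "nat \<Rightarrow> nat \<Rightarrow> real"
  proof -
    have smax: "0 \<le> smax" using \<sigma>[of 0] smin r by auto
    have ipF: "ip r (F i) x = (\<Sum>l<r. ent W i l * (\<Sum>k<r. R l k * x k))" if "i < n" for i x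
    proof -
      have "ip r (F i) x = (\<Sum>k<r. \<Sum>l<r. ent W i l * R l k * x k)"
        unfolding ip_def using R(1) that by (intro sum.cong refl) (simp add: sum_distrib_right)
      also have "\<dots> = (\<Sum>l<r. \<Sum>k<r. ent W i l * R l k * x k)" by (rule sum.swap)
      finally show ?thesis by (simp add: sum_distrib_left mult.assoc)
    qed
    have isoF: "(\<Sum>i<n. (ip r (F i) x)\<^sup>2) = (l2 r (\<lambda>l. \<Sum>k<r. R l k * x k))\<^sup>2" for x
      using orthonormal_columns_isotropic[OF W, of "\<lambda>l. \<Sum>k<r. R l k * x k"] ipF by simp
    have "(l2 r (F i))\<^sup>2 \<le> smax * \<gamma>" if i: "i < n" for i
    proof -
      have "(l2 r (F i))\<^sup>2 = (\<Sum>k<r. (\<Sum>l<r. R l k * ent W i l)\<^sup>2)"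
        unfolding l2_power2 using R(1) i by (intro sum.cong refl) (simp add: mult.commute)
      also have "\<dots> \<le> smax * (l2 r (ent W i))\<^sup>2" by (rule R(2)[rule_format])
      also have "\<dots> \<le> smax * \<gamma>" using bW[OF i] smax by (rule mult_left_mono)
      finally show ?thesis .
    qed
    moreover have "smin * (l2 r x)\<^sup>2 \<le> (\<Sum>i<n. (ip r (F i) x)\<^sup>2)" for x
      unfolding isoF l2_power2[of "\<lambda>l. \<Sum>k<r. R l k * x k"] using R(3) by blast
    moreover have "\<exists>y. (\<forall>i<n. ip r (F i) x = (\<Sum>k<r. ent W i k * y k)) \<and> (\<Sum>i<n. (ip r (F i) x)\<^sup>2) = (l2 r y)\<^sup>2" for x
      by (rule exI[of _ "\<lambda>l. \<Sum>k<r. R l k * x k"], intro conjI allI impI, erule ipF, rule isoF)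
    ultimately show ?thesis by simp
  qed
  obtain R1 :: "nat \<Rightarrow> nat \<Rightarrow> real" where "\<forall>i<n1. \<forall>k<r. Uf i k = (\<Sum>l<r. ent U i l * R1 l k)"
        "\<forall>y. (\<Sum>k<r. (\<Sum>l<r. R1 l k * y l)\<^sup>2) \<le> smax * (l2 r y)\<^sup>2"
        "\<forall>x. smin * (l2 r x)\<^sup>2 \<le> (\<Sum>l<r. (\<Sum>k<r. R1 l k * x k)\<^sup>2)"
    using balanced_factor[OF Xc[OF xi(1)] Yc[OF xi(1)] U V oU oV \<sigma> smin r M1 xi(3)] unfolding Uf_def by blast
  note FU = factor[OF U oU bU this]
  obtain R2 :: "nat \<Rightarrow> nat \<Rightarrow> real" where "\<forall>i<n2. \<forall>k<r. Vf i k = (\<Sum>l<r. ent V i l * R2 l k)"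
        "\<forall>y. (\<Sum>k<r. (\<Sum>l<r. R2 l k * y l)\<^sup>2) \<le> smax * (l2 r y)\<^sup>2"
        "\<forall>x. smin * (l2 r x)\<^sup>2 \<le> (\<Sum>l<r. (\<Sum>k<r. R2 l k * x k)\<^sup>2)"
    using balanced_factor[OF Yc[OF xi(1)] Xc[OF xi(1)] V U oV oU \<sigma> smin r M2 xi(3)[symmetric]] unfolding Vf_def by blast
  note FV = factor[OF V oV bV this]
  let ?B = "smax * \<gamma>" and ?h = "2 ^ 45 * sqrt (real (max n1 n2) * p)"
  define \<psi> where "\<psi> = noise_level d \<Omega> N X Y"
  note nb = noise_level_bound[OF Xc Yc N]
  have \<psi>0: "0 \<le> \<psi>" unfolding \<psi>_def by (rule nb(2)[OF _ _ th th])
  have uB: "l2 r (Uf i) \<le> sqrt ?B" if "i < n1" for i using FU that by (intro real_le_rsqrt) auto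
  have vB: "l2 r (Vf i) \<le> sqrt ?B" if "i < n2" for i using FV that by (intro real_le_rsqrt) auto
  have lam0: "0 \<le> lam"
  proof -
    have "0 \<le> 8 * (?h / p)" using p by simp
    then show ?thesis using lam by linarith
  qed
  have obj: "objective \<Omega> p (Mstar + N) X Y \<alpha> lam (th + t \<cdot>\<^sub>v dl)
     = line_objective n1 n2 r \<Omega> p \<alpha> lam (\<lambda>i j. ip r (Uf i) (Vf j) + ent N i j)
        (\<lambda>i k. Uf i k + \<Delta> i k + t * \<Delta> i k) (\<lambda>j k. Vf j k + \<Gamma> j k + t * \<Gamma> j k)" for t
  proof -
    have c: "th + t \<cdot>\<^sub>v dl \<in> carrier_vec d" using th dl by auto
    have "Mstar + N \<in> carrier_mat n1 n2" using Mc N by auto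
    then have "objective \<Omega> p (Mstar + N) X Y \<alpha> lam (th + t \<cdot>\<^sub>v dl) = line_objective n1 n2 r \<Omega> p \<alpha> lam (ent (Mstar + N))
        (ent (X (th + t \<cdot>\<^sub>v dl))) (ent (Y (th + t \<cdot>\<^sub>v dl)))"
      by (rule objective_eq[where X = X and Y = Y, OF Xc[OF c] Yc[OF c]])
    also have "\<dots> = line_objective n1 n2 r \<Omega> p \<alpha> lam (\<lambda>i j. ip r (Uf i) (Vf j) + ent N i j)
        (\<lambda>i k. Uf i k + \<Delta> i k + t * \<Delta> i k) (\<lambda>j k. Vf j k + \<Gamma> j k + t * \<Gamma> j k)"
      by (rule line_objective_cong) (use Xline Yline entM Mc N in auto)
    finally show ?thesis .
  qed
  have K: "0 \<le> (sampled_inner n1 n2 \<Omega> D D - 3 * sampled_inner n1 n2 \<Omega> (\<lambda>i j. P i j + Q i j + D i j) (\<lambda>i j. P i j + Q i j + D i j)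
         + 4 * (sampled_inner n1 n2 \<Omega> (ent N) (\<lambda>i j. P i j + D i j) + sampled_inner n1 n2 \<Omega> (ent N) Q) + 2 * sampled_inner n1 n2 \<Omega> (ent N) D) / p
      + (fro r (\<lambda>k l. gram n1 \<Delta> \<Delta> k l - gram n2 \<Gamma> \<Gamma> k l) (\<lambda>k l. gram n1 \<Delta> \<Delta> k l - gram n2 \<Gamma> \<Gamma> k l)
        - 3 * fro r (\<lambda>k l. (gram n1 Uf \<Delta> k l + gram n1 Uf \<Delta> l k + gram n1 \<Delta> \<Delta> k l) - (gram n2 Vf \<Gamma> k l + gram n2 Vf \<Gamma> l k + gram n2 \<Gamma> \<Gamma> k l))
          (\<lambda>k l. (gram n1 Uf \<Delta> k l + gram n1 Uf \<Delta> l k + gram n1 \<Delta> \<Delta> k l) - (gram n2 Vf \<Gamma> k l + gram n2 Vf \<Gamma> l k + gram n2 \<Gamma> \<Gamma> k l))) / 4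
      + lam * (20000 * \<alpha>\<^sup>2 * ((\<Sum>i<n1. (l2 r (\<Delta> i))\<^sup>2) + (\<Sum>j<n2. (l2 r (\<Gamma> j))\<^sup>2)) - ((\<Sum>i<n1. (l2 r (\<Delta> i)) ^ 4) + (\<Sum>j<n2. (l2 r (\<Gamma> j)) ^ 4)) / 2)"
    unfolding P_def Q_def D_def
  proof (rule second_order_condition[OF bal p lam0 \<alpha>(1,2) uB vB])
    \<comment> \<open>The added 1 keeps the radius positive also when \<open>dl\<close> is
      zero.\<close>
    show "0 < \<epsilon> / (vnorm dl + 1)" using \<epsilon>(1) vnorm_l2[OF dl] by (simp add: add_nonneg_pos)
    fix t :: real assume t: "\<bar>t\<bar> < \<epsilon> / (vnorm dl + 1)"
    have c: "th + t \<cdot>\<^sub>v dl \<in> carrier_vec d" using th dl by auto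
    have vn: "0 \<le> vnorm dl" using vnorm_l2[OF dl] by simp
    have "th + t \<cdot>\<^sub>v dl - th = t \<cdot>\<^sub>v dl" using th dl by (intro eq_vecI) auto
    then have "vnorm (th + t \<cdot>\<^sub>v dl - th) = \<bar>t\<bar> * vnorm dl"
      using dl vnorm_l2[of "t \<cdot>\<^sub>v dl" d] vnorm_l2[OF dl] l2_scale[of t "cmp dl" d] l2_cong[of d "cmp (t \<cdot>\<^sub>v dl)" "\<lambda>i. t * cmp dl i"] by simp
    also have "\<dots> \<le> \<bar>t\<bar> * (vnorm dl + 1)" by (intro mult_left_mono) auto
    also have "\<dots> < \<epsilon>" using t vn by (simp add: pos_less_divide_eq add_nonneg_pos)
    finally have "objective \<Omega> p (Mstar + N) X Y \<alpha> lam th \<le> objective \<Omega> p (Mstar + N) X Y \<alpha> lam (th + t \<cdot>\<^sub>v dl)"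
      by (rule \<epsilon>(2)[OF c])
    moreover have "th = th + 0 \<cdot>\<^sub>v dl" using th dl by (intro eq_vecI) auto
    ultimately have "objective \<Omega> p (Mstar + N) X Y \<alpha> lam (th + 0 \<cdot>\<^sub>v dl) \<le> objective \<Omega> p (Mstar + N) X Y \<alpha> lam (th + t \<cdot>\<^sub>v dl)"
      by simp
    then show "line_objective n1 n2 r \<Omega> p \<alpha> lam (\<lambda>i j. ip r (Uf i) (Vf j) + ent N i j)
        (\<lambda>i k. Uf i k + \<Delta> i k + 0 * \<Delta> i k) (\<lambda>j k. Vf j k + \<Gamma> j k + 0 * \<Gamma> j k)
       \<le> line_objective n1 n2 r \<Omega> p \<alpha> lam (\<lambda>i j. ip r (Uf i) (Vf j) + ent N i j)
        (\<lambda>i k. Uf i k + \<Delta> i k + t * \<Delta> i k) (\<lambda>j k. Vf j k + \<Gamma> j k + t * \<Gamma> j k)"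
      unfolding obj .
  qed
  have main: "full_inner n1 n2 (\<lambda>i j. P i j + Q i j + D i j) (\<lambda>i j. P i j + Q i j + D i j) \<le> 27000 * (sqrt (real r) * \<psi> / p)\<^sup>2"
    unfolding P_def Q_def D_def
  proof (rule deterministic_recovery[where h = ?h and B = ?B and s = smin and c = "20000 * \<alpha>\<^sup>2" and \<Omega> = \<Omega> and N = "ent N" and lam = lam])
    show "0 \<le> ?h" using p by simp
    show "\<bar>bil n1 n2 (\<lambda>i j. of_bool ((i, j) \<in> \<Omega>) - p) x y\<bar> \<le> ?h * l2 n1 x * l2 n2 y" for x y
      using reg unfolding sampling_regular_def by blast
    show "19/20 * p * (\<Sum>i<n1. (ip r (Uf i) (\<Gamma> j))\<^sup>2) \<le> (\<Sum>i<n1. of_bool ((i, j) \<in> \<Omega>) * (ip r (Uf i) (\<Gamma> j))\<^sup>2)" if j: "j < n2" for j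
    proof -
      obtain y where y: "\<forall>i<n1. ip r (Uf i) (\<Gamma> j) = (\<Sum>k<r. ent U i k * y k)" "(\<Sum>i<n1. (ip r (Uf i) (\<Gamma> j))\<^sup>2) = (l2 r y)\<^sup>2"
        using FU by blast
      have "19/20 * p * (l2 r y)\<^sup>2 \<le> (\<Sum>i<n1. of_bool ((i, j) \<in> \<Omega>) * (\<Sum>k<r. ent U i k * y k)\<^sup>2)"
        using reg j unfolding sampling_regular_def by blast
      also have "\<dots> = (\<Sum>i<n1. of_bool ((i, j) \<in> \<Omega>) * (ip r (Uf i) (\<Gamma> j))\<^sup>2)"
        using y(1) by (intro sum.cong refl) simp
      finally show ?thesis unfolding y(2) .
    qed
    have ipc: "ip r a b = ip r b a" for a b by (simp add: ip_def mult.commute)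
    show "19/20 * p * (\<Sum>j<n2. (ip r (\<Delta> i) (Vf j))\<^sup>2) \<le> (\<Sum>j<n2. of_bool ((i, j) \<in> \<Omega>) * (ip r (\<Delta> i) (Vf j))\<^sup>2)" if i: "i < n1" for i
    proof -
      obtain y where y: "\<forall>j<n2. ip r (Vf j) (\<Delta> i) = (\<Sum>k<r. ent V j k * y k)" "(\<Sum>j<n2. (ip r (Vf j) (\<Delta> i))\<^sup>2) = (l2 r y)\<^sup>2"
        using FV by blast
      have "19/20 * p * (l2 r y)\<^sup>2 \<le> (\<Sum>j<n2. of_bool ((i, j) \<in> \<Omega>) * (\<Sum>k<r. ent V j k * y k)\<^sup>2)"
        using reg i unfolding sampling_regular_def by blast
      also have "\<dots> = (\<Sum>j<n2. of_bool ((i, j) \<in> \<Omega>) * (ip r (Vf j) (\<Delta> i))\<^sup>2)"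
        using y(1) by (intro sum.cong refl) simp
      finally show ?thesis unfolding ipc[of "\<Delta> i"] y(2) .
    qed
    show "smin * (l2 r x)\<^sup>2 \<le> (\<Sum>i<n1. (ip r (Uf i) x)\<^sup>2)" for x using FU by blast
    show "smin * (l2 r x)\<^sup>2 \<le> (\<Sum>j<n2. (ip r x (Vf j))\<^sup>2)" for x unfolding ipc[of x] using FV by blast
    show "sampled_inner n1 n2 \<Omega> (ent N) (\<lambda>i j. ip r (\<Delta> i) (Vf j) + ip r (\<Delta> i) (\<Gamma> j))
       \<le> sqrt (real r) * \<psi> * sqrt (full_inner n1 n2 (\<lambda>i j. ip r (\<Delta> i) (Vf j) + ip r (\<Delta> i) (\<Gamma> j)) (\<lambda>i j. ip r (\<Delta> i) (Vf j) + ip r (\<Delta> i) (\<Gamma> j)))"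
    proof -
      \<comment> \<open>P + D is the product of \<open>X dl\<close> with the transpose of
        \<open>Y th\<close>, so the noise level applies with the parameters dl and th. The two
        remaining products belong to the pairs (xi, dl) and (dl, dl).\<close>
      have e: "ip r (\<Delta> i) (ent (Y th) j) = ip r (\<Delta> i) (Vf j) + ip r (\<Delta> i) (\<Gamma> j)" if "j < n2" for i j
        unfolding ip_def sum.distrib[symmetric] using Yth[OF that] by (intro sum.cong refl) (simp add: distrib_left)
      have "sampled_inner n1 n2 \<Omega> (ent N) (\<lambda>i j. ip r (\<Delta> i) (ent (Y th) j))
         \<le> sqrt (real r) * \<psi> * sqrt (full_inner n1 n2 (\<lambda>i j. ip r (\<Delta> i) (ent (Y th) j)) (\<lambda>i j. ip r (\<Delta> i) (ent (Y th) j)))"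
        unfolding \<Delta>_def \<psi>_def by (rule nb(1)[OF _ _ dl th])
      also have "full_inner n1 n2 (\<lambda>i j. ip r (\<Delta> i) (ent (Y th) j)) (\<lambda>i j. ip r (\<Delta> i) (ent (Y th) j))
        = full_inner n1 n2 (\<lambda>i j. ip r (\<Delta> i) (Vf j) + ip r (\<Delta> i) (\<Gamma> j)) (\<lambda>i j. ip r (\<Delta> i) (Vf j) + ip r (\<Delta> i) (\<Gamma> j))"
        by (intro sum.cong refl) (simp add: e)
      also have "sampled_inner n1 n2 \<Omega> (ent N) (\<lambda>i j. ip r (\<Delta> i) (ent (Y th) j))
        = sampled_inner n1 n2 \<Omega> (ent N) (\<lambda>i j. ip r (\<Delta> i) (Vf j) + ip r (\<Delta> i) (\<Gamma> j))"
        unfolding sampled_inner_def by (intro sum.cong refl) (simp add: e)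
      finally show ?thesis .
    qed
    show "sampled_inner n1 n2 \<Omega> (ent N) (\<lambda>i j. ip r (Uf i) (\<Gamma> j))
       \<le> sqrt (real r) * \<psi> * sqrt (full_inner n1 n2 (\<lambda>i j. ip r (Uf i) (\<Gamma> j)) (\<lambda>i j. ip r (Uf i) (\<Gamma> j)))"
      unfolding Uf_def \<Gamma>_def \<psi>_def by (rule nb(1)[OF _ _ xi(1) dl])
    show "sampled_inner n1 n2 \<Omega> (ent N) (\<lambda>i j. ip r (\<Delta> i) (\<Gamma> j))
       \<le> sqrt (real r) * \<psi> * sqrt (full_inner n1 n2 (\<lambda>i j. ip r (\<Delta> i) (\<Gamma> j)) (\<lambda>i j. ip r (\<Delta> i) (\<Gamma> j)))"
      unfolding \<Delta>_def \<Gamma>_def \<psi>_def by (rule nb(1)[OF _ _ dl dl])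
    show "0 \<le> sqrt (real r) * \<psi>" using \<psi>0 by simp
  qed (use bal sym psd' p lam small FU FV K[unfolded P_def Q_def D_def] in blast)+
  have Rc: "X th * (Y th)\<^sup>T \<in> carrier_mat n1 n2" using Xc[OF th] Yc[OF th] by auto
  have err: "(frob_norm (Mstar - X th * (Y th)\<^sup>T))\<^sup>2 = full_inner n1 n2 (\<lambda>i j. P i j + Q i j + D i j) (\<lambda>i j. P i j + Q i j + D i j)"
  proof -
    have "Mstar - X th * (Y th)\<^sup>T \<in> carrier_mat n1 n2" by (rule minus_carrier_mat[OF Rc])
    then have "(frob_norm (Mstar - X th * (Y th)\<^sup>T))\<^sup>2 = (\<Sum>i<n1. \<Sum>j<n2. (ent (Mstar - X th * (Y th)\<^sup>T) i j)\<^sup>2)"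
      by (rule frob_norm_power2)
    also have "\<dots> = full_inner n1 n2 (\<lambda>i j. P i j + Q i j + D i j) (\<lambda>i j. P i j + Q i j + D i j)"
    proof (intro sum.cong refl)
      fix i j assume "i \<in> {..<n1}" "j \<in> {..<n2}"
      then have ij: "i < n1" "j < n2" by auto
      have "ip r (ent (X th) i) (ent (Y th) j) = ip r (Uf i) (Vf j) + (P i j + Q i j + D i j)"
        unfolding P_def Q_def D_def ip_def sum.distrib[symmetric] using Xth[OF ij(1)] Yth[OF ij(2)]
        by (intro sum.cong refl) (simp add: algebra_simps)
      moreover have "ent (Mstar - X th * (Y th)\<^sup>T) i j = ent Mstar i j - ent (X th * (Y th)\<^sup>T) i j"
        by (rule ent_minus[OF Mc Rc ij])
      ultimately have "ent (Mstar - X th * (Y th)\<^sup>T) i j = - (P i j + Q i j + D i j)"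
        unfolding entM[OF ij] ent_mult_transpose[OF Xc[OF th] Yc[OF th] ij] by simp
      then show "(ent (Mstar - X th * (Y th)\<^sup>T) i j)\<^sup>2 = (P i j + Q i j + D i j) * (P i j + Q i j + D i j)"
        by (simp only: power2_minus power2_eq_square[symmetric])
    qed
    finally show ?thesis .
  qed
  show bound: "(frob_norm (Mstar - X th * (Y th)\<^sup>T))\<^sup>2 \<le> 27000 * (sqrt (real r) * noise_level d \<Omega> N X Y / p)\<^sup>2"
    using main unfolding err \<psi>_def .
  assume "N = 0\<^sub>m n1 n2"
  then have "noise_level d \<Omega> N X Y = 0" by (intro nb(3)[OF _ _ th th]) auto
  then have z: "(frob_norm (Mstar - X th * (Y th)\<^sup>T))\<^sup>2 \<le> 0" using bound by simp
  have dc: "Mstar - X th * (Y th)\<^sup>T \<in> carrier_mat n1 n2" by (rule minus_carrier_mat[OF Rc])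
  show "X th * (Y th)\<^sup>T = Mstar"
  proof (rule eq_matI)
    fix i j assume "i < dim_row Mstar" "j < dim_col Mstar"
    then have ij: "i < n1" "j < n2" using Mc by auto
    have "(ent (Mstar - X th * (Y th)\<^sup>T) i j)\<^sup>2 \<le> (\<Sum>j<n2. (ent (Mstar - X th * (Y th)\<^sup>T) i j)\<^sup>2)"
      using ij by (intro member_le_sum) auto
    also have "\<dots> \<le> (\<Sum>i<n1. \<Sum>j<n2. (ent (Mstar - X th * (Y th)\<^sup>T) i j)\<^sup>2)"
      using ij by (intro member_le_sum[where f = "\<lambda>i. \<Sum>j<n2. (ent (Mstar - X th * (Y th)\<^sup>T) i j)\<^sup>2"]) (auto intro: sum_nonneg)
    also have "\<dots> \<le> 0" using z unfolding frob_norm_power2[OF dc] .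
    finally have "ent (Mstar - X th * (Y th)\<^sup>T) i j = 0" by simp
    then show "(X th * (Y th)\<^sup>T) $$ (i, j) = Mstar $$ (i, j)" unfolding ent_minus[OF Mc Rc ij] by simp
  qed (use Mc Rc in auto)
qed

section \<open>Incoherence, sampling rate and tuning constants\<close>

lemma incoherence_bounds:
  assumes U: "U \<in> carrier_mat n1 r" and V: "V \<in> carrier_mat n2 r" and r: "1 \<le> r"
    and oU: "U\<^sup>T * U = 1\<^sub>m r" and oV: "V\<^sup>T * V = 1\<^sub>m r"
  shows "1 \<le> incoherence n1 n2 r U V" and "1 \<le> n1" and "1 \<le> n2"
    and "\<And>i. i < n1 \<Longrightarrow> (l2 r (ent U i))\<^sup>2 \<le> incoherence n1 n2 r U V * real r / real n1"
    and "\<And>j. j < n2 \<Longrightarrow> (l2 r (ent V j))\<^sup>2 \<le> incoherence n1 n2 r U V * real r / real n2"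
proof -
  have row: "(vnorm (Matrix.row W i))\<^sup>2 = (l2 r (ent W i))\<^sup>2" if "W \<in> carrier_mat n r" "i < n" for W :: "real mat" and n i
  proof -
    have "Matrix.row W i \<in> carrier_vec r" using that by auto
    then have "vnorm (Matrix.row W i) = l2 r (cmp (Matrix.row W i))" by (rule vnorm_l2)
    also have "\<dots> = l2 r (ent W i)" by (rule l2_cong) (use that in auto)
    finally show ?thesis by simp
  qed
  have key: "1 \<le> n \<and> 1 \<le> real n / real r * Max ((\<lambda>i. (vnorm (Matrix.row W i))\<^sup>2) ` {..<n})
     \<and> (\<forall>i<n. (l2 r (ent W i))\<^sup>2 \<le> (real n / real r * Max ((\<lambda>i. (vnorm (Matrix.row W i))\<^sup>2) ` {..<n})) * real r / real n)"
    if W: "W \<in> carrier_mat n r" "W\<^sup>T * W = 1\<^sub>m r" for W :: "real mat" and n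
  proof -
    let ?m = "Max ((\<lambda>i. (vnorm (Matrix.row W i))\<^sup>2) ` {..<n})"
    have le: "(l2 r (ent W i))\<^sup>2 \<le> ?m" if "i < n" for i
      unfolding row[OF W(1) that, symmetric] using that by (intro Max_ge) auto
    \<comment> \<open>The squared row norms add up to \<open>r\<close>, so their maximum is at least
      r / n; this gives incoherence at least one and rules out n = 0.\<close>
    have "real r = (\<Sum>k<r. (\<Sum>i<n. (\<Sum>l<r. ent W i l * of_bool (l = k))\<^sup>2))"
    proof -
      have "(\<Sum>l<r. (of_bool (l = k) :: real)\<^sup>2) = 1" if "k < r" for k
      proof -
        have "(\<Sum>l<r. (of_bool (l = k) :: real)\<^sup>2) = (\<Sum>l<r. if l = k then 1 else 0)"
          by (rule sum.cong) auto
        then show ?thesis using that by simp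
      qed
      then show ?thesis unfolding orthonormal_columns_isotropic[OF W] l2_power2 by simp
    qed
    also have "\<dots> = (\<Sum>k<r. \<Sum>i<n. (ent W i k)\<^sup>2)"
      by (intro sum.cong refl arg_cong[where f = "\<lambda>x. x\<^sup>2"]) (simp add: of_bool_def if_distrib[of "\<lambda>x. _ * x"] cong: if_cong)
    also have "\<dots> = (\<Sum>i<n. (l2 r (ent W i))\<^sup>2)" unfolding l2_power2 by (rule sum.swap)
    also have "\<dots> \<le> real n * ?m" using sum_bounded_above[of "{..<n}" "\<lambda>i. (l2 r (ent W i))\<^sup>2" ?m] le by simp
    finally have s: "real r \<le> real n * ?m" .
    then have "1 \<le> n" using r by (cases n) auto
    then show ?thesis using s r le by (auto simp: field_simps)
  qed
  note kU = key[OF U oU] and kV = key[OF V oV]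
  let ?a = "real n1 / real r * Max ((\<lambda>i. (vnorm (Matrix.row U i))\<^sup>2) ` {..<n1})"
  let ?b = "real n2 / real r * Max ((\<lambda>i. (vnorm (Matrix.row V i))\<^sup>2) ` {..<n2})"
  have inc: "?a \<le> incoherence n1 n2 r U V" "?b \<le> incoherence n1 n2 r U V" by (simp_all add: incoherence_def)
  show "1 \<le> n1" "1 \<le> n2" using kU kV by blast+
  show "1 \<le> incoherence n1 n2 r U V" using kU inc by linarith
  show "(l2 r (ent U i))\<^sup>2 \<le> incoherence n1 n2 r U V * real r / real n1" if "i < n1" for i
  proof -
    have "(l2 r (ent U i))\<^sup>2 \<le> ?a * real r / real n1" using kU that by blast
    also have "\<dots> \<le> incoherence n1 n2 r U V * real r / real n1" using inc by (intro divide_right_mono mult_right_mono) auto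
    finally show ?thesis .
  qed
  show "(l2 r (ent V j))\<^sup>2 \<le> incoherence n1 n2 r U V * real r / real n2" if "j < n2" for j
  proof -
    have "(l2 r (ent V j))\<^sup>2 \<le> ?b * real r / real n2" using kV that by blast
    also have "\<dots> \<le> incoherence n1 n2 r U V * real r / real n2" using inc by (intro divide_right_mono mult_right_mono) auto
    finally show ?thesis .
  qed
qed

text \<open>With \<gamma> = \<mu> r / n_min both sampling conditions are expressed by one quantity.
  Since r <= \<gamma> n, the second condition dominates \<gamma> r and so pays for the nets of the
  restricted bound, while the first gives \<gamma> ln n and, multiplied by n, the logarithm needed
  by the spectral bound.\<close>

lemma sampling_rate_bounds:
  fixes \<gamma> :: real
  assumes r: "1 \<le> r" "r \<le> \<gamma> * n" and \<kappa>: "1 \<le> \<kappa>" and \<gamma>: "0 < \<gamma>" and n: "1 \<le> n" and p: "p \<le> 1"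
    and p1: "2 ^ 350 * (\<gamma> * ln n) \<le> p" and p2: "2 ^ 350 * (n * \<gamma>\<^sup>2 * \<kappa>\<^sup>2) \<le> p"
  shows "0 < p" "\<gamma> \<le> 1 / 40" "2 \<le> n" "1000000 * \<gamma> * (r + ln n) \<le> p" "1000000 * ln n \<le> n * p"
    "sqrt (n / p) * (\<gamma> * \<kappa>) \<le> 1 / 2 ^ 175"
proof -
  have ln: "0 \<le> ln n" using n by simp
  have "0 < 2 ^ 350 * (n * \<gamma>\<^sup>2 * \<kappa>\<^sup>2)" using n \<gamma> \<kappa> by (intro mult_pos_pos) auto
  then show p0: "0 < p" using p2 by linarith
  have \<kappa>2: "1 \<le> \<kappa>\<^sup>2" using \<kappa> by simp
  have "\<gamma> * r \<le> \<gamma> * (\<gamma> * n)" using r \<gamma> by (intro mult_left_mono) auto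
  also have "\<dots> \<le> n * \<gamma>\<^sup>2 * \<kappa>\<^sup>2"
  proof -
    have "0 \<le> n * \<gamma>\<^sup>2" using n by simp
    from mult_left_mono[OF \<kappa>2 this] show ?thesis by (simp add: power2_eq_square mult_ac)
  qed
  finally have "2 ^ 350 * (\<gamma> * r) \<le> 2 ^ 350 * (n * \<gamma>\<^sup>2 * \<kappa>\<^sup>2)" by (rule mult_left_mono) simp
  then have p3: "2 ^ 350 * (\<gamma> * r) \<le> p" using p2 by linarith
  have gr: "\<gamma> \<le> \<gamma> * r" using r \<gamma> by simp
  then show g40: "\<gamma> \<le> 1 / 40" using p3 p by simp
  \<comment> \<open>For n < 2 the product \<gamma> n would be at most 1/20, yet it is at least r >=
    1.\<close>
  show "2 \<le> n"
  proof (rule ccontr)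
    assume "\<not> 2 \<le> n"
    then have "\<gamma> * n \<le> 1 / 40 * 2" using g40 \<gamma> n by (intro mult_mono) auto
    then show False using r by simp
  qed
  have "0 \<le> \<gamma> * r" "0 \<le> \<gamma> * ln n" using r \<gamma> ln by auto
  then have "2000000 * (\<gamma> * r) \<le> 2 ^ 350 * (\<gamma> * r)" "2000000 * (\<gamma> * ln n) \<le> 2 ^ 350 * (\<gamma> * ln n)"
    by (intro mult_right_mono; simp)+
  then show "1000000 * \<gamma> * (r + ln n) \<le> p" using p1 p3 by (simp add: distrib_left)
  have "1000000 * ln n \<le> 2 ^ 350 * ((\<gamma> * n) * ln n)"
    using r ln by (intro mult_mono[of 1000000 "2 ^ 350"] mult_right_mono[of 1 "\<gamma> * n" "ln n", simplified]) auto
  also have "\<dots> = n * (2 ^ 350 * (\<gamma> * ln n))" by simp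
  also have "\<dots> \<le> n * p" using p1 n by (intro mult_left_mono) auto
  finally show "1000000 * ln n \<le> n * p" .
  have "n / p * (\<gamma> * \<kappa>)\<^sup>2 \<le> (1 / 2 ^ 175)\<^sup>2"
  proof -
    have e: "((1::real) / 2 ^ 175)\<^sup>2 = 1 / 2 ^ 350" unfolding power_divide power_mult[symmetric] by simp
    show ?thesis unfolding e using p2 p0 by (simp add: field_simps power_mult_distrib del: power_numeral)
  qed
  then have "sqrt (n / p * (\<gamma> * \<kappa>)\<^sup>2) \<le> 1 / 2 ^ 175" by (intro real_le_lsqrt) auto
  then show "sqrt (n / p) * (\<gamma> * \<kappa>) \<le> 1 / 2 ^ 175" unfolding real_sqrt_mult using \<gamma> \<kappa> by simp
qed

text \<open>Here q = sqrt (n_max / p), so 2^45 q is the spectral bound divided by p. The factor 2^48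
  = 8 * 2^45 gives the lower bound on \<open>lam\<close>. For the last claim, 10 * 2^48 * 20000 *
  100 * 2^96 is 2 * 10^7 * 2^144, below 2^169 even after the first summand is added; the rate
  supplies 2^(-175), and 2^(-6) is less than 1/20.\<close>

lemma tuning_bounds:
  fixes \<gamma> :: real
  assumes q: "0 \<le> q" and smin: "0 < smin" "smin \<le> smax" and \<gamma>: "0 < \<gamma>" and rate: "q * (\<gamma> * (smax / smin)) \<le> 1 / 2 ^ 175"
    and lam: "2 ^ 48 * q \<le> lam" "lam \<le> 10 * 2 ^ 48 * q"
    and \<alpha>: "2 ^ 48 * sqrt (\<gamma> * smax) \<le> \<alpha>" "\<alpha> \<le> 10 * 2 ^ 48 * sqrt (\<gamma> * smax)"
  shows "8 * (2 ^ 45 * q) \<le> lam" "0 < \<alpha>" "100 * sqrt (smax * \<gamma>) \<le> \<alpha>"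
    "6 * (2 ^ 45 * q) * (smax * \<gamma>) + lam * (20000 * \<alpha>\<^sup>2) \<le> smin / 20"
proof -
  show "8 * (2 ^ 45 * q) \<le> lam" using lam by simp
  have gs: "0 < \<gamma> * smax" using \<gamma> smin by simp
  then have s0: "0 < sqrt (\<gamma> * smax)" by simp
  then show a0: "0 < \<alpha>" using \<alpha> by (simp add: less_le_trans[OF _ \<alpha>(1)])
  have "100 * sqrt (\<gamma> * smax) \<le> 2 ^ 48 * sqrt (\<gamma> * smax)" using gs by (intro mult_right_mono) auto
  then show "100 * sqrt (smax * \<gamma>) \<le> \<alpha>" using \<alpha>(1) unfolding mult.commute[of smax] by linarith
  have "\<alpha>\<^sup>2 \<le> (10 * 2 ^ 48 * sqrt (\<gamma> * smax))\<^sup>2" using a0 \<alpha>(2) by (intro power_mono) auto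
  also have "\<dots> = 100 * 2 ^ 96 * (\<gamma> * smax)" using gs by (simp add: power_mult_distrib)
  finally have "lam * (20000 * \<alpha>\<^sup>2) \<le> (10 * 2 ^ 48 * q) * (20000 * (100 * 2 ^ 96 * (\<gamma> * smax)))"
    using lam q by (intro mult_mono) auto
  also have "\<dots> = 20000000 * 2 ^ 144 * (q * (\<gamma> * smax))" by simp
  finally have "6 * (2 ^ 45 * q) * (smax * \<gamma>) + lam * (20000 * \<alpha>\<^sup>2) \<le> (6 * 2 ^ 45 + 20000000 * 2 ^ 144) * (q * (\<gamma> * smax))"
    by (simp add: algebra_simps)
  also have "\<dots> \<le> 2 ^ 169 * (q * (\<gamma> * smax))" using q gs by (intro mult_right_mono) auto
  also have "\<dots> = 2 ^ 169 * (q * (\<gamma> * (smax / smin))) * smin" using smin by simp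
  also have "\<dots> \<le> 2 ^ 169 * (1 / 2 ^ 175) * smin" using rate smin by (intro mult_right_mono mult_left_mono) auto
  also have "\<dots> \<le> smin / 20" using smin by simp
  finally show "6 * (2 ^ 45 * q) * (smax * \<gamma>) + lam * (20000 * \<alpha>\<^sup>2) \<le> smin / 20" .
qed

theorem theorem2p1:
  shows "\<exists>C1 C2 C3 :: real. 0 < C1 \<and> 0 < C2 \<and> 0 < C3 \<and>
    (\<forall>(n1::nat) (n2::nat) (r::nat) (d::nat) (Mstar::real mat) (U::real mat) (\<sigma>::nat \<Rightarrow> real)
       (V::real mat) (X::real vec \<Rightarrow> real mat) (Y::real vec \<Rightarrow> real mat) (N::real mat)
       (D::(nat \<times> nat) set pmf) (p::real) (\<alpha>::real) (lam::real)
       (\<mu>::real) (\<kappa>::real) (n_max::real) (n_min::real).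
       1 \<le> r \<longrightarrow>
       Mstar \<in> carrier_mat n1 n2 \<longrightarrow>
       vec_space.rank n1 Mstar = r \<longrightarrow>
       reduced_svd n1 n2 r Mstar U \<sigma> V \<longrightarrow>
       \<kappa> = \<sigma> 0 / \<sigma> (r - 1) \<longrightarrow>
       \<mu> = incoherence n1 n2 r U V \<longrightarrow>
       linear_param d n1 r X \<longrightarrow>
       linear_param d n2 r Y \<longrightarrow>
       correlated_parametric_factorization d Mstar X Y \<longrightarrow>
       0 \<le> p \<longrightarrow> p \<le> 1 \<longrightarrow>
       sampling_law n1 n2 p D \<longrightarrow>
       N \<in> carrier_mat n1 n2 \<longrightarrow>
       n_max = real (max n1 n2) \<longrightarrow>
       n_min = real (min n1 n2) \<longrightarrow>
       p \<ge> C1 * max (1 / n_min * \<mu> * real r * ln n_max)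
                     (n_max / n_min\<^sup>2 * \<mu>\<^sup>2 * (real r)\<^sup>2 * \<kappa>\<^sup>2) \<longrightarrow>
       C2 * sqrt (n_max / p) \<le> lam \<longrightarrow>
       lam \<le> 10 * C2 * sqrt (n_max / p) \<longrightarrow>
       C2 * sqrt (\<mu> * real r * \<sigma> 0 / n_min) \<le> \<alpha> \<longrightarrow>
       \<alpha> \<le> 10 * C2 * sqrt (\<mu> * real r * \<sigma> 0 / n_min) \<longrightarrow>
       (\<exists>E. measure_pmf.prob D E \<ge> 1 - 1 / (real (n1 + n2)) ^ 3 \<and>
          (\<forall>\<Omega> \<in> E. \<forall>\<xi>. local_min d (objective \<Omega> p (Mstar + N) X Y \<alpha> lam) \<xi> \<longrightarrow>
             (frob_norm (Mstar - X \<xi> * (Y \<xi>)\<^sup>T))\<^sup>2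
               \<le> C3 * real r / p\<^sup>2 * (noise_level d \<Omega> N X Y)\<^sup>2 \<and>
             (N = 0\<^sub>m n1 n2 \<longrightarrow>
                X \<xi> * (Y \<xi>)\<^sup>T = Mstar + N \<and> X \<xi> * (Y \<xi>)\<^sup>T = Mstar))))"
proof -
  \<comment> \<open>2^350 = (2^175)^2 is dictated by \<open>tuning_bounds\<close>, where the square
    root of the rate must reach 2^(-175); 2^48 is 8 times the spectral constant, and 27000 comes
    from \<open>deterministic_recovery\<close>.\<close>
  define C1 C2 C3 :: real where C: "C1 = 2 ^ 350" "C2 = 2 ^ 48" "C3 = 27000"
  have pos: "0 < C1" "0 < C2" "0 < C3" by (simp_all add: C)
  show ?thesis
  proof (rule exI[of _ C1], rule exI[of _ C2], rule exI[of _ C3], intro conjI pos allI impI)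
    fix n1 n2 r d :: nat and Mstar U :: "real mat" and \<sigma> :: "nat \<Rightarrow> real" and V :: "real mat"
      and X Y :: "real Matrix.vec \<Rightarrow> real mat" and N :: "real mat" and D :: "(nat \<times> nat) set pmf"
      and p \<alpha> lam \<mu> \<kappa> n_max n_min :: real
    assume r: "1 \<le> r" and Mc: "Mstar \<in> carrier_mat n1 n2" and "vec_space.rank n1 Mstar = r"
      and svd: "reduced_svd n1 n2 r Mstar U \<sigma> V" and \<kappa>: "\<kappa> = \<sigma> 0 / \<sigma> (r - 1)"
      and \<mu>: "\<mu> = incoherence n1 n2 r U V" and X: "linear_param d n1 r X" and Y: "linear_param d n2 r Y"
      and cpf: "correlated_parametric_factorization d Mstar X Y" and "0 \<le> p" and p1: "p \<le> 1"
      and law: "sampling_law n1 n2 p D" and N: "N \<in> carrier_mat n1 n2"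
      and nmax: "n_max = real (max n1 n2)" and nmin: "n_min = real (min n1 n2)"
      and rate: "p \<ge> C1 * max (1 / n_min * \<mu> * real r * ln n_max)
                     (n_max / n_min\<^sup>2 * \<mu>\<^sup>2 * (real r)\<^sup>2 * \<kappa>\<^sup>2)"
      and lam: "C2 * sqrt (n_max / p) \<le> lam" "lam \<le> 10 * C2 * sqrt (n_max / p)"
      and \<alpha>: "C2 * sqrt (\<mu> * real r * \<sigma> 0 / n_min) \<le> \<alpha>" "\<alpha> \<le> 10 * C2 * sqrt (\<mu> * real r * \<sigma> 0 / n_min)"
    have U: "U \<in> carrier_mat n1 r" and V: "V \<in> carrier_mat n2 r" and oU: "U\<^sup>T * U = 1\<^sub>m r" and oV: "V\<^sup>T * V = 1\<^sub>m r"
      and M: "Mstar = U * mat_diag r \<sigma> * V\<^sup>T" and \<sigma>pos: "\<And>i. i < r \<Longrightarrow> 0 < \<sigma> i"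
      and \<sigma>mono: "\<And>i j. i \<le> j \<Longrightarrow> j < r \<Longrightarrow> \<sigma> j \<le> \<sigma> i"
      using svd by (auto simp: reduced_svd_def)
    have \<sigma>: "\<sigma> (r - 1) \<le> \<sigma> i \<and> \<sigma> i \<le> \<sigma> 0" if "i < r" for i using \<sigma>mono[of i "r - 1"] \<sigma>mono[of 0 i] that by auto
    have s: "0 < \<sigma> (r - 1)" "\<sigma> (r - 1) \<le> \<sigma> 0" using \<sigma>pos[of "r - 1"] \<sigma>[of 0] r by auto
    note inc = incoherence_bounds[OF U V r oU oV, folded \<mu>]
    \<comment> \<open>A common bound for the squared row norms of both singular-vector matrices,
      obtained by using the smaller dimension for each.\<close>
    define \<gamma> where "\<gamma> = \<mu> * real r / n_min"
    have nm: "1 \<le> n_min" "n_min \<le> n_max" "n_min \<le> real n1" "n_min \<le> real n2" using inc(2,3) by (auto simp: nmin nmax)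
    have \<gamma>0: "0 < \<gamma>" using inc(1) r nm by (simp add: \<gamma>_def)
    have bU: "(l2 r (ent U i))\<^sup>2 \<le> \<gamma>" if "i < n1" for i
    proof -
      have "\<mu> * real r / real n1 \<le> \<gamma>" unfolding \<gamma>_def using nm inc(1) by (intro divide_left_mono) auto
      then show ?thesis using inc(4)[OF that] by linarith
    qed
    have bV: "(l2 r (ent V j))\<^sup>2 \<le> \<gamma>" if "j < n2" for j
    proof -
      have "\<mu> * real r / real n2 \<le> \<gamma>" unfolding \<gamma>_def using nm inc(1) by (intro divide_left_mono) auto
      then show ?thesis using inc(5)[OF that] by linarith
    qed
    have rn: "real r \<le> \<gamma> * n_max"
    proof -
      have "real r * n_min \<le> (\<mu> * real r) * n_max" using inc(1) nm r by (intro mult_mono) auto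
      then show ?thesis using nm by (simp add: \<gamma>_def field_simps)
    qed
    have \<kappa>1: "1 \<le> \<kappa>" using s by (simp add: \<kappa>)
    have rate1: "2 ^ 350 * (\<gamma> * ln n_max) \<le> p"
    proof -
      have "C1 * (1 / n_min * \<mu> * real r * ln n_max) \<le> p" using rate pos(1) by (elim order_trans[rotated]) (intro mult_left_mono, auto)
      then show ?thesis by (simp add: C(1) \<gamma>_def mult_ac)
    qed
    have rate2: "2 ^ 350 * (n_max * \<gamma>\<^sup>2 * \<kappa>\<^sup>2) \<le> p"
    proof -
      have "C1 * (n_max / n_min\<^sup>2 * \<mu>\<^sup>2 * (real r)\<^sup>2 * \<kappa>\<^sup>2) \<le> p" using rate pos(1) by (elim order_trans[rotated]) (intro mult_left_mono, auto)
      moreover have "n_max / n_min\<^sup>2 * \<mu>\<^sup>2 * (real r)\<^sup>2 * \<kappa>\<^sup>2 = n_max * \<gamma>\<^sup>2 * \<kappa>\<^sup>2"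
        by (simp add: \<gamma>_def power_divide power_mult_distrib)
      ultimately show ?thesis by (simp only: C(1))
    qed
    have nmax1: "1 \<le> n_max" using nm by linarith
    note sr = sampling_rate_bounds[OF _ rn \<kappa>1 \<gamma>0 nmax1 p1 rate1 rate2]
    have r1: "1 \<le> real r" using r by simp
    note sr = sr[OF r1]
    have qe: "2 ^ 45 * sqrt (real (max n1 n2) * p) / p = 2 ^ 45 * sqrt (n_max / p)"
      using sr(1) by (simp add: nmax real_sqrt_mult real_sqrt_divide real_div_sqrt field_simps)
    have q0: "0 \<le> sqrt (n_max / p)" using sr(1) nmax1 by simp
    have ae: "\<mu> * real r * \<sigma> 0 / n_min = \<gamma> * \<sigma> 0" by (simp add: \<gamma>_def)
    note tb = tuning_bounds[OF q0 s \<gamma>0 sr(6)[unfolded \<kappa>] lam[unfolded C(2)] \<alpha>[unfolded C(2) ae], folded qe]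
    \<comment> \<open>The event is fixed before any local minimum is considered, and noise and
      parametrization do not occur in it.\<close>
    let ?E = "{\<Omega>. sampling_regular n1 n2 r p (ent U) (ent V) \<Omega>}"
    show "\<exists>E. measure_pmf.prob D E \<ge> 1 - 1 / (real (n1 + n2)) ^ 3 \<and>
          (\<forall>\<Omega> \<in> E. \<forall>\<xi>. local_min d (objective \<Omega> p (Mstar + N) X Y \<alpha> lam) \<xi> \<longrightarrow>
             (frob_norm (Mstar - X \<xi> * (Y \<xi>)\<^sup>T))\<^sup>2
               \<le> C3 * real r / p\<^sup>2 * (noise_level d \<Omega> N X Y)\<^sup>2 \<and>
             (N = 0\<^sub>m n1 n2 \<longrightarrow>
                X \<xi> * (Y \<xi>)\<^sup>T = Mstar + N \<and> X \<xi> * (Y \<xi>)\<^sup>T = Mstar))"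
    proof (intro exI[of _ ?E] conjI ballI allI impI)
      show "1 - 1 / (real (n1 + n2)) ^ 3 \<le> measure_pmf.prob D ?E"
      proof (rule prob_sampling_regular[OF law sr(1) p1 refl _ \<gamma>0 sr(2)])
        show "2 \<le> max n1 n2" using sr(3) unfolding nmax by linarith
        show "1000000 * \<gamma> * (real r + ln (real (max n1 n2))) \<le> p" using sr(4) unfolding nmax .
        show "1000000 * ln (real (max n1 n2)) \<le> real (max n1 n2) * p" using sr(5) unfolding nmax .
      qed (fact orthonormal_columns_isotropic[OF U oU] orthonormal_columns_isotropic[OF V oV] bU bV)+
    next
      fix \<Omega> \<xi> assume "\<Omega> \<in> ?E" and lm: "local_min d (objective \<Omega> p (Mstar + N) X Y \<alpha> lam) \<xi>"
      then have reg: "sampling_regular n1 n2 r p (ent U) (ent V) \<Omega>" by simp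
      note rec = local_min_recovery[OF r U V oU oV \<sigma> s(1) M X Y cpf N bU bV sr(1) reg tb lm]
      have "(frob_norm (Mstar - X \<xi> * (Y \<xi>)\<^sup>T))\<^sup>2 \<le> 27000 * (sqrt (real r) * noise_level d \<Omega> N X Y / p)\<^sup>2"
        by (rule rec(1))
      then show "(frob_norm (Mstar - X \<xi> * (Y \<xi>)\<^sup>T))\<^sup>2 \<le> C3 * real r / p\<^sup>2 * (noise_level d \<Omega> N X Y)\<^sup>2"
        by (simp add: C(3) power_mult_distrib power_divide)
      assume N0: "N = 0\<^sub>m n1 n2"
      show "X \<xi> * (Y \<xi>)\<^sup>T = Mstar" by (rule rec(2)[OF _ _ _ N0])
      then show "X \<xi> * (Y \<xi>)\<^sup>T = Mstar + N" using Mc N0 by simp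
    qed
  qed
qed

end
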